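(* The toric Fano fourfold $\mathbf{P}_{(\mathbf{P}^1)^3}(\mathcal{O}\oplus\mathcal{O}(1,1,1))$ is a relatively Ding unstable Calabi dream manifold.
   Context: Calabi dream manifold: a compact K\"ahler manifold that admits an extremal K\"ahler metric (in the sense of Calabi) in each of its K\"ahler classes. A Fano polytope is an $n$-dimensional lattice polytope $P\subset\mathbf{R}^n$ (lattice $\mathbf{Z}^n$) that is Delzant, contains the origin in its interior, and is reflexive, i.e. its dual $P^\vee=\{y\in\mathbf{R}^n\mid \langle x,y\rangle\ge -1 \text{ for all } x\in P\}$ is again a lattice polytope. Isomorphism classes of Fano polytopes (under the action of $GL(n,\mathbf{Z})$) correspond bijectively to isomorphism classes of $n$-dimensional toric Fano manifolds $X_P$ with the anticanonical polarization; $P$ is the moment polytope of $(X_P,-K_{X_P})$. Let $\mathrm{vol}(P)=\int_P dx$ (Lebesgue measure). The potential function $\theta_P$ of the extremal K\"ahler vector field is the unique affine function on $\mathbf{R}^n$ with $\int_P\theta_P\,dx=0$ and $\int_P x_i(1-\theta_P(x))\,dx=0$ for $i=1,\dots,n$. A rational PL convex function on $P$ is a convex function $f\colon P\to\mathbf{R}$ of the form $f=\max\{\ell_1,\dots,\ell_m\}$ with each $\ell_k$ a rational affine function. For such $f$ put $$D_v^{NA}(f)=-f(0)+\frac{1}{\mathrm{vol}(P)}\int_P f(x)(1-\theta_P(x))\,dx.$$ $X_P$ is relatively Ding semistable if $D_v^{NA}(f)\ge 0$ for every rational PL convex function $f$ on $P$, and relatively Ding unstable if it is not relatively Ding semistable.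 *)

theory Defs
  imports "HOL-Analysis.Analysis"
begin

section \<open>Complex manifolds\<close>

primrec Ck_on :: "nat \<Rightarrow> ('a::real_normed_vector \<Rightarrow> 'b::real_normed_vector) \<Rightarrow> 'a set \<Rightarrow> bool" where
  "Ck_on 0 f S \<longleftrightarrow> continuous_on S f"
| "Ck_on (Suc k) f S \<longleftrightarrow> (\<forall>x\<in>S. f differentiable (at x)) \<and>
     (\<forall>v. Ck_on k (\<lambda>x. frechet_derivative f (at x) v) S)"

definition smooth_on :: "('a::real_normed_vector \<Rightarrow> 'b::real_normed_vector) \<Rightarrow> 'a set \<Rightarrow> bool" where
  "smooth_on f S \<longleftrightarrow> (\<forall>k. Ck_on k f S)"

text \<open>Only used on open sets.\<close>

definition holomorphic_map_on ::
  "(complex^'n \<Rightarrow> complex^'m) \<Rightarrow> (complex^'n::finite) set \<Rightarrow> bool" where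
  "holomorphic_map_on f S \<longleftrightarrow>
     (\<forall>z\<in>S. \<exists>D. (f has_derivative D) (at z) \<and> (\<forall>v. D (\<i> *s v) = \<i> *s D v))"

text \<open>A manifold of complex dimension \<open>CARD('n)\<close> is given by its atlas, a set of pairs
  (domain, coordinate map). The underlying set is the union of the domains, and the topology is
  the one induced by the charts.\<close>

type_synonym ('p, 'n) chart = "'p set \<times> ('p \<Rightarrow> complex^'n)"

definition points :: "('p, 'n) chart set \<Rightarrow> 'p set" where
  "points A = (\<Union>c\<in>A. fst c)"

abbreviation image_of_chart :: "('p, 'n) chart \<Rightarrow> (complex^'n) set" where
  "image_of_chart c \<equiv> snd c ` fst c"

definition overlap :: "('p, 'n) chart \<Rightarrow> ('p, 'n) chart \<Rightarrow> (complex^'n) set" where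
  "overlap c d = snd c ` (fst c \<inter> fst d)"

definition transition :: "('p, 'n) chart \<Rightarrow> ('p, 'n) chart \<Rightarrow> complex^'n \<Rightarrow> complex^'n" where
  "transition c d = snd d \<circ> inv_into (fst c) (snd c)"

definition complex_atlas :: "('p, 'n::finite) chart set \<Rightarrow> bool" where
  "complex_atlas A \<longleftrightarrow>
     (\<forall>c\<in>A. inj_on (snd c) (fst c) \<and> open (image_of_chart c)) \<and>
     (\<forall>c\<in>A. \<forall>d\<in>A. open (overlap c d) \<and> holomorphic_map_on (transition c d) (overlap c d))"

definition manifold_topology :: "('p, 'n::finite) chart set \<Rightarrow> 'p topology" where
  "manifold_topology A =
     topology_generated_by {{p \<in> fst c. snd c p \<in> W} | c W. c \<in> A \<and> open W}"

text \<open>Second countability follows from compactness.\<close>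

definition compact_complex_manifold :: "('p, 'n::finite) chart set \<Rightarrow> bool" where
  "compact_complex_manifold A \<longleftrightarrow> complex_atlas A \<and> points A \<noteq> {} \<and>
     Hausdorff_space (manifold_topology A) \<and> compact_space (manifold_topology A) \<and>
     connected_space (manifold_topology A)"

definition holomorphic_between ::
  "('p, 'n::finite) chart set \<Rightarrow> ('q, 'm::finite) chart set \<Rightarrow> ('p \<Rightarrow> 'q) \<Rightarrow> bool" where
  "holomorphic_between A B F \<longleftrightarrow> F ` points A \<subseteq> points B \<and>
     (\<forall>c\<in>A. \<forall>d\<in>B. let W = snd c ` {p \<in> fst c. F p \<in> fst d} in
        open W \<and> holomorphic_map_on (snd d \<circ> F \<circ> inv_into (fst c) (snd c)) W)"

definition biholomorphic ::
  "('p, 'n::finite) chart set \<Rightarrow> ('q, 'm::finite) chart set \<Rightarrow> bool" where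
  "biholomorphic A B \<longleftrightarrow> (\<exists>F G. holomorphic_between A B F \<and> holomorphic_between B A G \<and>
     (\<forall>p\<in>points A. G (F p) = p) \<and> (\<forall>q\<in>points B. F (G q) = q))"

section \<open>Kaehler forms, Kaehler classes and extremal metrics\<close>

text \<open>Real differential forms are families of local forms, indexed by the charts of the atlas and
  compatible under pullback by the transition maps.\<close>

type_synonym ('p, 'n) form1 = "('p, 'n) chart \<Rightarrow> complex^'n \<Rightarrow> complex^'n \<Rightarrow> real"
type_synonym ('p, 'n) form2 =
  "('p, 'n) chart \<Rightarrow> complex^'n \<Rightarrow> complex^'n \<Rightarrow> complex^'n \<Rightarrow> real"

definition one_form :: "('p, 'n::finite) chart set \<Rightarrow> ('p, 'n) form1 \<Rightarrow> bool" where
  "one_form A \<beta> \<longleftrightarrow>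
     (\<forall>c\<in>A. (\<forall>z\<in>image_of_chart c. linear (\<beta> c z)) \<and>
        (\<forall>u. smooth_on (\<lambda>z. \<beta> c z u) (image_of_chart c))) \<and>
     (\<forall>c\<in>A. \<forall>d\<in>A. \<forall>z\<in>overlap c d. let T = transition c d; dT = frechet_derivative T (at z) in
        \<forall>u. \<beta> c z u = \<beta> d (T z) (dT u))"

definition two_form :: "('p, 'n::finite) chart set \<Rightarrow> ('p, 'n) form2 \<Rightarrow> bool" where
  "two_form A \<omega> \<longleftrightarrow>
     (\<forall>c\<in>A. (\<forall>z\<in>image_of_chart c. bilinear (\<omega> c z) \<and> (\<forall>u. \<omega> c z u u = 0)) \<and>
        (\<forall>u v. smooth_on (\<lambda>z. \<omega> c z u v) (image_of_chart c))) \<and>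
     (\<forall>c\<in>A. \<forall>d\<in>A. \<forall>z\<in>overlap c d. let T = transition c d; dT = frechet_derivative T (at z) in
        \<forall>u v. \<omega> c z u v = \<omega> d (T z) (dT u) (dT v))"

definition closed_form :: "('p, 'n::finite) chart set \<Rightarrow> ('p, 'n) form2 \<Rightarrow> bool" where
  "closed_form A \<omega> \<longleftrightarrow> (\<forall>c\<in>A. \<forall>z\<in>image_of_chart c. \<forall>u v w.
     frechet_derivative (\<lambda>y. \<omega> c y v w) (at z) u
   + frechet_derivative (\<lambda>y. \<omega> c y w u) (at z) v
   + frechet_derivative (\<lambda>y. \<omega> c y u v) (at z) w = 0)"

definition kaehler_form :: "('p, 'n::finite) chart set \<Rightarrow> ('p, 'n) form2 \<Rightarrow> bool" where
  "kaehler_form A \<omega> \<longleftrightarrow> two_form A \<omega> \<and> closed_form A \<omega> \<and>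
     (\<forall>c\<in>A. \<forall>z\<in>image_of_chart c.
        (\<forall>u v. \<omega> c z (\<i> *s u) (\<i> *s v) = \<omega> c z u v) \<and>
        (\<forall>u. u \<noteq> 0 \<longrightarrow> \<omega> c z u (\<i> *s u) > 0))"

text \<open>Equality of de Rham classes: \<open>\<omega>' - \<omega> = d\<beta>\<close> for a global one-form \<open>\<beta>\<close>.\<close>

definition cohomologous ::
  "('p, 'n::finite) chart set \<Rightarrow> ('p, 'n) form2 \<Rightarrow> ('p, 'n) form2 \<Rightarrow> bool" where
  "cohomologous A \<omega> \<omega>' \<longleftrightarrow> (\<exists>\<beta>. one_form A \<beta> \<and>
     (\<forall>c\<in>A. \<forall>z\<in>image_of_chart c. \<forall>u v.
        \<omega>' c z u v - \<omega> c z u v =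
          frechet_derivative (\<lambda>y. \<beta> c y v) (at z) u - frechet_derivative (\<lambda>y. \<beta> c y u) (at z) v))"

text \<open>The Wirtinger operators \<open>\<partial>/\<partial>z\<^sub>j\<close> and \<open>\<partial>/\<partial>\<bar>z\<^sub>j\<close>.\<close>

definition d_z :: "'n \<Rightarrow> (complex^'n \<Rightarrow> complex) \<Rightarrow> complex^'n::finite \<Rightarrow> complex" where
  "d_z j f z = (frechet_derivative f (at z) (axis j 1)
                - \<i> * frechet_derivative f (at z) (axis j \<i>)) / 2"

definition d_zbar :: "'n \<Rightarrow> (complex^'n \<Rightarrow> complex) \<Rightarrow> complex^'n::finite \<Rightarrow> complex" where
  "d_zbar j f z = (frechet_derivative f (at z) (axis j 1)
                   + \<i> * frechet_derivative f (at z) (axis j \<i>)) / 2"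

text \<open>The Hermitian matrix \<open>g\<^sub>j\<^sub>k\<close> (with second index barred) such that
  \<open>\<omega> = \<i> \<Sum>\<^sub>j\<^sub>k g\<^sub>j\<^sub>k dz\<^sub>j \<and> d\<bar>z\<^sub>k\<close>; since \<open>\<omega>\<close> is invariant under \<open>\<i>\<close>, the Hermitian form
  \<open>\<Sum>\<^sub>j\<^sub>k g\<^sub>j\<^sub>k u\<^sub>j \<bar>v\<^sub>k\<close> equals \<open>(\<omega>(u, \<i>v) - \<i> \<omega>(u, v)) / 2\<close>.\<close>

definition metric_matrix ::
  "('p, 'n::finite) form2 \<Rightarrow> ('p, 'n) chart \<Rightarrow> complex^'n \<Rightarrow> complex^'n^'n" where
  "metric_matrix \<omega> c z = (\<chi> j k. Complex (\<omega> c z (axis j 1) (axis k \<i>) / 2)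
                                        (- \<omega> c z (axis j 1) (axis k 1) / 2))"

text \<open>The entry \<open>g\<^sup>j\<^sup>k\<close> (second index barred) of the inverse metric is normalised by
  \<open>\<Sum>\<^sub>k g\<^sup>j\<^sup>k g\<^sub>l\<^sub>k = \<delta>\<^sub>j\<^sub>l\<close>, so it is the \<open>(k, j)\<close> entry of the inverse matrix.\<close>

definition inverse_metric ::
  "('p, 'n::finite) form2 \<Rightarrow> ('p, 'n) chart \<Rightarrow> 'n \<Rightarrow> 'n \<Rightarrow> complex^'n \<Rightarrow> complex" where
  "inverse_metric \<omega> c j k z = matrix_inv (metric_matrix \<omega> c z) $ k $ j"

definition scalar_curvature ::
  "('p, 'n::finite) form2 \<Rightarrow> ('p, 'n) chart \<Rightarrow> complex^'n \<Rightarrow> complex" where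
  "scalar_curvature \<omega> c z =
     - (\<Sum>j\<in>UNIV. \<Sum>k\<in>UNIV. inverse_metric \<omega> c j k z *
          d_z j (d_zbar k (\<lambda>y. of_real (ln (Re (det (metric_matrix \<omega> c y)))))) z)"

text \<open>Extremal in the sense of Calabi: the (1,0)-gradient of the scalar curvature \<open>S\<close>, with
  components \<open>\<Sum>\<^sub>k g\<^sup>j\<^sup>k \<partial>S/\<partial>\<bar>z\<^sub>k\<close>, is a holomorphic vector field (the Euler-Lagrange equation of the
  functional \<open>\<integral> S\<^sup>2\<close> on a Kaehler class).\<close>

definition extremal_gradient ::
  "('p, 'n::finite) form2 \<Rightarrow> ('p, 'n) chart \<Rightarrow> complex^'n \<Rightarrow> complex^'n" where
  "extremal_gradient \<omega> c z =
     (\<chi> j. \<Sum>k\<in>UNIV. inverse_metric \<omega> c j k z * d_zbar k (scalar_curvature \<omega> c) z)"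

definition extremal :: "('p, 'n::finite) chart set \<Rightarrow> ('p, 'n) form2 \<Rightarrow> bool" where
  "extremal A \<omega> \<longleftrightarrow> kaehler_form A \<omega> \<and>
     (\<forall>c\<in>A. holomorphic_map_on (extremal_gradient \<omega> c) (image_of_chart c))"

definition calabi_dream_manifold :: "('p, 'n::finite) chart set \<Rightarrow> bool" where
  "calabi_dream_manifold A \<longleftrightarrow> compact_complex_manifold A \<and> (\<exists>\<omega>. kaehler_form A \<omega>) \<and>
     (\<forall>\<omega>. kaehler_form A \<omega> \<longrightarrow> (\<exists>\<omega>'. extremal A \<omega>' \<and> cohomologous A \<omega> \<omega>'))"

section \<open>Fano polytopes and relative Ding stability\<close>

definition integer_lattice :: "(real^'n) set" where
  "integer_lattice = {x. \<forall>i. x $ i \<in> \<int>}"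

definition lattice_polytope :: "(real^'n::finite) set \<Rightarrow> bool" where
  "lattice_polytope P \<longleftrightarrow> (\<exists>V. finite V \<and> V \<subseteq> integer_lattice \<and> P = convex hull V)"

definition lattice_basis :: "('n \<Rightarrow> real^'n::finite) \<Rightarrow> bool" where
  "lattice_basis b \<longleftrightarrow> (\<forall>i. b i \<in> integer_lattice) \<and>
     (\<forall>x\<in>integer_lattice. \<exists>!a :: 'n \<Rightarrow> int. x = (\<Sum>i\<in>UNIV. of_int (a i) *\<^sub>R b i))"

text \<open>At each vertex there are exactly \<open>n\<close> edges, whose directions form a lattice basis.\<close>

definition delzant :: "(real^'n::finite) set \<Rightarrow> bool" where
  "delzant P \<longleftrightarrow> polytope P \<and> interior P \<noteq> {} \<and>
     (\<forall>v. v extreme_point_of P \<longrightarrow> (\<exists>b w. lattice_basis b \<and> (\<forall>i. w i > 0) \<and>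
        {E. E edge_of P \<and> v \<in> E} = range (\<lambda>i. closed_segment v (v + w i *\<^sub>R b i))))"

definition dual_polytope :: "(real^'n::finite) set \<Rightarrow> (real^'n) set" where
  "dual_polytope P = {y. \<forall>x\<in>P. x \<bullet> y \<ge> -1}"

definition fano_polytope :: "(real^'n::finite) set \<Rightarrow> bool" where
  "fano_polytope P \<longleftrightarrow> lattice_polytope P \<and> delzant P \<and> 0 \<in> interior P \<and>
     lattice_polytope (dual_polytope P)"

definition extremal_potential :: "(real^'n::finite) set \<Rightarrow> real^'n \<Rightarrow> real" where
  "extremal_potential P = (THE \<theta>. (\<exists>a c. \<theta> = (\<lambda>x. a \<bullet> x + c)) \<and>
     (LINT x:P|lborel. \<theta> x) = 0 \<and> (\<forall>i. (LINT x:P|lborel. x $ i * (1 - \<theta> x)) = 0))"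

definition rational_affine :: "(real^'n::finite \<Rightarrow> real) \<Rightarrow> bool" where
  "rational_affine l \<longleftrightarrow>
     (\<exists>a c. (\<forall>i. a $ i \<in> \<rat>) \<and> c \<in> \<rat> \<and> l = (\<lambda>x. a \<bullet> x + c))"

definition rational_PL_convex :: "(real^'n::finite) set \<Rightarrow> (real^'n \<Rightarrow> real) \<Rightarrow> bool" where
  "rational_PL_convex P f \<longleftrightarrow> (\<exists>L. finite L \<and> L \<noteq> {} \<and> (\<forall>l\<in>L. rational_affine l) \<and>
     (\<forall>x\<in>P. f x = Max ((\<lambda>l. l x) ` L)))"

definition ding_invariant :: "(real^'n::finite) set \<Rightarrow> (real^'n \<Rightarrow> real) \<Rightarrow> real" where
  "ding_invariant P f =
     - f 0 + 1 / measure lborel P * (LINT x:P|lborel. f x * (1 - extremal_potential P x))"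

definition relatively_Ding_semistable :: "(real^'n::finite) set \<Rightarrow> bool" where
  "relatively_Ding_semistable P \<longleftrightarrow> (\<forall>f. rational_PL_convex P f \<longrightarrow> ding_invariant P f \<ge> 0)"

section \<open>The toric manifold of a Fano polytope\<close>

text \<open>Cox's quotient construction for the normal fan of \<open>P\<close>. The rays of the fan are spanned by the
  primitive inner facet normals, which are the vertices \<open>u\<close> of the dual polytope
  (\<open>P = {x. \<forall>u. x \<bullet> u \<ge> -1}\<close>); the maximal cones correspond to the vertices \<open>v\<close> of \<open>P\<close>.
  There is one homogeneous coordinate per ray, and a point is an orbit of the
  group \<open>cox_group P\<close>.\<close>

definition rays :: "(real^'n::finite) set \<Rightarrow> (real^'n) set" where
  "rays P = {u. u extreme_point_of dual_polytope P}"

definition cone_rays :: "(real^'n::finite) set \<Rightarrow> real^'n \<Rightarrow> (real^'n) set" where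
  "cone_rays P v = {u \<in> rays P. v \<bullet> u = -1}"

definition cox_group :: "(real^'n::finite) set \<Rightarrow> (real^'n \<Rightarrow> complex) set" where
  "cox_group P = {t \<in> rays P \<rightarrow>\<^sub>E (UNIV - {0}).
     \<forall>m\<in>integer_lattice. (\<Prod>u\<in>rays P. t u powi \<lfloor>m \<bullet> u\<rfloor>) = 1}"

definition cox_orbit ::
  "(real^'n::finite) set \<Rightarrow> (real^'n \<Rightarrow> complex) \<Rightarrow> (real^'n \<Rightarrow> complex) set" where
  "cox_orbit P z = {\<lambda>u\<in>rays P. t u * z u | t. t \<in> cox_group P}"

definition toric_chart_domain ::
  "(real^'n::finite) set \<Rightarrow> real^'n \<Rightarrow> (real^'n \<Rightarrow> complex) set set" where
  "toric_chart_domain P v =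
     {cox_orbit P z | z. z \<in> rays P \<rightarrow>\<^sub>E UNIV \<and> (\<forall>u\<in>rays P - cone_rays P v. z u \<noteq> 0)}"

text \<open>The coordinates are the Laurent monomials whose exponents \<open>m i\<close> form the basis dual to the rays
  of the cone; they are constant on orbits, hence may be evaluated at any representative.\<close>

definition toric_chart_map ::
  "(real^'n::finite) set \<Rightarrow> ('n \<Rightarrow> real^'n) \<Rightarrow> (real^'n \<Rightarrow> complex) set \<Rightarrow> complex^'n" where
  "toric_chart_map P m p =
     (let z = (SOME z. z \<in> p) in \<chi> i. \<Prod>u\<in>rays P. z u powi \<lfloor>m i \<bullet> u\<rfloor>)"

definition toric_manifold ::
  "(real^'n::finite) set \<Rightarrow> ((real^'n \<Rightarrow> complex) set, 'n) chart set" where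
  "toric_manifold P = {(toric_chart_domain P v, toric_chart_map P m) | v m.
     v extreme_point_of P \<and>
     (\<exists>b. bij_betw b UNIV (cone_rays P v) \<and> (\<forall>i j. m i \<bullet> b j = (if i = j then 1 else 0)))}"

section \<open>The bundle \<open>P(O \<oplus> O(1,1,1))\<close> over \<open>(P\<^sup>1)\<^sup>3\<close>\<close>

text \<open>A point of the base has homogeneous coordinates \<open>x $ k \<in> \<complex>\<^sup>2 - {0}\<close> for \<open>k = 1, 2, 3\<close>. The total space
  of \<open>O(1,1,1)\<close> is the quotient of the pairs \<open>(x, b)\<close>, with \<open>b \<in> \<complex>\<close>, by
  \<open>(x, b) \<sim> ((t\<^sub>k x\<^sub>k)\<^sub>k, t\<^sub>1 t\<^sub>2 t\<^sub>3 b)\<close>, so that its sections are the multihomogeneous polynomials of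
  degree \<open>(1,1,1)\<close>. In \<open>y \<in> \<complex>\<^sup>2 - {0}\<close> the component \<open>y $ 1\<close> belongs to \<open>O\<close> and \<open>y $ 2\<close> to
  \<open>O(1,1,1)\<close>; the scalar \<open>s\<close> projectivises the fibre.\<close>

type_synonym bundle_coords = "((complex^2)^3) \<times> (complex^2)"

definition bundle_orbit :: "bundle_coords \<Rightarrow> bundle_coords set" where
  "bundle_orbit = (\<lambda>(x, y).
     {((\<chi> k. t $ k *s x $ k), vector [s * y $ 1, s * (\<Prod>k\<in>UNIV. t $ k) * y $ 2]) | t s.
        (\<forall>k. t $ k \<noteq> 0) \<and> s \<noteq> 0})"

text \<open>On \<open>x $ k $ i k \<noteq> 0\<close>, \<open>y $ j \<noteq> 0\<close>. In the index type \<open>2\<close> one has \<open>2 = 0\<close> and \<open>1 + 1 = 2\<close>, so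
  \<open>i k + 1\<close> is the index other than \<open>i k\<close>.\<close>

definition bundle_chart_domain :: "(3 \<Rightarrow> 2) \<Rightarrow> 2 \<Rightarrow> bundle_coords set set" where
  "bundle_chart_domain i j =
     {bundle_orbit (x, y) | x y. (\<forall>k. x $ k \<noteq> 0) \<and> y \<noteq> 0 \<and> (\<forall>k. x $ k $ i k \<noteq> 0) \<and> y $ j \<noteq> 0}"

definition bundle_chart_map :: "(3 \<Rightarrow> 2) \<Rightarrow> 2 \<Rightarrow> bundle_coords set \<Rightarrow> complex^4" where
  "bundle_chart_map i j p =
     (let (x, y) = (SOME z. z \<in> p);
          w = (\<lambda>k. x $ k $ (i k + 1) / x $ k $ i k);
          e = (\<Prod>k\<in>UNIV. x $ k $ i k)
      in vector [w 1, w 2, w 3, if j = 1 then y $ 2 / (e * y $ 1) else e * y $ 1 / y $ 2])"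

definition P_O_O111 :: "(bundle_coords set, 4) chart set" where
  "P_O_O111 = {(bundle_chart_domain i j, bundle_chart_map i j) | i j. True}"

end

theory Submission
  imports Defs "HOL-Computational_Algebra.Polynomial"
begin

text \<open>The four-dimensional torus acts on the bundle. Averaging a Kaehler form over the torus does not
  change its class, and by the Poincare lemma in the charts two invariant Kaehler forms are
  cohomologous as soon as their moment maps agree at the fixed points. A Kaehler class is therefore
  given by the length \<open>L\<close> of the moment interval of the fibre and by three numbers \<open>C\<^sub>k > L\<close>.
  In every such class Calabi's momentum construction works: with fibre momentum \<open>\<tau> \<in> (0, L)\<close> and
  \<open>q(\<tau>) = \<Prod>\<^sub>k (C\<^sub>k - \<tau>)\<close>, a profile \<open>F / q\<close> gives a metric of scalar curvature
  \<open>\<Sum>\<^sub>k 2 / (C\<^sub>k - \<tau>) - F'' / q\<close>. It is extremal if this is affine in \<open>\<tau>\<close>, which together with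
  the boundary conditions for a smooth metric determines a polynomial \<open>F\<close>, and \<open>F\<close> is positive on \<open>(0, L)\<close>.

  The slice of the anticanonical moment polytope over \<open>x\<^sub>4 = y \<in> [-1, 1]\<close> is the cube \<open>[-1, 1 - y]\<^sup>3\<close>.
  Computing three moments of the weight \<open>(2 - y)\<^sup>3\<close> shows that \<open>1 - \<theta>\<close> is a positive multiple of
  \<open>x\<^sub>4 + 58/63\<close>. As \<open>58/63 < 1\<close>, it is negative near the facet \<open>x\<^sub>4 = -1\<close>, and the function
  \<open>max 0 (- x\<^sub>4 - 58/63)\<close>, which vanishes at the origin, has negative Ding invariant.\<close>

text \<open>Forms are compared on the open torus orbit, where the transition maps are monomials: in
  the frame \<open>z * \<xi>\<close> (componentwise product) their derivative is a constant integer
  matrix, and continuity carries the result to the coordinate hyperplanes. De Rham theory is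
  replaced by one explicit primitive per chart, integration along rays from the origin. For an
  invariant form it vanishes on the real directions of this frame and is the moment map on the
  rotation fields, so the primitives glue exactly when the moment maps do; these differ by constants
  only, which L and the C_k record. The metric must extend smoothly over both ends of the fibre,
  while the momentum as a function of the squared fibre norm r is under control near r = 0 only;
  hence a second profile is built from the reflected polynomial F(L - x) and matched with the first
  under r -> 1/r. Positivity of F in every class rests on the convexity of the sum of the 2 / (C_k -
  x). The destabilising function is a multiple of the negative part of 1 - \<theta>, so that its
  product with 1 - \<theta> is nowhere positive.\<close>

abbreviation "FD f z u \<equiv> frechet_derivative f (at z) u"

lemma FD_eq: "(f has_derivative f') (at z) \<Longrightarrow> FD f z u = f' u"
  by (metis frechet_derivative_at)

lemma has_derivative_FD: "f differentiable (at z) \<Longrightarrow> (f has_derivative (\<lambda>u. FD f z u)) (at z)"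
  by (simp add: frechet_derivative_works)

section \<open>Functions of class C^k on open sets\<close>

lemma Ck_on_SucD: "Ck_on (Suc k) f S \<Longrightarrow> Ck_on k f S"
proof (induction k arbitrary: f)
  case 0
  then show ?case
    by (auto simp: continuous_on_eq_continuous_within differentiable_imp_continuous_within
        intro: continuous_at_imp_continuous_at_within)
next
  case (Suc k)
  then show ?case by (metis Ck_on.simps(2))
qed

lemma Ck_on_imp_continuous_on: "Ck_on k f S \<Longrightarrow> continuous_on S f"
  by (induction k) (use Ck_on_SucD in \<open>auto simp del: Ck_on.simps(2)\<close>)

text \<open>\<open>Ck_on\<close> speaks of \<open>frechet_derivative\<close>, a choice operator;
  this rule lets a derivative be supplied as a formula. The formula is right only on the open set S,
  so congruence on S is part of the argument: a function that equals g on S inherits the derivatives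
  of g there, by induction on the order.\<close>

lemma Ck_on_SucI:
  assumes "\<And>x. x \<in> S \<Longrightarrow> (f has_derivative f' x) (at x)"
    and "\<And>v. Ck_on k (\<lambda>x. f' x v) S" and "open S"
  shows "Ck_on (Suc k) f S"
proof -
  have cong: "Ck_on k g S \<Longrightarrow> (\<And>x. x \<in> S \<Longrightarrow> f x = g x) \<Longrightarrow> Ck_on k f S"
    for k and f g :: "'a \<Rightarrow> 'b"
  proof (induction k arbitrary: f g)
    case 0
    then show ?case by (simp cong: continuous_on_cong)
  next
    case (Suc k)
    have d: "(f has_derivative (\<lambda>u. FD g x u)) (at x)" if "x \<in> S" for x
      using Suc.prems that \<open>open S\<close>
      by (intro has_derivative_transform_within_open[OF has_derivative_FD]) auto
    then have "FD f x v = FD g x v" if "x \<in> S" for x v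
      using that by (simp add: FD_eq)
    then have "Ck_on k (\<lambda>x. FD f x v) S" for v
      using Suc.prems(1) by (rule_tac Suc.IH[of "\<lambda>x. FD g x v"]) auto
    then show ?case using d by (auto simp: differentiable_def)
  qed
  have "FD f x v = f' x v" if "x \<in> S" for x v
    using assms(1)[OF that] by (rule FD_eq)
  then have "Ck_on k (\<lambda>x. FD f x v) S" for v
    by (rule_tac cong[OF assms(2)]) auto
  then show ?thesis using assms(1) by (auto simp: differentiable_def)
qed

lemma Ck_on_SucE:
  assumes "Ck_on (Suc k) f S" "x \<in> S"
  shows "(f has_derivative (\<lambda>u. FD f x u)) (at x)"
  using assms by (simp add: has_derivative_FD)

lemma Ck_on_cong:
  assumes "Ck_on k g S" "\<And>x. x \<in> S \<Longrightarrow> f x = g x" "open S"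
  shows "Ck_on k f S"
  using assms
proof (cases k)
  case 0
  then show ?thesis using assms by (simp cong: continuous_on_cong)
next
  case (Suc n)
  have "(f has_derivative (\<lambda>u. FD g x u)) (at x)" if "x \<in> S" for x
    using assms that Suc
    by (intro has_derivative_transform_within_open[OF has_derivative_FD]) auto
  then show ?thesis unfolding Suc using assms Suc
    by (intro Ck_on_SucI[where f'="\<lambda>x u. FD g x u"]) auto
qed

lemma Ck_on_subset: "Ck_on k f T \<Longrightarrow> S \<subseteq> T \<Longrightarrow> Ck_on k f S"
  by (induction k arbitrary: f) (auto intro: continuous_on_subset)

lemma Ck_on_const: "open S \<Longrightarrow> Ck_on k (\<lambda>x. c) S"
proof (induction k arbitrary: c)
  case (Suc k)
  then show ?case by (intro Ck_on_SucI[where f'="\<lambda>x u. 0"]) auto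
qed simp

lemma Ck_on_bounded_linear:
  assumes "bounded_linear L" "Ck_on k f S" "open S"
  shows "Ck_on k (\<lambda>x. L (f x)) S"
  using assms(2)
proof (induction k arbitrary: f)
  case 0
  then show ?case using bounded_linear.continuous_on[OF assms(1)] by simp
next
  case (Suc k)
  then show ?case
    by (intro Ck_on_SucI[where f'="\<lambda>x u. L (FD f x u)"] assms
        bounded_linear.has_derivative[OF assms(1)] Ck_on_SucE Suc.IH) auto
qed

lemma Ck_on_linear:
  assumes "bounded_linear L" "open S"
  shows "Ck_on k L S"
proof (cases k)
  case 0
  then show ?thesis using assms by (simp add: linear_continuous_on)
next
  case (Suc n)
  then show ?thesis
    using Ck_on_SucI[where f=L and f'="\<lambda>x. L", OF bounded_linear_imp_has_derivative[OF assms(1)] Ck_on_const] assms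
    by blast
qed

lemma Ck_on_add:
  assumes "Ck_on k f S" "Ck_on k g S" "open S"
  shows "Ck_on k (\<lambda>x. f x + g x) S"
  using assms(1,2)
proof (induction k arbitrary: f g)
  case 0
  then show ?case by (simp add: continuous_on_add)
next
  case (Suc k)
  show ?case
  proof (rule Ck_on_SucI[where f'="\<lambda>x u. FD f x u + FD g x u"])
    show "((\<lambda>x. f x + g x) has_derivative (\<lambda>u. FD f x u + FD g x u)) (at x)" if "x \<in> S" for x
      using Suc.prems that by (intro has_derivative_add Ck_on_SucE)
    show "Ck_on k (\<lambda>x. FD f x v + FD g x v) S" for v
      using Suc.prems by (intro Suc.IH) auto
  qed fact
qed

lemma Ck_on_sum:
  assumes "finite I" "\<And>i. i \<in> I \<Longrightarrow> Ck_on k (f i) S" "open S"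
  shows "Ck_on k (\<lambda>x. \<Sum>i\<in>I. f i x) S"
  using assms(1,2) by (induction I) (auto intro!: Ck_on_const Ck_on_add \<open>open S\<close>)

lemma Ck_on_bilinear:
  assumes B: "bounded_bilinear B" and "Ck_on k f S" "Ck_on k g S" "open S"
  shows "Ck_on k (\<lambda>x. B (f x) (g x)) S"
  using assms(2,3)
proof (induction k arbitrary: f g)
  case 0
  then show ?case by (simp add: bounded_bilinear.continuous_on[OF B])
next
  case (Suc k)
  show ?case
  proof (rule Ck_on_SucI[where f'="\<lambda>x u. B (f x) (FD g x u) + B (FD f x u) (g x)"])
    show "((\<lambda>x. B (f x) (g x)) has_derivative (\<lambda>u. B (f x) (FD g x u) + B (FD f x u) (g x))) (at x)"
      if "x \<in> S" for x
      using Suc.prems that by (intro bounded_bilinear.FDERIV[OF B] Ck_on_SucE)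
    show "Ck_on k (\<lambda>x. B (f x) (FD g x v) + B (FD f x v) (g x)) S" for v
      using Suc.prems Suc.prems[THEN Ck_on_SucD] \<open>open S\<close> by (intro Ck_on_add Suc.IH) auto
  qed fact
qed

lemma Ck_on_components:
  fixes f :: "'a::real_normed_vector \<Rightarrow> 'b::euclidean_space"
  assumes "\<And>b. b \<in> Basis \<Longrightarrow> Ck_on k (\<lambda>x. f x \<bullet> b) S" "open S"
  shows "Ck_on k f S"
proof -
  have "Ck_on k (\<lambda>x. \<Sum>b\<in>Basis. (f x \<bullet> b) *\<^sub>R b) S"
    by (intro Ck_on_sum Ck_on_bounded_linear[OF bounded_linear_scaleR_left] assms) auto
  then show ?thesis by (simp add: euclidean_representation)
qed

text \<open>In the chain rule the direction \<open>FD f x u\<close> moves with x, which the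
  induction hypothesis cannot handle. Expanding it in \<open>Basis\<close> leaves products of a
  scalar with \<open>FD g (f x) b\<close> for a fixed b, and such a factor is again a composition
  with f, of lower order. Hence the induction varies g and keeps f.\<close>

lemma Ck_on_compose:
  fixes f :: "'a::real_normed_vector \<Rightarrow> 'b::euclidean_space" and g :: "'b \<Rightarrow> 'c::real_normed_vector"
  assumes "Ck_on k g T" "Ck_on k f S" "open S" "f ` S \<subseteq> T"
  shows "Ck_on k (\<lambda>x. g (f x)) S"
  using assms(1,2)
proof (induction k arbitrary: g)
  case 0
  then show ?case using assms(4) continuous_on_compose2 by auto
next
  case (Suc k)
  let ?g' = "\<lambda>x u. \<Sum>b\<in>Basis. (FD f x u \<bullet> b) *\<^sub>R FD g (f x) b"
  have "((\<lambda>x. g (f x)) has_derivative ?g' x) (at x)" if "x \<in> S" for x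
  proof -
    have g: "(g has_derivative (\<lambda>u. FD g (f x) u)) (at (f x))"
      using Suc.prems(1) that assms(4) by (intro Ck_on_SucE) auto
    have f: "(f has_derivative (\<lambda>u. FD f x u)) (at x)"
      using Suc.prems(2) that by (rule Ck_on_SucE)
    have "FD g (f x) w = (\<Sum>b\<in>Basis. (w \<bullet> b) *\<^sub>R FD g (f x) b)" for w
    proof -
      interpret bounded_linear "\<lambda>u. FD g (f x) u" using g by (rule has_derivative_bounded_linear)
      show ?thesis
        by (subst euclidean_representation[of w, symmetric]) (simp only: sum scaleR)
    qed
    then have "(\<lambda>u. FD g (f x) (FD f x u)) = ?g' x" by (intro ext)
    with diff_chain_at[OF f g] show "((\<lambda>x. g (f x)) has_derivative ?g' x) (at x)"
      unfolding o_def by (simp only:)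
  qed
  then show ?case
  proof (rule Ck_on_SucI)
    fix v show "Ck_on k (\<lambda>x. ?g' x v) S"
    proof (intro Ck_on_sum Ck_on_bilinear[OF bounded_bilinear_scaleR])
      fix b :: 'b
      show "Ck_on k (\<lambda>x. FD f x v \<bullet> b) S"
        using Suc.prems \<open>open S\<close> by (intro Ck_on_bounded_linear[OF bounded_linear_inner_left]) auto
      show "Ck_on k (\<lambda>x. FD g (f x) b) S"
        using Suc.prems Ck_on_SucD[OF Suc.prems(2)] by (rule_tac Suc.IH[of "\<lambda>y. FD g y b"]) auto
    qed (use assms in auto)
  qed (use assms in auto)
qed

lemma Ck_on_inverse_real: "Ck_on k (inverse :: real \<Rightarrow> real) (- {0})"
proof (induction k)
  case 0
  then show ?case by (auto intro: continuous_intros)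
next
  case (Suc k)
  show ?case
  proof (rule Ck_on_SucI[where f'="\<lambda>x u. - (inverse x * u * inverse x)"])
    fix v :: real
    have "Ck_on k (\<lambda>x. (- v) * (inverse x * inverse x)) (-{0::real})"
      by (intro Ck_on_bounded_linear[OF bounded_linear_mult_right]
         Ck_on_bilinear[OF bounded_bilinear_mult] Suc) auto
    then show "Ck_on k (\<lambda>x. - (inverse x * v * inverse x)) (-{0::real})" by (simp add: mult_ac)
  qed (auto intro!: has_derivative_inverse')
qed

lemma Ck_on_exp_real: "Ck_on k (exp :: real \<Rightarrow> real) UNIV"
proof (induction k)
  case (Suc k)
  show ?case
    by (rule Ck_on_SucI[where f'="\<lambda>x u. exp x * u"])
      (auto intro!: derivative_eq_intros Ck_on_bilinear[OF bounded_bilinear_mult] Suc Ck_on_const)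
qed (auto intro: continuous_intros)

lemma Ck_on_ln_real: "Ck_on k (ln :: real \<Rightarrow> real) {0<..}"
proof (cases k)
  case (Suc n)
  show ?thesis unfolding Suc
    by (rule Ck_on_SucI[where f'="\<lambda>x u. inverse x * u"])
      (auto intro!: derivative_eq_intros Ck_on_bilinear[OF bounded_bilinear_mult] Ck_on_const
         Ck_on_subset[OF Ck_on_inverse_real] simp: inverse_eq_divide[symmetric] divide_inverse mult.commute)
qed (auto intro!: continuous_intros)

subsection \<open>Smooth functions\<close>

lemma smooth_on_Ck: "smooth_on f S \<Longrightarrow> Ck_on k f S"
  by (simp add: smooth_on_def)

lemma smooth_on_imp_continuous_on: "smooth_on f S \<Longrightarrow> continuous_on S f"
  using smooth_on_Ck Ck_on_imp_continuous_on by blast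

lemma smooth_on_has_derivative:
  "smooth_on f S \<Longrightarrow> x \<in> S \<Longrightarrow> (f has_derivative (\<lambda>u. FD f x u)) (at x)"
  by (blast intro: Ck_on_SucE smooth_on_Ck)

lemma smooth_on_FD: "smooth_on f S \<Longrightarrow> smooth_on (\<lambda>x. FD f x v) S"
  unfolding smooth_on_def by (metis Ck_on.simps(2))

lemma smooth_on_cong:
  "smooth_on g S \<Longrightarrow> (\<And>x. x \<in> S \<Longrightarrow> f x = g x) \<Longrightarrow> open S \<Longrightarrow> smooth_on f S"
  unfolding smooth_on_def using Ck_on_cong by blast

lemma smooth_on_subset: "smooth_on f T \<Longrightarrow> S \<subseteq> T \<Longrightarrow> smooth_on f S"
  unfolding smooth_on_def using Ck_on_subset by blast

lemma smooth_on_has_derivativeI: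
  assumes "\<And>x. x \<in> S \<Longrightarrow> (f has_derivative f' x) (at x)"
    and "\<And>v. smooth_on (\<lambda>x. f' x v) S" and "open S"
  shows "smooth_on f S"
  unfolding smooth_on_def
proof
  fix k show "Ck_on k f S"
    using Ck_on_SucI[OF assms(1) _ assms(3), of k] assms(2) by (auto simp: smooth_on_def intro: Ck_on_SucD)
qed

named_theorems smooth_intros

lemma smooth_on_const [smooth_intros]: "open S \<Longrightarrow> smooth_on (\<lambda>x. c) S"
  by (simp add: smooth_on_def Ck_on_const)

lemma smooth_on_bounded_linear:
  "bounded_linear L \<Longrightarrow> smooth_on f S \<Longrightarrow> open S \<Longrightarrow> smooth_on (\<lambda>x. L (f x)) S"
  by (simp add: smooth_on_def Ck_on_bounded_linear)

lemma smooth_on_linear: "bounded_linear L \<Longrightarrow> open S \<Longrightarrow> smooth_on L S"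
  by (simp add: smooth_on_def Ck_on_linear)

lemma smooth_on_id [smooth_intros]: "open S \<Longrightarrow> smooth_on (\<lambda>x. x) S"
  using smooth_on_linear[OF bounded_linear_ident] .

lemma smooth_on_add [smooth_intros]:
  "smooth_on f S \<Longrightarrow> smooth_on g S \<Longrightarrow> open S \<Longrightarrow> smooth_on (\<lambda>x. f x + g x) S"
  by (simp add: smooth_on_def Ck_on_add)

lemma smooth_on_minus [smooth_intros]: "smooth_on f S \<Longrightarrow> open S \<Longrightarrow> smooth_on (\<lambda>x. - f x) S"
  by (rule smooth_on_bounded_linear[OF bounded_linear_minus[OF bounded_linear_ident]])

lemma smooth_on_diff [smooth_intros]:
  "smooth_on f S \<Longrightarrow> smooth_on g S \<Longrightarrow> open S \<Longrightarrow> smooth_on (\<lambda>x. f x - g x) S"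
  using smooth_on_add[of f S "\<lambda>x. - g x"] smooth_on_minus by fastforce

lemma smooth_on_sum [smooth_intros]:
  "(\<And>i. i \<in> I \<Longrightarrow> smooth_on (f i) S) \<Longrightarrow> finite I \<Longrightarrow> open S \<Longrightarrow> smooth_on (\<lambda>x. \<Sum>i\<in>I. f i x) S"
  by (simp add: smooth_on_def Ck_on_sum)

lemma smooth_on_bilinear:
  "bounded_bilinear B \<Longrightarrow> smooth_on f S \<Longrightarrow> smooth_on g S \<Longrightarrow> open S \<Longrightarrow> smooth_on (\<lambda>x. B (f x) (g x)) S"
  by (simp add: smooth_on_def Ck_on_bilinear)

lemma smooth_on_mult [smooth_intros]:
  fixes f g :: "_ \<Rightarrow> 'a::real_normed_algebra"
  shows "smooth_on f S \<Longrightarrow> smooth_on g S \<Longrightarrow> open S \<Longrightarrow> smooth_on (\<lambda>x. f x * g x) S"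
  by (rule smooth_on_bilinear[OF bounded_bilinear_mult])

lemma smooth_on_scaleR [smooth_intros]:
  "smooth_on f S \<Longrightarrow> smooth_on g S \<Longrightarrow> open S \<Longrightarrow> smooth_on (\<lambda>x. f x *\<^sub>R g x) S"
  by (rule smooth_on_bilinear[OF bounded_bilinear_scaleR])

lemma smooth_on_compose:
  fixes f :: "'a::real_normed_vector \<Rightarrow> 'b::euclidean_space"
  shows "smooth_on g T \<Longrightarrow> smooth_on f S \<Longrightarrow> open S \<Longrightarrow> f ` S \<subseteq> T \<Longrightarrow> smooth_on (\<lambda>x. g (f x)) S"
  unfolding smooth_on_def using Ck_on_compose[of _ g T f S] by blast

lemma smooth_on_power [smooth_intros]:
  fixes f :: "_ \<Rightarrow> 'a::real_normed_algebra_1"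
  shows "smooth_on f S \<Longrightarrow> open S \<Longrightarrow> smooth_on (\<lambda>x. f x ^ n) S"
  by (induction n) (auto intro!: smooth_intros)

lemma smooth_on_prod [smooth_intros]:
  fixes f :: "_ \<Rightarrow> _ \<Rightarrow> 'a::{real_normed_algebra_1, comm_monoid_mult}"
  shows "(\<And>i. i \<in> I \<Longrightarrow> smooth_on (f i) S) \<Longrightarrow> finite I \<Longrightarrow> open S \<Longrightarrow> smooth_on (\<lambda>x. \<Prod>i\<in>I. f i x) S"
  by (induction I rule: infinite_finite_induct) (auto intro!: smooth_intros)

lemma smooth_on_components:
  fixes f :: "'a::real_normed_vector \<Rightarrow> 'b::euclidean_space"
  shows "(\<And>b. b \<in> Basis \<Longrightarrow> smooth_on (\<lambda>x. f x \<bullet> b) S) \<Longrightarrow> open S \<Longrightarrow> smooth_on f S"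
  by (simp add: smooth_on_def Ck_on_components)

lemma smooth_on_inverse [smooth_intros]:
  fixes f :: "_ \<Rightarrow> real"
  shows "smooth_on f S \<Longrightarrow> (\<And>x. x \<in> S \<Longrightarrow> f x \<noteq> 0) \<Longrightarrow> open S \<Longrightarrow> smooth_on (\<lambda>x. inverse (f x)) S"
  by (rule smooth_on_compose[where T="-{0}"]) (auto simp: smooth_on_def Ck_on_inverse_real)

lemma smooth_on_divide [smooth_intros]:
  fixes f :: "_ \<Rightarrow> real"
  shows "smooth_on f S \<Longrightarrow> smooth_on g S \<Longrightarrow> (\<And>x. x \<in> S \<Longrightarrow> g x \<noteq> 0) \<Longrightarrow> open S \<Longrightarrow> smooth_on (\<lambda>x. f x / g x) S"
  unfolding divide_inverse by (intro smooth_intros)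

lemma smooth_on_ln [smooth_intros]:
  fixes f :: "_ \<Rightarrow> real"
  shows "smooth_on f S \<Longrightarrow> (\<And>x. x \<in> S \<Longrightarrow> f x > 0) \<Longrightarrow> open S \<Longrightarrow> smooth_on (\<lambda>x. ln (f x)) S"
  by (rule smooth_on_compose[where T="{0<..}"]) (auto simp: smooth_on_def Ck_on_ln_real)

lemma smooth_on_exp [smooth_intros]:
  fixes f :: "_ \<Rightarrow> real"
  shows "smooth_on f S \<Longrightarrow> open S \<Longrightarrow> smooth_on (\<lambda>x. exp (f x)) S"
  by (rule smooth_on_compose[where T=UNIV]) (auto simp: smooth_on_def Ck_on_exp_real)

lemma smooth_on_vec_nth [smooth_intros]:
  "smooth_on f S \<Longrightarrow> open S \<Longrightarrow> smooth_on (\<lambda>x. f x $ i) S"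
  by (rule smooth_on_bounded_linear[OF bounded_linear_vec_nth])

lemma smooth_on_cnj [smooth_intros]: "smooth_on f S \<Longrightarrow> open S \<Longrightarrow> smooth_on (\<lambda>x. cnj (f x)) S"
  by (rule smooth_on_bounded_linear[OF bounded_linear_cnj])

lemma smooth_on_Re [smooth_intros]: "smooth_on f S \<Longrightarrow> open S \<Longrightarrow> smooth_on (\<lambda>x. Re (f x)) S"
  by (rule smooth_on_bounded_linear[OF bounded_linear_Re])

lemma smooth_on_Im [smooth_intros]: "smooth_on f S \<Longrightarrow> open S \<Longrightarrow> smooth_on (\<lambda>x. Im (f x)) S"
  by (rule smooth_on_bounded_linear[OF bounded_linear_Im])

lemma smooth_on_of_real [smooth_intros]:
  "smooth_on f S \<Longrightarrow> open S \<Longrightarrow> smooth_on (\<lambda>x. complex_of_real (f x)) S"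
  by (rule smooth_on_bounded_linear[OF bounded_linear_of_real])

lemma smooth_on_fst [smooth_intros]: "smooth_on f S \<Longrightarrow> open S \<Longrightarrow> smooth_on (\<lambda>x. fst (f x)) S"
  by (rule smooth_on_bounded_linear[OF bounded_linear_fst])

lemma smooth_on_snd [smooth_intros]: "smooth_on f S \<Longrightarrow> open S \<Longrightarrow> smooth_on (\<lambda>x. snd (f x)) S"
  by (rule smooth_on_bounded_linear[OF bounded_linear_snd])

lemma smooth_on_vec_lambda [smooth_intros]:
  fixes f :: "'n::finite \<Rightarrow> _ \<Rightarrow> 'b::euclidean_space"
  assumes "\<And>i. smooth_on (f i) S" "open S"
  shows "smooth_on (\<lambda>x. \<chi> i. f i x) S"
proof (rule smooth_on_components)
  fix b :: "'b^'n" assume "b \<in> Basis"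
  then obtain i c where b: "b = axis i c" by (auto simp: Basis_vec_def)
  show "smooth_on (\<lambda>x. (\<chi> i. f i x) \<bullet> b) S"
    unfolding b inner_axis using assms
    by (auto intro!: smooth_on_bounded_linear[OF bounded_linear_inner_left])
qed fact

subsection \<open>Differentiation under the integral sign\<close>

text \<open>The Leibniz rule wants the derivative as a continuous family of bounded linear maps.
  Only the directional derivatives are known to be continuous, one direction at a time; in finite
  dimension, checking the basis vectors is enough.\<close>

lemma has_derivative_parametric_integral:
  fixes f :: "real \<times> 'a::euclidean_space \<Rightarrow> real"
  assumes "Ck_on (Suc 0) f UNIV"
  shows "((\<lambda>x. integral {0..1} (\<lambda>t. f (t, x))) has_derivative
     (\<lambda>u. integral {0..1} (\<lambda>t. FD f (t, x) (0, u)))) (at x)"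
proof -
  have df: "(f has_derivative (\<lambda>u. FD f p u)) (at p)" for p
    using assms by (rule Ck_on_SucE) auto
  have cont: "continuous_on UNIV (\<lambda>p. FD f p u)" for u
    using assms by (cases u) auto
  have lin: "bounded_linear (\<lambda>u. FD f p u)" for p
    using df by (rule has_derivative_bounded_linear)
  then have lin2: "bounded_linear (\<lambda>u. FD f p (0, u))" for p
    using bounded_linear_compose[OF _ bounded_linear_Pair[OF bounded_linear_zero bounded_linear_ident]] by blast
  define F where "F = (\<lambda>x t. Blinfun (\<lambda>u. FD f (t, x) (0, u)))"
  have F: "blinfun_apply (F x t) = (\<lambda>u. FD f (t, x) (0, u))" for x t
    unfolding F_def by (rule bounded_linear_Blinfun_apply[OF lin2])
  have cF: "continuous_on S (\<lambda>(x, t). F x t)" for S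
  proof (rule continuous_on_blinfun_componentwise)
    fix i :: 'a assume "i \<in> Basis"
    show "continuous_on S (\<lambda>s. blinfun_apply (case s of (x, t) \<Rightarrow> F x t) i)"
      using continuous_on_compose2[OF cont[of "(0,i)"], where f="\<lambda>s. (snd s, fst s)" and s=S]
      by (auto simp: F case_prod_beta continuous_intros)
  qed
  have contf: "continuous_on UNIV f" using assms Ck_on_imp_continuous_on by blast
  have d1: "((\<lambda>x. f (t, x)) has_derivative blinfun_apply (F x t)) (at x within UNIV)" for x t
    using has_derivative_compose[OF has_derivative_Pair[OF has_derivative_const has_derivative_ident] df, of t x]
    by (simp add: F)
  have i1: "(\<lambda>t. f (t, x)) integrable_on cbox 0 1" for x
    by (intro integrable_continuous continuous_on_compose2[OF contf] continuous_intros) auto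
  have "((\<lambda>x. integral (cbox 0 1) (\<lambda>t. f (t, x))) has_derivative
     integral (cbox 0 1) (F x)) (at x within UNIV)"
    by (rule leibniz_rule[where fx=F and U=UNIV]) (use d1 i1 cF in auto)
  moreover have "blinfun_apply (integral (cbox 0 1) (F x)) = (\<lambda>u. integral (cbox 0 1) (\<lambda>t. FD f (t, x) (0, u)))"
  proof
    fix u
    have "continuous_on (cbox 0 1) (F x)"
      using continuous_on_compose2[OF cF[of UNIV], where f="\<lambda>t. (x, t)" and s="cbox 0 1"]
      by (auto simp: continuous_intros)
    then have "F x integrable_on cbox 0 1" by (rule integrable_continuous)
    then show "blinfun_apply (integral (cbox 0 1) (F x)) u = integral (cbox 0 1) (\<lambda>t. FD f (t, x) (0, u))"
      using integral_linear[OF _ blinfun.bounded_linear_left, of "F x" "cbox 0 1" u]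
      by (simp add: o_def F)
  qed
  ultimately show ?thesis by simp
qed

text \<open>The derivative in a direction u is a parametric integral of the same shape, with
  integrand \<open>FD f (t, x) (0, u)\<close>, so the induction runs over all integrands at
  once.\<close>

lemma smooth_on_parametric_integral:
  fixes f :: "real \<times> 'a::euclidean_space \<Rightarrow> real"
  assumes "smooth_on f UNIV"
  shows "smooth_on (\<lambda>x. integral {0..1} (\<lambda>t. f (t, x))) UNIV"
proof -
  have "Ck_on k f UNIV \<Longrightarrow> Ck_on k (\<lambda>x. integral {0..1} (\<lambda>t. f (t, x))) UNIV" for k
  proof (induction k arbitrary: f)
    case 0
    then have c: "continuous_on UNIV f" by simp
    have "continuous_on (UNIV \<times> cbox 0 1) (\<lambda>(x, t). f (t, x))"
      using continuous_on_compose2[OF c, where f="\<lambda>s. (snd s, fst s)" and s="UNIV \<times> cbox 0 1"]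
      by (auto simp: case_prod_beta continuous_intros)
    then show ?case using integral_continuous_on_param[of UNIV 0 1 "\<lambda>x t. f (t, x)"] by simp
  next
    case (Suc k)
    have "Ck_on (Suc 0) f UNIV" using Suc.prems by (metis Ck_on.simps Ck_on_imp_continuous_on)
    then show ?case
      by (intro Ck_on_SucI[OF has_derivative_parametric_integral] Suc.IH)
        (use Suc.prems in auto)
  qed
  then show ?thesis using assms by (simp add: smooth_on_def)
qed

subsection \<open>Symmetry of second derivatives\<close>

text \<open>Schwarz's theorem by second differences: two uses of the mean value theorem turn the
  second difference with step h into h^2 times a mixed derivative, in either order, at a point whose
  distance from x is of order h. Continuity of both mixed derivatives gives equality as h tends to
  0.\<close>

lemma second_derivative_symmetric:
  fixes f :: "'a::euclidean_space \<Rightarrow> real"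
  assumes "smooth_on f UNIV"
  shows "FD (\<lambda>y. FD f y u) x v = FD (\<lambda>y. FD f y v) x u"
proof -
  have lin: "g differentiable (at y) \<Longrightarrow> FD g y (c *\<^sub>R w) = c * FD g y w" for g :: "'a \<Rightarrow> real" and y c w
    using linear_frechet_derivative linear_scale by fastforce
  have d1: "f differentiable (at y)" for y
    using smooth_on_has_derivative[OF assms] by (auto simp: differentiable_def)
  have d2: "(\<lambda>y. FD f y w) differentiable (at y)" for y w
    using smooth_on_has_derivative[OF smooth_on_FD[OF assms]] by (auto simp: differentiable_def)
  have line: "((\<lambda>t. g (p + t *\<^sub>R w)) has_real_derivative FD g (p + t *\<^sub>R w) w) (at t)"
    if "\<And>y. g differentiable (at y)" for g :: "'a \<Rightarrow> real" and p w t
  proof -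
    have "((\<lambda>t. g (p + t *\<^sub>R w)) has_derivative (\<lambda>s. FD g (p + t *\<^sub>R w) (s *\<^sub>R w))) (at t)"
      by (rule has_derivative_compose[OF _ has_derivative_FD[OF that]]) (auto intro!: derivative_eq_intros)
    then show ?thesis
      by (simp add: has_field_derivative_def lin[OF that] mult.commute[of _ "FD g _ w"])
  qed
  have mixed: "\<exists>s\<in>{0<..<h}. \<exists>t\<in>{0<..<h}. f (x + h *\<^sub>R v + h *\<^sub>R u) - f (x + h *\<^sub>R v) - f (x + h *\<^sub>R u) + f x
      = h * h * FD (\<lambda>y. FD f y u) (x + s *\<^sub>R v + t *\<^sub>R u) v"
    if "h > 0" for h u v
  proof -
    let ?p = "\<lambda>t. f ((x + h *\<^sub>R v) + t *\<^sub>R u) - f (x + t *\<^sub>R u)"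
    have "\<exists>z>0. z < h \<and> ?p h - ?p 0 = (h - 0) * (FD f ((x + h *\<^sub>R v) + z *\<^sub>R u) u - FD f (x + z *\<^sub>R u) u)"
      by (rule MVT2[OF that]) (intro DERIV_diff line d1)
    then obtain t where t: "0 < t" "t < h"
      "?p h - ?p 0 = h * (FD f ((x + h *\<^sub>R v) + t *\<^sub>R u) u - FD f (x + t *\<^sub>R u) u)" by auto
    have "\<exists>z>0. z < h \<and> FD f ((x + t *\<^sub>R u) + h *\<^sub>R v) u - FD f ((x + t *\<^sub>R u) + 0 *\<^sub>R v) u
        = (h - 0) * FD (\<lambda>y. FD f y u) ((x + t *\<^sub>R u) + z *\<^sub>R v) v"
      by (rule MVT2[OF that]) (intro line d2)
    then obtain s where s: "0 < s" "s < h" "FD f ((x + t *\<^sub>R u) + h *\<^sub>R v) u - FD f (x + t *\<^sub>R u) u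
        = h * FD (\<lambda>y. FD f y u) ((x + t *\<^sub>R u) + s *\<^sub>R v) v" by auto
    have e: "(x + t *\<^sub>R u) + r *\<^sub>R v = x + r *\<^sub>R v + t *\<^sub>R u" for r by simp
    show ?thesis
      using s t by (intro bexI[of _ s] bexI[of _ t]) (auto simp: e)
  qed
  define A where "A = (\<lambda>y. FD (\<lambda>y. FD f y u) y v)"
  define B where "B = (\<lambda>y. FD (\<lambda>y. FD f y v) y u)"
  have cont: "continuous (at x) A" "continuous (at x) B"
    unfolding A_def B_def
    using smooth_on_imp_continuous_on[OF smooth_on_FD[OF smooth_on_FD[OF assms]]]
    by (auto simp: continuous_on_eq_continuous_at)
  let ?h = "\<lambda>n. inverse (real (Suc n))"
  have "\<exists>y z. norm (y - x) \<le> ?h n * (norm u + norm v) \<and> norm (z - x) \<le> ?h n * (norm u + norm v) \<and> A y = B z" for n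
  proof -
    have h: "?h n > 0" by simp
    have nrm: "norm ((x + s *\<^sub>R a + t *\<^sub>R b) - x) \<le> ?h n * (norm a + norm b)"
      if "s \<in> {0<..<?h n}" "t \<in> {0<..<?h n}" for s t :: real and a b :: 'a
    proof -
      have "norm (s *\<^sub>R a + t *\<^sub>R b) \<le> s * norm a + t * norm b"
        using that by (metis abs_of_pos greaterThanLessThan_iff norm_scaleR norm_triangle_ineq)
      also have "\<dots> \<le> ?h n * norm a + ?h n * norm b"
        using that by (intro add_mono mult_right_mono) auto
      finally show ?thesis by (simp add: algebra_simps)
    qed
    from mixed[OF h, of v u] obtain s t where st: "s \<in> {0<..<?h n}" "t \<in> {0<..<?h n}"
      and e1: "f (x + ?h n *\<^sub>R v + ?h n *\<^sub>R u) - f (x + ?h n *\<^sub>R v) - f (x + ?h n *\<^sub>R u) + f x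
        = ?h n * ?h n * A (x + s *\<^sub>R v + t *\<^sub>R u)" unfolding A_def by blast
    from mixed[OF h, of u v] obtain s' t' where st': "s' \<in> {0<..<?h n}" "t' \<in> {0<..<?h n}"
      and e2: "f (x + ?h n *\<^sub>R u + ?h n *\<^sub>R v) - f (x + ?h n *\<^sub>R u) - f (x + ?h n *\<^sub>R v) + f x
        = ?h n * ?h n * B (x + s' *\<^sub>R u + t' *\<^sub>R v)" unfolding B_def by blast
    have "?h n * ?h n * A (x + s *\<^sub>R v + t *\<^sub>R u) = ?h n * ?h n * B (x + s' *\<^sub>R u + t' *\<^sub>R v)"
      unfolding e1[symmetric] e2[symmetric] by (simp add: add.commute add.left_commute)
    then have "A (x + s *\<^sub>R v + t *\<^sub>R u) = B (x + s' *\<^sub>R u + t' *\<^sub>R v)" using h by (metis mult_cancel_left mult_eq_0_iff less_irrefl)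
    then show ?thesis using nrm[OF st, of v u] nrm[OF st', of u v] by (metis add.commute)
  qed
  then obtain y z where yz: "\<And>n. norm (y n - x) \<le> ?h n * (norm u + norm v)"
    "\<And>n. norm (z n - x) \<le> ?h n * (norm u + norm v)" "\<And>n. A (y n) = B (z n)"
    by metis
  have h0: "(\<lambda>n. ?h n * (norm u + norm v)) \<longlonglongrightarrow> 0"
    using LIMSEQ_inverse_real_of_nat tendsto_mult_left_zero by blast
  have "y \<longlonglongrightarrow> x" "z \<longlonglongrightarrow> x"
    using yz by (auto intro!: LIM_zero_cancel[of _ x] Lim_null_comparison[OF _ h0])
  then have "(\<lambda>n. A (y n)) \<longlonglongrightarrow> A x" "(\<lambda>n. B (z n)) \<longlonglongrightarrow> B x"
    using cont by (auto intro: isCont_tendsto_compose)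
  then have "A x = B x" using yz(3) LIMSEQ_unique by auto
  then show ?thesis by (simp add: A_def B_def)
qed

section \<open>The charts of the bundle\<close>

lemma vector_4 [simp]:
  "(vector [w,x,y,z] :: 'a::zero^4) $ 1 = w" "(vector [w,x,y,z] :: 'a^4) $ 2 = x"
  "(vector [w,x,y,z] :: 'a^4) $ 3 = y" "(vector [w,x,y,z] :: 'a^4) $ 4 = z"
  unfolding vector_def by simp_all

lemma neq_2_iff: "(a::2) \<noteq> b \<longleftrightarrow> a = b + 1"
  using exhaust_2[of a] exhaust_2[of b] by (elim disjE; hypsubst) simp_all

text \<open>The coordinates of a chart are indexed by the type \<open>4\<close>, with \<open>4\<close> the index of the fibre
  coordinate, and a chart by the function \<open>s\<close> that combines \<open>i\<close> and \<open>j\<close>.\<close>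

definition emb :: "3 \<Rightarrow> 4" where "emb k = (if k = 1 then 1 else if k = 2 then 2 else 3)"

lemma emb_simps [simp]: "emb 1 = 1" "emb 2 = 2" "emb 3 = 3" by (simp_all add: emb_def)

definition chart :: "(4 \<Rightarrow> 2) \<Rightarrow> (bundle_coords set, 4) chart" where
  "chart s = (bundle_chart_domain (s \<circ> emb) (s 4), bundle_chart_map (s \<circ> emb) (s 4))"

text \<open>The representative in homogeneous coordinates in which every coordinate selected by s is
  normalised to 1. The factor \<open>e\<close> of \<open>bundle_chart_map\<close> is then 1, and the
  remaining entries are the chart coordinates.\<close>

definition hom :: "(4 \<Rightarrow> 2) \<Rightarrow> complex^4 \<Rightarrow> bundle_coords" where
  "hom s z = ((\<chi> k c. if c = s (emb k) then 1 else z $ emb k), (\<chi> c. if c = s 4 then 1 else z $ 4))"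

definition pt :: "(4 \<Rightarrow> 2) \<Rightarrow> complex^4 \<Rightarrow> bundle_coords set" where
  "pt s z = bundle_orbit (hom s z)"

lemma P_O_O111_eq: "P_O_O111 = range chart"
proof -
  have "\<exists>s. i = s \<circ> emb \<and> j = s 4" for i :: "3 \<Rightarrow> 2" and j :: 2
    by (rule exI[of _ "\<lambda>l. if l = 4 then j else if l = 1 then i 1 else if l = 2 then i 2 else i 3"])
      (auto simp: fun_eq_iff forall_3)
  then have "(bundle_chart_domain i j, bundle_chart_map i j) \<in> range chart" for i j
  proof -
    obtain s where "i = s \<circ> emb" "j = s 4" using \<open>\<And>i j. \<exists>s. i = s \<circ> emb \<and> j = s 4\<close> by blast
    then show ?thesis unfolding chart_def by (intro image_eqI[of _ _ s]) auto
  qed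
  then show ?thesis by (auto simp: P_O_O111_def chart_def)
qed

lemma bundle_orbit_iff: "(x', y') \<in> bundle_orbit (x, y) \<longleftrightarrow> (\<exists>t s. (\<forall>k. t $ k \<noteq> 0) \<and> s \<noteq> 0 \<and>
   x' = (\<chi> k. t $ k *s x $ k) \<and> y' = vector [s * y $ 1, s * (\<Prod>k\<in>UNIV. t $ k) * y $ 2])"
  unfolding bundle_orbit_def by auto

lemma vec_2_eq_iff: "(x::'a::zero^2) = y \<longleftrightarrow> x $ 1 = y $ 1 \<and> x $ 2 = y $ 2"
  by (simp add: vec_eq_iff forall_2)

lemma bundle_orbit_trans:
  assumes "a \<in> bundle_orbit b" "b \<in> bundle_orbit c"
  shows "a \<in> bundle_orbit c"
proof -
  obtain x y x' y' x'' y'' where e: "a = (x, y)" "b = (x', y')" "c = (x'', y'')" by (cases a, cases b, cases c)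
  from assms obtain t s t' s' where h: "\<forall>k. t $ k \<noteq> 0" "s \<noteq> 0" "\<forall>k. t' $ k \<noteq> 0" "s' \<noteq> 0"
    "x = (\<chi> k. t $ k *s x' $ k)" "y = vector [s * y' $ 1, s * (\<Prod>k\<in>UNIV. t $ k) * y' $ 2]"
    "x' = (\<chi> k. t' $ k *s x'' $ k)" "y' = vector [s' * y'' $ 1, s' * (\<Prod>k\<in>UNIV. t' $ k) * y'' $ 2]"
    unfolding e bundle_orbit_iff by blast
  have "x = (\<chi> k. (t * t') $ k *s x'' $ k)" using h by (simp add: vec_eq_iff)
  moreover have "y = vector [(s * s') * y'' $ 1, (s * s') * (\<Prod>k\<in>UNIV. (t * t') $ k) * y'' $ 2]"
    using h by (simp add: vec_2_eq_iff prod.distrib)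
  moreover have "(\<forall>k. (t * t') $ k \<noteq> 0) \<and> s * s' \<noteq> 0" using h by simp
  ultimately show ?thesis unfolding e bundle_orbit_iff by blast
qed

lemma bundle_orbit_sym:
  assumes "a \<in> bundle_orbit b"
  shows "b \<in> bundle_orbit a"
proof -
  obtain x y x' y' where e: "a = (x, y)" "b = (x', y')" by (cases a, cases b)
  from assms obtain t s where h: "\<forall>k. t $ k \<noteq> 0" "s \<noteq> 0"
    "x = (\<chi> k. t $ k *s x' $ k)" "y = vector [s * y' $ 1, s * (\<Prod>k\<in>UNIV. t $ k) * y' $ 2]"
    unfolding e bundle_orbit_iff by blast
  define p where "p = (\<Prod>k\<in>UNIV. t $ k)"
  have p: "p \<noteq> 0" using h by (simp add: p_def)
  have "x' = (\<chi> k. (\<chi> k. inverse (t $ k)) $ k *s x $ k)" using h by (simp add: vec_eq_iff)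
  moreover have "y' = vector [inverse s * y $ 1, inverse s * (\<Prod>k\<in>UNIV. (\<chi> k. inverse (t $ k)) $ k) * y $ 2]"
  proof -
    have "(\<Prod>k\<in>UNIV. (\<chi> k. inverse (t $ k)) $ k) = inverse p"
      by (simp add: p_def prod_inversef[unfolded o_def])
    then show ?thesis using h(2,4) p by (simp add: vec_2_eq_iff p_def[symmetric] field_simps)
  qed
  moreover have "(\<forall>k. (\<chi> k. inverse (t $ k)) $ k \<noteq> 0) \<and> inverse s \<noteq> 0" using h by simp
  ultimately show ?thesis unfolding e bundle_orbit_iff by blast
qed

lemma bundle_orbit_refl: "a \<in> bundle_orbit a"
  by (cases a) (auto simp: bundle_orbit_iff vec_eq_iff forall_2 intro!: exI[of _ "1"])

lemma bundle_orbit_eq: "a \<in> bundle_orbit b \<Longrightarrow> bundle_orbit a = bundle_orbit b"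
  using bundle_orbit_trans bundle_orbit_sym by blast

text \<open>The value at the chosen representative is that at any other: the quotients in the base
  lose the factor \<open>t $ k\<close>, while both \<open>e\<close> and \<open>y $ 2 / y $ 1\<close>
  are multiplied by the product of the \<open>t $ k\<close>.\<close>

lemma bundle_chart_map_orbit:
  assumes "\<forall>k. x $ k $ i k \<noteq> 0" "y $ j \<noteq> 0"
  shows "bundle_chart_map i j (bundle_orbit (x, y)) =
    (let w = (\<lambda>k. x $ k $ (i k + 1) / x $ k $ i k); e = (\<Prod>k\<in>UNIV. x $ k $ i k)
     in vector [w 1, w 2, w 3, if j = 1 then y $ 2 / (e * y $ 1) else e * y $ 1 / y $ 2])"
proof -
  have "(SOME z. z \<in> bundle_orbit (x, y)) \<in> bundle_orbit (x, y)"
    using bundle_orbit_refl by (rule someI)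
  then obtain x' y' where e: "(SOME z. z \<in> bundle_orbit (x, y)) = (x', y')" "(x', y') \<in> bundle_orbit (x, y)"
    by (metis surj_pair)
  then obtain t s where h: "\<forall>k. t $ k \<noteq> 0" "s \<noteq> 0"
    "x' = (\<chi> k. t $ k *s x $ k)" "y' = vector [s * y $ 1, s * (\<Prod>k\<in>UNIV. t $ k) * y $ 2]"
    unfolding bundle_orbit_iff by blast
  have nz: "x $ k $ i k \<noteq> 0" "t $ k \<noteq> 0" for k using assms h by auto
  have "(\<Prod>k\<in>UNIV. t $ k) \<noteq> 0" using h by simp
  then show ?thesis
    unfolding bundle_chart_map_def e(1) using nz h(2) assms(2) exhaust_2[of j]
    by (auto simp: h(3,4) vec_eq_iff forall_4 Let_def prod.distrib)
qed

lemma hom_nonzero: "hom s z = (x, y) \<Longrightarrow> x $ k \<noteq> 0" "hom s z = (x, y) \<Longrightarrow> y \<noteq> 0"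
proof -
  have "hom s z = (x, y) \<Longrightarrow> x $ k $ s (emb k) \<noteq> 0" "hom s z = (x, y) \<Longrightarrow> y $ s 4 \<noteq> 0"
    by (auto simp: hom_def)
  then show "hom s z = (x, y) \<Longrightarrow> x $ k \<noteq> 0" "hom s z = (x, y) \<Longrightarrow> y \<noteq> 0" by auto
qed

lemma fst_chart: "fst (chart s) = range (pt s)"
proof (intro set_eqI iffI)
  fix p assume "p \<in> range (pt s)"
  then obtain z where z: "p = pt s z" by auto
  obtain x y where xy: "hom s z = (x, y)" by fastforce
  have "x $ k $ s (emb k) = 1" "y $ s 4 = 1" for k using xy by (auto simp: hom_def)
  then have "(\<forall>k. x $ k \<noteq> 0) \<and> y \<noteq> 0 \<and> (\<forall>k. x $ k $ (s \<circ> emb) k \<noteq> 0) \<and> y $ (s 4) \<noteq> 0"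
    using hom_nonzero[OF xy] by simp
  then show "p \<in> fst (chart s)"
    unfolding z pt_def xy chart_def bundle_chart_domain_def fst_conv by blast
next
  fix p assume "p \<in> fst (chart s)"
  then obtain x y where xy: "p = bundle_orbit (x, y)" "\<forall>k. x $ k $ s (emb k) \<noteq> 0" "y $ s 4 \<noteq> 0"
    by (auto simp: chart_def bundle_chart_domain_def)
  define e where "e = (\<Prod>k\<in>UNIV. x $ k $ s (emb k))"
  have e: "e \<noteq> 0" using xy by (simp add: e_def)
  define z :: "complex^4" where "z = vector [x $ 1 $ (s 1 + 1) / x $ 1 $ s 1, x $ 2 $ (s 2 + 1) / x $ 2 $ s 2,
    x $ 3 $ (s 3 + 1) / x $ 3 $ s 3, if s 4 = 1 then y $ 2 / (e * y $ 1) else e * y $ 1 / y $ 2]"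
  have zk: "z $ emb k = x $ k $ (s (emb k) + 1) / x $ k $ s (emb k)" for k
    using exhaust_3[of k] by (auto simp: z_def)
  have "hom s z \<in> bundle_orbit (x, y)"
    unfolding hom_def bundle_orbit_iff
  \<comment> \<open>The base scalars make the selected base coordinates 1. Their product is 1 / e
    and multiplies \<open>y $ 2\<close>, so the fibre scalar has to be e / y_2 when
    \<open>y $ 2\<close> is to become 1, but 1 / y_1 in the other case.\<close>
  proof (rule exI[of _ "\<chi> k. inverse (x $ k $ s (emb k))"],
      rule exI[of _ "if s 4 = 1 then inverse (y $ 1) else e / y $ 2"], intro conjI)
    show "(\<chi> k c. if c = s (emb k) then 1 else z $ emb k) = (\<chi> k. (\<chi> k. inverse (x $ k $ s (emb k))) $ k *s x $ k)"
      using xy(2) neq_2_iff by (auto simp: vec_eq_iff zk divide_inverse)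
    have p: "(\<Prod>k\<in>UNIV. (\<chi> k. inverse (x $ k $ s (emb k))) $ k) = inverse e"
      by (simp add: e_def prod_inversef[unfolded o_def])
    show "(\<chi> c. if c = s 4 then 1 else z $ 4) = vector [(if s 4 = 1 then inverse (y $ 1) else e / y $ 2) * y $ 1,
       (if s 4 = 1 then inverse (y $ 1) else e / y $ 2) * (\<Prod>k\<in>UNIV. (\<chi> k. inverse (x $ k $ s (emb k))) $ k) * y $ 2]"
      unfolding p using exhaust_2[of "s 4"] xy(3) e by (auto simp: vec_2_eq_iff z_def field_simps)
  qed (use xy e exhaust_2[of "s 4"] in auto)
  then show "p \<in> range (pt s)"
    unfolding xy(1) pt_def using bundle_orbit_eq by blast
qed

text \<open>The transition maps are monomial; \<open>mat_log\<close> is the matrix of exponents.\<close>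

definition flips :: "(4 \<Rightarrow> 2) \<Rightarrow> (4 \<Rightarrow> 2) \<Rightarrow> 4 set" where
  "flips s s' = {l. l \<noteq> 4 \<and> s l \<noteq> s' l}"

definition trans_fun :: "(4 \<Rightarrow> 2) \<Rightarrow> (4 \<Rightarrow> 2) \<Rightarrow> complex^4 \<Rightarrow> complex^4" where
  "trans_fun s s' z = (\<chi> l. if l = 4
     then let w = z $ 4 * (if s 4 = 1 then inverse (\<Prod>k\<in>flips s s'. z $ k) else (\<Prod>k\<in>flips s s'. z $ k))
          in if s 4 = s' 4 then w else inverse w
     else if s l = s' l then z $ l else inverse (z $ l))"

text \<open>The sign is 1 when the fibre coordinate lies in \<open>O(1,1,1)\<close> and -1 when it
  is the reciprocal one, lying in the dual line bundle.\<close>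

definition sgn_fib :: "(4 \<Rightarrow> 2) \<Rightarrow> real" where
  "sgn_fib s = (if s 4 = 1 then 1 else -1)"

definition mat_log :: "(4 \<Rightarrow> 2) \<Rightarrow> (4 \<Rightarrow> 2) \<Rightarrow> complex^4 \<Rightarrow> complex^4" where
  "mat_log s s' \<xi> = (\<chi> l. if l = 4
     then let w = \<xi> $ 4 - of_real (sgn_fib s) * (\<Sum>k\<in>flips s s'. \<xi> $ k)
          in if s 4 = s' 4 then w else - w
     else if s l = s' l then \<xi> $ l else - \<xi> $ l)"

definition overl :: "(4 \<Rightarrow> 2) \<Rightarrow> (4 \<Rightarrow> 2) \<Rightarrow> (complex^4) set" where
  "overl s s' = {z. \<forall>l. s l \<noteq> s' l \<longrightarrow> z $ l \<noteq> 0}"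

definition torus :: "(complex^4) set" where
  "torus = {z. \<forall>l. z $ l \<noteq> 0}"

lemma torus_overl: "torus \<subseteq> overl s s'" by (auto simp: torus_def overl_def)

lemma prod_emb: "(\<Prod>k\<in>UNIV. f (emb k)) = f 1 * f 2 * (f 3 :: complex)"
  unfolding UNIV_3 by (simp add: mult.assoc)

lemma flips_subset: "flips s s' \<subseteq> {1,2,3}"
proof
  fix l assume "l \<in> flips s s'"
  then show "l \<in> {1,2,3}" using exhaust_4[of l] by (auto simp: flips_def)
qed

lemma prod_flips: "(\<Prod>k\<in>flips s s'. z $ k) = (\<Prod>k\<in>UNIV. if s (emb k) = s' (emb k) then 1 else (z::complex^4) $ emb k)"
proof -
  have "(\<Prod>k\<in>flips s s'. z $ k) = (\<Prod>k\<in>{1,2,3}. if s k = s' k then 1 else z $ k)"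
    using flips_subset by (intro prod.mono_neutral_cong_left) (auto simp: flips_def)
  then show ?thesis unfolding prod_emb[of "\<lambda>k. if s k = s' k then 1 else z $ k"] by simp
qed

lemma pt_mem_iff: "pt s z \<in> fst (chart s') \<longleftrightarrow> z \<in> overl s s'"
proof
  obtain x y where xy: "hom s z = (x, y)" by fastforce
  have c: "x $ k $ c = (if c = s (emb k) then 1 else z $ emb k)" "y $ c = (if c = s 4 then 1 else z $ 4)" for k c
    using xy by (auto simp: hom_def)
  {
    assume "z \<in> overl s s'"
    then have "x $ k $ s' (emb k) \<noteq> 0" "y $ s' 4 \<noteq> 0" for k by (auto simp: c overl_def)
    then have "(\<forall>k. x $ k \<noteq> 0) \<and> y \<noteq> 0 \<and> (\<forall>k. x $ k $ (s' \<circ> emb) k \<noteq> 0) \<and> y $ (s' 4) \<noteq> 0"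
      using hom_nonzero[OF xy] by simp
    then show "pt s z \<in> fst (chart s')"
      unfolding pt_def xy chart_def bundle_chart_domain_def fst_conv by blast
  next
    assume "pt s z \<in> fst (chart s')"
    then obtain x' y' where xy': "(x', y') \<in> bundle_orbit (x, y)" "\<forall>k. x' $ k $ s' (emb k) \<noteq> 0" "y' $ s' 4 \<noteq> 0"
      unfolding pt_def xy chart_def bundle_chart_domain_def using bundle_orbit_refl by fastforce
    then have "x $ k $ s' (emb k) \<noteq> 0" "y $ s' 4 \<noteq> 0" for k
      using exhaust_2[of "s' 4"] by (auto simp: bundle_orbit_iff)
    then have "s' (emb k) \<noteq> s (emb k) \<Longrightarrow> z $ emb k \<noteq> 0" "s' 4 \<noteq> s 4 \<Longrightarrow> z $ 4 \<noteq> 0" for k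
      by (metis c)+
    from this(1)[of 1] this(1)[of 2] this(1)[of 3] this(2) show "z \<in> overl s s'"
      by (auto simp: overl_def forall_4)
  }
qed

lemma chart_map_pt:
  assumes "z \<in> overl s s'"
  shows "snd (chart s') (pt s z) = trans_fun s s' z"
proof -
  obtain x y where xy: "hom s z = (x, y)" by fastforce
  have c: "x $ k $ c = (if c = s (emb k) then 1 else z $ emb k)" "y $ c = (if c = s 4 then 1 else z $ 4)" for k c
    using xy by (auto simp: hom_def)
  have "x $ k $ s' (emb k) \<noteq> 0" "y $ s' 4 \<noteq> 0" for k using assms by (auto simp: c overl_def)
  then have "snd (chart s') (pt s z) = (let w = (\<lambda>k. x $ k $ ((s' \<circ> emb) k + 1) / x $ k $ (s' \<circ> emb) k); e = (\<Prod>k\<in>UNIV. x $ k $ (s' \<circ> emb) k)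
     in vector [w 1, w 2, w 3, if s' 4 = 1 then y $ 2 / (e * y $ 1) else e * y $ 1 / y $ 2])"
    unfolding chart_def pt_def xy snd_conv by (intro bundle_chart_map_orbit) auto
  also have "(\<Prod>k\<in>UNIV. x $ k $ (s' \<circ> emb) k) = (\<Prod>k\<in>flips s s'. z $ k)"
    unfolding prod_flips by (intro prod.cong) (auto simp: c)
  also have "(let w = (\<lambda>k. x $ k $ ((s' \<circ> emb) k + 1) / x $ k $ (s' \<circ> emb) k); e = (\<Prod>k\<in>flips s s'. z $ k)
     in vector [w 1, w 2, w 3, if s' 4 = 1 then y $ 2 / (e * y $ 1) else e * y $ 1 / y $ 2]) = trans_fun s s' z"
  proof -
    have "x $ k $ ((s' \<circ> emb) k + 1) / x $ k $ (s' \<circ> emb) k = (if s (emb k) = s' (emb k) then z $ emb k else inverse (z $ emb k))" for k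
      using neq_2_iff[of "s (emb k)" "s' (emb k)"] by (auto simp: c inverse_eq_divide)
    note this[of 1] this[of 2] this[of 3]
    then show ?thesis
      using exhaust_2[of "s 4"] exhaust_2[of "s' 4"]
      by (auto simp: vec_eq_iff forall_4 trans_fun_def Let_def c divide_inverse)
  qed
  finally show ?thesis .
qed

lemma trans_fun_id: "trans_fun s s z = z"
  by (simp add: trans_fun_def vec_eq_iff flips_def)

lemma overl_self [simp]: "overl s s = UNIV" by (simp add: overl_def)

lemma chart_map_pt_self [simp]: "snd (chart s) (pt s z) = z"
  by (simp add: chart_map_pt trans_fun_id)

lemma image_chart [simp]: "image_of_chart (chart s) = UNIV"
  using chart_map_pt_self by (force simp: fst_chart image_image)

lemma inj_chart_map: "inj_on (snd (chart s)) (fst (chart s))"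
  by (auto simp: fst_chart inj_on_def)

lemma inv_chart_map [simp]: "inv_into (fst (chart s)) (snd (chart s)) z = pt s z"
  by (rule inv_into_f_eq[OF inj_chart_map]) (auto simp: fst_chart)

lemma overlap_chart: "overlap (chart s) (chart s') = overl s s'"
proof -
  have "fst (chart s) \<inter> fst (chart s') = pt s ` overl s s'"
    using pt_mem_iff[of s _ s'] by (auto simp: fst_chart)
  then show ?thesis by (simp add: overlap_def image_image)
qed

lemma transition_chart: "z \<in> overl s s' \<Longrightarrow> transition (chart s) (chart s') z = trans_fun s s' z"
  by (simp add: transition_def chart_map_pt)

lemma inj_chart: "inj chart"
proof (rule injI)
  fix s s' assume "chart s = chart s'"
  then have "pt s 0 \<in> fst (chart s')" by (metis fst_chart rangeI)
  then show "s = s'" by (auto simp: pt_mem_iff overl_def fun_eq_iff)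
qed

lemma pt_trans_fun: "z \<in> overl s s' \<Longrightarrow> pt s' (trans_fun s s' z) = pt s z"
proof -
  assume z: "z \<in> overl s s'"
  then obtain z' where "pt s z = pt s' z'" using pt_mem_iff fst_chart by (metis imageE)
  then show ?thesis using chart_map_pt[OF z] by simp
qed

lemma open_overl: "open (overl s s')"
proof -
  have "overl s s' = (\<Inter>l\<in>{l. s l \<noteq> s' l}. {z. z $ l \<noteq> 0})" by (auto simp: overl_def)
  moreover have "open {z::complex^4. z $ l \<noteq> 0}" for l
    by (intro open_Collect_neq continuous_intros)
  ultimately show ?thesis by auto
qed

lemma smooth_on_inverse_complex [smooth_intros]:
  fixes f :: "_ \<Rightarrow> complex"
  assumes "smooth_on f S" "\<And>x. x \<in> S \<Longrightarrow> f x \<noteq> 0" "open S"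
  shows "smooth_on (\<lambda>x. inverse (f x)) S"
proof -
  have "smooth_on (\<lambda>x. cnj (f x) * of_real (inverse ((Re (f x))\<^sup>2 + (Im (f x))\<^sup>2))) S"
    using assms by (intro smooth_intros) (auto simp: complex_eq_iff sum_power2_eq_zero_iff)
  then show ?thesis
  proof (rule smooth_on_cong)
    fix x assume "x \<in> S"
    show "inverse (f x) = cnj (f x) * of_real (inverse ((Re (f x))\<^sup>2 + (Im (f x))\<^sup>2))"
      by (rule complex_eqI) (simp_all add: divide_inverse del: of_real_inverse of_real_add of_real_power)
  qed fact
qed

lemma prod_flips_nonzero: "z \<in> overl s s' \<Longrightarrow> (\<Prod>k\<in>flips s s'. z $ k) \<noteq> 0"
  by (auto simp: overl_def flips_def)

lemma smooth_trans_fun: "smooth_on (trans_fun s s') (overl s s')"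
proof -
  note o = open_overl[of s s']
  have nz: "z $ l \<noteq> 0" if "z \<in> overl s s'" "s l \<noteq> s' l" for z l using that by (auto simp: overl_def)
  have c: "smooth_on (\<lambda>z. z $ l) (overl s s')" for l by (intro smooth_intros o)
  have p: "smooth_on (\<lambda>z. \<Prod>k\<in>flips s s'. z $ k) (overl s s')" by (intro smooth_intros o) auto
  have w: "smooth_on (\<lambda>z. z $ 4 * (if s 4 = 1 then inverse (\<Prod>k\<in>flips s s'. z $ k)
      else (\<Prod>k\<in>flips s s'. z $ k))) (overl s s')" (is "smooth_on ?w _")
    using smooth_on_mult[OF c smooth_on_inverse_complex[OF p prod_flips_nonzero o] o]
      smooth_on_mult[OF c p o] by (cases "s 4 = 1") simp_all
  have w0: "?w z \<noteq> 0" if "z \<in> overl s s'" "s 4 \<noteq> s' 4" for z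
    using prod_flips_nonzero[OF that(1)] nz[OF that] by auto
  have "smooth_on (\<lambda>z. trans_fun s s' z $ l) (overl s s')" for l
    unfolding trans_fun_def Let_def vec_lambda_beta
    using w smooth_on_inverse_complex[OF w w0 o] c[of l] smooth_on_inverse_complex[OF c[of l] nz o]
    by (cases "l = 4"; cases "s 4 = s' 4"; cases "s l = s' l") (simp_all del: inverse_mult_distrib)
  then have "smooth_on (\<lambda>z. \<chi> l. trans_fun s s' z $ l) (overl s s')"
    by (rule smooth_on_vec_lambda[OF _ open_overl])
  then show ?thesis by simp
qed

section \<open>Holomorphy of the transition maps\<close>

definition chol :: "((complex^'n::finite) \<Rightarrow> complex) \<Rightarrow> complex^'n \<Rightarrow> bool" where
  "chol f z \<longleftrightarrow> (\<exists>D. (f has_derivative D) (at z) \<and> (\<forall>v. D (\<i> *s v) = \<i> * D v))"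

lemma chol_nth: "chol (\<lambda>z. z $ l) z"
  unfolding chol_def
  by (rule exI[of _ "\<lambda>u. u $ l"]) (auto intro!: bounded_linear_imp_has_derivative bounded_linear_vec_nth)

lemma chol_mult: "chol f z \<Longrightarrow> chol g z \<Longrightarrow> chol (\<lambda>z. f z * g z) z"
  unfolding chol_def
proof safe
  fix D D' assume a: "(f has_derivative D) (at z)" "\<forall>v. D (\<i> *s v) = \<i> * D v"
    "(g has_derivative D') (at z)" "\<forall>v. D' (\<i> *s v) = \<i> * D' v"
  show "\<exists>D. ((\<lambda>z. f z * g z) has_derivative D) (at z) \<and> (\<forall>v. D (\<i> *s v) = \<i> * D v)"
    by (rule exI, rule conjI, rule has_derivative_mult[OF a(1,3)]) (use a in \<open>auto simp: algebra_simps\<close>)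
qed

lemma chol_inverse: "chol f z \<Longrightarrow> f z \<noteq> 0 \<Longrightarrow> chol (\<lambda>z. inverse (f z)) z"
  unfolding chol_def
proof safe
  fix D assume a: "(f has_derivative D) (at z)" "\<forall>v. D (\<i> *s v) = \<i> * D v" "f z \<noteq> 0"
  show "\<exists>D. ((\<lambda>z. inverse (f z)) has_derivative D) (at z) \<and> (\<forall>v. D (\<i> *s v) = \<i> * D v)"
    by (rule exI, rule conjI, rule Deriv.has_derivative_inverse[OF a(3,1)]) (use a in auto)
qed

lemma chol_const: "chol (\<lambda>z. c) z"
  unfolding chol_def by (rule exI[of _ "\<lambda>u. 0"]) auto

lemma chol_prod: "(\<And>k. k \<in> A \<Longrightarrow> chol (\<lambda>z. z $ k) z) \<Longrightarrow> chol (\<lambda>z. \<Prod>k\<in>A. z $ k) z"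
  by (induction A rule: infinite_finite_induct) (auto intro!: chol_mult chol_const)

lemma has_derivative_vec:
  fixes f :: "'a::euclidean_space \<Rightarrow> 'b::euclidean_space^'n::finite"
  assumes "\<And>l. ((\<lambda>z. f z $ l) has_derivative (\<lambda>u. D u $ l)) (at z)"
  shows "(f has_derivative D) (at z)"
proof -
  have r: "(v :: 'b^'n) = (\<Sum>l\<in>UNIV. axis l (v $ l))" for v
    by (simp add: vec_eq_iff axis_def if_distrib[of "\<lambda>x. x $ _"] sum.If_cases cong: if_cong)
  have "((\<lambda>z. \<Sum>l\<in>UNIV. axis l (f z $ l)) has_derivative (\<lambda>u. \<Sum>l\<in>UNIV. axis l (D u $ l))) (at z)"
    by (intro has_derivative_sum bounded_linear.has_derivative[OF _ assms])
      (auto simp: linear_conv_bounded_linear[symmetric] axis_def vec_eq_iff intro!: linearI)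
  then show ?thesis by (simp add: r[symmetric])
qed

lemma holomorphic_map_onI:
  assumes "\<And>z l. z \<in> S \<Longrightarrow> chol (\<lambda>z. f z $ l) z"
  shows "holomorphic_map_on f S"
  unfolding holomorphic_map_on_def
proof
  fix z assume "z \<in> S"
  with assms have "\<forall>l. \<exists>D. ((\<lambda>z. f z $ l) has_derivative D) (at z) \<and> (\<forall>v. D (\<i> *s v) = \<i> * D v)"
    by (auto simp: chol_def)
  then obtain D where D: "\<And>l. ((\<lambda>z. f z $ l) has_derivative D l) (at z)" "\<And>l v. D l (\<i> *s v) = \<i> * D l v"
    by metis
  have "(f has_derivative (\<lambda>u. \<chi> l. D l u)) (at z)"
    by (intro has_derivative_vec) (simp add: D)
  then show "\<exists>D. (f has_derivative D) (at z) \<and> (\<forall>v. D (\<i> *s v) = \<i> *s D v)"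
    by (rule_tac exI) (auto simp: D vec_eq_iff)
qed

lemma chol_trans_fun: "z \<in> overl s s' \<Longrightarrow> chol (\<lambda>z. trans_fun s s' z $ l) z"
  using prod_flips_nonzero[of z s s'] unfolding trans_fun_def Let_def vec_lambda_beta
  by (cases "l = 4"; cases "s 4 = 1"; cases "s l = s' l")
    (auto intro!: chol_mult chol_inverse chol_prod chol_nth simp: overl_def)

lemma holomorphic_map_on_cong:
  "holomorphic_map_on g S \<Longrightarrow> open S \<Longrightarrow> (\<And>z. z \<in> S \<Longrightarrow> f z = g z) \<Longrightarrow> holomorphic_map_on f S"
  unfolding holomorphic_map_on_def
  by (metis has_derivative_transform_within_open)

lemma holomorphic_transition:
  "holomorphic_map_on (transition (chart s) (chart s')) (overl s s')"
  by (rule holomorphic_map_on_cong[OF holomorphic_map_onI open_overl transition_chart]) (rule chol_trans_fun)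

lemma complex_atlas_P_O_O111: "complex_atlas P_O_O111"
  by (auto simp: complex_atlas_def P_O_O111_eq inj_chart_map overlap_chart open_overl holomorphic_transition)

subsection \<open>Derivatives of the transition maps in the logarithmic frame\<close>

text \<open>The logarithmic derivative: along \<open>u = z * \<xi>\<close> the derivative of f is
  f(z) times L(\<xi>). Products add the forms L and inverses negate them, so for a monomial L simply
  lists the exponents and does not depend on z.\<close>

definition has_logder :: "((complex^4) \<Rightarrow> complex) \<Rightarrow> (complex^4 \<Rightarrow> complex) \<Rightarrow> complex^4 \<Rightarrow> bool" where
  "has_logder f L z \<longleftrightarrow> (f has_derivative (\<lambda>u. f z * L (\<chi> l. u $ l / z $ l))) (at z)"

lemma has_logder_nth: "z $ l \<noteq> 0 \<Longrightarrow> has_logder (\<lambda>z. z $ l) (\<lambda>\<xi>. \<xi> $ l) z"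
  unfolding has_logder_def by (auto intro!: bounded_linear_imp_has_derivative bounded_linear_vec_nth)

lemma has_logder_mult:
  "has_logder f L z \<Longrightarrow> has_logder g K z \<Longrightarrow> has_logder (\<lambda>z. f z * g z) (\<lambda>\<xi>. L \<xi> + K \<xi>) z"
  unfolding has_logder_def by (rule has_derivative_eq_rhs, rule has_derivative_mult) (auto simp: algebra_simps)

lemma has_logder_inverse:
  "has_logder f L z \<Longrightarrow> f z \<noteq> 0 \<Longrightarrow> has_logder (\<lambda>z. inverse (f z)) (\<lambda>\<xi>. - L \<xi>) z"
  unfolding has_logder_def by (rule has_derivative_eq_rhs, rule Deriv.has_derivative_inverse) (auto simp: algebra_simps)

lemma has_logder_one: "has_logder (\<lambda>z. 1) (\<lambda>\<xi>. 0) z"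
  unfolding has_logder_def by auto

lemma has_logder_prod:
  assumes "z \<in> torus" shows "has_logder (\<lambda>z. \<Prod>k\<in>A. z $ k) (\<lambda>\<xi>. \<Sum>k\<in>A. \<xi> $ k) z"
  using assms
  by (induction A rule: infinite_finite_induct)
    (auto intro!: has_logder_mult has_logder_one has_logder_nth simp: torus_def)

lemma has_logder_trans_fun:
  assumes "z \<in> torus"
  shows "has_logder (\<lambda>z. trans_fun s s' z $ l) (\<lambda>\<xi>. mat_log s s' \<xi> $ l) z"
proof -
  have nz: "z $ k \<noteq> 0" for k using assms by (auto simp: torus_def)
  have w: "has_logder (\<lambda>z. z $ 4 * (if s 4 = 1 then inverse (\<Prod>k\<in>flips s s'. z $ k) else (\<Prod>k\<in>flips s s'. z $ k)))
     (\<lambda>\<xi>. \<xi> $ 4 - of_real (sgn_fib s) * (\<Sum>k\<in>flips s s'. \<xi> $ k)) z"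
    using has_logder_mult[OF has_logder_nth[OF nz[of 4]] has_logder_prod[OF assms, of "flips s s'"]]
      has_logder_mult[OF has_logder_nth[OF nz[of 4]] has_logder_inverse[OF has_logder_prod[OF assms, of "flips s s'"]]]
      nz
    by (auto simp: sgn_fib_def)
  have w0: "z $ 4 * (if s 4 = 1 then inverse (\<Prod>k\<in>flips s s'. z $ k) else (\<Prod>k\<in>flips s s'. z $ k)) \<noteq> 0"
    using nz by auto
  show ?thesis
    using w has_logder_inverse[OF w w0] has_logder_nth[OF nz[of l]] has_logder_inverse[OF has_logder_nth[OF nz[of l]] nz[of l]]
    unfolding trans_fun_def mat_log_def Let_def vec_lambda_beta
    by (cases "l = 4"; cases "s 4 = s' 4"; cases "s l = s' l") (simp_all del: inverse_mult_distrib)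
qed

text \<open>Every component of the transition map is a monomial. Up to the componentwise factor
  \<open>trans_fun s s' z\<close>, its derivative in the frame \<open>z * \<xi>\<close> is therefore
  the constant matrix of exponents.\<close>

lemma FD_trans_fun:
  assumes "z \<in> torus"
  shows "FD (trans_fun s s') z (z * \<xi>) = trans_fun s s' z * mat_log s s' \<xi>"
proof -
  have nz: "z $ k \<noteq> 0" for k using assms by (auto simp: torus_def)
  have "(trans_fun s s' has_derivative (\<lambda>u. trans_fun s s' z * mat_log s s' (\<chi> l. u $ l / z $ l))) (at z)"
    using has_logder_trans_fun[OF assms] by (intro has_derivative_vec) (simp add: has_logder_def)
  moreover have "(\<chi> l. (z * \<xi>) $ l / z $ l) = \<xi>" using nz by (simp add: vec_eq_iff)
  ultimately show ?thesis by (simp add: FD_eq)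
qed

lemma trans_fun_torus: "z \<in> torus \<Longrightarrow> trans_fun s s' z \<in> torus"
  using prod_flips_nonzero[of z s s'] by (auto simp: torus_def trans_fun_def Let_def overl_def)

lemma FD_transition:
  assumes "z \<in> overl s s'"
  shows "FD (transition (chart s) (chart s')) z u = FD (trans_fun s s') z u"
proof -
  have "(trans_fun s s' has_derivative (\<lambda>u. FD (trans_fun s s') z u)) (at z)"
    using smooth_on_has_derivative[OF smooth_trans_fun assms] .
  then have "(transition (chart s) (chart s') has_derivative (\<lambda>u. FD (trans_fun s s') z u)) (at z)"
    by (rule has_derivative_transform_within_open[OF _ open_overl assms]) (simp add: transition_chart)
  then show ?thesis by (simp add: FD_eq)
qed

text \<open>Replacing the vanishing coordinates of z by 1/(n + 1) gives points of the torus that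
  converge to z. Identities between continuous functions thus need checking only where the
  logarithmic frame spans all tangent vectors.\<close>

lemma torus_dense:
  assumes "continuous_on (overl s s') f" "continuous_on (overl s s') (g :: _ \<Rightarrow> real)"
    and "\<And>z. z \<in> torus \<Longrightarrow> f z = g z" "z \<in> overl s s'"
  shows "f z = g z"
proof -
  define y where "y = (\<lambda>n. \<chi> l. if z $ l = 0 then complex_of_real (inverse (real (Suc n))) else z $ l)"
  have t: "y n \<in> torus" for n by (auto simp: y_def torus_def simp del: of_nat_Suc)
  have "(\<lambda>n. y n $ l) \<longlonglongrightarrow> z $ l" for l
  proof (cases "z $ l = 0")
    case True
    have "(\<lambda>n. complex_of_real (inverse (real (Suc n)))) \<longlonglongrightarrow> complex_of_real 0"
      by (intro tendsto_of_real LIMSEQ_inverse_real_of_nat)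
    with True show ?thesis by (simp add: y_def)
  qed (simp add: y_def)
  then have lim: "y \<longlonglongrightarrow> z" by (intro vec_tendstoI)
  have "isCont f z" "isCont g z"
    using assms open_overl by (auto simp: continuous_on_eq_continuous_at)
  then have "(\<lambda>n. f (y n)) \<longlonglongrightarrow> f z" "(\<lambda>n. g (y n)) \<longlonglongrightarrow> g z"
    using lim by (auto intro: isCont_tendsto_compose)
  moreover have "f (y n) = g (y n)" for n using assms(3) t by blast
  ultimately show ?thesis using LIMSEQ_unique by auto
qed

subsection \<open>Forms on the bundle\<close>

lemma smooth_on_form1:
  fixes \<beta> :: "'a::euclidean_space \<Rightarrow> 'b::euclidean_space \<Rightarrow> real"
  assumes "\<And>p. linear (\<beta> p)" "\<And>b. smooth_on (\<lambda>p. \<beta> p b) UNIV"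
    and "smooth_on f S" "smooth_on a S" "open S"
  shows "smooth_on (\<lambda>x. \<beta> (f x) (a x)) S"
proof -
  have sm: "smooth_on (\<lambda>x. \<Sum>b\<in>Basis. (a x \<bullet> b) * \<beta> (f x) b) S"
    using assms by (intro smooth_intros smooth_on_bounded_linear[OF bounded_linear_inner_left]
        smooth_on_compose[OF assms(2), of f]) auto
  have ex: "\<beta> p w = (\<Sum>b\<in>Basis. (w \<bullet> b) * \<beta> p b)" for p w
  proof -
    interpret linear "\<beta> p" by (rule assms)
    have "\<beta> p w = \<beta> p (\<Sum>b\<in>Basis. (w \<bullet> b) *\<^sub>R b)" by (simp add: euclidean_representation)
    also have "\<dots> = (\<Sum>b\<in>Basis. (w \<bullet> b) * \<beta> p b)" by (simp only: sum scale real_scaleR_def)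
    finally show ?thesis .
  qed
  show ?thesis by (rule smooth_on_cong[OF sm ex assms(5)])
qed

lemma bilinear_expand:
  fixes \<omega> :: "'b::euclidean_space \<Rightarrow> 'b \<Rightarrow> real"
  assumes "bilinear \<omega>"
  shows "\<omega> v w = (\<Sum>b\<in>Basis. \<Sum>c\<in>Basis. (v \<bullet> b) * ((w \<bullet> c) * \<omega> b c))"
proof -
  have l: "linear (\<omega> v)" "linear (\<lambda>v. \<omega> v w)" for v w using assms by (auto simp: bilinear_def)
  have "\<omega> v w = \<omega> (\<Sum>b\<in>Basis. (v \<bullet> b) *\<^sub>R b) w" by (simp add: euclidean_representation)
  also have "\<dots> = (\<Sum>b\<in>Basis. (v \<bullet> b) * \<omega> b w)"
    by (simp only: linear_sum[OF l(2)] linear_scale[OF l(2)] real_scaleR_def)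
  also have "\<dots> = (\<Sum>b\<in>Basis. (v \<bullet> b) * (\<Sum>c\<in>Basis. (w \<bullet> c) * \<omega> b c))"
  proof (intro sum.cong refl arg_cong2[where f="(*)"])
    fix b :: 'b
    have "\<omega> b w = \<omega> b (\<Sum>c\<in>Basis. (w \<bullet> c) *\<^sub>R c)" by (simp add: euclidean_representation)
    also have "\<dots> = (\<Sum>c\<in>Basis. (w \<bullet> c) * \<omega> b c)"
      by (simp only: linear_sum[OF l(1)] linear_scale[OF l(1)] real_scaleR_def)
    finally show "\<omega> b w = (\<Sum>c\<in>Basis. (w \<bullet> c) * \<omega> b c)" .
  qed
  finally show ?thesis by (simp add: sum_distrib_left)
qed

lemma smooth_on_form2:
  fixes \<omega> :: "'a::euclidean_space \<Rightarrow> 'b::euclidean_space \<Rightarrow> 'b \<Rightarrow> real"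
  assumes "\<And>p. bilinear (\<omega> p)" "\<And>b c. smooth_on (\<lambda>p. \<omega> p b c) UNIV"
    and "smooth_on f S" "smooth_on v S" "smooth_on w S" "open S"
  shows "smooth_on (\<lambda>x. \<omega> (f x) (v x) (w x)) S"
proof -
  have "smooth_on (\<lambda>x. \<Sum>b\<in>Basis. \<Sum>c\<in>Basis. (v x \<bullet> b) * ((w x \<bullet> c) * \<omega> (f x) b c)) S"
    using assms by (intro smooth_intros smooth_on_bounded_linear[OF bounded_linear_inner_left]
        smooth_on_compose[OF assms(2), of f]) auto
  then show ?thesis
    by (rule smooth_on_cong) (use assms in \<open>auto intro: bilinear_expand\<close>)
qed

lemma torus_decomp: "z \<in> torus \<Longrightarrow> \<exists>\<xi>. u = z * \<xi>"
  by (rule exI[of _ "\<chi> l. u $ l / z $ l"]) (auto simp: torus_def vec_eq_iff)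

definition local_two_form :: "(complex^'n::finite \<Rightarrow> complex^'n \<Rightarrow> complex^'n \<Rightarrow> real) \<Rightarrow> bool" where
  "local_two_form \<omega> \<longleftrightarrow> (\<forall>z. bilinear (\<omega> z) \<and> (\<forall>u. \<omega> z u u = 0)) \<and> (\<forall>u v. smooth_on (\<lambda>z. \<omega> z u v) UNIV)"

definition local_one_form :: "(complex^'n::finite \<Rightarrow> complex^'n \<Rightarrow> real) \<Rightarrow> bool" where
  "local_one_form \<beta> \<longleftrightarrow> (\<forall>z. linear (\<beta> z)) \<and> (\<forall>u. smooth_on (\<lambda>z. \<beta> z u) UNIV)"

text \<open>Compatibility on overlaps becomes an identity with constant matrices on the torus. For
  the converse, both sides of the transformation rule are continuous on the overlap, and on the
  torus every vector is some \<open>z * \<xi>\<close>.\<close>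

lemma two_form_iff:
  "two_form P_O_O111 \<omega> \<longleftrightarrow> (\<forall>s. local_two_form (\<omega> (chart s))) \<and>
    (\<forall>s s'. \<forall>z\<in>torus. \<forall>\<xi> \<eta>. \<omega> (chart s) z (z * \<xi>) (z * \<eta>) =
       \<omega> (chart s') (trans_fun s s' z) (trans_fun s s' z * mat_log s s' \<xi>) (trans_fun s s' z * mat_log s s' \<eta>))"
  (is "?L \<longleftrightarrow> ?A \<and> ?B")
proof -
  let ?C = "\<forall>s s'. \<forall>z\<in>overl s s'. \<forall>u v. \<omega> (chart s) z u v =
     \<omega> (chart s') (trans_fun s s' z) (FD (trans_fun s s') z u) (FD (trans_fun s s') z v)"
  have L: "?L \<longleftrightarrow> ?A \<and> ?C"
    unfolding two_form_def P_O_O111_eq local_two_form_def Let_def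
    by (simp add: overlap_chart FD_transition transition_chart fst_chart image_image)
  have "?C" if A: "?A" and B: "?B"
  proof (intro allI ballI)
    fix s s' z u v assume z: "z \<in> overl s s'"
    have sm: "smooth_on (\<lambda>z. \<omega> (chart s) z u v) (overl s s')"
      using A by (rule_tac smooth_on_subset[of _ UNIV]) (auto simp: local_two_form_def)
    have sm': "smooth_on (\<lambda>z. \<omega> (chart s') (trans_fun s s' z) (FD (trans_fun s s') z u) (FD (trans_fun s s') z v)) (overl s s')"
      using A by (rule_tac smooth_on_form2[OF _ _ smooth_trans_fun smooth_on_FD[OF smooth_trans_fun]
          smooth_on_FD[OF smooth_trans_fun] open_overl]) (auto simp: local_two_form_def)
    show "\<omega> (chart s) z u v =
     \<omega> (chart s') (trans_fun s s' z) (FD (trans_fun s s') z u) (FD (trans_fun s s') z v)"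
    proof (rule torus_dense[OF sm[THEN smooth_on_imp_continuous_on] sm'[THEN smooth_on_imp_continuous_on] _ z])
      fix z assume z: "z \<in> torus"
      obtain \<xi> \<eta> where "u = z * \<xi>" "v = z * \<eta>" using torus_decomp[OF z] by metis
      then show "\<omega> (chart s) z u v =
        \<omega> (chart s') (trans_fun s s' z) (FD (trans_fun s s') z u) (FD (trans_fun s s') z v)"
        using B z by (simp add: FD_trans_fun)
    qed
  qed
  moreover have "?B" if "?C"
  proof (intro allI ballI)
    fix s s' z \<xi> \<eta> assume z: "z \<in> torus"
    then have "z \<in> overl s s'" using torus_overl by blast
    with that show "\<omega> (chart s) z (z * \<xi>) (z * \<eta>) =
       \<omega> (chart s') (trans_fun s s' z) (trans_fun s s' z * mat_log s s' \<xi>) (trans_fun s s' z * mat_log s s' \<eta>)"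
      using FD_trans_fun[OF z] by metis
  qed
  ultimately show ?thesis using L by blast
qed

lemma one_form_iff:
  "one_form P_O_O111 \<beta> \<longleftrightarrow> (\<forall>s. local_one_form (\<beta> (chart s))) \<and>
    (\<forall>s s'. \<forall>z\<in>torus. \<forall>\<xi>. \<beta> (chart s) z (z * \<xi>) =
       \<beta> (chart s') (trans_fun s s' z) (trans_fun s s' z * mat_log s s' \<xi>))"
  (is "?L \<longleftrightarrow> ?A \<and> ?B")
proof -
  let ?C = "\<forall>s s'. \<forall>z\<in>overl s s'. \<forall>u. \<beta> (chart s) z u =
     \<beta> (chart s') (trans_fun s s' z) (FD (trans_fun s s') z u)"
  have L: "?L \<longleftrightarrow> ?A \<and> ?C"
    unfolding one_form_def P_O_O111_eq local_one_form_def Let_def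
    by (simp add: overlap_chart FD_transition transition_chart fst_chart image_image)
  have "?C" if A: "?A" and B: "?B"
  proof (intro allI ballI)
    fix s s' z u assume z: "z \<in> overl s s'"
    have sm: "smooth_on (\<lambda>z. \<beta> (chart s) z u) (overl s s')"
      using A by (rule_tac smooth_on_subset[of _ UNIV]) (auto simp: local_one_form_def)
    have sm': "smooth_on (\<lambda>z. \<beta> (chart s') (trans_fun s s' z) (FD (trans_fun s s') z u)) (overl s s')"
      using A by (rule_tac smooth_on_form1[OF _ _ smooth_trans_fun smooth_on_FD[OF smooth_trans_fun] open_overl])
        (auto simp: local_one_form_def)
    show "\<beta> (chart s) z u = \<beta> (chart s') (trans_fun s s' z) (FD (trans_fun s s') z u)"
    proof (rule torus_dense[OF sm[THEN smooth_on_imp_continuous_on] sm'[THEN smooth_on_imp_continuous_on] _ z])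
      fix z assume z: "z \<in> torus"
      obtain \<xi> where "u = z * \<xi>" using torus_decomp[OF z] by metis
      then show "\<beta> (chart s) z u = \<beta> (chart s') (trans_fun s s' z) (FD (trans_fun s s') z u)"
        using B z by (simp add: FD_trans_fun)
    qed
  qed
  moreover have "?B" if "?C"
  proof (intro allI ballI)
    fix s s' z \<xi> assume z: "z \<in> torus"
    then have "z \<in> overl s s'" using torus_overl by blast
    with that show "\<beta> (chart s) z (z * \<xi>) =
       \<beta> (chart s') (trans_fun s s' z) (trans_fun s s' z * mat_log s s' \<xi>)"
      using FD_trans_fun[OF z] by metis
  qed
  ultimately show ?thesis using L by blast
qed

subsection \<open>The topology of the bundle\<close>

abbreviation "bundle_top \<equiv> manifold_topology P_O_O111"

lemma points_P_O_O111: "points P_O_O111 = (\<Union>s. range (pt s))"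
  by (auto simp: points_def P_O_O111_eq fst_chart)

lemma chart_open_eq: "{p \<in> fst (chart s). snd (chart s) p \<in> W} = pt s ` W"
  by (auto simp: fst_chart)

lemma bundle_top_eq: "bundle_top = topology_generated_by {pt s ` W | s W. open W}"
proof -
  have "{{p \<in> fst c. snd c p \<in> W} | c W. c \<in> P_O_O111 \<and> open W} = {pt s ` W | s W. open W}"
    by (simp only: P_O_O111_eq chart_open_eq[symmetric] image_iff) blast
  then show ?thesis by (simp add: manifold_topology_def)
qed

lemma topspace_bundle: "topspace bundle_top = points P_O_O111"
proof -
  have "\<Union>{pt s ` W | s W. open W} = (\<Union>s. range (pt s))" using open_UNIV by blast
  then show ?thesis by (simp add: bundle_top_eq points_P_O_O111)
qed

lemma openin_pt_image: "open W \<Longrightarrow> openin bundle_top (pt s ` W)"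
  unfolding bundle_top_eq by (rule topology_generated_by_Basis) auto

lemma openin_bundle_topI:
  assumes "V \<subseteq> points P_O_O111" "\<And>s. open {z. pt s z \<in> V}"
  shows "openin bundle_top V"
proof -
  have "V = (\<Union>s. pt s ` {z. pt s z \<in> V})" 
  proof (intro set_eqI iffI)
    fix p assume p: "p \<in> V"
    then obtain s z where "p = pt s z" using assms(1) by (auto simp: points_P_O_O111)
    then show "p \<in> (\<Union>s. pt s ` {z. pt s z \<in> V})" using p by blast
  qed auto
  moreover have "openin bundle_top (\<Union>s. pt s ` {z. pt s z \<in> V})"
    using assms(2) by (intro openin_Union) (auto intro: openin_pt_image)
  ultimately show ?thesis by simp
qed

lemma continuous_map_pt: "continuous_map euclidean bundle_top (pt s)"
proof -
  have "open (pt s -` U \<inter> UNIV)" if "U \<in> {pt s ` W | s W. open W}" for U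
  proof -
    obtain s' W where U: "U = pt s' ` W" "open W" using \<open>U \<in> _\<close> by auto
    have "pt s -` U = {z \<in> overl s s'. trans_fun s s' z \<in> W}"
    proof (intro set_eqI iffI)
      fix z assume "z \<in> pt s -` U"
      then obtain w where w: "pt s z = pt s' w" "w \<in> W" using U by auto
      then have "z \<in> overl s s'" by (metis pt_mem_iff fst_chart rangeI)
      moreover have "trans_fun s s' z = w" using chart_map_pt[OF calculation] w by simp
      ultimately show "z \<in> {z \<in> overl s s'. trans_fun s s' z \<in> W}" using w by simp
    next
      fix z assume "z \<in> {z \<in> overl s s'. trans_fun s s' z \<in> W}"
      then show "z \<in> pt s -` U" using U pt_trans_fun by (auto simp: image_iff) metis
    qed
    also have "\<dots> = overl s s' \<inter> trans_fun s s' -` W" by auto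
    also have "open \<dots>"
      using continuous_open_preimage[OF smooth_on_imp_continuous_on[OF smooth_trans_fun] open_overl U(2)] .
    finally show ?thesis by simp
  qed
  note op = this
  have "pt s ` topspace euclidean \<subseteq> \<Union> {pt s ` W | s W. open W}" using open_UNIV by blast
  then show ?thesis
    unfolding bundle_top_eq
    by (intro continuous_on_generated_topo) (use op in auto)
qed

text \<open>The closed unit polydiscs of the sixteen charts cover the bundle, since a coordinate of
  modulus greater than 1 is inverted by passing to the opposite index.\<close>

lemma compact_space_bundle: "compact_space bundle_top"
proof -
  let ?D = "{z::complex^4. \<forall>l. norm (z $ l) \<le> 1}"
  have "bounded ?D"
    unfolding bounded_iff
  proof (intro exI[of _ 4] ballI)
    fix z assume "z \<in> ?D"
    then have "norm z \<le> (\<Sum>l\<in>UNIV. norm (z $ l))" "\<And>l. norm (z $ l) \<le> 1"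
      using norm_le_l1_cart by (auto simp: norm_vec_def L2_set_le_sum)
    moreover have "(\<Sum>l\<in>UNIV. norm (z $ l)) \<le> (\<Sum>l\<in>(UNIV::4 set). 1)" using calculation(2) by (intro sum_mono)
    ultimately show "norm z \<le> 4" by simp
  qed
  moreover have "closed ?D"
  proof -
    have "?D = (\<Inter>l. {z. norm (z $ l) \<le> 1})" by auto
    then show ?thesis by (auto intro!: closed_INT closed_Collect_le continuous_intros)
  qed
  ultimately have "compact ?D" by (simp add: compact_eq_bounded_closed)
  then have "compactin bundle_top (pt s ` ?D)" for s
    by (intro image_compactin[OF _ continuous_map_pt]) simp
  then have "compactin bundle_top (\<Union>s. pt s ` ?D)"
    by (intro compactin_Union) auto
  moreover have "(\<Union>s. pt s ` ?D) = topspace bundle_top"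
  proof -
    have "pt s z \<in> (\<Union>s. pt s ` ?D)" for s z
    proof -
      \<comment> \<open>The base is treated before the fibre: flipping base coordinates rescales the
        fibre coordinate, whereas flipping the fibre coordinate leaves the base alone.\<close>
      define s1 where "s1 = (\<lambda>l. if l \<noteq> 4 \<and> norm (z $ l) > 1 then s l + 1 else s l)"
      have z1: "z \<in> overl s s1" by (auto simp: overl_def s1_def)
      define w where "w = trans_fun s s1 z"
      define s2 where "s2 = (\<lambda>l. if l = 4 \<and> norm (w $ l) > 1 then s1 l + 1 else s1 l)"
      have w2: "w \<in> overl s1 s2" by (auto simp: overl_def s2_def)
      have neq: "(a::2) + 1 \<noteq> a" for a by simp
      have w: "norm (w $ l) \<le> 1" if "l \<noteq> 4" for l
        using that neq[of "s l"] by (auto simp: w_def trans_fun_def s1_def norm_inverse inverse_le_1_iff)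
      have f: "flips s1 s2 = {}" by (auto simp: flips_def s2_def)
      have "norm (trans_fun s1 s2 w $ l) \<le> 1" for l
        using w[of l] neq[of "s1 4"] unfolding trans_fun_def f
        by (auto simp: s2_def Let_def norm_inverse inverse_le_1_iff split: if_splits)
      moreover have "pt s z = pt s2 (trans_fun s1 s2 w)"
        using pt_trans_fun[OF z1] pt_trans_fun[OF w2] by (simp add: w_def)
      ultimately show ?thesis by blast
    qed
    then show ?thesis unfolding topspace_bundle points_P_O_O111 by blast
  qed
  ultimately show ?thesis by (simp add: compact_space_def)
qed

lemma one_in_overl: "1 \<in> overl s s'" "trans_fun s s' 1 = 1"
  by (auto simp: overl_def trans_fun_def vec_eq_iff)

text \<open>Each chart is a copy of coordinate space, and all of them contain the point whose
  coordinates are all 1, which every transition map fixes.\<close>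

lemma connected_space_bundle: "connected_space bundle_top"
proof -
  have "connectedin bundle_top (\<Union>(range (\<lambda>s. range (pt s))))"
  proof (rule connectedin_Union)
    fix S assume "S \<in> range (\<lambda>s. range (pt s))"
    then show "connectedin bundle_top S"
      using connectedin_continuous_map_image[OF continuous_map_pt, of UNIV] by auto
  next
    have "pt s 1 = pt s' 1" for s s' using pt_trans_fun[OF one_in_overl(1)] one_in_overl(2) by metis
    then have "pt (\<lambda>_. 1) 1 \<in> range (pt s)" for s by (metis rangeI)
    then show "\<Inter>(range (\<lambda>s. range (pt s))) \<noteq> {}" by blast
  qed
  then show ?thesis
    using connectedin_topspace[of bundle_top] by (simp add: topspace_bundle points_P_O_O111)
qed

text \<open>Two points without a common chart are separated by one of these functions, which are
  constant on orbits.\<close>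

definition sep_fun :: "4 \<Rightarrow> bundle_coords \<Rightarrow> real" where
  "sep_fun l = (\<lambda>(x, y). if l = 4
     then (cmod (y $ 1))\<^sup>2 * (\<Prod>k\<in>UNIV. (norm (x $ k))\<^sup>2) / ((cmod (y $ 1))\<^sup>2 * (\<Prod>k\<in>UNIV. (norm (x $ k))\<^sup>2) + (cmod (y $ 2))\<^sup>2)
     else (let k = (THE k. emb k = l) in (cmod (x $ k $ 1))\<^sup>2 / (norm (x $ k))\<^sup>2))"

lemma norm_scale_c2: "norm (c *s (v::complex^2)) = cmod c * norm v"
  by (simp add: norm_vec_def L2_set_def norm_mult sum_2 power_mult_distrib real_sqrt_mult flip: distrib_left)

lemma sep_fun_orbit:
  assumes "a \<in> bundle_orbit b" "\<And>k. fst b $ k \<noteq> 0"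
  shows "sep_fun l a = sep_fun l b"
proof -
  obtain x y x' y' where e: "a = (x, y)" "b = (x', y')" by (cases a, cases b)
  from assms obtain t s where h: "\<forall>k. t $ k \<noteq> 0" "s \<noteq> 0"
    "x = (\<chi> k. t $ k *s x' $ k)" "y = vector [s * y' $ 1, s * (\<Prod>k\<in>UNIV. t $ k) * y' $ 2]"
    unfolding e bundle_orbit_iff by blast
  show ?thesis
  proof (cases "l = 4")
    case True
    define c where "c = (cmod s)\<^sup>2 * (cmod (\<Prod>k\<in>UNIV. t $ k))\<^sup>2"
    have c: "c \<noteq> 0" using h by (simp add: c_def)
    have p: "(\<Prod>k\<in>UNIV. (norm (x $ k))\<^sup>2) = (cmod (\<Prod>k\<in>UNIV. t $ k))\<^sup>2 * (\<Prod>k\<in>UNIV. (norm (x' $ k))\<^sup>2)"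
      by (simp add: h(3) norm_scale_c2 power_mult_distrib prod.distrib prod_norm[symmetric] prod_power_distrib)
    have y: "(cmod (y $ 1))\<^sup>2 = (cmod s)\<^sup>2 * (cmod (y' $ 1))\<^sup>2"
      "(cmod (y $ 2))\<^sup>2 = c * (cmod (y' $ 2))\<^sup>2"
      by (simp_all add: h(4) c_def norm_mult power_mult_distrib)
    have yp: "(cmod (y $ 1))\<^sup>2 * (\<Prod>k\<in>UNIV. (norm (x $ k))\<^sup>2) = c * ((cmod (y' $ 1))\<^sup>2 * (\<Prod>k\<in>UNIV. (norm (x' $ k))\<^sup>2))"
      unfolding p y c_def by simp
    show ?thesis
      unfolding sep_fun_def e split_conv True if_True eqTrueI[OF refl] yp y(2) distrib_left[symmetric]
      using c by simp
  next
    case False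
    then show ?thesis using h(1) unfolding sep_fun_def e
      by (simp add: h(3) norm_scale_c2 norm_mult power_mult_distrib Let_def)
  qed
qed

definition orbit_fun :: "4 \<Rightarrow> bundle_coords set \<Rightarrow> real" where
  "orbit_fun l p = sep_fun l (SOME a. a \<in> p)"

lemma orbit_fun_pt: "orbit_fun l (pt s z) = sep_fun l (hom s z)"
proof -
  have "(SOME a. a \<in> pt s z) \<in> bundle_orbit (hom s z)"
    unfolding pt_def using bundle_orbit_refl by (rule someI)
  moreover have "fst (hom s z) $ k \<noteq> 0" for k using hom_nonzero(1)[of s z] by (metis prod.collapse)
  ultimately show ?thesis unfolding orbit_fun_def by (intro sep_fun_orbit)
qed

lemma norm_c2: "(norm (v::complex^2))\<^sup>2 = (cmod (v $ 1))\<^sup>2 + (cmod (v $ 2))\<^sup>2"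
  by (simp add: norm_vec_def L2_set_def sum_2)

lemma continuous_sep_fun_hom: "continuous_on UNIV (\<lambda>z. sep_fun l (hom s z))"
proof -
  have x: "(norm (\<chi> c. if c = s (emb k) then 1 else z $ emb k :: complex^2))\<^sup>2 = 1 + (cmod (z $ emb k))\<^sup>2" for k z
    using exhaust_2[of "s (emb k)"] by (auto simp: norm_c2)
  have x0: "1 + (cmod (z $ emb k))\<^sup>2 > 0" for k and z :: "complex^4" by (simp add: add_pos_nonneg)
  have p: "(\<Prod>k\<in>UNIV. 1 + (cmod (z $ emb k))\<^sup>2) > 0" for z :: "complex^4"
    by (intro prod_pos) (use x0 in auto)
  show ?thesis
  proof (cases "l = 4")
    case True
    have pos: "a * P + b \<noteq> 0" if "a = 1 \<and> b \<ge> 0 \<or> b = 1 \<and> a \<ge> 0" "P > 0" for a b P :: real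
      using that by (metis add_pos_nonneg add_nonneg_pos less_irrefl mult_1 mult_nonneg_nonneg zero_less_one less_imp_le)
    have n: "(\<Prod>k\<in>UNIV. 1 + (cmod (z $ emb k))\<^sup>2) + (cmod (z $ 4))\<^sup>2 \<noteq> 0"
      "(cmod (z $ 4))\<^sup>2 * (\<Prod>k\<in>UNIV. 1 + (cmod (z $ emb k))\<^sup>2) + 1 \<noteq> 0" for z :: "complex^4"
      using pos[of 1 "(cmod (z $ 4))\<^sup>2", OF _ p[of z]] pos[of "(cmod (z $ 4))\<^sup>2" 1, OF _ p[of z]] by auto
    show ?thesis using True p exhaust_2[of "s 4"] unfolding sep_fun_def hom_def
      by (auto simp: x n intro!: continuous_intros)
  next
    case False
    have *: "1 + (cmod (z $ emb k))\<^sup>2 \<noteq> 0" for k and z :: "complex^4" using x0[of z k] by simp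
    define k where "k = (THE k. emb k = l)"
    have "sep_fun l (hom s z) = (cmod (if 1 = s (emb k) then 1 else z $ emb k))\<^sup>2 / (1 + (cmod (z $ emb k))\<^sup>2)" for z
      unfolding sep_fun_def hom_def k_def[symmetric] by (simp only: x Let_def split_conv False if_False vec_lambda_beta)
    then show ?thesis using * by (cases "1 = s (emb k)") (auto intro!: continuous_intros)
  qed
qed

text \<open>A zero of the l-th coordinate lies over one of the two poles of the corresponding
  sphere. The function takes the values 1 and 0 there, and so tells the poles apart.\<close>

lemma sep_fun_hom_0:
  assumes "z $ l = 0"
  shows "sep_fun l (hom s z) = (if s l = 1 then 1 else 0)"
proof (cases "l = 4")
  case True
  have x: "(norm (\<chi> c. if c = s (emb k) then 1 else z $ emb k :: complex^2))\<^sup>2 = 1 + (cmod (z $ emb k))\<^sup>2" for k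
    using exhaust_2[of "s (emb k)"] by (auto simp: norm_c2)
  have "(\<Prod>k\<in>UNIV. 1 + (cmod (z $ emb k))\<^sup>2) > 0"
    by (intro prod_pos) (auto simp: add_pos_nonneg)
  then have "(\<Prod>k\<in>UNIV. 1 + (cmod (z $ emb k))\<^sup>2) \<noteq> 0" by linarith
  then show ?thesis using True assms by (simp add: sep_fun_def hom_def x del: prod_zero_iff)
next
  case False
  then obtain k where k: "l = emb k" using exhaust_4[of l] emb_simps by metis
  have inj: "emb i = emb j \<longleftrightarrow> i = j" for i j
    using exhaust_3[of i] exhaust_3[of j] by (elim disjE; hypsubst) simp_all
  have "(THE k. emb k = l) = k" unfolding k by (rule the_equality) (auto simp: inj)
  then show ?thesis using False assms exhaust_2[of "s (emb k)"]
    by (auto simp: sep_fun_def hom_def k norm_c2 Let_def)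
qed

lemma Hausdorff_space_bundle: "Hausdorff_space bundle_top"
  unfolding Hausdorff_space_def topspace_bundle
proof (intro allI impI, elim conjE)
  fix p q assume pq: "p \<in> points P_O_O111" "q \<in> points P_O_O111" "p \<noteq> q"
  then obtain s z s' z' where p: "p = pt s z" and q: "q = pt s' z'" by (auto simp: points_P_O_O111)
  show "\<exists>U V. openin bundle_top U \<and> openin bundle_top V \<and> p \<in> U \<and> q \<in> V \<and> disjnt U V"
  proof (cases "\<exists>l. s l \<noteq> s' l \<and> z $ l = 0 \<and> z' $ l = 0")
    case True
    then obtain l where l: "s l \<noteq> s' l" "z $ l = 0" "z' $ l = 0" by auto
    have op: "openin bundle_top {p \<in> points P_O_O111. orbit_fun l p \<in> W}" if "open W" for W
    proof (rule openin_bundle_topI)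
      fix s
      have "{z. pt s z \<in> {p \<in> points P_O_O111. orbit_fun l p \<in> W}} = (\<lambda>z. sep_fun l (hom s z)) -` W"
        by (auto simp: points_P_O_O111 orbit_fun_pt)
      then show "open {z. pt s z \<in> {p \<in> points P_O_O111. orbit_fun l p \<in> W}}"
        using open_vimage[OF that continuous_sep_fun_hom] by simp
    qed auto
    have "orbit_fun l p = (if s l = 1 then 1 else 0)" "orbit_fun l q = (if s' l = 1 then 1 else 0)"
      unfolding p q orbit_fun_pt using l by (simp_all only: sep_fun_hom_0)
    moreover have "s l = 1 \<longleftrightarrow> s' l \<noteq> 1" using l(1) exhaust_2[of "s l"] exhaust_2[of "s' l"] by metis
    ultimately have "orbit_fun l p \<noteq> orbit_fun l q" by simp
    from separation_t2[THEN iffD1, OF this]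
    obtain A B where AB: "open A" "open B" "orbit_fun l p \<in> A" "orbit_fun l q \<in> B" "A \<inter> B = {}"
      by (elim exE conjE)
    show ?thesis
      by (rule exI[of _ "{p \<in> points P_O_O111. orbit_fun l p \<in> A}"],
          rule exI[of _ "{p \<in> points P_O_O111. orbit_fun l p \<in> B}"])
        (use AB pq op in \<open>auto simp: disjnt_def\<close>)
  next
    case False
    \<comment> \<open>A common chart: from \<open>s'\<close> only indices with nonzero
      \<open>z' $ l\<close> are changed, and from \<open>s\<close> only indices at which
      \<open>z' $ l\<close> vanishes, where \<open>z $ l\<close> is nonzero by the case
      assumption.\<close>
    define s'' where "s'' = (\<lambda>l. if z' $ l = 0 then s' l else s l)"
    have "z \<in> overl s s''" "z' \<in> overl s' s''" using False by (auto simp: overl_def s''_def)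
    then obtain w w' where w: "p = pt s'' w" "q = pt s'' w'" using pt_trans_fun p q by metis
    then have "w \<noteq> w'" using pq by auto
    from separation_t2[THEN iffD1, OF this]
    obtain A B where AB: "open A" "open B" "w \<in> A" "w' \<in> B" "A \<inter> B = {}"
      by (elim exE conjE)
    have "inj (pt s'')" by (metis chart_map_pt_self injI)
    then have "pt s'' ` A \<inter> pt s'' ` B = {}" using AB by (auto simp: inj_def)
    then show ?thesis
      using AB w by (intro exI[of _ "pt s'' ` A"] exI[of _ "pt s'' ` B"]) (auto simp: disjnt_def openin_pt_image)
  qed
qed

lemma compact_complex_manifold_P_O_O111: "compact_complex_manifold P_O_O111"
  unfolding compact_complex_manifold_def
  using complex_atlas_P_O_O111 Hausdorff_space_bundle compact_space_bundle connected_space_bundle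
  by (auto simp: points_P_O_O111)

section \<open>Closed forms on coordinate space\<close>

definition local_closed :: "('a::euclidean_space \<Rightarrow> 'a \<Rightarrow> 'a \<Rightarrow> real) \<Rightarrow> bool" where
  "local_closed \<omega> \<longleftrightarrow> (\<forall>z u v w. FD (\<lambda>y. \<omega> y v w) z u + FD (\<lambda>y. \<omega> y w u) z v + FD (\<lambda>y. \<omega> y u v) z w = 0)"

definition smooth_form2 :: "('a::euclidean_space \<Rightarrow> 'a \<Rightarrow> 'a \<Rightarrow> real) \<Rightarrow> bool" where
  "smooth_form2 \<omega> \<longleftrightarrow> (\<forall>z. bilinear (\<omega> z) \<and> (\<forall>u. \<omega> z u u = 0)) \<and> (\<forall>u v. smooth_on (\<lambda>z. \<omega> z u v) UNIV)"

definition smooth_form1 :: "('a::euclidean_space \<Rightarrow> 'a \<Rightarrow> real) \<Rightarrow> bool" where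
  "smooth_form1 \<beta> \<longleftrightarrow> (\<forall>z. linear (\<beta> z)) \<and> (\<forall>u. smooth_on (\<lambda>z. \<beta> z u) UNIV)"

lemma local_two_form_eq: "local_two_form = smooth_form2"
  by (auto simp: local_two_form_def smooth_form2_def fun_eq_iff)

lemma local_one_form_eq: "local_one_form = smooth_form1"
  by (auto simp: local_one_form_def smooth_form1_def fun_eq_iff)

lemma smooth_form2D:
  assumes "smooth_form2 \<omega>"
  shows "bilinear (\<omega> z)" "\<omega> z u u = 0" "smooth_on (\<lambda>z. \<omega> z u v) UNIV"
  using assms by (auto simp: smooth_form2_def)

lemma smooth_form1D:
  assumes "smooth_form1 \<beta>"
  shows "linear (\<beta> z)" "smooth_on (\<lambda>z. \<beta> z u) UNIV"
  using assms by (auto simp: smooth_form1_def)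

lemma form2_simps:
  assumes "smooth_form2 \<omega>"
  shows "\<omega> z (u + u') v = \<omega> z u v + \<omega> z u' v" "\<omega> z u (v + v') = \<omega> z u v + \<omega> z u v'"
    "\<omega> z (c *\<^sub>R u) v = c * \<omega> z u v" "\<omega> z u (c *\<^sub>R v) = c * \<omega> z u v"
    "\<omega> z 0 v = 0" "\<omega> z u 0 = 0" "\<omega> z (- u) v = - \<omega> z u v" "\<omega> z u (- v) = - \<omega> z u v"
  using smooth_form2D(1)[OF assms, of z]
  by (auto simp: bilinear_ladd bilinear_radd bilinear_lmul bilinear_rmul bilinear_lzero bilinear_rzero
      bilinear_lneg bilinear_rneg)

lemma form2_swap: "smooth_form2 \<omega> \<Longrightarrow> \<omega> z v u = - \<omega> z u v"
proof -
  assume a: "smooth_form2 \<omega>"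
  have "\<omega> z (u + v) (u + v) = \<omega> z u u + \<omega> z v u + (\<omega> z u v + \<omega> z v v)"
    by (simp only: form2_simps[OF a])
  then show ?thesis by (simp add: smooth_form2D(2)[OF a])
qed

lemma linear_expand:
  fixes \<beta> :: "'b::euclidean_space \<Rightarrow> real"
  assumes "linear \<beta>"
  shows "\<beta> w = (\<Sum>b\<in>Basis. (w \<bullet> b) * \<beta> b)"
proof -
  have "\<beta> w = \<beta> (\<Sum>b\<in>Basis. (w \<bullet> b) *\<^sub>R b)" by (simp add: euclidean_representation)
  also have "\<dots> = (\<Sum>b\<in>Basis. (w \<bullet> b) * \<beta> b)"
    by (simp only: linear_sum[OF assms] linear_scale[OF assms] real_scaleR_def)
  finally show ?thesis .
qed

lemma smooth_FD_apply: "smooth_on f UNIV \<Longrightarrow> (f has_derivative (\<lambda>u. FD f x u)) (at x)"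
  by (rule smooth_on_has_derivative) auto

text \<open>A form is known to be smooth for fixed vectors only. Expanding the moving vector in
  \<open>Basis\<close> reduces the product rule to scalar functions, and linearity reassembles the
  sum.\<close>

lemma has_derivative_form1:
  fixes \<beta> :: "'b::euclidean_space \<Rightarrow> 'b \<Rightarrow> real" and f a :: "'a::real_normed_vector \<Rightarrow> 'b"
  assumes \<beta>: "smooth_form1 \<beta>" and f: "(f has_derivative f') (at x)" and a: "(a has_derivative a') (at x)"
  shows "((\<lambda>x. \<beta> (f x) (a x)) has_derivative
     (\<lambda>u. FD (\<lambda>y. \<beta> y (a x)) (f x) (f' u) + \<beta> (f x) (a' u))) (at x)"
proof -
  have b: "((\<lambda>x. \<beta> (f x) c) has_derivative (\<lambda>u. FD (\<lambda>y. \<beta> y c) (f x) (f' u))) (at x)" for c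
    using has_derivative_compose[OF f smooth_FD_apply[OF smooth_form1D(2)[OF \<beta>]]] .
  have d: "((\<lambda>y. \<beta> y w) has_derivative (\<lambda>u. \<Sum>c\<in>Basis. (w \<bullet> c) * FD (\<lambda>y. \<beta> y c) p u)) (at p)" for w p
    by (subst linear_expand[OF smooth_form1D(1)[OF \<beta>]])
      (intro has_derivative_sum has_derivative_mult_right smooth_FD_apply smooth_form1D(2)[OF \<beta>])
  have "((\<lambda>x. \<Sum>c\<in>Basis. (a x \<bullet> c) * \<beta> (f x) c) has_derivative
    (\<lambda>u. \<Sum>c\<in>Basis. (a x \<bullet> c) * FD (\<lambda>y. \<beta> y c) (f x) (f' u) + (a' u \<bullet> c) * \<beta> (f x) c)) (at x)"
    by (intro has_derivative_sum has_derivative_mult b has_derivative_inner_left a)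
  moreover have "(\<Sum>c\<in>Basis. (a x \<bullet> c) * FD (\<lambda>y. \<beta> y c) (f x) (f' u) + (a' u \<bullet> c) * \<beta> (f x) c)
    = FD (\<lambda>y. \<beta> y (a x)) (f x) (f' u) + \<beta> (f x) (a' u)" for u
    using FD_eq[OF d, of "a x" "f x" "f' u"] linear_expand[OF smooth_form1D(1)[OF \<beta>], of "f x" "a' u"]
    by (simp only: sum.distrib)
  ultimately show ?thesis
    by (simp only: linear_expand[OF smooth_form1D(1)[OF \<beta>], of "f _" "a _", symmetric])
qed

lemma has_derivative_form2:
  fixes \<omega> :: "'b::euclidean_space \<Rightarrow> 'b \<Rightarrow> 'b \<Rightarrow> real" and f a b :: "'a::real_normed_vector \<Rightarrow> 'b"
  assumes \<omega>: "smooth_form2 \<omega>" and f: "(f has_derivative f') (at x)"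
    and a: "(a has_derivative a') (at x)" and b: "(b has_derivative b') (at x)"
  shows "((\<lambda>x. \<omega> (f x) (a x) (b x)) has_derivative
     (\<lambda>u. FD (\<lambda>y. \<omega> y (a x) (b x)) (f x) (f' u) + \<omega> (f x) (a' u) (b x) + \<omega> (f x) (a x) (b' u))) (at x)"
proof -
  note e = bilinear_expand[OF smooth_form2D(1)[OF \<omega>]]
  have p: "((\<lambda>x. \<omega> (f x) c d) has_derivative (\<lambda>u. FD (\<lambda>y. \<omega> y c d) (f x) (f' u))) (at x)" for c d
    using has_derivative_compose[OF f smooth_FD_apply[OF smooth_form2D(3)[OF \<omega>]]] .
  have d: "((\<lambda>y. \<omega> y v w) has_derivative
      (\<lambda>u. \<Sum>c\<in>Basis. \<Sum>d\<in>Basis. (v \<bullet> c) * ((w \<bullet> d) * FD (\<lambda>y. \<omega> y c d) p u))) (at p)" for v w p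
    by (subst e)
      (intro has_derivative_sum has_derivative_mult_right smooth_FD_apply smooth_form2D(3)[OF \<omega>])
  have "((\<lambda>x. \<Sum>c\<in>Basis. \<Sum>d\<in>Basis. (a x \<bullet> c) * ((b x \<bullet> d) * \<omega> (f x) c d)) has_derivative
    (\<lambda>u. \<Sum>c\<in>Basis. \<Sum>d\<in>Basis. (a x \<bullet> c) * ((b x \<bullet> d) * FD (\<lambda>y. \<omega> y c d) (f x) (f' u) + (b' u \<bullet> d) * \<omega> (f x) c d)
       + (a' u \<bullet> c) * ((b x \<bullet> d) * \<omega> (f x) c d))) (at x)"
    by (intro has_derivative_sum has_derivative_mult p has_derivative_inner_left a b)
  moreover have "(\<Sum>c\<in>Basis. \<Sum>d\<in>Basis. (a x \<bullet> c) * ((b x \<bullet> d) * FD (\<lambda>y. \<omega> y c d) (f x) (f' u) + (b' u \<bullet> d) * \<omega> (f x) c d)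
       + (a' u \<bullet> c) * ((b x \<bullet> d) * \<omega> (f x) c d))
    = FD (\<lambda>y. \<omega> y (a x) (b x)) (f x) (f' u) + \<omega> (f x) (a' u) (b x) + \<omega> (f x) (a x) (b' u)" for u
    using FD_eq[OF d, of "a x" "b x" "f x" "f' u"] e[of "f x" "a' u" "b x"] e[of "f x" "a x" "b' u"]
    by (simp only: sum.distrib distrib_left)
  ultimately show ?thesis
    by (simp only: e[of "f _" "a _" "b _", symmetric])
qed

lemma FD_pair:
  fixes f :: "real \<times> 'a::euclidean_space \<Rightarrow> real"
  assumes "smooth_on f UNIV" "((\<lambda>z. f (t, z)) has_derivative D) (at z)"
  shows "FD f (t, z) (0, u) = D u"
proof -
  have "((\<lambda>z. f (t, z)) has_derivative (\<lambda>u. FD f (t, z) (0, u))) (at z)"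
    using has_derivative_compose[OF has_derivative_Pair[OF has_derivative_const has_derivative_ident]
        smooth_FD_apply[OF assms(1)], of t z] .
  then show ?thesis using assms(2) has_derivative_unique by metis
qed

lemma has_derivative_integral:
  fixes f :: "real \<times> 'a::euclidean_space \<Rightarrow> real"
  assumes "smooth_on f UNIV" "\<And>t. ((\<lambda>z. f (t, z)) has_derivative D t) (at z)"
  shows "((\<lambda>z. integral {0..1} (\<lambda>t. f (t, z))) has_derivative (\<lambda>u. integral {0..1} (\<lambda>t. D t u))) (at z)"
  using has_derivative_parametric_integral[OF smooth_on_Ck[OF assms(1)], of z]
  unfolding FD_pair[OF assms(1) assms(2)] .

lemma integrable_smooth_pair:
  fixes f :: "real \<times> 'a::euclidean_space \<Rightarrow> real"
  assumes "smooth_on f UNIV"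
  shows "(\<lambda>t. f (t, z)) integrable_on {0..1}"
  by (rule integrable_continuous_interval[OF continuous_on_compose2[OF smooth_on_imp_continuous_on[OF assms]]])
    (auto intro: continuous_intros)

lemma integrable_smooth_deriv:
  fixes f :: "real \<times> 'a::euclidean_space \<Rightarrow> real"
  assumes "smooth_on f UNIV" "\<And>t. ((\<lambda>z. f (t, z)) has_derivative D t) (at z)"
  shows "(\<lambda>t. D t u) integrable_on {0..1}"
proof -
  have "(\<lambda>t. FD f (t, z) (0, u)) integrable_on {0..1}"
    by (rule integrable_smooth_pair[OF smooth_on_FD[OF assms(1)]])
  then show ?thesis by (simp only: FD_pair[OF assms(1) assms(2)])
qed

lemma continuous_smooth_pair:
  fixes f :: "real \<times> 'a::euclidean_space \<Rightarrow> real"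
  assumes "smooth_on f UNIV"
  shows "continuous_on S (\<lambda>t. f (t, z))"
  by (rule continuous_on_compose2[OF smooth_on_imp_continuous_on[OF assms]])
    (auto intro: continuous_intros)

text \<open>Closedness with the vector z singled out: by antisymmetry, the exterior derivative of
  the contraction with a constant vector z is the derivative of the form along z. This is the shape
  needed for homotopy arguments, both radial and along a flow.\<close>

lemma local_closed_swap:
  assumes "smooth_form2 \<omega>" "local_closed \<omega>"
  shows "FD (\<lambda>y. \<omega> y z v) p u - FD (\<lambda>y. \<omega> y z u) p v = FD (\<lambda>y. \<omega> y u v) p z"
proof -
  have neg: "FD (\<lambda>y. \<omega> y a b) p c = - FD (\<lambda>y. \<omega> y b a) p c" for a b c
  proof -
    have "((\<lambda>y. - \<omega> y b a) has_derivative (\<lambda>c. - FD (\<lambda>y. \<omega> y b a) p c)) (at p)"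
      by (intro has_derivative_minus smooth_FD_apply smooth_form2D(3)[OF assms(1)])
    moreover have "(\<lambda>y. \<omega> y a b) = (\<lambda>y. - \<omega> y b a)" by (rule ext) (rule form2_swap[OF assms(1)])
    ultimately show ?thesis using FD_eq by fastforce
  qed
  have "FD (\<lambda>y. \<omega> y z v) p u + FD (\<lambda>y. \<omega> y v u) p z + FD (\<lambda>y. \<omega> y u z) p v = 0"
    using assms(2) by (simp add: local_closed_def)
  then show ?thesis using neg[of v u z] neg[of u z v] by simp
qed

subsection \<open>The Poincare lemma\<close>

text \<open>The homotopy operator for the contraction of coordinate space to 0: the form is
  contracted with the radial vector and integrated along the ray.\<close>

definition poincare :: "('a::euclidean_space \<Rightarrow> 'a \<Rightarrow> 'a \<Rightarrow> real) \<Rightarrow> 'a \<Rightarrow> 'a \<Rightarrow> real" where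
  "poincare \<omega> z u = integral {0..1} (\<lambda>t. t * \<omega> (t *\<^sub>R z) z u)"

lemma smooth_poincare_aux:
  assumes "smooth_form2 (\<omega> :: 'a::euclidean_space \<Rightarrow> _)"
  shows "smooth_on (\<lambda>(t, z). t * \<omega> (t *\<^sub>R z) z u) UNIV"
  unfolding case_prod_beta
  by (intro smooth_intros smooth_on_form2[where f="\<lambda>p. fst p *\<^sub>R snd p" and v=snd and w="\<lambda>_. u" and \<omega>=\<omega>])
    (auto intro!: smooth_intros smooth_form2D[OF assms] simp: smooth_on_linear bounded_linear_snd)

lemma smooth_form1_poincare:
  assumes "smooth_form2 \<omega>"
  shows "smooth_form1 (poincare \<omega>)"
  unfolding smooth_form1_def
proof (intro conjI allI)
  fix z
  have i: "(\<lambda>t. t * \<omega> (t *\<^sub>R z) z u) integrable_on {0..1}" for u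
    using integrable_smooth_pair[OF smooth_poincare_aux[OF assms]] by simp
  show "linear (poincare \<omega> z)"
  proof (rule linearI)
    fix u v show "poincare \<omega> z (u + v) = poincare \<omega> z u + poincare \<omega> z v"
      unfolding poincare_def form2_simps[OF assms] distrib_left by (rule Henstock_Kurzweil_Integration.integral_add[OF i i])
  next
    fix c u show "poincare \<omega> z (c *\<^sub>R u) = c *\<^sub>R poincare \<omega> z u"
      unfolding poincare_def form2_simps[OF assms] by (simp add: mult.left_commute[of _ c])
  qed
  fix u show "smooth_on (\<lambda>z. poincare \<omega> z u) UNIV"
    using smooth_on_parametric_integral[OF smooth_poincare_aux[OF assms]] by (simp add: poincare_def)
qed

text \<open>After closedness is used, the integrand of the exterior derivative at (u, v) is the
  t-derivative of \<open>t\<^sup>2 * \<omega> (t *\<^sub>R z) u v\<close>, whose values at 1 and 0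
  are \<open>\<omega> z u v\<close> and 0.\<close>

lemma poincare:
  assumes "smooth_form2 \<omega>" "local_closed \<omega>"
  shows "FD (\<lambda>y. poincare \<omega> y v) z u - FD (\<lambda>y. poincare \<omega> y u) z v = \<omega> z u v"
proof -
  let ?D = "\<lambda>v t u. t * (FD (\<lambda>y. \<omega> y z v) (t *\<^sub>R z) (t *\<^sub>R u) + \<omega> (t *\<^sub>R z) u v)"
  have d: "((\<lambda>z. (\<lambda>(t, z). t * \<omega> (t *\<^sub>R z) z v) (t, z)) has_derivative ?D v t) (at z)" for v t
    using has_derivative_mult_right[OF has_derivative_form2[OF assms(1)
          has_derivative_scaleR_right[OF has_derivative_ident[of "at z"], of t] has_derivative_ident[of "at z"]
          has_derivative_const[of v "at z"]], of t]
    by (simp add: form2_simps[OF assms(1)])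
  note sm = smooth_poincare_aux[OF assms(1)]
  have FD: "FD (\<lambda>y. poincare \<omega> y v) z u = integral {0..1} (\<lambda>t. ?D v t u)" for u v
    using has_derivative_integral[OF sm d] unfolding poincare_def split_conv by (rule FD_eq)
  let ?g = "\<lambda>t. t\<^sup>2 * \<omega> (t *\<^sub>R z) u v"
  have sc: "FD (\<lambda>y. \<omega> y a b) p (t *\<^sub>R c) = t * FD (\<lambda>y. \<omega> y a b) p c" for a b c p t
    using linear_scale[OF has_derivative_linear[OF smooth_FD_apply[OF smooth_form2D(3)[OF assms(1)]]]] by simp
  have g: "(?g has_vector_derivative ?D v t u - ?D u t v) (at t within {0..1})" for t
  proof -
    have "((\<lambda>t. \<omega> (t *\<^sub>R z) u v) has_derivative (\<lambda>h. FD (\<lambda>y. \<omega> y u v) (t *\<^sub>R z) (h *\<^sub>R z))) (at t)"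
      using has_derivative_form2[OF assms(1) has_derivative_scaleR_left[OF has_derivative_ident[of "at t"], of z]
          has_derivative_const[of u] has_derivative_const[of v]]
      by (simp add: form2_simps[OF assms(1)])
    then have "((\<lambda>t. \<omega> (t *\<^sub>R z) u v) has_real_derivative FD (\<lambda>y. \<omega> y u v) (t *\<^sub>R z) z) (at t)"
      by (simp add: has_field_derivative_def sc mult.commute[of _ "FD _ _ _"])
    then have "(?g has_real_derivative t\<^sup>2 * FD (\<lambda>y. \<omega> y u v) (t *\<^sub>R z) z + 2 * t * \<omega> (t *\<^sub>R z) u v) (at t)"
      by (auto intro!: derivative_eq_intros)
    moreover have "t\<^sup>2 * FD (\<lambda>y. \<omega> y u v) (t *\<^sub>R z) z + 2 * t * \<omega> (t *\<^sub>R z) u v = ?D v t u - ?D u t v"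
      unfolding sc local_closed_swap[OF assms, of z v "t *\<^sub>R z" u, symmetric]
        form2_swap[OF assms(1), of "t *\<^sub>R z" v u]
      by (simp add: algebra_simps power2_eq_square)
    ultimately show ?thesis
      by (simp add: has_real_derivative_iff_has_vector_derivative has_vector_derivative_at_within)
  qed
  have i: "(\<lambda>t. ?D v t u) integrable_on {0..1}" for u v
    by (rule integrable_smooth_deriv[OF sm d])
  have "((\<lambda>t. ?D v t u - ?D u t v) has_integral (?g 1 - ?g 0)) {0..1}"
    by (rule fundamental_theorem_of_calculus) (use g in auto)
  then have "integral {0..1} (\<lambda>t. ?D v t u - ?D u t v) = \<omega> z u v"
    by (simp add: integral_unique)
  then show ?thesis
    unfolding FD Henstock_Kurzweil_Integration.integral_diff[OF i i] .
qed

subsection \<open>Averaging over a circle\<close>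

definition rot :: "real^4 \<Rightarrow> complex^4 \<Rightarrow> complex^4" where
  "rot \<theta> z = (\<chi> l. cis (\<theta> $ l) * z $ l)"

text \<open>The vector field that generates the flow
  \<open>rot (t *\<^sub>R \<theta>)\<close>.\<close>

definition vf :: "real^4 \<Rightarrow> complex^4 \<Rightarrow> complex^4" where
  "vf \<theta> z = (\<chi> l. \<i> * of_real (\<theta> $ l) * z $ l)"

lemma rot_simps: "rot \<theta> (z + w) = rot \<theta> z + rot \<theta> w" "rot \<theta> (c *\<^sub>R z) = c *\<^sub>R rot \<theta> z"
  "rot \<theta> 0 = 0" "rot \<theta> (\<i> *s z) = \<i> *s rot \<theta> z" "rot \<theta> (rot \<theta>' z) = rot (\<theta> + \<theta>') z" "rot 0 z = z"
  "rot \<theta> (vf \<theta>' z) = vf \<theta>' (rot \<theta> z)" "rot \<theta> (z * w) = rot \<theta> z * w"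
  by (auto simp: rot_def vf_def vec_eq_iff algebra_simps scaleR_conv_of_real cis_mult)

lemma linear_rot: "linear (rot \<theta>)" by (rule linearI) (simp_all add: rot_simps)

lemma bounded_linear_rot: "bounded_linear (rot \<theta>)"
  using linear_rot by (simp add: linear_conv_bounded_linear)

lemma linear_vf: "linear (vf \<theta>)"
  by (rule linearI) (auto simp: vf_def vec_eq_iff algebra_simps scaleR_conv_of_real)

lemma bounded_linear_vf: "bounded_linear (vf \<theta>)"
  using linear_vf by (simp add: linear_conv_bounded_linear)

lemma has_derivative_rot: "((\<lambda>t. rot (t *\<^sub>R \<theta>) z) has_derivative (\<lambda>h. h *\<^sub>R vf \<theta> (rot (t *\<^sub>R \<theta>) z))) (at t)"
  unfolding rot_def vf_def
proof (rule has_derivative_vec)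
  fix l
  have "((\<lambda>t. cis (t * \<theta> $ l) * z $ l) has_derivative
      (\<lambda>h. (h * \<theta> $ l) *\<^sub>R (\<i> * cis (t * \<theta> $ l)) * z $ l)) (at t)"
    by (auto intro!: derivative_eq_intros)
  then show "((\<lambda>t. (\<chi> l. cis ((t *\<^sub>R \<theta>) $ l) * z $ l) $ l) has_derivative
      (\<lambda>h. (h *\<^sub>R (\<chi> l. \<i> * of_real (\<theta> $ l) * (\<chi> l. cis ((t *\<^sub>R \<theta>) $ l) * z $ l) $ l)) $ l)) (at t)"
    unfolding vec_lambda_beta vector_scaleR_component real_scaleR_def
    by (rule has_derivative_eq_rhs) (auto simp: fun_eq_iff scaleR_conv_of_real algebra_simps)
qed

lemma smooth_cis [smooth_intros]:
  assumes "smooth_on f S" "open S"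
  shows "smooth_on (\<lambda>x. cis (f x)) S"
proof -
  have "Ck_on k cis UNIV" for k
  proof (induction k)
    case (Suc k)
    show ?case
    proof (rule Ck_on_SucI[where f'="\<lambda>x u. u *\<^sub>R (\<i> * cis x)"])
      show "(cis has_derivative (\<lambda>u. u *\<^sub>R (\<i> * cis x))) (at x)" for x
        using has_derivative_cis[OF has_derivative_ident[of "at x"]] by simp
      show "Ck_on k (\<lambda>x. v *\<^sub>R (\<i> * cis x)) UNIV" for v
        by (intro Ck_on_bounded_linear[OF bounded_linear_scaleR_right] Ck_on_bounded_linear[OF bounded_linear_mult_right] Suc) auto
    qed auto
  qed (auto intro: continuous_intros)
  then have "smooth_on cis UNIV" by (simp add: smooth_on_def)
  then show ?thesis using assms by (rule smooth_on_compose) auto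
qed

lemma smooth_rot: "smooth_on f S \<Longrightarrow> smooth_on g S \<Longrightarrow> open S \<Longrightarrow> smooth_on (\<lambda>p. rot (f p *\<^sub>R \<theta>) (g p)) S"
  unfolding rot_def by (intro smooth_intros) auto

definition avg :: "real^4 \<Rightarrow> (complex^4 \<Rightarrow> complex^4 \<Rightarrow> complex^4 \<Rightarrow> real) \<Rightarrow> complex^4 \<Rightarrow> complex^4 \<Rightarrow> complex^4 \<Rightarrow> real" where
  "avg \<theta> \<omega> z u v = integral {0..1} (\<lambda>t. \<omega> (rot (t *\<^sub>R \<theta>) z) (rot (t *\<^sub>R \<theta>) u) (rot (t *\<^sub>R \<theta>) v))"

text \<open>A primitive of \<open>avg \<theta> \<omega> - \<omega>\<close>. By Cartan's formula the
  pullback of a closed form along the flow has as its time derivative the exterior derivative of the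
  pulled back contraction with \<open>vf \<theta>\<close>; integration by parts in time produces the
  weight 1 - t.\<close>

definition avg_prim :: "real^4 \<Rightarrow> (complex^4 \<Rightarrow> complex^4 \<Rightarrow> complex^4 \<Rightarrow> real) \<Rightarrow> complex^4 \<Rightarrow> complex^4 \<Rightarrow> real" where
  "avg_prim \<theta> \<omega> z u = integral {0..1} (\<lambda>t. (1 - t) * \<omega> (rot (t *\<^sub>R \<theta>) z) (vf \<theta> (rot (t *\<^sub>R \<theta>) z)) (rot (t *\<^sub>R \<theta>) u))"

lemma smooth_avg_aux:
  assumes "smooth_form2 \<omega>"
  shows "smooth_on (\<lambda>(t, z). \<omega> (rot (t *\<^sub>R \<theta>) z) (rot (t *\<^sub>R \<theta>) u) (rot (t *\<^sub>R \<theta>) v)) UNIV"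
  unfolding case_prod_beta
  by (rule smooth_on_form2[where f="\<lambda>p. rot (fst p *\<^sub>R \<theta>) (snd p)" and v="\<lambda>p. rot (fst p *\<^sub>R \<theta>) u" and w="\<lambda>p. rot (fst p *\<^sub>R \<theta>) v" and \<omega>=\<omega>])
    (auto intro!: smooth_form2D[OF assms] smooth_rot smooth_on_const smooth_on_fst smooth_on_snd smooth_on_id)

lemma smooth_avg_prim_aux:
  assumes "smooth_form2 \<omega>"
  shows "smooth_on (\<lambda>(t, z). (1 - t) * \<omega> (rot (t *\<^sub>R \<theta>) z) (vf \<theta> (rot (t *\<^sub>R \<theta>) z)) (rot (t *\<^sub>R \<theta>) u)) UNIV"
  unfolding case_prod_beta
proof (intro smooth_on_mult)
  show "smooth_on (\<lambda>p. \<omega> (rot (fst p *\<^sub>R \<theta>) (snd p)) (vf \<theta> (rot (fst p *\<^sub>R \<theta>) (snd p))) (rot (fst p *\<^sub>R \<theta>) u)) (UNIV :: (real \<times> _) set)"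
    by (rule smooth_on_form2[where f="\<lambda>p. rot (fst p *\<^sub>R \<theta>) (snd p)" and v="\<lambda>p. vf \<theta> (rot (fst p *\<^sub>R \<theta>) (snd p))" and w="\<lambda>p. rot (fst p *\<^sub>R \<theta>) u" and \<omega>=\<omega>])
      (auto intro!: smooth_form2D[OF assms] smooth_on_bounded_linear[OF bounded_linear_vf]
       smooth_rot smooth_on_const smooth_on_fst smooth_on_snd smooth_on_id)
qed (auto intro!: smooth_intros)

lemma smooth_form2_avg:
  assumes "smooth_form2 \<omega>"
  shows "smooth_form2 (avg \<theta> \<omega>)"
  unfolding smooth_form2_def
proof (intro conjI allI)
  fix z
  have i: "(\<lambda>t. \<omega> (rot (t *\<^sub>R \<theta>) z) (rot (t *\<^sub>R \<theta>) u) (rot (t *\<^sub>R \<theta>) v)) integrable_on {0..1}" for u v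
    using integrable_smooth_pair[OF smooth_avg_aux[OF assms]] by simp
  show "bilinear (avg \<theta> \<omega> z)"
    unfolding bilinear_def avg_def
    by (auto intro!: linearI simp: rot_simps form2_simps[OF assms] Henstock_Kurzweil_Integration.integral_add[OF i i])
  show "avg \<theta> \<omega> z u u = 0" for u
    by (simp add: avg_def smooth_form2D(2)[OF assms])
  show "smooth_on (\<lambda>z. avg \<theta> \<omega> z u v) UNIV" for u v
    using smooth_on_parametric_integral[OF smooth_avg_aux[OF assms]] by (simp add: avg_def)
qed

lemma smooth_form1_avg_prim:
  assumes "smooth_form2 \<omega>"
  shows "smooth_form1 (avg_prim \<theta> \<omega>)"
  unfolding smooth_form1_def
proof (intro conjI allI)
  fix z
  have i: "(\<lambda>t. (1 - t) * \<omega> (rot (t *\<^sub>R \<theta>) z) (vf \<theta> (rot (t *\<^sub>R \<theta>) z)) (rot (t *\<^sub>R \<theta>) u)) integrable_on {0..1}" for u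
    using integrable_smooth_pair[OF smooth_avg_prim_aux[OF assms]] by simp
  show "linear (avg_prim \<theta> \<omega> z)"
  proof (rule linearI)
    fix u v show "avg_prim \<theta> \<omega> z (u + v) = avg_prim \<theta> \<omega> z u + avg_prim \<theta> \<omega> z v"
      unfolding avg_prim_def rot_simps form2_simps[OF assms] distrib_left
      by (rule Henstock_Kurzweil_Integration.integral_add[OF i i])
  next
    fix c u show "avg_prim \<theta> \<omega> z (c *\<^sub>R u) = c *\<^sub>R avg_prim \<theta> \<omega> z u"
      unfolding avg_prim_def rot_simps form2_simps[OF assms] by (simp add: mult.left_commute)
  qed
  fix u show "smooth_on (\<lambda>z. avg_prim \<theta> \<omega> z u) UNIV"
    using smooth_on_parametric_integral[OF smooth_avg_prim_aux[OF assms]] by (simp add: avg_prim_def)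
qed

lemma FD_scale2:
  assumes "smooth_form2 \<omega>"
  shows "FD (\<lambda>y. \<omega> y a b) p (t *\<^sub>R c) = t * FD (\<lambda>y. \<omega> y a b) p c"
  using linear_scale[OF has_derivative_linear[OF smooth_FD_apply[OF smooth_form2D(3)[OF assms]]]] by simp

lemma FD_avg:
  assumes "smooth_form2 \<omega>"
  shows "FD (\<lambda>y. avg \<theta> \<omega> y v w) z u = integral {0..1} (\<lambda>t.
     FD (\<lambda>y. \<omega> y (rot (t *\<^sub>R \<theta>) v) (rot (t *\<^sub>R \<theta>) w)) (rot (t *\<^sub>R \<theta>) z) (rot (t *\<^sub>R \<theta>) u))" (is ?A)
   "(\<lambda>t. FD (\<lambda>y. \<omega> y (rot (t *\<^sub>R \<theta>) v) (rot (t *\<^sub>R \<theta>) w)) (rot (t *\<^sub>R \<theta>) z) (rot (t *\<^sub>R \<theta>) u)) integrable_on {0..1}" (is ?B)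
proof -
  have d: "((\<lambda>z. (\<lambda>(t, z). \<omega> (rot (t *\<^sub>R \<theta>) z) (rot (t *\<^sub>R \<theta>) v) (rot (t *\<^sub>R \<theta>) w)) (t, z)) has_derivative
     (\<lambda>u. FD (\<lambda>y. \<omega> y (rot (t *\<^sub>R \<theta>) v) (rot (t *\<^sub>R \<theta>) w)) (rot (t *\<^sub>R \<theta>) z) (rot (t *\<^sub>R \<theta>) u))) (at z)" for t
    using has_derivative_form2[OF assms bounded_linear_imp_has_derivative[OF bounded_linear_rot]
        has_derivative_const[of "rot (t *\<^sub>R \<theta>) v"] has_derivative_const[of "rot (t *\<^sub>R \<theta>) w"],
        of "t *\<^sub>R \<theta>" z]
    by (simp add: form2_simps[OF assms])
  show ?A
    using has_derivative_integral[OF smooth_avg_aux[OF assms] d] unfolding avg_def split_conv by (rule FD_eq)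
  show ?B by (rule integrable_smooth_deriv[OF smooth_avg_aux[OF assms] d])
qed

lemma local_closed_avg:
  assumes "smooth_form2 \<omega>" "local_closed \<omega>"
  shows "local_closed (avg \<theta> \<omega>)"
  unfolding local_closed_def
proof (intro allI)
  fix z u v w
  have "FD (\<lambda>y. \<omega> y (rot r v) (rot r w)) (rot r z) (rot r u)
      + FD (\<lambda>y. \<omega> y (rot r w) (rot r u)) (rot r z) (rot r v)
      + FD (\<lambda>y. \<omega> y (rot r u) (rot r v)) (rot r z) (rot r w) = 0" for r
    using assms(2) by (simp add: local_closed_def)
  then show "FD (\<lambda>y. avg \<theta> \<omega> y v w) z u + FD (\<lambda>y. avg \<theta> \<omega> y w u) z v + FD (\<lambda>y. avg \<theta> \<omega> y u v) z w = 0"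
    unfolding FD_avg(1)[OF assms(1)]
    by (simp add: Henstock_Kurzweil_Integration.integral_add[symmetric] FD_avg(2)[OF assms(1)] integrable_add)
qed

text \<open>With g(t) the pulled back form on (u, v), closedness identifies the integrand of the
  exterior derivative with (1 - t) g'(t). Integrating the derivative of (1 - t) g(t) leaves the
  boundary term - g(0), which is minus the original form.\<close>

lemma avg_prim:
  assumes "smooth_form2 \<omega>" "local_closed \<omega>"
  shows "avg \<theta> \<omega> z u v - \<omega> z u v = FD (\<lambda>y. avg_prim \<theta> \<omega> y v) z u - FD (\<lambda>y. avg_prim \<theta> \<omega> y u) z v"
proof -
  let ?R = "\<lambda>t. rot (t *\<^sub>R \<theta>)"
  let ?D = "\<lambda>v t u. (1 - t) * (FD (\<lambda>y. \<omega> y (vf \<theta> (?R t z)) (?R t v)) (?R t z) (?R t u) + \<omega> (?R t z) (vf \<theta> (?R t u)) (?R t v))"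
  have d: "((\<lambda>z. (\<lambda>(t, z). (1 - t) * \<omega> (?R t z) (vf \<theta> (?R t z)) (?R t v)) (t, z)) has_derivative ?D v t) (at z)" for v t
    using has_derivative_mult_right[OF has_derivative_form2[OF assms(1)
          bounded_linear_imp_has_derivative[OF bounded_linear_rot[of "t *\<^sub>R \<theta>"]]
          bounded_linear_imp_has_derivative[OF bounded_linear_compose[OF bounded_linear_vf[of \<theta>] bounded_linear_rot[of "t *\<^sub>R \<theta>"]]]
          has_derivative_const[of "?R t v" "at z"]], of "1 - t"]
    by (simp add: form2_simps[OF assms(1)])
  note sm = smooth_avg_prim_aux[OF assms(1)]
  have FD: "FD (\<lambda>y. avg_prim \<theta> \<omega> y v) z u = integral {0..1} (\<lambda>t. ?D v t u)" for u v
    using has_derivative_integral[OF sm d] unfolding avg_prim_def split_conv by (rule FD_eq)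
  let ?g = "\<lambda>t. \<omega> (?R t z) (?R t u) (?R t v)"
  have g: "((\<lambda>t. (1 - t) * ?g t) has_vector_derivative ?D v t u - ?D u t v - ?g t) (at t within {0..1})" for t
  proof -
    let ?g' = "FD (\<lambda>y. \<omega> y (?R t u) (?R t v)) (?R t z) (vf \<theta> (?R t z))
       + \<omega> (?R t z) (vf \<theta> (?R t u)) (?R t v) + \<omega> (?R t z) (?R t u) (vf \<theta> (?R t v))"
    have "(?g has_real_derivative ?g') (at t)"
      using has_derivative_form2[OF assms(1) has_derivative_rot[of \<theta> z t] has_derivative_rot[of \<theta> u t] has_derivative_rot[of \<theta> v t]]
      unfolding FD_scale2[OF assms(1)] form2_simps[OF assms(1)]
      by (auto simp: has_field_derivative_def algebra_simps fun_eq_iff elim!: has_derivative_eq_rhs)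
    then have "((\<lambda>t. (1 - t) * ?g t) has_real_derivative (1 - t) * ?g' - ?g t) (at t)"
      by (auto intro!: derivative_eq_intros)
    moreover have "(1 - t) * ?g' = ?D v t u - ?D u t v"
      using local_closed_swap[OF assms, of "vf \<theta> (?R t z)" "?R t v" "?R t z" "?R t u"]
        form2_swap[OF assms(1), of "?R t z" "vf \<theta> (?R t v)" "?R t u"]
      unfolding distrib_left[symmetric] right_diff_distrib[symmetric]
      by (intro arg_cong2[where f="(*)"] refl) linarith
    ultimately show ?thesis
      by (simp add: has_real_derivative_iff_has_vector_derivative has_vector_derivative_at_within)
  qed
  have i: "(\<lambda>t. ?D v t u) integrable_on {0..1}" for u v
    by (rule integrable_smooth_deriv[OF sm d])
  have ig: "?g integrable_on {0..1}"
    using integrable_smooth_pair[OF smooth_avg_aux[OF assms(1)]] by simp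
  have "((\<lambda>t. ?D v t u - ?D u t v - ?g t) has_integral ((1 - 1) * ?g 1 - (1 - 0) * ?g 0)) {0..1}"
    by (rule fundamental_theorem_of_calculus) (use g in auto)
  then have "integral {0..1} (\<lambda>t. ?D v t u - ?D u t v - ?g t) = - \<omega> z u v"
    by (simp add: integral_unique rot_simps)
  moreover have "integral {0..1} (\<lambda>t. ?D v t u - ?D u t v - ?g t) = integral {0..1} (\<lambda>t. ?D v t u)
     - integral {0..1} (\<lambda>t. ?D u t v) - integral {0..1} ?g"
    unfolding Henstock_Kurzweil_Integration.integral_diff[OF integrable_diff[OF i i] ig]
      Henstock_Kurzweil_Integration.integral_diff[OF i i] ..
  ultimately show ?thesis unfolding FD by (simp add: avg_def)
qed

definition J_invariant :: "(complex^4 \<Rightarrow> complex^4 \<Rightarrow> complex^4 \<Rightarrow> real) \<Rightarrow> bool" where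
  "J_invariant \<omega> \<longleftrightarrow> (\<forall>z u v. \<omega> z (\<i> *s u) (\<i> *s v) = \<omega> z u v)"

definition pos_form :: "(complex^4 \<Rightarrow> complex^4 \<Rightarrow> complex^4 \<Rightarrow> real) \<Rightarrow> bool" where
  "pos_form \<omega> \<longleftrightarrow> (\<forall>z u. u \<noteq> 0 \<longrightarrow> \<omega> z u (\<i> *s u) > 0)"

lemma J_invariant_avg: "J_invariant \<omega> \<Longrightarrow> J_invariant (avg \<theta> \<omega>)"
  by (simp add: J_invariant_def avg_def rot_simps)

lemma integral_pos_continuous:
  fixes f :: "real \<Rightarrow> real"
  assumes "continuous_on {0..1} f" "\<And>t. t \<in> {0..1} \<Longrightarrow> f t \<ge> 0" "c \<in> {0..1}" "f c > 0"
  shows "integral {0..1} f > 0"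
proof -
  have "integral {0..1} f \<ge> 0"
    by (intro integral_nonneg integrable_continuous_interval assms)
  moreover have "integral {0..1} f \<noteq> 0"
  proof
    assume "integral {0..1} f = 0"
    then have "f c = 0"
      using integral_eq_0_iff[OF assms(1), of ] assms by auto
    with assms show False by simp
  qed
  ultimately show ?thesis by simp
qed

lemma pos_form_avg:
  assumes "smooth_form2 \<omega>" "pos_form \<omega>"
  shows "pos_form (avg \<theta> \<omega>)"
  unfolding pos_form_def
proof (intro allI impI)
  fix z u :: "complex^4" assume u: "u \<noteq> 0"
  have r: "rot \<theta> u \<noteq> 0" for \<theta> using u by (auto simp: rot_def vec_eq_iff)
  have p: "\<omega> (rot r z) (rot r u) (rot r (\<i> *s u)) > 0" for r
    using assms(2) r[of r] by (simp add: pos_form_def rot_simps)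
  show "avg \<theta> \<omega> z u (\<i> *s u) > 0" unfolding avg_def
  proof (rule integral_pos_continuous[where c=0])
    show "continuous_on {0..1} (\<lambda>t. \<omega> (rot (t *\<^sub>R \<theta>) z) (rot (t *\<^sub>R \<theta>) u) (rot (t *\<^sub>R \<theta>) (\<i> *s u)))"
      using continuous_smooth_pair[OF smooth_avg_aux[OF assms(1)]] by simp
  qed (use p in \<open>auto intro: less_imp_le\<close>)
qed

section \<open>Invariance of averaged forms\<close>

definition invariant :: "real^4 \<Rightarrow> (complex^4 \<Rightarrow> complex^4 \<Rightarrow> complex^4 \<Rightarrow> real) \<Rightarrow> bool" where
  "invariant \<theta> \<omega> \<longleftrightarrow> (\<forall>t z u v. \<omega> (rot (t *\<^sub>R \<theta>) z) (rot (t *\<^sub>R \<theta>) u) (rot (t *\<^sub>R \<theta>) v) = \<omega> z u v)"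

text \<open>Rotations commute, so averaging over one circle keeps the invariance already gained for
  another; the circles may be treated one after the other.\<close>

lemma invariant_avg_other:
  assumes "invariant \<theta>' \<omega>"
  shows "invariant \<theta>' (avg \<theta> \<omega>)"
  unfolding invariant_def avg_def
proof (intro allI)
  fix t z u v
  have c: "rot a (rot b z) = rot b (rot a z)" for a b z by (simp add: rot_simps add.commute)
  show "integral {0..1} (\<lambda>s. \<omega> (rot (s *\<^sub>R \<theta>) (rot (t *\<^sub>R \<theta>') z)) (rot (s *\<^sub>R \<theta>) (rot (t *\<^sub>R \<theta>') u)) (rot (s *\<^sub>R \<theta>) (rot (t *\<^sub>R \<theta>') v)))
    = integral {0..1} (\<lambda>s. \<omega> (rot (s *\<^sub>R \<theta>) z) (rot (s *\<^sub>R \<theta>) u) (rot (s *\<^sub>R \<theta>) v))"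
    unfolding c[of "_ *\<^sub>R \<theta>" "t *\<^sub>R \<theta>'"] using assms by (simp add: invariant_def)
qed

text \<open>For an antiderivative G of g the function G(s + 1) - G(s) has derivative 0 by
  periodicity, hence is constant in s.\<close>

lemma integral_periodic:
  fixes g :: "real \<Rightarrow> real"
  assumes "continuous_on UNIV g" "\<And>t. g (t + 1) = g t"
  shows "integral {0..1} (\<lambda>t. g (t + s)) = integral {0..1} g"
proof -
  have i: "g integrable_on {a..b}" for a b
    using assms(1) by (intro integrable_continuous_interval continuous_on_subset[OF assms(1)]) auto
  \<comment> \<open>Integrals over reversed intervals would be 0, so the sign is put in by hand to
    obtain an antiderivative on the whole line.\<close>
  define G where "G x = (if x \<ge> 0 then integral {0..x} g else - integral {x..0} g)" for x
  have G: "(G has_real_derivative g x) (at x)" for x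
  proof -
    define a where "a = min x 0 - 1"
    have a0: "a \<le> 0" by (simp add: a_def)
    have "((\<lambda>y. integral {a..y} g) has_real_derivative g x) (at x within {a..max x 0 + 1})"
      by (rule integral_has_real_derivative[OF continuous_on_subset[OF assms(1)]]) (auto simp: a_def)
    then have "((\<lambda>y. integral {a..y} g) has_real_derivative g x) (at x)"
      by (subst (asm) at_within_Icc_at) (auto simp: a_def)
    then have d: "((\<lambda>y. integral {a..y} g - integral {a..0} g) has_real_derivative g x) (at x)"
      by (auto intro!: derivative_eq_intros)
    have "G y = integral {a..y} g - integral {a..0} g" if "y > a" for y
    proof (cases "y \<ge> 0")
      case True
      then show ?thesis using Henstock_Kurzweil_Integration.integral_combine[of a 0 y g] i that a0 by (simp add: G_def)
    next
      case False
      then show ?thesis using Henstock_Kurzweil_Integration.integral_combine[of a y 0 g] i that by (simp add: G_def)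
    qed
    then show ?thesis
      by (intro has_field_derivative_transform_within_open[OF d, of "{a<..}"]) (auto simp: a_def)
  qed
  have F: "integral {0..1} (\<lambda>t. g (t + s)) = G (1 + s) - G s" for s
  proof -
    have "((\<lambda>t. g (t + s)) has_integral (G (1 + s) - G (0 + s))) {0..1}"
    proof (rule fundamental_theorem_of_calculus)
      fix t :: real
      have "((\<lambda>t. G (t + s)) has_real_derivative g (t + s)) (at t)"
        using DERIV_shift[of G "g (t + s)" t s] G by simp
      then show "((\<lambda>t. G (t + s)) has_vector_derivative g (t + s)) (at t within {0..1})"
        by (simp add: has_real_derivative_iff_has_vector_derivative has_vector_derivative_at_within)
    qed simp
    then show ?thesis by (simp add: integral_unique)
  qed
  have "((\<lambda>s. G (s + 1) - G s) has_real_derivative 0) (at s)" for s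
    using DERIV_diff[OF DERIV_shift[THEN iffD1, OF G[of "s + 1"]] G[of s]] assms(2)[of s] by simp
  then have "G (s + 1) - G s = G (0 + 1) - G 0"
    by (intro DERIV_isconst_all allI)
  then show ?thesis using F[of s] F[of 0] by (simp add: add.commute)
qed

lemma rot_period: "(\<And>l. \<theta> $ l / (2 * pi) \<in> \<int>) \<Longrightarrow> rot \<theta> z = z"
proof -
  assume a: "\<And>l. \<theta> $ l / (2 * pi) \<in> \<int>"
  have "cis (\<theta> $ l) = 1" for l
  proof -
    obtain n where "\<theta> $ l / (2 * pi) = of_int n" using a Ints_cases by blast
    then have "\<theta> $ l = 2 * pi * of_int n" by (simp add: field_simps)
    then show ?thesis using cis_multiple_2pi[of "of_int n"] by simp
  qed
  then show ?thesis by (simp add: rot_def vec_eq_iff)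
qed

text \<open>As the entries of \<theta> are integer multiples of 2 pi, the flow has period 1, and
  rotating by s only shifts a periodic integrand over a full period.\<close>

lemma invariant_avg_self:
  assumes "smooth_form2 \<omega>" "\<And>l. \<theta> $ l / (2 * pi) \<in> \<int>"
  shows "invariant \<theta> (avg \<theta> \<omega>)"
  unfolding invariant_def avg_def
proof (intro allI)
  fix s z u v
  let ?g = "\<lambda>t. \<omega> (rot (t *\<^sub>R \<theta>) z) (rot (t *\<^sub>R \<theta>) u) (rot (t *\<^sub>R \<theta>) v)"
  have r: "rot ((t + 1) *\<^sub>R \<theta>) z = rot (t *\<^sub>R \<theta>) z" for t z
    using rot_period[of \<theta> "rot (t *\<^sub>R \<theta>) z"] assms(2) by (simp add: rot_simps scaleR_left_distrib add.commute)
  have "integral {0..1} (\<lambda>t. ?g (t + s)) = integral {0..1} ?g"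
  proof (rule integral_periodic)
    show "continuous_on UNIV ?g"
      using continuous_smooth_pair[OF smooth_avg_aux[OF assms(1)]] by simp
  qed (simp add: r)
  then show "integral {0..1} (\<lambda>t. \<omega> (rot (t *\<^sub>R \<theta>) (rot (s *\<^sub>R \<theta>) z)) (rot (t *\<^sub>R \<theta>) (rot (s *\<^sub>R \<theta>) u)) (rot (t *\<^sub>R \<theta>) (rot (s *\<^sub>R \<theta>) v)))
    = integral {0..1} ?g"
    by (simp add: rot_simps scaleR_left_distrib)
qed

section \<open>Cohomology classes of Kaehler forms\<close>

lemma kaehler_iff:
  "kaehler_form P_O_O111 \<omega> \<longleftrightarrow> two_form P_O_O111 \<omega> \<and>
     (\<forall>s. local_closed (\<omega> (chart s)) \<and> J_invariant (\<omega> (chart s)) \<and> pos_form (\<omega> (chart s)))"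
  unfolding kaehler_form_def closed_form_def local_closed_def J_invariant_def pos_form_def P_O_O111_eq
  by (simp add: fst_chart all_conj_distrib)

lemma cohomologous_iff:
  "cohomologous P_O_O111 \<omega> \<omega>' \<longleftrightarrow> (\<exists>\<beta>. one_form P_O_O111 \<beta> \<and> (\<forall>s z u v.
     \<omega>' (chart s) z u v - \<omega> (chart s) z u v =
       FD (\<lambda>y. \<beta> (chart s) y v) z u - FD (\<lambda>y. \<beta> (chart s) y u) z v))"
  unfolding cohomologous_def P_O_O111_eq by (simp add: fst_chart)

lemma inv_chart [simp]: "inv chart (chart s) = s"
  by (simp add: inj_chart)

lemma smooth_form1_add:
  "smooth_form1 \<beta> \<Longrightarrow> smooth_form1 \<beta>' \<Longrightarrow> smooth_form1 (\<lambda>z u. \<beta> z u + \<beta>' z u)"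
  unfolding smooth_form1_def by (auto intro!: smooth_intros linear_compose_add)

lemma cohomologous_trans:
  assumes "cohomologous P_O_O111 \<omega> \<omega>'" "cohomologous P_O_O111 \<omega>' \<omega>''"
  shows "cohomologous P_O_O111 \<omega> \<omega>''"
proof -
  obtain \<beta> where b: "one_form P_O_O111 \<beta>" "\<And>s z u v. \<omega>' (chart s) z u v - \<omega> (chart s) z u v =
       FD (\<lambda>y. \<beta> (chart s) y v) z u - FD (\<lambda>y. \<beta> (chart s) y u) z v"
    using assms(1) unfolding cohomologous_iff by blast
  obtain \<beta>' where b': "one_form P_O_O111 \<beta>'" "\<And>s z u v. \<omega>'' (chart s) z u v - \<omega>' (chart s) z u v =
       FD (\<lambda>y. \<beta>' (chart s) y v) z u - FD (\<lambda>y. \<beta>' (chart s) y u) z v"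
    using assms(2) unfolding cohomologous_iff by blast
  have f: "smooth_form1 (\<beta> (chart s))" "smooth_form1 (\<beta>' (chart s))" for s
    using b(1) b'(1) by (auto simp: one_form_iff local_one_form_eq)
  have FD: "FD (\<lambda>y. \<beta> (chart s) y v + \<beta>' (chart s) y v) z u
      = FD (\<lambda>y. \<beta> (chart s) y v) z u + FD (\<lambda>y. \<beta>' (chart s) y v) z u" for s z u v
    by (rule FD_eq) (intro has_derivative_add smooth_FD_apply smooth_form1D(2)[OF f(1)] smooth_form1D(2)[OF f(2)])
  have "one_form P_O_O111 (\<lambda>c z u. \<beta> c z u + \<beta>' c z u)"
    using b(1) b'(1) by (simp add: one_form_iff local_one_form_eq smooth_form1_add)
  moreover have "\<omega>'' (chart s) z u v - \<omega> (chart s) z u v =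
       FD (\<lambda>y. \<beta> (chart s) y v + \<beta>' (chart s) y v) z u - FD (\<lambda>y. \<beta> (chart s) y u + \<beta>' (chart s) y u) z v" for s z u v
    unfolding FD using b(2)[of s z u v] b'(2)[of s z u v] by simp
  ultimately show ?thesis unfolding cohomologous_iff
    by (intro exI[of _ "\<lambda>c z u. \<beta> c z u + \<beta>' c z u"] conjI allI)
qed

subsection \<open>The torus action\<close>

text \<open>The exponent matrix of \<open>mat_log\<close>, acting on rotation angles:
  \<open>trans_fun s s'\<close> carries the rotation by \<theta> to the rotation by
  \<open>wt s s' \<theta>\<close>.\<close>

definition wt :: "(4 \<Rightarrow> 2) \<Rightarrow> (4 \<Rightarrow> 2) \<Rightarrow> real^4 \<Rightarrow> real^4" where
  "wt s s' \<theta> = (\<chi> l. if l = 4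
     then let w = \<theta> $ 4 - sgn_fib s * (\<Sum>k\<in>flips s s'. \<theta> $ k)
          in if s 4 = s' 4 then w else - w
     else if s l = s' l then \<theta> $ l else - \<theta> $ l)"

lemma wt_linear: "wt s s' (\<theta> + \<theta>') = wt s s' \<theta> + wt s s' \<theta>'" "wt s s' (c *\<^sub>R \<theta>) = c *\<^sub>R wt s s' \<theta>"
  by (auto simp: wt_def vec_eq_iff Let_def sum.distrib sum_distrib_left algebra_simps)

lemma linear_wt: "linear (wt s s')" by (rule linearI) (simp_all add: wt_linear)

lemma Im_mat_log: "(\<chi> l. Im (mat_log s s' \<xi> $ l)) = wt s s' (\<chi> l. Im (\<xi> $ l))"
  by (auto simp: wt_def mat_log_def vec_eq_iff Let_def)

lemma vf_eq: "vf \<theta> z = z * (\<chi> l. \<i> * of_real (\<theta> $ l))"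
  by (simp add: vf_def vec_eq_iff)

lemma mat_log_imaginary: "mat_log s s' (\<chi> l. \<i> * of_real (\<theta> $ l)) = (\<chi> l. \<i> * of_real (wt s s' \<theta> $ l))"
  by (auto simp: wt_def mat_log_def vec_eq_iff Let_def sum_distrib_left algebra_simps)

lemma sum_flips: "(\<Sum>k\<in>flips s s'. f k) = (\<Sum>k\<in>{1,2,3}. if s k = s' k then 0 else f k :: real)"
  using flips_subset by (intro sum.mono_neutral_cong_left) (auto simp: flips_def)

text \<open>A base index flipped twice contributes \<open>\<theta> $ k\<close> and then its negative
  to the fibre angle, so only the indices that differ between the first and the last chart remain.
  Angles fixed in one chart thereby act consistently in all of them.\<close>

lemma wt_cocycle: "wt s' s'' (wt s s' \<theta>) = wt s s'' \<theta>"
proof -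
  have base: "wt s' s'' (wt s s' \<theta>) $ l = wt s s'' \<theta> $ l" if "l \<noteq> 4" for l
    using that exhaust_2[of "s l"] exhaust_2[of "s' l"] exhaust_2[of "s'' l"]
    by (elim disjE) (simp_all add: wt_def)
  have "(\<Sum>k\<in>{1,2,3}. if s k = s' k then 0 else \<theta> $ k) + (\<Sum>k\<in>{1,2,3}. if s' k = s'' k then 0 else wt s s' \<theta> $ k)
      = (\<Sum>k\<in>{1,2,3}. (if s k = s' k then 0 else \<theta> $ k) + (if s' k = s'' k then 0 else wt s s' \<theta> $ k))"
    by (simp only: sum.distrib)
  also have "\<dots> = (\<Sum>k\<in>{1,2,3}. if s k = s'' k then 0 else \<theta> $ k)"
  proof (intro sum.cong refl)
    fix k :: 4 assume "k \<in> {1,2,3}"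
    then have "k \<noteq> 4" by auto
    then show "(if s k = s' k then 0 else \<theta> $ k) + (if s' k = s'' k then 0 else wt s s' \<theta> $ k)
      = (if s k = s'' k then 0 else \<theta> $ k)"
      using exhaust_2[of "s k"] exhaust_2[of "s' k"] exhaust_2[of "s'' k"]
      by (elim disjE) (simp_all add: wt_def)
  qed
  finally have sm: "(\<Sum>k\<in>flips s s'. \<theta> $ k) + (\<Sum>k\<in>flips s' s''. wt s s' \<theta> $ k) = (\<Sum>k\<in>flips s s''. \<theta> $ k)"
    by (simp only: sum_flips)
  have "wt s' s'' (wt s s' \<theta>) $ 4 = wt s s'' \<theta> $ 4"
  proof -
    have w: "wt a b \<phi> $ 4 = (if a 4 = b 4 then 1 else -1) * (\<phi> $ 4 - sgn_fib a * (\<Sum>k\<in>flips a b. \<phi> $ k))" for a b \<phi>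
      by (simp add: wt_def Let_def)
    show ?thesis
      unfolding w[of s' s''] w[of s s''] sm[symmetric] unfolding w[of s s' \<theta>]
      using exhaust_2[of "s 4"] exhaust_2[of "s' 4"] exhaust_2[of "s'' 4"]
      by (elim disjE) (simp_all add: sgn_fib_def algebra_simps)
  qed
  with base show ?thesis by (metis vec_eq_iff)
qed

lemma wt_self: "wt s s \<theta> = \<theta>"
  by (simp add: wt_def flips_def vec_eq_iff)

lemma cis_prod: "finite A \<Longrightarrow> (\<Prod>k\<in>A. cis (f k) * g k) = cis (\<Sum>k\<in>A. f k) * (\<Prod>k\<in>A. g k)"
  by (induction A rule: finite_induct) (auto simp: cis_mult[symmetric] algebra_simps)

lemma trans_fun_rot: "trans_fun s s' (rot \<theta> z) = rot (wt s s' \<theta>) (trans_fun s s' z)"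
proof -
  have neg: "cis (- a) = 1 / cis a" for a by (simp add: divide_inverse)
  have "trans_fun s s' (rot \<theta> z) $ l = rot (wt s s' \<theta>) (trans_fun s s' z) $ l" for l
  proof (cases "l = 4")
    case True
    let ?S = "\<Sum>k\<in>flips s s'. \<theta> $ k"
    have p: "(\<Prod>k\<in>flips s s'. rot \<theta> z $ k) = cis ?S * (\<Prod>k\<in>flips s s'. z $ k)"
      by (simp add: rot_def cis_prod)
    have c: "cis (a - b) = cis a * inverse (cis b)" for a b by (simp add: cis_mult)
    show ?thesis
      unfolding True trans_fun_def rot_def[of "wt s s' \<theta>"] wt_def vec_lambda_beta Let_def if_True p eqTrueI[OF refl]
      using exhaust_2[of "s 4"] exhaust_2[of "s' 4"]
      by (elim disjE) (simp_all add: rot_def sgn_fib_def cis_mult[symmetric] c neg field_simps del: cis_inverse)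
  next
    case False
    then show ?thesis by (simp add: trans_fun_def rot_def wt_def)
  qed
  then show ?thesis by (simp add: vec_eq_iff)
qed

lemma rot_torus: "z \<in> torus \<Longrightarrow> rot \<theta> z \<in> torus"
  by (simp add: torus_def rot_def)

text \<open>The a-th circle of the globally acting torus, as seen in chart s: a full turn of the
  a-th coordinate in the reference chart, transported by the cocycle.\<close>

definition circ :: "4 \<Rightarrow> (4 \<Rightarrow> 2) \<Rightarrow> real^4" where
  "circ a s = wt (\<lambda>_. 1) s (axis a (2 * pi))"

lemma wt_circ: "wt s s' (circ a s) = circ a s'"
  by (simp add: circ_def wt_cocycle)

lemma circ_period: "circ a s $ l / (2 * pi) \<in> \<int>"
proof -
  have "(\<Sum>k\<in>B. axis a (2 * pi) $ k) / (2 * pi) \<in> \<int>" for B :: "4 set"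
  proof -
    have "(\<Sum>k\<in>B. axis a (2 * pi) $ k) / (2 * pi) = (\<Sum>k\<in>B. (axis a (2 * pi) $ k) / (2 * pi))"
      by (simp only: sum_divide_distrib)
    also have "\<dots> \<in> \<int>" by (intro Ints_sum) (simp add: axis_def)
    finally show ?thesis .
  qed
  note this[of "flips (\<lambda>_. 1) s"] this[of "{l}"] this[of "{4}"]
  then show ?thesis
    by (auto simp: circ_def wt_def Let_def sgn_fib_def diff_divide_distrib minus_divide_left[symmetric]
       intro!: Ints_diff)
qed

text \<open>The rotation vector differs from chart to chart, and \<open>inv chart c\<close> recovers
  the index it depends on. Transition maps intertwine the rotations, so the integrands agree for
  every time t.\<close>

lemma two_form_avg:
  assumes "two_form P_O_O111 \<omega>"
  shows "two_form P_O_O111 (\<lambda>c. avg (circ a (inv chart c)) (\<omega> c))"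
  unfolding two_form_iff inv_chart
proof (intro conjI allI ballI)
  show "local_two_form (avg (circ a s) (\<omega> (chart s)))" for s
    using assms by (simp add: two_form_iff local_two_form_eq smooth_form2_avg)
  fix s s' z \<xi> \<eta> assume z: "z \<in> torus"
  have "\<omega> (chart s) (rot (t *\<^sub>R circ a s) z) (rot (t *\<^sub>R circ a s) (z * \<xi>)) (rot (t *\<^sub>R circ a s) (z * \<eta>)) =
     \<omega> (chart s') (rot (t *\<^sub>R circ a s') (trans_fun s s' z)) (rot (t *\<^sub>R circ a s') (trans_fun s s' z * mat_log s s' \<xi>))
       (rot (t *\<^sub>R circ a s') (trans_fun s s' z * mat_log s s' \<eta>))" for t
  proof -
    have "rot (t *\<^sub>R circ a s) z \<in> torus" using z by (rule rot_torus)
    moreover have "trans_fun s s' (rot (t *\<^sub>R circ a s) z) = rot (t *\<^sub>R circ a s') (trans_fun s s' z)"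
      by (simp add: trans_fun_rot wt_linear wt_circ)
    ultimately show ?thesis using assms unfolding two_form_iff rot_simps by metis
  qed
  then show "avg (circ a s) (\<omega> (chart s)) z (z * \<xi>) (z * \<eta>) =
    avg (circ a s') (\<omega> (chart s')) (trans_fun s s' z) (trans_fun s s' z * mat_log s s' \<xi>)
      (trans_fun s s' z * mat_log s s' \<eta>)"
    unfolding avg_def by simp
qed

lemma one_form_avg_prim:
  assumes "two_form P_O_O111 \<omega>"
  shows "one_form P_O_O111 (\<lambda>c. avg_prim (circ a (inv chart c)) (\<omega> c))"
  unfolding one_form_iff inv_chart
proof (intro conjI allI ballI)
  show "local_one_form (avg_prim (circ a s) (\<omega> (chart s)))" for s
    using assms by (simp add: two_form_iff local_two_form_eq local_one_form_eq smooth_form1_avg_prim)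
  fix s s' z \<xi> assume z: "z \<in> torus"
  have "\<omega> (chart s) (rot (t *\<^sub>R circ a s) z) (vf (circ a s) (rot (t *\<^sub>R circ a s) z)) (rot (t *\<^sub>R circ a s) (z * \<xi>)) =
     \<omega> (chart s') (rot (t *\<^sub>R circ a s') (trans_fun s s' z)) (vf (circ a s') (rot (t *\<^sub>R circ a s') (trans_fun s s' z)))
       (rot (t *\<^sub>R circ a s') (trans_fun s s' z * mat_log s s' \<xi>))" for t
  proof -
    have "rot (t *\<^sub>R circ a s) z \<in> torus" using z by (rule rot_torus)
    moreover have "trans_fun s s' (rot (t *\<^sub>R circ a s) z) = rot (t *\<^sub>R circ a s') (trans_fun s s' z)"
      by (simp add: trans_fun_rot wt_linear wt_circ)
    ultimately show ?thesis using assms mat_log_imaginary[of s s' "circ a s"]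
      unfolding two_form_iff rot_simps vf_eq wt_circ by metis
  qed
  then show "avg_prim (circ a s) (\<omega> (chart s)) z (z * \<xi>) =
    avg_prim (circ a s') (\<omega> (chart s')) (trans_fun s s' z) (trans_fun s s' z * mat_log s s' \<xi>)"
    unfolding avg_prim_def by simp
qed

definition T_invariant :: "(complex^4 \<Rightarrow> complex^4 \<Rightarrow> complex^4 \<Rightarrow> real) \<Rightarrow> bool" where
  "T_invariant \<omega> \<longleftrightarrow> (\<forall>\<theta> z u v. \<omega> (rot \<theta> z) (rot \<theta> u) (rot \<theta> v) = \<omega> z u v)"

lemma average_one_circle:
  assumes "kaehler_form P_O_O111 \<omega>" "\<And>b s. b \<in> B \<Longrightarrow> invariant (circ b s) (\<omega> (chart s))"
  shows "\<exists>\<omega>'. kaehler_form P_O_O111 \<omega>' \<and> cohomologous P_O_O111 \<omega> \<omega>' \<and>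
     (\<forall>b\<in>insert a B. \<forall>s. invariant (circ b s) (\<omega>' (chart s)))"
proof (intro exI conjI ballI allI)
  let ?w = "\<lambda>c. avg (circ a (inv chart c)) (\<omega> c)"
  have tf: "two_form P_O_O111 \<omega>" and sf: "smooth_form2 (\<omega> (chart s))"
    and cl: "local_closed (\<omega> (chart s))" "J_invariant (\<omega> (chart s))" "pos_form (\<omega> (chart s))" for s
    using assms by (auto simp: kaehler_iff two_form_iff local_two_form_eq)
  show "kaehler_form P_O_O111 ?w"
    unfolding kaehler_iff using two_form_avg[OF tf] sf cl
    by (auto intro: local_closed_avg J_invariant_avg pos_form_avg)
  show "cohomologous P_O_O111 \<omega> ?w"
    unfolding cohomologous_iff
    using one_form_avg_prim[OF tf, of a] avg_prim[OF sf cl(1)] by (intro exI[of _ "\<lambda>c. avg_prim (circ a (inv chart c)) (\<omega> c)"]) auto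
  fix b s assume "b \<in> insert a B"
  then show "invariant (circ b s) (?w (chart s))"
    using invariant_avg_other[OF assms(2)] invariant_avg_self[OF sf circ_period] by auto
qed

text \<open>Averaging over the four circles in turn suffices: in every chart the vectors
  \<open>circ a s\<close> span the rotation angles, so an arbitrary rotation is a composite of
  rotations along the circles.\<close>

lemma average:
  assumes "kaehler_form P_O_O111 \<omega>"
  shows "\<exists>\<omega>'. kaehler_form P_O_O111 \<omega>' \<and> cohomologous P_O_O111 \<omega> \<omega>' \<and> (\<forall>s. T_invariant (\<omega>' (chart s)))"
proof -
  obtain w1 where 1: "kaehler_form P_O_O111 w1" "cohomologous P_O_O111 \<omega> w1"
    "\<And>b s. b \<in> {1} \<Longrightarrow> invariant (circ b s) (w1 (chart s))"
    using average_one_circle[OF assms, where B="{}" and a=1] by auto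
  obtain w2 where 2: "kaehler_form P_O_O111 w2" "cohomologous P_O_O111 w1 w2"
    "\<And>b s. b \<in> {2, 1} \<Longrightarrow> invariant (circ b s) (w2 (chart s))"
    using average_one_circle[OF 1(1,3), where a=2 and B="{1}"] by blast
  obtain w3 where 3: "kaehler_form P_O_O111 w3" "cohomologous P_O_O111 w2 w3"
    "\<And>b s. b \<in> {3, 2, 1} \<Longrightarrow> invariant (circ b s) (w3 (chart s))"
    using average_one_circle[OF 2(1,3), where a=3 and B="{2, 1}"] by blast
  obtain w4 where 4: "kaehler_form P_O_O111 w4" "cohomologous P_O_O111 w3 w4"
    "\<And>b s. b \<in> {4, 3, 2, 1} \<Longrightarrow> invariant (circ b s) (w4 (chart s))"
    using average_one_circle[OF 3(1,3), where a=4 and B="{3, 2, 1}"] by blast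
  have "T_invariant (w4 (chart s))" for s
    unfolding T_invariant_def
  proof (intro allI)
    fix \<theta> z u v
    \<comment> \<open>The same rotation in the reference chart, where its coordinates with respect
      to the circles can be read off.\<close>
    define \<phi> where "\<phi> = wt s (\<lambda>_. 1) \<theta>"
    have "\<phi> = (\<Sum>a\<in>UNIV. (\<phi> $ a / (2 * pi)) *\<^sub>R axis a (2 * pi))"
      by (simp add: vec_eq_iff axis_def if_distrib[of "\<lambda>x. _ * x"] cong: if_cong)
    then have "wt (\<lambda>_. 1) s \<phi> = wt (\<lambda>_. 1) s (\<Sum>a\<in>UNIV. (\<phi> $ a / (2 * pi)) *\<^sub>R axis a (2 * pi))" by simp
    also have "\<dots> = (\<Sum>a\<in>UNIV. (\<phi> $ a / (2 * pi)) *\<^sub>R circ a s)"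
      by (simp only: linear_sum[OF linear_wt] linear_scale[OF linear_wt] circ_def)
    finally have \<theta>: "\<theta> = (\<Sum>a\<in>UNIV. (\<phi> $ a / (2 * pi)) *\<^sub>R circ a s)"
      by (simp add: \<phi>_def wt_cocycle wt_self)
    have inv: "w4 (chart s) (rot (t *\<^sub>R circ a s) z) (rot (t *\<^sub>R circ a s) u) (rot (t *\<^sub>R circ a s) v) = w4 (chart s) z u v" for a t z u v
      using 4(3)[of a s] exhaust_4[of a] by (auto simp: invariant_def)
    have r: "rot \<theta> z = rot ((\<phi> $ 1 / (2 * pi)) *\<^sub>R circ 1 s) (rot ((\<phi> $ 2 / (2 * pi)) *\<^sub>R circ 2 s)
       (rot ((\<phi> $ 3 / (2 * pi)) *\<^sub>R circ 3 s) (rot ((\<phi> $ 4 / (2 * pi)) *\<^sub>R circ 4 s) z)))" for z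
      by (subst \<theta>) (simp add: sum_4 rot_simps add.assoc)
    show "w4 (chart s) (rot \<theta> z) (rot \<theta> u) (rot \<theta> v) = w4 (chart s) z u v"
      unfolding r inv ..
  qed
  moreover have "cohomologous P_O_O111 \<omega> w4"
    using 1(2) 2(2) 3(2) 4(2) cohomologous_trans by blast
  ultimately show ?thesis using 4(1) by blast
qed

subsection \<open>Moment maps\<close>

definition toric_form :: "(complex^4 \<Rightarrow> complex^4 \<Rightarrow> complex^4 \<Rightarrow> real) \<Rightarrow> bool" where
  "toric_form \<eta> \<longleftrightarrow> smooth_form2 \<eta> \<and> local_closed \<eta> \<and> J_invariant \<eta> \<and> T_invariant \<eta>"

text \<open>The moment map of the rotation field, obtained by evaluating an invariant primitive on
  it. It is normalised to vanish at the origin of the chart, so that moment maps of different charts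
  differ by constants.\<close>

definition mom :: "(complex^4 \<Rightarrow> complex^4 \<Rightarrow> complex^4 \<Rightarrow> real) \<Rightarrow> real^4 \<Rightarrow> complex^4 \<Rightarrow> real" where
  "mom \<eta> \<theta> z = poincare \<eta> z (vf \<theta> z)"

lemma vf_linear: "vf (\<theta> + \<theta>') z = vf \<theta> z + vf \<theta>' z" "vf (c *\<^sub>R \<theta>) z = c *\<^sub>R vf \<theta> z" "vf 0 z = 0"
  "vf \<theta> (c *\<^sub>R z) = c *\<^sub>R vf \<theta> z"
  by (auto simp: vf_def vec_eq_iff algebra_simps scaleR_conv_of_real[where 'a=complex])

lemma toric_formD:
  assumes "toric_form \<eta>"
  shows "smooth_form2 \<eta>" "local_closed \<eta>" "smooth_form1 (poincare \<eta>)"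
    "\<eta> z (\<i> *s u) (\<i> *s v) = \<eta> z u v" "\<eta> (rot \<theta> z) (rot \<theta> u) (rot \<theta> v) = \<eta> z u v"
  using assms smooth_form1_poincare by (auto simp: toric_form_def J_invariant_def T_invariant_def)

lemma poincare_rot:
  assumes "toric_form \<eta>"
  shows "poincare \<eta> (rot \<theta> z) (rot \<theta> u) = poincare \<eta> z u"
proof -
  have "\<eta> (t *\<^sub>R rot \<theta> z) (rot \<theta> z) (rot \<theta> u) = \<eta> (t *\<^sub>R z) z u" for t
    using toric_formD(5)[OF assms, of \<theta> "t *\<^sub>R z" z u] by (simp add: rot_simps)
  then show ?thesis by (simp add: poincare_def)
qed

lemma mom_linear:
  assumes "toric_form \<eta>"
  shows "mom \<eta> (\<theta> + \<theta>') z = mom \<eta> \<theta> z + mom \<eta> \<theta>' z" "mom \<eta> (c *\<^sub>R \<theta>) z = c * mom \<eta> \<theta> z"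
  using smooth_form1D(1)[OF toric_formD(3)[OF assms]]
  by (auto simp: mom_def vf_linear linear_add linear_scale)

lemma linear_mom: "toric_form \<eta> \<Longrightarrow> linear (\<lambda>\<theta>. mom \<eta> \<theta> z)"
  by (rule linearI) (simp_all add: mom_linear)

text \<open>Differentiating the rotation invariance of the primitive at time 0 says that its Lie
  derivative along the field is 0. Cartan's formula then turns the differential of its value on the
  field into the contraction of the form.\<close>

lemma has_derivative_mom:
  assumes "toric_form \<eta>"
  shows "(mom \<eta> \<theta> has_derivative (\<lambda>u. \<eta> z u (vf \<theta> z))) (at z)"
proof -
  note \<beta> = toric_formD(3)[OF assms]
  let ?\<beta> = "poincare \<eta>"
  have d: "(mom \<eta> \<theta> has_derivative (\<lambda>u. FD (\<lambda>y. ?\<beta> y (vf \<theta> z)) z u + ?\<beta> z (vf \<theta> u))) (at z)"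
    unfolding mom_def[abs_def]
    using has_derivative_form1[OF \<beta> has_derivative_ident[of "at z"] bounded_linear_imp_has_derivative[OF bounded_linear_vf[of \<theta>]]] .
  have "FD (\<lambda>y. ?\<beta> y v) z (vf \<theta> z) + ?\<beta> z (vf \<theta> v) = 0" for v
  proof -
    have "((\<lambda>t. ?\<beta> (rot (t *\<^sub>R \<theta>) z) (rot (t *\<^sub>R \<theta>) v)) has_derivative
      (\<lambda>h. FD (\<lambda>y. ?\<beta> y (rot (0 *\<^sub>R \<theta>) v)) (rot (0 *\<^sub>R \<theta>) z) (h *\<^sub>R vf \<theta> (rot (0 *\<^sub>R \<theta>) z))
        + ?\<beta> (rot (0 *\<^sub>R \<theta>) z) (h *\<^sub>R vf \<theta> (rot (0 *\<^sub>R \<theta>) v)))) (at 0)"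
      by (rule has_derivative_form1[OF \<beta> has_derivative_rot has_derivative_rot])
    moreover have "((\<lambda>t. ?\<beta> (rot (t *\<^sub>R \<theta>) z) (rot (t *\<^sub>R \<theta>) v)) has_derivative (\<lambda>h. 0)) (at 0)"
      unfolding poincare_rot[OF assms] by simp
    ultimately have "(\<lambda>h. FD (\<lambda>y. ?\<beta> y (rot (0 *\<^sub>R \<theta>) v)) (rot (0 *\<^sub>R \<theta>) z) (h *\<^sub>R vf \<theta> (rot (0 *\<^sub>R \<theta>) z))
        + ?\<beta> (rot (0 *\<^sub>R \<theta>) z) (h *\<^sub>R vf \<theta> (rot (0 *\<^sub>R \<theta>) v))) = (\<lambda>h. 0)"
      by (rule has_derivative_unique)
    then show ?thesis by (auto simp: fun_eq_iff rot_simps dest: spec[of _ 1])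
  qed
  then have "FD (\<lambda>y. ?\<beta> y (vf \<theta> z)) z u + ?\<beta> z (vf \<theta> u) = \<eta> z u (vf \<theta> z)" for u
    using poincare[OF toric_formD(1,2)[OF assms], of "vf \<theta> z" z u] by (simp add: eq_neg_iff_add_eq_0[symmetric])
  with d show ?thesis by simp
qed

text \<open>A moment map is constant along torus orbits, and its derivative along another rotation
  field is the form evaluated on the two fields.\<close>

lemma isotropic:
  assumes "toric_form \<eta>"
  shows "\<eta> z (vf \<theta> z) (vf \<theta>' z) = 0"
proof -
  have "mom \<eta> \<theta>' (rot (t *\<^sub>R \<theta>) z) = mom \<eta> \<theta>' z" for t
    unfolding mom_def rot_simps(7)[symmetric] poincare_rot[OF assms] ..
  then have "((\<lambda>t. mom \<eta> \<theta>' (rot (t *\<^sub>R \<theta>) z)) has_derivative (\<lambda>h. 0)) (at 0)" by simp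
  moreover have "((\<lambda>t. mom \<eta> \<theta>' (rot (t *\<^sub>R \<theta>) z)) has_derivative
      (\<lambda>h. \<eta> (rot (0 *\<^sub>R \<theta>) z) (h *\<^sub>R vf \<theta> (rot (0 *\<^sub>R \<theta>) z)) (vf \<theta>' (rot (0 *\<^sub>R \<theta>) z)))) (at 0)"
    by (rule has_derivative_compose[OF has_derivative_rot has_derivative_mom[OF assms]])
  ultimately have "(\<lambda>h. 0) = (\<lambda>h. \<eta> (rot (0 *\<^sub>R \<theta>) z) (h *\<^sub>R vf \<theta> (rot (0 *\<^sub>R \<theta>) z)) (vf \<theta>' (rot (0 *\<^sub>R \<theta>) z)))"
    by (rule has_derivative_unique)
  then show ?thesis by (auto simp: fun_eq_iff rot_simps dest: spec[of _ 1])
qed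

text \<open>The integrand pairs z with the real multiple \<open>z * Re \<xi>\<close>. Multiplied by
  \<open>\<i>\<close>, both become rotation fields, so the pairing vanishes by J-invariance and
  isotropy. Only the imaginary part of \<xi> survives, which reduces the gluing of primitives to
  that of moment maps.\<close>

lemma poincare_log_frame:
  assumes "toric_form \<eta>"
  shows "poincare \<eta> z (z * \<xi>) = mom \<eta> (\<chi> l. Im (\<xi> $ l)) z"
proof -
  let ?re = "\<chi> l. Re (\<xi> $ l)" and ?w = "z * (\<chi> l. of_real (Re (\<xi> $ l)))"
  have "z * \<xi> = ?w + vf (\<chi> l. Im (\<xi> $ l)) z"
    by (simp add: vec_eq_iff vf_def complex_eq_iff algebra_simps)
  moreover have "poincare \<eta> z ?w = 0"
  proof -
    have z0: "t * \<eta> (t *\<^sub>R z) z ?w = 0" if "t \<in> {0..1}" for t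
    proof (cases "t = 0")
      case False
      have "\<eta> (t *\<^sub>R z) (vf 1 (t *\<^sub>R z)) (vf ?re (t *\<^sub>R z)) = 0" by (rule isotropic[OF assms])
      moreover have "vf 1 z = \<i> *s z" "vf ?re z = \<i> *s ?w" by (auto simp: vf_def vec_eq_iff)
      ultimately have "t * (t * \<eta> (t *\<^sub>R z) z ?w) = 0"
        unfolding vf_linear form2_simps[OF toric_formD(1)[OF assms]] by (simp add: toric_formD(4)[OF assms])
      with False show ?thesis by simp
    qed simp
    have "integral {0..1} (\<lambda>t. t * \<eta> (t *\<^sub>R z) z ?w) = integral {0..1::real} (\<lambda>t. 0)"
      by (rule Henstock_Kurzweil_Integration.integral_cong) (rule z0)
    then show ?thesis by (simp add: poincare_def)
  qed
  ultimately show ?thesis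
    using linear_add[OF smooth_form1D(1)[OF toric_formD(3)[OF assms]]] by (simp add: mom_def)
qed

lemma mom_axis_zero:
  assumes "toric_form \<eta>" "z $ k = 0"
  shows "mom \<eta> (axis k c) z = 0"
proof -
  have "vf (axis k c) z = 0" using assms(2) by (auto simp: vf_def vec_eq_iff axis_def)
  then show ?thesis using linear_0[OF smooth_form1D(1)[OF toric_formD(3)[OF assms(1)]]] by (simp add: mom_def)
qed

text \<open>On its own coordinate axis the rotation field is \<open>\<i>\<close> times the radial
  vector, so the integrand along the ray is positive for t > 0.\<close>

lemma mom_axis_pos:
  assumes "toric_form \<eta>" "pos_form \<eta>"
  shows "mom \<eta> (axis k 1) (axis k 1) > 0"
proof -
  have v: "vf (axis k 1) (axis k 1) = \<i> *s axis k 1" by (auto simp: vf_def vec_eq_iff axis_def)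
  have p: "\<eta> z (axis k 1) (\<i> *s axis k 1) > 0" for z
    using assms(2) by (simp add: pos_form_def axis_eq_0_iff)
  show ?thesis unfolding mom_def v poincare_def
  proof (rule integral_pos_continuous[where c=1])
    show "continuous_on {0..1} (\<lambda>t. t * \<eta> (t *\<^sub>R axis k 1) (axis k 1) (\<i> *s axis k 1))"
      using continuous_smooth_pair[OF smooth_poincare_aux[OF toric_formD(1)[OF assms(1)]]] by simp
  qed (use p in \<open>auto intro: less_imp_le mult_nonneg_nonneg\<close>)
qed

lemma continuous_mom: "toric_form \<eta> \<Longrightarrow> continuous_on S (mom \<eta> \<theta>)"
  by (intro continuous_at_imp_continuous_on ballI has_derivative_continuous[OF has_derivative_mom])

subsection \<open>The cohomology class in terms of the moment maps\<close>

definition toric_two_form :: "(bundle_coords set, 4) form2 \<Rightarrow> bool" where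
  "toric_two_form \<eta> \<longleftrightarrow> two_form P_O_O111 \<eta> \<and> (\<forall>s. toric_form (\<eta> (chart s)))"

text \<open>Componentwise logarithms give a curve in the torus from 1 to z. Along it the difference
  of the two moment maps has derivative 0, because the forms are compatible and the transition map
  carries one rotation field to the other.\<close>

lemma mom_transition_torus:
  assumes "toric_two_form \<eta>" "z \<in> torus"
  shows "mom (\<eta> (chart s)) \<theta> z - mom (\<eta> (chart s')) (wt s s' \<theta>) (trans_fun s s' z)
    = mom (\<eta> (chart s)) \<theta> 1 - mom (\<eta> (chart s')) (wt s s' \<theta>) 1"
proof -
  define \<zeta> where "\<zeta> = (\<chi> l. Ln (z $ l))"
  define \<gamma> where "\<gamma> t = (\<chi> l. exp (of_real t * \<zeta> $ l))" for t
  have \<gamma>t: "\<gamma> t \<in> torus" for t by (simp add: \<gamma>_def torus_def)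
  have \<gamma>01: "\<gamma> 0 = 1" "\<gamma> 1 = z" using assms(2) by (auto simp: \<gamma>_def \<zeta>_def vec_eq_iff torus_def)
  have t: "toric_form (\<eta> (chart s))" for s using assms by (simp add: toric_two_form_def)
  let ?F = "\<lambda>t. mom (\<eta> (chart s)) \<theta> (\<gamma> t) - mom (\<eta> (chart s')) (wt s s' \<theta>) (trans_fun s s' (\<gamma> t))"
  have d\<gamma>: "(\<gamma> has_derivative (\<lambda>h. \<gamma> t * (h *\<^sub>R \<zeta>))) (at t)" for t
  proof (rule has_derivative_vec)
    fix l
    have "((\<lambda>t. of_real t * \<zeta> $ l) has_derivative (\<lambda>h. of_real h * \<zeta> $ l)) (at t)"
      by (auto intro!: derivative_eq_intros)
    from has_derivative_compose[OF this DERIV_exp[unfolded has_field_derivative_def]]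
    show "((\<lambda>t. \<gamma> t $ l) has_derivative (\<lambda>h. (\<gamma> t * (h *\<^sub>R \<zeta>)) $ l)) (at t)"
      by (simp add: \<gamma>_def scaleR_conv_of_real[where 'a=complex] mult_ac)
  qed
  have "(?F has_real_derivative 0) (at t)" for t
  proof -
    have tr: "(trans_fun s s' has_derivative (\<lambda>u. FD (trans_fun s s') (\<gamma> t) u)) (at (\<gamma> t))"
      using smooth_on_has_derivative[OF smooth_trans_fun] torus_overl \<gamma>t by blast
    have "((\<lambda>t. trans_fun s s' (\<gamma> t)) has_derivative (\<lambda>h. trans_fun s s' (\<gamma> t) * mat_log s s' (h *\<^sub>R \<zeta>))) (at t)"
      using has_derivative_compose[OF d\<gamma> tr] unfolding FD_trans_fun[OF \<gamma>t] .
    from has_derivative_diff[OF has_derivative_compose[OF d\<gamma> has_derivative_mom[OF t]]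
        has_derivative_compose[OF this has_derivative_mom[OF t]]]
    have "(?F has_derivative (\<lambda>h. \<eta> (chart s) (\<gamma> t) (\<gamma> t * (h *\<^sub>R \<zeta>)) (vf \<theta> (\<gamma> t))
      - \<eta> (chart s') (trans_fun s s' (\<gamma> t)) (trans_fun s s' (\<gamma> t) * mat_log s s' (h *\<^sub>R \<zeta>))
          (vf (wt s s' \<theta>) (trans_fun s s' (\<gamma> t))))) (at t)" .
    moreover have "\<eta> (chart s) (\<gamma> t) (\<gamma> t * (h *\<^sub>R \<zeta>)) (vf \<theta> (\<gamma> t))
      - \<eta> (chart s') (trans_fun s s' (\<gamma> t)) (trans_fun s s' (\<gamma> t) * mat_log s s' (h *\<^sub>R \<zeta>))
          (vf (wt s s' \<theta>) (trans_fun s s' (\<gamma> t))) = 0" for h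
    proof -
      have "\<eta> (chart s) (\<gamma> t) (\<gamma> t * (h *\<^sub>R \<zeta>)) (\<gamma> t * (\<chi> l. \<i> * of_real (\<theta> $ l)))
        = \<eta> (chart s') (trans_fun s s' (\<gamma> t)) (trans_fun s s' (\<gamma> t) * mat_log s s' (h *\<^sub>R \<zeta>))
          (trans_fun s s' (\<gamma> t) * mat_log s s' (\<chi> l. \<i> * of_real (\<theta> $ l)))"
        using assms(1) \<gamma>t unfolding toric_two_form_def two_form_iff by blast
      then show ?thesis by (simp only: mat_log_imaginary vf_eq diff_self)
    qed
    ultimately show ?thesis by (simp add: has_field_derivative_def lambda_zero[symmetric])
  qed
  then have "?F 1 = ?F 0" by (intro DERIV_isconst_all allI)
  then show ?thesis by (simp add: \<gamma>01 one_in_overl)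
qed

lemma mom_transition:
  assumes "toric_two_form \<eta>" "z \<in> overl s s'"
  shows "mom (\<eta> (chart s)) \<theta> z - mom (\<eta> (chart s')) (wt s s' \<theta>) (trans_fun s s' z)
    = mom (\<eta> (chart s)) \<theta> 1 - mom (\<eta> (chart s')) (wt s s' \<theta>) 1"
proof (rule torus_dense[OF _ _ mom_transition_torus[OF assms(1)] assms(2)])
  have t: "toric_form (\<eta> (chart s))" for s using assms by (simp add: toric_two_form_def)
  show "continuous_on (overl s s') (\<lambda>z. mom (\<eta> (chart s)) \<theta> z - mom (\<eta> (chart s')) (wt s s' \<theta>) (trans_fun s s' z))"
    by (intro continuous_intros continuous_mom[OF t] continuous_on_compose2[OF continuous_mom[OF t]]
        smooth_on_imp_continuous_on[OF smooth_trans_fun]) auto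
qed auto

text \<open>The moment maps vanish at the different chart origins; they are compared at the point 1,
  which all charts share.\<close>

definition gm :: "(bundle_coords set, 4) form2 \<Rightarrow> (4 \<Rightarrow> 2) \<Rightarrow> 4 \<Rightarrow> real" where
  "gm \<eta> s k = mom (\<eta> (chart s)) (axis k 1) 1"

text \<open>The distance in momentum from the point 1 to either end of the fibre, added up: the
  length of the moment interval.\<close>

definition class_fib :: "(bundle_coords set, 4) form2 \<Rightarrow> real" where
  "class_fib \<eta> = gm \<eta> (\<lambda>_. 1) 4 + gm \<eta> (\<lambda>_. 2) 4"

text \<open>The moment length of the k-th sphere inside the section \<open>z $ 4 = 0\<close> of the
  charts with \<open>s 4 = 1\<close>. Flipping the k-th coordinate mixes the fibre rotation into the
  base rotation, whence the third summand.\<close>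

definition class_base :: "(bundle_coords set, 4) form2 \<Rightarrow> 4 \<Rightarrow> real" where
  "class_base \<eta> k = gm \<eta> (\<lambda>_. 1) k + gm \<eta> (\<lambda>_. 2) k + gm \<eta> (\<lambda>_. 1) 4"

lemma wt_axis_4: "wt s s' (axis 4 1) = (if s 4 = s' 4 then axis 4 1 else - axis 4 1)"
  by (auto simp: wt_def vec_eq_iff axis_def Let_def flips_def intro!: sum.neutral)

lemma wt_axis:
  assumes "k \<noteq> 4"
  shows "wt s s' (axis k 1) = (if s k = s' k then axis k 1 else - axis k 1 - sgn_fib s' *\<^sub>R axis 4 1)"
proof -
  have "(\<Sum>i\<in>flips s s'. axis k 1 $ i) = (if s k = s' k then 0 else 1 :: real)"
    using assms by (simp add: axis_def flips_def if_distrib cong: if_cong)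
  then have s: "(\<Sum>i\<in>flips s s'. if i = k then 1 else 0) = (if s k = s' k then 0 else 1 :: real)"
    by (simp add: axis_def)
  have sg: "sgn_fib s' = (if s 4 = s' 4 then sgn_fib s else - sgn_fib s)"
    using exhaust_2[of "s 4"] exhaust_2[of "s' 4"] by (auto simp: sgn_fib_def)
  show ?thesis
    using assms s by (auto simp: wt_def vec_eq_iff axis_def Let_def sg)
qed

text \<open>The constant relating the two moment maps is also their difference at the point with
  k-th coordinate 0 and all others 1. There the k-th rotation field vanishes in both charts.\<close>

lemma gm_agree:
  assumes "toric_two_form \<eta>" "s k = s' k"
  shows "gm \<eta> s k = gm \<eta> s' k"
proof -
  have t: "toric_form (\<eta> (chart s))" for s using assms by (simp add: toric_two_form_def)
  let ?p = "(\<chi> l. if l = k then 0 else 1) :: complex^4"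
  have o: "?p \<in> overl s s'" using assms(2) by (auto simp: overl_def)
  have w: "wt s s' (axis k 1) = axis k 1" using assms(2) by (cases "k = 4") (auto simp: wt_axis_4 wt_axis)
  have "trans_fun s s' ?p $ k = 0" using assms(2) by (cases "k = 4") (auto simp: trans_fun_def)
  then have "mom (\<eta> (chart s)) (axis k 1) ?p = 0" "mom (\<eta> (chart s')) (axis k 1) (trans_fun s s' ?p) = 0"
    using mom_axis_zero[OF t] by auto
  then show ?thesis using mom_transition[OF assms(1) o, of "axis k 1"] by (simp add: w gm_def)
qed

lemma gm_sum:
  assumes "toric_two_form \<eta>" "s k \<noteq> s' k"
  shows "gm \<eta> s k + gm \<eta> s' k = gm \<eta> (\<lambda>_. 1) k + gm \<eta> (\<lambda>_. 2) k"
proof -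
  have "s k = 1 \<and> s' k = 2 \<or> s k = 2 \<and> s' k = 1"
    using assms(2) exhaust_2[of "s k"] exhaust_2[of "s' k"] by metis
  then show ?thesis
    using gm_agree[OF assms(1), of s k "\<lambda>_. s k"] gm_agree[OF assms(1), of s' k "\<lambda>_. s' k"] by auto
qed

lemma gm_4:
  assumes "toric_two_form \<eta>"
  shows "sgn_fib s * gm \<eta> s 4 = gm \<eta> (\<lambda>_. 1) 4 - (if s 4 = 1 then 0 else class_fib \<eta>)"
  using exhaust_2[of "s 4"] gm_agree[OF assms, of s 4 "\<lambda>_. s 4"]
  by (auto simp: sgn_fib_def class_fib_def)

text \<open>All transition constants come from the four class numbers. The section at the other end
  of the fibre sees \<open>class_base\<close> diminished by \<open>class_fib\<close>, an effect of
  the twist.\<close>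

lemma mom_transition_const:
  assumes "toric_two_form \<eta>"
  shows "mom (\<eta> (chart s)) (axis k 1) 1 - mom (\<eta> (chart s')) (wt s s' (axis k 1)) 1 =
    (if s k = s' k then 0 else if k = 4 then class_fib \<eta>
     else class_base \<eta> k - (if s' 4 = 1 then 0 else class_fib \<eta>))"
proof -
  have t: "toric_form (\<eta> (chart s))" for s using assms by (simp add: toric_two_form_def)
  have m: "mom (\<eta> (chart s)) (- \<theta>) z = - mom (\<eta> (chart s)) \<theta> z"
    "mom (\<eta> (chart s)) (\<theta> - \<theta>') z = mom (\<eta> (chart s)) \<theta> z - mom (\<eta> (chart s)) \<theta>' z" for s \<theta> \<theta>' z
    using linear_neg[OF linear_mom[OF t]] linear_diff[OF linear_mom[OF t]] by auto
  show ?thesis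
    using gm_agree[OF assms, of s k s'] gm_sum[OF assms, of s k s'] gm_4[OF assms, of s']
    by (auto simp: wt_axis_4 wt_axis m mom_linear[OF t] gm_def[symmetric] class_fib_def class_base_def)
qed

text \<open>The radial primitives of the charts themselves form a global one-form: in the
  logarithmic frame they are moment maps, and the constants by which these could fail to match are
  given by the class numbers.\<close>

lemma exact_if_class_zero:
  assumes "toric_two_form \<eta>" "class_fib \<eta> = 0" "\<And>k. k \<noteq> 4 \<Longrightarrow> class_base \<eta> k = 0"
  shows "\<exists>\<beta>. one_form P_O_O111 \<beta> \<and> (\<forall>s z u v.
     \<eta> (chart s) z u v = FD (\<lambda>y. \<beta> (chart s) y v) z u - FD (\<lambda>y. \<beta> (chart s) y u) z v)"
proof (intro exI[of _ "\<lambda>c. poincare (\<eta> c)"] conjI allI)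
  have t: "toric_form (\<eta> (chart s))" for s using assms by (simp add: toric_two_form_def)
  show "\<eta> (chart s) z u v = FD (\<lambda>y. poincare (\<eta> (chart s)) y v) z u - FD (\<lambda>y. poincare (\<eta> (chart s)) y u) z v" for s z u v
    using poincare[OF toric_formD(1,2)[OF t]] by simp
  have mt: "mom (\<eta> (chart s)) \<theta> z = mom (\<eta> (chart s')) (wt s s' \<theta>) (trans_fun s s' z)" if "z \<in> torus" for s s' \<theta> z
  proof -
    \<comment> \<open>The matching constant is linear in \<theta>, so it vanishes once it does so on
      the axis vectors.\<close>
    let ?K = "\<lambda>\<theta>. mom (\<eta> (chart s)) \<theta> 1 - mom (\<eta> (chart s')) (wt s s' \<theta>) 1"
    have lin: "linear ?K"
      using linear_compose[OF linear_wt[of s s'] linear_mom[OF t[of s'], of 1]]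
      by (intro linear_compose_sub linear_mom t) (simp add: o_def)
    have "?K (axis k 1) = 0" for k
      using mom_transition_const[OF assms(1), of s k s'] assms(2,3) by auto
    then have "?K (\<Sum>k\<in>UNIV. \<theta> $ k *\<^sub>R axis k 1) = 0"
      by (simp only: linear_sum[OF lin] linear_scale[OF lin]) simp
    moreover have "(\<Sum>k\<in>UNIV. \<theta> $ k *\<^sub>R axis k 1) = \<theta>"
      by (simp add: vec_eq_iff axis_def if_distrib[of "\<lambda>x. _ * x"] cong: if_cong)
    ultimately show ?thesis using mom_transition_torus[OF assms(1) that, of s \<theta> s'] by simp
  qed
  show "one_form P_O_O111 (\<lambda>c. poincare (\<eta> c))"
    unfolding one_form_iff
  proof (intro conjI allI ballI)
    show "local_one_form (poincare (\<eta> (chart s)))" for s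
      using toric_formD(3)[OF t] by (simp add: local_one_form_eq)
    fix s s' z \<xi> assume z: "z \<in> torus"
    show "poincare (\<eta> (chart s)) z (z * \<xi>) =
       poincare (\<eta> (chart s')) (trans_fun s s' z) (trans_fun s s' z * mat_log s s' \<xi>)"
      unfolding poincare_log_frame[OF t] Im_mat_log by (rule mt[OF z])
  qed
qed

text \<open>The point with fibre coordinate 1 and base coordinates 0 lies on the fibre axis of two
  opposite charts; the moments measured from both ends are positive there and add up to the
  length.\<close>

lemma class_fib_pos:
  assumes "toric_two_form \<eta>" "\<And>s. pos_form (\<eta> (chart s))"
  shows "class_fib \<eta> > 0"
proof -
  have t: "toric_form (\<eta> (chart s))" for s using assms by (simp add: toric_two_form_def)
  define s s' :: "4 \<Rightarrow> 2" where "s = (\<lambda>_. 1)" and "s' = s(4 := 2)"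
  have ax: "axis 4 1 \<in> overl s s'" "trans_fun s s' (axis 4 1) = axis 4 1"
    by (auto simp: overl_def trans_fun_def s_def s'_def axis_def vec_eq_iff flips_def)
  have "class_fib \<eta> = mom (\<eta> (chart s)) (axis 4 1) (axis 4 1) - mom (\<eta> (chart s')) (wt s s' (axis 4 1)) (axis 4 1)"
    using mom_transition[OF assms(1) ax(1), of "axis 4 1"] mom_transition_const[OF assms(1), of s 4 s'] ax(2)
    by (simp add: s_def s'_def)
  moreover have "wt s s' (axis 4 1) = - axis 4 1" by (simp add: wt_axis_4 s_def s'_def)
  ultimately show ?thesis
    using mom_axis_pos[OF t[of s] assms(2)[of s], of 4] mom_axis_pos[OF t[of s'] assms(2)[of s'], of 4] linear_neg[OF linear_mom[OF t]]
    by (simp add: add_pos_pos)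
qed

text \<open>The argument for the fibre, applied to the k-th sphere in the section at the end of the
  fibre where the sphere has moment length \<open>class_base \<eta> k - class_fib \<eta>\<close>.
  The fibre rotation vanishes on that section.\<close>

lemma class_base_gt:
  assumes "toric_two_form \<eta>" "\<And>s. pos_form (\<eta> (chart s))" "k \<noteq> 4"
  shows "class_base \<eta> k > class_fib \<eta>"
proof -
  have t: "toric_form (\<eta> (chart s))" for s using assms by (simp add: toric_two_form_def)
  define s s' :: "4 \<Rightarrow> 2" where "s = (\<lambda>_. 1)(4 := 2)" and "s' = s(k := 2)"
  have ax: "axis k 1 \<in> overl s s'" "trans_fun s s' (axis k 1) = axis k 1"
    using assms(3) by (auto simp: overl_def trans_fun_def s_def s'_def axis_def vec_eq_iff flips_def)
  have "class_base \<eta> k - class_fib \<eta> = mom (\<eta> (chart s)) (axis k 1) (axis k 1) - mom (\<eta> (chart s')) (wt s s' (axis k 1)) (axis k 1)"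
    using mom_transition[OF assms(1) ax(1), of "axis k 1"] mom_transition_const[OF assms(1), of s k s'] ax(2) assms(3)
    by (simp add: s_def s'_def)
  moreover have "wt s s' (axis k 1) = - axis k 1 + axis 4 1" using assms(3) by (simp add: wt_axis s_def s'_def sgn_fib_def)
  moreover have "mom (\<eta> (chart s')) (axis 4 1) (axis k 1) = 0"
    using assms(3) by (intro mom_axis_zero t) (simp add: axis_def)
  ultimately show ?thesis
    using mom_axis_pos[OF t[of s] assms(2)[of s], of k] mom_axis_pos[OF t[of s'] assms(2)[of s'], of k] linear_diff[OF linear_mom[OF t]]
    by (simp add: add_pos_pos)
qed

lemma mom_unique:
  assumes "toric_form \<eta>" "\<And>z. (h has_derivative (\<lambda>u. \<eta> z u (vf (axis k 1) z))) (at z)" "h 0 = 0"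
  shows "h z = mom \<eta> (axis k 1) z"
proof -
  have "((\<lambda>z. h z - mom \<eta> (axis k 1) z) has_derivative (\<lambda>u. 0)) (at z within UNIV)" for z
    using has_derivative_diff[OF assms(2)[of z] has_derivative_mom[OF assms(1), of "axis k 1" z]] by simp
  then obtain c where "\<And>z. h z - mom \<eta> (axis k 1) z = c"
    using has_derivative_zero_constant[of UNIV "\<lambda>z. h z - mom \<eta> (axis k 1) z"] by auto
  moreover have "mom \<eta> (axis k 1) 0 = 0" using mom_axis_zero[OF assms(1)] by simp
  ultimately show ?thesis using assms(3) by (metis cancel_comm_monoid_add_class.diff_cancel eq_iff_diff_eq_0)
qed

lemma poincare_diff:
  assumes "smooth_form2 \<omega>" "smooth_form2 \<omega>'"
  shows "poincare (\<lambda>z u v. \<omega>' z u v - \<omega> z u v) z u = poincare \<omega>' z u - poincare \<omega> z u"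
  using integrable_smooth_pair[OF smooth_poincare_aux[OF assms(1)], of u z]
    integrable_smooth_pair[OF smooth_poincare_aux[OF assms(2)], of u z]
  by (simp add: poincare_def right_diff_distrib Henstock_Kurzweil_Integration.integral_diff)

text \<open>The difference of the two forms is again toric, and moment maps depend linearly on the
  form, so the class numbers of the difference vanish.\<close>

lemma cohomologous_if_class_eq:
  assumes "toric_two_form \<omega>" "toric_two_form \<omega>'" "class_fib \<omega> = class_fib \<omega>'"
    "\<And>k. k \<noteq> 4 \<Longrightarrow> class_base \<omega> k = class_base \<omega>' k"
  shows "cohomologous P_O_O111 \<omega> \<omega>'"
proof -
  let ?\<eta> = "\<lambda>c z u v. \<omega>' c z u v - \<omega> c z u v"
  have f: "smooth_form2 (\<omega> (chart s))" "smooth_form2 (\<omega>' (chart s))"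
    "local_closed (\<omega> (chart s))" "local_closed (\<omega>' (chart s))" for s
    using assms(1,2) by (auto simp: toric_two_form_def toric_form_def)
  have FD: "FD (\<lambda>y. ?\<eta> (chart s) y v w) z u = FD (\<lambda>y. \<omega>' (chart s) y v w) z u - FD (\<lambda>y. \<omega> (chart s) y v w) z u" for s u v w z
    by (rule FD_eq) (intro has_derivative_diff smooth_FD_apply smooth_form2D(3) f)
  have "smooth_form2 (?\<eta> (chart s))" for s
    using f(1,2)[of s] unfolding smooth_form2_def bilinear_def
    by (auto intro!: smooth_intros linear_compose_sub)
  moreover have "local_closed (?\<eta> (chart s))" for s
    using f(3,4)[of s] unfolding local_closed_def FD by (smt (verit, best))
  ultimately have "toric_two_form ?\<eta>"
    using assms(1,2) unfolding toric_two_form_def two_form_iff toric_form_def local_two_form_eq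
      J_invariant_def T_invariant_def by simp
  moreover have gm: "gm ?\<eta> s k = gm \<omega>' s k - gm \<omega> s k" for s k
    by (simp add: gm_def mom_def poincare_diff[OF f(1,2)])
  ultimately show ?thesis
    unfolding cohomologous_iff using assms(3,4)
    by (intro exact_if_class_zero) (auto simp: class_fib_def class_base_def gm, force)
qed

section \<open>The momentum profile\<close>

lemma smooth_on_poly [smooth_intros]:
  fixes f :: "_ \<Rightarrow> real"
  assumes "smooth_on f S" "open S"
  shows "smooth_on (\<lambda>x. poly p (f x)) S"
  unfolding poly_altdef by (intro smooth_intros assms) auto

lemma pderiv_sum: "pderiv (\<Sum>i\<in>A. f i) = (\<Sum>i\<in>A. pderiv (f i :: real poly))"
  by (induction A rule: infinite_finite_induct) (simp_all add: pderiv_add)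

lemma antiderivative_poly: "\<exists>P::real poly. pderiv P = p \<and> poly P 0 = 0"
proof -
  let ?P = "\<Sum>i\<le>degree p. monom (coeff p i / real (Suc i)) (Suc i)"
  have "pderiv ?P = (\<Sum>i\<le>degree p. monom (coeff p i) i)"
    by (simp add: pderiv_sum pderiv_monom del: of_nat_Suc)
  also have "\<dots> = p" by (rule poly_as_sum_of_monoms)
  finally show ?thesis by (intro exI[of _ ?P]) (simp add: poly_sum poly_monom)
qed

lemma integral_poly:
  fixes P :: "real poly"
  assumes "0 \<le> L"
  shows "integral {0..L} (poly (pderiv P)) = poly P L - poly P 0"
proof -
  have "(poly (pderiv P) has_integral (poly P L - poly P 0)) {0..L}"
    by (rule fundamental_theorem_of_calculus[OF assms])
      (metis poly_DERIV has_real_derivative_iff_has_vector_derivative has_vector_derivative_at_within)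
  then show ?thesis by (rule integral_unique)
qed

lemma integrable_poly: "poly (p :: real poly) integrable_on {a..b}"
  by (intro integrable_continuous_interval continuous_intros)

lemma integral_pos_on:
  fixes f :: "real \<Rightarrow> real"
  assumes "a < b" "continuous_on {a..b} f" "\<And>t. t \<in> {a..b} \<Longrightarrow> f t \<ge> 0" "c \<in> {a..b}" "f c > 0"
  shows "integral {a..b} f > 0"
proof -
  have "integral {a..b} f \<ge> 0"
    by (intro integral_nonneg integrable_continuous_interval assms)
  moreover have "integral {a..b} f \<noteq> 0"
  proof
    assume "integral {a..b} f = 0"
    then have "f c = 0" using integral_eq_0_iff[OF assms(2)] assms by auto
    with assms show False by simp
  qed
  ultimately show ?thesis by simp
qed

text \<open>Integrating the equation for \<open>F''\<close> leaves a linear system for \<open>\<alpha>\<close> and \<open>\<beta>\<close>, whose matrix consists of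
  the moments of the positive weight \<open>q\<close> on \<open>[0, L]\<close>.\<close>

lemma extremal_poly_exists:
  fixes q N :: "real poly" and L :: real
  assumes L: "L > 0" and q: "\<And>x. x \<in> {0..L} \<Longrightarrow> poly q x > 0"
  shows "\<exists>F \<alpha> \<beta>. poly F 0 = 0 \<and> poly F L = 0 \<and> poly (pderiv F) 0 = poly q 0 \<and>
     poly (pderiv F) L = - poly q L \<and> pderiv (pderiv F) = N - [:\<beta>, \<alpha>:] * q"
proof -
  define I where "I p = integral {0..L} (poly p)" for p :: "real poly"
  have I_add: "I (p + p') = I p + I p'" for p p'
    unfolding I_def poly_add by (rule Henstock_Kurzweil_Integration.integral_add[OF integrable_poly integrable_poly])
  have I_smult: "I (smult c p) = c * I p" for c p
  proof -
    have "poly (smult c p) = (\<lambda>x. c * poly p x)" by auto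
    then show ?thesis by (simp add: I_def)
  qed
  have I_diff: "I (p - p') = I p - I p'" for p p'
    unfolding I_def poly_diff by (rule Henstock_Kurzweil_Integration.integral_diff[OF integrable_poly integrable_poly])
  have I_pderiv: "I (pderiv p) = poly p L - poly p 0" for p
    unfolding I_def using L by (simp add: integral_poly)
  define m0 m1 m2 where "m0 = I q" and "m1 = I ([:0, 1:] * q)" and "m2 = I ([:0, 1:] * ([:0, 1:] * q))"
  have m0: "m0 > 0" unfolding m0_def I_def
    using L q by (intro integral_pos_on[where c=0]) (auto intro!: continuous_intros less_imp_le)
  \<comment> \<open>The variance of x under the weight q; multiplied by \<open>m0\<close> it is the
    determinant of the system.\<close>
  have "I ([:- m1 / m0, 1:] * ([:- m1 / m0, 1:] * q)) > 0"
    unfolding I_def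
  proof (rule integral_pos_on[OF L])
    show "continuous_on {0..L} (poly ([:- m1 / m0, 1:] * ([:- m1 / m0, 1:] * q)))" by (intro continuous_intros)
    have ev: "poly ([:- m1 / m0, 1:] * ([:- m1 / m0, 1:] * q)) t = (t - m1 / m0)\<^sup>2 * poly q t" for t
      by (simp add: power2_eq_square algebra_simps)
    show "0 \<le> poly ([:- m1 / m0, 1:] * ([:- m1 / m0, 1:] * q)) t" if "t \<in> {0..L}" for t
      unfolding ev using q[OF that] by simp
    \<comment> \<open>An endpoint different from the mean, where the square is strictly
      positive.\<close>
    show "(if m1 / m0 = 0 then L else 0) \<in> {0..L}" using L by simp
    show "0 < poly ([:- m1 / m0, 1:] * ([:- m1 / m0, 1:] * q)) (if m1 / m0 = 0 then L else 0)"
      unfolding ev using L q[of 0] q[of L] m0 by auto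
  qed
  moreover have "[:- m1 / m0, 1:] * ([:- m1 / m0, 1:] * q) =
     [:0, 1:] * ([:0, 1:] * q) + smult (- 2 * (m1 / m0)) ([:0, 1:] * q) + smult ((m1 / m0)\<^sup>2) q"
    by (rule poly_ext) (simp add: algebra_simps power2_eq_square)
  ultimately have "I ([:0, 1:] * ([:0, 1:] * q) + smult (- 2 * (m1 / m0)) ([:0, 1:] * q) + smult ((m1 / m0)\<^sup>2) q) > 0"
    by (simp only:)
  then have "m2 - 2 * (m1 / m0) * m1 + (m1 / m0)\<^sup>2 * m0 > 0"
    unfolding I_add I_smult m0_def[symmetric] m1_def[symmetric] m2_def[symmetric] by simp
  then have det: "m0 * m2 - m1 * m1 > 0"
    using m0 by (simp add: field_simps power2_eq_square)
  \<comment> \<open>The boundary conditions prescribe the integrals of F'' and of x F'': they are -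
    q(L) - q(0) and - L q(L). Hence these are the values that the integrals of (\<alpha> x +
    \<beta>) q and x (\<alpha> x + \<beta>) q must take.\<close>
  define d0 d1 where "d0 = I N + poly q 0 + poly q L" and "d1 = I ([:0, 1:] * N) + L * poly q L"
  define \<alpha> \<beta> where "\<alpha> = (d1 * m0 - d0 * m1) / (m0 * m2 - m1 * m1)" and "\<beta> = (d0 * m2 - d1 * m1) / (m0 * m2 - m1 * m1)"
  have e0: "\<alpha> * m1 + \<beta> * m0 = d0" and e1: "\<alpha> * m2 + \<beta> * m1 = d1"
  proof -
    define D where "D = m0 * m2 - m1 * m1"
    have D: "D \<noteq> 0" using det by (simp add: D_def)
    have "\<alpha> * D = d1 * m0 - d0 * m1" "\<beta> * D = d0 * m2 - d1 * m1"
      using D by (simp_all add: \<alpha>_def \<beta>_def D_def[symmetric])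
    then have "(\<alpha> * m1 + \<beta> * m0) * D = (d1 * m0 - d0 * m1) * m1 + (d0 * m2 - d1 * m1) * m0"
      "(\<alpha> * m2 + \<beta> * m1) * D = (d1 * m0 - d0 * m1) * m2 + (d0 * m2 - d1 * m1) * m1"
      by (metis (no_types) distrib_right mult.assoc mult.commute)+
    then have "(\<alpha> * m1 + \<beta> * m0) * D = d0 * D" "(\<alpha> * m2 + \<beta> * m1) * D = d1 * D"
      by (simp_all add: D_def algebra_simps)
    then show "\<alpha> * m1 + \<beta> * m0 = d0" "\<alpha> * m2 + \<beta> * m1 = d1" using D by simp_all
  qed
  define F2 where "F2 = N - [:\<beta>, \<alpha>:] * q"
  have lq: "[:\<beta>, \<alpha>:] * q = smult \<beta> q + smult \<alpha> ([:0, 1:] * q)"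
    by (rule poly_ext) (simp add: algebra_simps)
  obtain P where P: "pderiv P = F2" "poly P 0 = 0" using antiderivative_poly by blast
  obtain F where F: "pderiv F = [:poly q 0:] + P" "poly F 0 = 0" using antiderivative_poly by blast
  have pF: "pderiv (pderiv F) = F2" by (simp add: F P pderiv_add pderiv_pCons)
  have I2: "I F2 = - poly q L - poly q 0"
    unfolding F2_def I_diff lq I_add I_smult using e0 by (simp add: m0_def m1_def d0_def algebra_simps)
  have I2x: "I ([:0, 1:] * F2) = - L * poly q L"
  proof -
    have "[:0, 1:] * F2 = [:0, 1:] * N - (smult \<beta> ([:0, 1:] * q) + smult \<alpha> ([:0, 1:] * ([:0, 1:] * q)))"
      unfolding F2_def by (rule poly_ext) (simp add: algebra_simps)
    then have "I ([:0, 1:] * F2) = I ([:0, 1:] * N) - (\<beta> * m1 + \<alpha> * m2)"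
      by (simp only: I_diff I_add I_smult m1_def m2_def)
    then show ?thesis using e1 by (simp add: d1_def)
  qed
  have F'L: "poly (pderiv F) L = - poly q L"
    using I_pderiv[of P] I2 P F by simp
  \<comment> \<open>Integration by parts: x F' - F is an antiderivative of x F'', so the second
    moment condition forces F(L) = 0.\<close>
  have "pderiv ([:0, 1:] * pderiv F - F) = [:0, 1:] * F2"
    by (simp add: pderiv_diff pderiv_mult pF pderiv_pCons)
  then have "L * poly (pderiv F) L - poly F L = - L * poly q L"
    using I_pderiv[of "[:0, 1:] * pderiv F - F"] I2x F(2) by simp
  then have "poly F L = 0" using F'L by simp
  then show ?thesis using F P F'L pF F2_def by (intro exI[of _ F] exI[of _ \<alpha>] exI[of _ \<beta>]) simp
qed

text \<open>Each 2 / (c_k - x) is convex left of its pole, and so is the sum minus an affine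
  function; a convex function that is negative at two points is negative between them.\<close>

lemma sum_inverse_convex:
  fixes c :: "'i \<Rightarrow> real"
  assumes "finite A" "\<And>k. k \<in> A \<Longrightarrow> c k > x2" "x0 < x1" "x1 < x2"
    and "(\<Sum>k\<in>A. 2 / (c k - x0)) - (\<alpha> * x0 + \<beta>) < 0" "(\<Sum>k\<in>A. 2 / (c k - x2)) - (\<alpha> * x2 + \<beta>) < 0"
  shows "(\<Sum>k\<in>A. 2 / (c k - x1)) - (\<alpha> * x1 + \<beta>) < 0"
proof -
  define t where "t = (x1 - x0) / (x2 - x0)"
  have t: "0 < t" "t < 1" using assms by (auto simp: t_def)
  have x1: "x1 = (1 - t) * x0 + t * x2" 
  proof -
    have "t * (x2 - x0) = x1 - x0" using assms by (simp add: t_def)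
    then show ?thesis by (simp add: algebra_simps)
  qed
  have "2 / (c k - x1) \<le> (1 - t) * (2 / (c k - x0)) + t * (2 / (c k - x2))" if "k \<in> A" for k
  proof -
    have p: "c k - x0 > 0" "c k - x2 > 0" using assms(2)[OF that] assms by auto
    have "inverse ((1 - t) *\<^sub>R (c k - x0) + t *\<^sub>R (c k - x2)) \<le> (1 - t) * inverse (c k - x0) + t * inverse (c k - x2)"
      using convex_onD[OF convex_on_inverse[of "{0<..}"], of t "c k - x0" "c k - x2"] t p by auto
    moreover have "(1 - t) *\<^sub>R (c k - x0) + t *\<^sub>R (c k - x2) = c k - x1" unfolding x1 by (simp add: algebra_simps)
    ultimately show ?thesis by (simp add: divide_inverse)
  qed
  then have "(\<Sum>k\<in>A. 2 / (c k - x1)) \<le> (\<Sum>k\<in>A. (1 - t) * (2 / (c k - x0)) + t * (2 / (c k - x2)))"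
    by (rule sum_mono)
  also have "\<dots> = (1 - t) * (\<Sum>k\<in>A. 2 / (c k - x0)) + t * (\<Sum>k\<in>A. 2 / (c k - x2))"
    by (simp add: sum.distrib sum_distrib_left)
  finally have "(\<Sum>k\<in>A. 2 / (c k - x1)) - (\<alpha> * x1 + \<beta>)
     \<le> (1 - t) * ((\<Sum>k\<in>A. 2 / (c k - x0)) - (\<alpha> * x0 + \<beta>)) + t * ((\<Sum>k\<in>A. 2 / (c k - x2)) - (\<alpha> * x2 + \<beta>))"
    unfolding x1 by (simp add: algebra_simps)
  also have "\<dots> < 0" using t assms(5,6) by (intro add_neg_neg mult_pos_neg) auto
  finally show ?thesis .
qed

text \<open>If \<open>F\<close> were not positive, \<open>F''\<close> would be negative, positive and negative at three
  successive points, against the convexity of \<open>F''\<close> divided by the product.\<close>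

lemma extremal_poly_pos:
  fixes F :: "real poly" and c :: "'i \<Rightarrow> real"
  assumes L: "L > 0" and F: "poly F 0 = 0" "poly F L = 0" "poly (pderiv F) 0 > 0" "poly (pderiv F) L < 0"
    and c: "finite A" "\<And>k. k \<in> A \<Longrightarrow> c k > L"
    and F2: "\<And>x. x \<in> {0<..<L} \<Longrightarrow> poly (pderiv (pderiv F)) x
        = ((\<Sum>k\<in>A. 2 / (c k - x)) - (\<alpha> * x + \<beta>)) * (\<Prod>k\<in>A. c k - x)"
    and x: "x \<in> {0<..<L}"
  shows "poly F x > 0"
proof (rule ccontr)
  assume "\<not> poly F x > 0"
  then have Fx: "poly F x \<le> 0" by simp
  note D = poly_DERIV
  have "\<exists>d>0. \<forall>h>0. h < d \<longrightarrow> poly F 0 < poly F (0 + h)"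
    by (rule DERIV_pos_inc_right[OF D F(3)])
  then obtain d1 where d1: "d1 > 0" "\<And>h. h > 0 \<Longrightarrow> h < d1 \<Longrightarrow> poly F h > 0" using F(1) by auto
  have "\<exists>d>0. \<forall>h>0. h < d \<longrightarrow> poly F L < poly F (L - h)"
    by (rule DERIV_neg_dec_left[OF D F(4)])
  then obtain d2 where d2: "d2 > 0" "\<And>h. h > 0 \<Longrightarrow> h < d2 \<Longrightarrow> poly F (L - h) > 0" using F(2) by auto
  define s1 where "s1 = min d1 x / 2"
  define h2 where "h2 = min d2 (L - x) / 2"
  have s1: "0 < s1" "s1 < x" "poly F s1 > 0" using d1 x by (auto simp: s1_def min_def)
  have h2: "0 < h2" "h2 < L - x" "poly F (L - h2) > 0" using d2 x by (auto simp: h2_def min_def)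
  obtain p where p: "s1 < p" "p < x" "poly F x - poly F s1 = (x - s1) * poly (pderiv F) p"
    using MVT2[OF s1(2), of "poly F" "poly (pderiv F)"] D by blast
  then have Fp: "poly (pderiv F) p < 0" using s1 Fx by (smt (verit) mult_nonneg_nonneg)
  have "x < L - h2" using h2 by simp
  then obtain p' where p': "x < p'" "p' < L - h2" "poly F (L - h2) - poly F x = ((L - h2) - x) * poly (pderiv F) p'"
    using MVT2[of x "L - h2" "poly F" "poly (pderiv F)"] D by blast
  then have Fp': "poly (pderiv F) p' > 0" using h2 Fx
    by (smt (verit) mult_nonneg_nonpos)
  have mvt: "\<exists>y. a < y \<and> y < b \<and> poly (pderiv F) b - poly (pderiv F) a = (b - a) * poly (pderiv (pderiv F)) y" if "a < b" for a b
    using MVT2[OF that, of "poly (pderiv F)" "poly (pderiv (pderiv F))"] D by blast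
  \<comment> \<open>F' is positive at 0, negative at p, positive at p' and negative at L. The mean
    value theorem on the three intervals between these points yields y0 < y1 < y2.\<close>
  have "0 < p" using s1 p by simp
  from mvt[OF this] obtain y0 where y0: "0 < y0" "y0 < p"
    "poly (pderiv F) p - poly (pderiv F) 0 = (p - 0) * poly (pderiv (pderiv F)) y0" by blast
  have n0: "poly (pderiv (pderiv F)) y0 < 0" using y0 Fp F(3) \<open>0 < p\<close> by (smt (verit) mult_nonneg_nonneg)
  have "p < p'" using p p' by simp
  from mvt[OF this] obtain y1 where y1: "p < y1" "y1 < p'"
    "poly (pderiv F) p' - poly (pderiv F) p = (p' - p) * poly (pderiv (pderiv F)) y1" by blast
  have n1: "poly (pderiv (pderiv F)) y1 > 0" using y1 Fp Fp' \<open>p < p'\<close> by (smt (verit) mult_nonneg_nonpos)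
  have "p' < L" using p' h2 by simp
  from mvt[OF this] obtain y2 where y2: "p' < y2" "y2 < L"
    "poly (pderiv F) L - poly (pderiv F) p' = (L - p') * poly (pderiv (pderiv F)) y2" by blast
  have n2: "poly (pderiv (pderiv F)) y2 < 0" using y2 Fp' F(4) \<open>p' < L\<close> by (smt (verit) mult_nonneg_nonneg)
  have in_I: "y0 \<in> {0<..<L}" "y1 \<in> {0<..<L}" "y2 \<in> {0<..<L}" using y0 y1 y2 \<open>p < p'\<close> \<open>p' < L\<close> \<open>0 < p\<close> by auto
  have qpos: "(\<Prod>k\<in>A. c k - y) > 0" if "y \<in> {0<..<L}" for y
    using c(2) that by (intro prod_pos) fastforce
  have "(\<Sum>k\<in>A. 2 / (c k - y1)) - (\<alpha> * y1 + \<beta>) < 0"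
  proof (rule sum_inverse_convex[OF c(1)])
    show "y0 < y1" "y1 < y2" using y0 y1 y2 by auto
    show "y2 < c k" if "k \<in> A" for k using c(2)[OF that] y2 by simp
    show "(\<Sum>k\<in>A. 2 / (c k - y0)) - (\<alpha> * y0 + \<beta>) < 0"
      using n0 F2[OF in_I(1)] qpos[OF in_I(1)] by (simp add: mult_less_0_iff)
    show "(\<Sum>k\<in>A. 2 / (c k - y2)) - (\<alpha> * y2 + \<beta>) < 0"
      using n2 F2[OF in_I(3)] qpos[OF in_I(3)] by (simp add: mult_less_0_iff)
  qed
  then have "poly (pderiv (pderiv F)) y1 < 0"
    using F2[OF in_I(2)] qpos[OF in_I(2)] by (simp add: mult_less_0_iff)
  with n1 show False by simp
qed

section \<open>The momentum as a function of the squared fibre norm\<close>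

text \<open>The equation r \<tau>'(r) q(\<tau>) = F(\<tau>) is solved through the inverse function
  R, for which (ln R)' = q / F. Writing F = x G and q = G + x K gives q / F = 1/x + K/G, so R(s) = c
  s exp(E(s)) with E' = K/G, which makes sense slightly to the left of 0 too. Thus \<tau> is smooth
  on a neighbourhood of [0, \<infinity>), as smoothness of the metric along the zero section
  requires.\<close>

lemma profile_exists:
  fixes F q :: "real poly"
  assumes L: "L > 0" and F0: "poly F 0 = 0" and FL: "poly F L = 0" and F': "poly (pderiv F) 0 = poly q 0"
    and q: "\<And>x. x \<in> {0..L} \<Longrightarrow> poly q x > 0" and F: "\<And>x. x \<in> {0<..<L} \<Longrightarrow> poly F x > 0"
  shows "\<exists>r0 \<tau> \<tau>' \<sigma> R. r0 < 0 \<and> smooth_on \<tau> {r0<..} \<and> smooth_on \<tau>' {r0<..} \<and> smooth_on \<sigma> {r0<..} \<and>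
     (\<forall>r>r0. (\<tau> has_real_derivative \<tau>' r) (at r) \<and> \<tau>' r > 0 \<and> \<tau> r = r * \<sigma> r \<and>
        poly q (\<tau> r) > 0 \<and> r * \<tau>' r * poly q (\<tau> r) = poly F (\<tau> r)) \<and>
     (\<forall>r\<ge>0. 0 \<le> \<tau> r \<and> \<tau> r < L) \<and>
     (\<forall>r>0. \<tau> r \<in> {0<..<L} \<and> R (\<tau> r) = r) \<and> (\<forall>s\<in>{0<..<L}. R s > 0 \<and> \<tau> (R s) = s \<and>
        ((\<lambda>s. ln (R s)) has_real_derivative poly q s / poly F s) (at s)) \<and> R (L / 2) = 1"
proof -
  have "[:0, 1:] dvd F" using F0 poly_eq_0_iff_dvd[of F 0] by simp
  then obtain G where G: "F = [:0, 1:] * G" by (auto simp: dvd_def)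
  have "poly (q - G) 0 = 0" using F' by (simp add: G pderiv_mult pderiv_pCons)
  then have "[:0, 1:] dvd q - G" using poly_eq_0_iff_dvd[of "q - G" 0] by simp
  then obtain K where K: "q - G = [:0, 1:] * K" by (auto simp: dvd_def)
  have G0: "poly G 0 > 0" using F' q[of 0] L by (simp add: G pderiv_mult pderiv_pCons)
  have Gpos: "poly G x > 0" if "0 \<le> x" "x < L" for x
  proof (cases "x = 0")
    case False
    then have "x > 0" using that by simp
    then show ?thesis using F[of x] that by (simp add: G zero_less_mult_iff)
  qed (use G0 in simp)
  \<comment> \<open>G(0) = F'(0) = q(0) > 0, so positivity persists a little to the left of
    0.\<close>
  have "\<exists>e>0. \<forall>x. - e \<le> x \<and> x < L \<longrightarrow> poly G x > 0 \<and> poly q x > 0"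
  proof -
    have "\<forall>\<^sub>F x in nhds 0. poly G x > 0" "\<forall>\<^sub>F x in nhds 0. poly q x > 0"
      using G0 q[of 0] L poly_isCont[of 0 G] poly_isCont[of 0 q]
      by (auto intro!: order_tendstoD(1)[of "poly _" "poly _ 0"] simp: isCont_def tendsto_at_iff_tendsto_nhds)
    then have "\<forall>\<^sub>F x in nhds 0. poly G x > 0 \<and> poly q x > 0" by eventually_elim simp
    then obtain d where d: "d > 0" "\<And>x. dist x 0 < d \<Longrightarrow> poly G x > 0 \<and> poly q x > 0"
      by (auto simp: eventually_nhds_metric)
    show ?thesis
    proof (intro exI[of _ "d / 2"] conjI allI impI)
      fix x assume x: "- (d / 2) \<le> x \<and> x < L"
      show "poly G x > 0" "poly q x > 0"
        using d(2)[of x] Gpos[of x] q[of x] x d(1) by (cases "x < 0"; auto simp: dist_real_def)+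
    qed (use d in auto)
  qed
  then obtain e where e: "e > 0" "\<And>x. - e \<le> x \<Longrightarrow> x < L \<Longrightarrow> poly G x > 0 \<and> poly q x > 0" by blast
  define E where "E s = integral {- e..s} (\<lambda>x. poly K x / poly G x)" for s
  have dE: "(E has_real_derivative poly K s / poly G s) (at s)" if "s \<in> {-e<..<L}" for s
  proof -
    have "s < L" using that by simp
    from dense[OF this] obtain b where b: "s < b" "b < L" by blast
    have "((\<lambda>u. integral {- e..u} (\<lambda>x. poly K x / poly G x)) has_real_derivative poly K s / poly G s) (at s within {- e..b})"
      by (rule integral_has_real_derivative) (use e b that in \<open>force intro!: continuous_intros\<close>)+
    then show ?thesis unfolding E_def using that b by (subst (asm) at_within_Icc_at) auto
  qed
  have smE: "smooth_on E {-e<..<L}"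
  proof (rule smooth_on_has_derivativeI)
    show "(E has_derivative (\<lambda>u. u * (poly K s / poly G s))) (at s)" if "s \<in> {-e<..<L}" for s
      using dE[OF that] unfolding has_field_derivative_def
      by (rule has_derivative_eq_rhs) (auto simp: fun_eq_iff)
    show "smooth_on (\<lambda>s. v * (poly K s / poly G s)) {-e<..<L}" for v
    proof (intro smooth_intros)
      show "poly G x \<noteq> 0" if "x \<in> {-e<..<L}" for x using e(2)[of x] that by auto
    qed auto
  qed auto
  \<comment> \<open>The constant of integration is fixed by R(L / 2) = 1, a condition symmetric
    under x -> L - x and r -> 1/r; this makes the profiles of the two ends fit together.\<close>
  define c where "c = 1 / ((L / 2) * exp (E (L / 2)))"
  have c: "c > 0" using L by (simp add: c_def)
  define R where "R s = c * s * exp (E s)" for s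
  have R2: "R (L / 2) = 1" using L by (simp add: R_def c_def)
  have KG: "poly G s + s * poly K s = poly q s" for s
    using arg_cong[OF K, of "\<lambda>p. poly p s"] by simp
  have dR: "(R has_real_derivative c * exp (E s) * poly q s / poly G s) (at s)" if "s \<in> {-e<..<L}" for s
  proof -
    have "poly G s \<noteq> 0" using e(2)[of s] that by auto
    then have "c * s * (exp (E s) * (poly K s / poly G s)) + c * exp (E s) = c * exp (E s) * poly q s / poly G s"
      unfolding KG[symmetric] by (simp add: field_simps)
    moreover have "(R has_real_derivative c * s * (exp (E s) * (poly K s / poly G s)) + c * exp (E s)) (at s)"
      unfolding R_def using dE[OF that] by (auto intro!: derivative_eq_intros)
    ultimately show ?thesis by simp
  qed
  have R'pos: "c * exp (E s) * poly q s / poly G s > 0" if "s \<in> {-e<..<L}" for s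
    using c e(2)[of s] that by auto
  have contR: "isCont R s" if "s \<in> {-e<..<L}" for s using dR[OF that] by (rule DERIV_isCont)
  have Rmono: "R a < R b" if "a \<in> {-e<..<L}" "b \<in> {-e<..<L}" "a < b" for a b
  proof (rule DERIV_pos_imp_increasing[OF that(3)])
    fix x assume "a \<le> x" "x \<le> b"
    then have "x \<in> {-e<..<L}" using that by auto
    then show "\<exists>y. (R has_real_derivative y) (at x) \<and> 0 < y" using dR R'pos by blast
  qed
  have Rinj: "a = b" if "a \<in> {-e<..<L}" "b \<in> {-e<..<L}" "R a = R b" for a b
    using Rmono[of a b] Rmono[of b a] that by (cases a b rule: linorder_cases) auto
  have R0: "R 0 = 0" by (simp add: R_def)
  have Rpos: "R s > 0" if "s \<in> {0<..<L}" for s using c that by (simp add: R_def)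
  have dlnR: "((\<lambda>s. ln (R s)) has_real_derivative poly q s / poly F s) (at s)" if "s \<in> {0<..<L}" for s
  proof -
    have "s \<in> {-e<..<L}" using that e by auto
    from dR[OF this] have "((\<lambda>s. ln (R s)) has_real_derivative (1 / R s) * (c * exp (E s) * poly q s / poly G s)) (at s)"
      using Rpos[OF that] by (auto intro!: derivative_eq_intros)
    moreover have "(1 / R s) * (c * exp (E s) * poly q s / poly G s) = poly q s / poly F s"
      using c that by (simp add: R_def G field_simps)
    ultimately show ?thesis by simp
  qed
  \<comment> \<open>F has a zero at L, so F(s) is at most M (L - s), while q is at least m > 0.
    Therefore ln R(s) + (m / M) ln (L - s) is nondecreasing, and R tends to infinity at L.\<close>
  have unbdd: "\<exists>s\<in>{0<..<L}. R s \<ge> r" for r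
  proof -
    obtain m where m: "m > 0" "\<And>x. x \<in> {0..L} \<Longrightarrow> poly q x \<ge> m"
    proof -
      have "\<exists>x\<in>{0..L}. \<forall>y\<in>{0..L}. poly q x \<le> poly q y"
        using L by (intro continuous_attains_inf continuous_intros) auto
      then show ?thesis using that q by blast
    qed
    have "[:- L, 1:] dvd F" using FL poly_eq_0_iff_dvd[of F L] by simp
    then obtain H where H: "F = [:- L, 1:] * H" by (auto simp: dvd_def)
    obtain M0 where M0: "\<And>x. x \<in> {0..L} \<Longrightarrow> - poly H x \<le> M0"
    proof -
      have "\<exists>x\<in>{0..L}. \<forall>y\<in>{0..L}. - poly H y \<le> - poly H x"
        using L by (intro continuous_attains_sup continuous_intros) auto
      then show ?thesis using that by blast
    qed
    define M where "M = max M0 1"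
    have M: "M > 0" "\<And>x. x \<in> {0..L} \<Longrightarrow> - poly H x \<le> M" using M0 by (auto simp: M_def intro: max.coboundedI1)
    have Fle: "poly F x \<le> M * (L - x)" if "x \<in> {0<..<L}" for x
    proof -
      have "poly F x = (- poly H x) * (L - x)" by (simp add: H algebra_simps)
      also have "\<dots> \<le> M * (L - x)" using M(2)[of x] that by (intro mult_right_mono) auto
      finally show ?thesis .
    qed
    define Dd where "Dd s = ln (R s) + (m / M) * ln (L - s)" for s
    have "Dd (L / 2) \<le> Dd s" if "L / 2 \<le> s" "s < L" for s
    proof (rule DERIV_nonneg_imp_nondecreasing[OF that(1)])
      fix x assume x: "L / 2 \<le> x" "x \<le> s"
      then have xI: "x \<in> {0<..<L}" using L that by auto
      have "(Dd has_real_derivative poly q x / poly F x - (m / M) / (L - x)) (at x)"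
      proof -
        have "((\<lambda>s. (m / M) * ln (L - s)) has_real_derivative - ((m / M) / (L - x))) (at x)"
          using xI M(1) by (auto intro!: derivative_eq_intros)
        from DERIV_add[OF dlnR[OF xI] this] show ?thesis unfolding Dd_def by simp
      qed
      moreover have "(m / M) / (L - x) \<le> poly q x / poly F x"
      proof -
        have "(m / M) / (L - x) = m / (M * (L - x))" by simp
        also have "\<dots> \<le> poly q x / poly F x"
          using m(1) m(2)[of x] Fle[OF xI] F[OF xI] xI by (intro frac_le) auto
        finally show ?thesis .
      qed
      ultimately show "\<exists>y. (Dd has_real_derivative y) (at x) \<and> 0 \<le> y" by (intro exI conjI) auto
    qed
    then have low: "ln (R s) \<ge> (m / M) * (ln (L / 2) - ln (L - s))" if "L / 2 \<le> s" "s < L" for s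
      using that R2 by (simp add: Dd_def algebra_simps)
    define r1 where "r1 = max r 1"
    \<comment> \<open>Chosen so that the lower bound for ln R at L - h equals ln r1.\<close>
    define h where "h = (L / 2) * exp (- (M / m) * ln r1)"
    have r1: "r1 \<ge> 1" "r1 \<ge> r" by (auto simp: r1_def)
    have h: "0 < h" "h \<le> L / 2" using L m M r1 by (auto simp: h_def mult_le_cancel_left2 intro!: mult_left_le)
    have "ln (L / 2) - ln h = (M / m) * ln r1" 
    proof -
      have "ln h = ln (L / 2) + ln (exp (- (M / m) * ln r1))"
        unfolding h_def using L by (intro ln_mult_pos) auto
      then show ?thesis by simp
    qed
    then have "ln (R (L - h)) \<ge> ln r1" using low[of "L - h"] h m M by simp
    moreover have I: "L - h \<in> {0<..<L}" using h L by auto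
    ultimately have "R (L - h) \<ge> r" using Rpos[OF I] r1 by (simp add: ln_le_cancel_iff)
    then show ?thesis using I by blast
  qed
  \<comment> \<open>Half of the extension to the left is kept back, so that R is differentiable at
    the left end of J as well.\<close>
  define r0 where "r0 = R (- e / 2)"
  have "R (- e / 2) < R 0" using e L by (intro Rmono) auto
  then have r0: "r0 < 0" by (simp add: r0_def R0)
  define J where "J = {- e / 2<..<L}"
  have JI: "s \<in> {-e<..<L}" if "s \<in> J" for s using that e by (auto simp: J_def)
  have ex: "\<exists>s\<in>J. R s = r" if "r > r0" for r
  proof -
    obtain b where b: "b \<in> {0<..<L}" "R b \<ge> r + 1" using unbdd by blast
    have "\<exists>x\<ge>- e / 2. x \<le> b \<and> R x = r"
    proof (rule IVT)
      show "R (- e / 2) \<le> r" "r \<le> R b" using that b by (auto simp: r0_def)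
      show "\<forall>x. - e / 2 \<le> x \<and> x \<le> b \<longrightarrow> isCont R x" using b e by (auto intro!: contR)
    qed (use b e in auto)
    then obtain x where x: "- e / 2 \<le> x" "x \<le> b" "R x = r" by blast
    then have "x \<noteq> - e / 2" using that by (auto simp: r0_def)
    then show ?thesis using x b by (intro bexI[of _ x]) (auto simp: J_def)
  qed
  define \<tau> where "\<tau> r = (SOME s. s \<in> J \<and> R s = r)" for r
  have \<tau>: "\<tau> r \<in> J" "R (\<tau> r) = r" if "r > r0" for r
    using someI_ex[of "\<lambda>s. s \<in> J \<and> R s = r"] ex[OF that] by (auto simp: \<tau>_def)
  have RJ: "R s > r0" if "s \<in> J" for s
    unfolding r0_def using that e by (intro Rmono) (auto simp: J_def)
  have \<tau>R: "\<tau> (R s) = s" if "s \<in> J" for s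
    using \<tau>[OF RJ[OF that]] that Rinj JI by blast
  define T where "T s = poly G s / (c * exp (E s) * poly q s)" for s
  have d\<tau>: "(\<tau> has_real_derivative T (\<tau> r)) (at r)" if "r > r0" for r
  proof -
    let ?s = "\<tau> r"
    have s: "?s \<in> {- e / 2<..<L}" using \<tau>[OF that] by (simp add: J_def)
    obtain a b where ab: "- e / 2 < a" "a < ?s" "?s < b" "b < L"
      using dense[of "- e / 2" ?s] dense[of ?s L] s by auto
    have "isCont \<tau> (R ?s)"
    proof (rule isCont_inverse_function2[where f=R and x="?s" and a=a and b=b])
      show "\<And>z. a \<le> z \<Longrightarrow> z \<le> b \<Longrightarrow> \<tau> (R z) = z" using ab by (auto intro!: \<tau>R simp: J_def)
      show "\<And>z. a \<le> z \<Longrightarrow> z \<le> b \<Longrightarrow> isCont R z" using ab e by (auto intro!: contR)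
    qed (use ab in auto)
    then have ct: "isCont \<tau> r" by (simp add: \<tau>[OF that])
    have "(\<tau> has_real_derivative inverse (c * exp (E ?s) * poly q ?s / poly G ?s)) (at r)"
    proof (rule DERIV_inverse_function[where f=R and a=r0 and b="r + 1"])
      show "(R has_real_derivative c * exp (E ?s) * poly q ?s / poly G ?s) (at ?s)"
        using dR JI \<tau>(1)[OF that] by blast
      show "c * exp (E ?s) * poly q ?s / poly G ?s \<noteq> 0" using R'pos[OF JI[OF \<tau>(1)[OF that]]] by (rule less_imp_neq[symmetric])
    qed (use that \<tau> ct in auto)
    then show ?thesis by (simp add: T_def)
  qed
  have smE': "smooth_on E J" using smE by (rule smooth_on_subset) (use JI in blast)
  have smT: "smooth_on T J"
    unfolding T_def
  proof (intro smooth_intros smE')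
    show "c * exp (E s) * poly q s \<noteq> 0" if "s \<in> J" for s
      using c e(2)[of s] JI[OF that] by auto
  qed (auto simp: J_def)
  have o: "open {r0<..}" by simp
  \<comment> \<open>The derivative of \<tau> is T composed with \<tau>, with T smooth; each order of
    differentiability of \<tau> therefore yields the next.\<close>
  have "Ck_on k \<tau> {r0<..}" for k
  proof (induction k)
    case 0
    show ?case using d\<tau> by (auto intro!: continuous_at_imp_continuous_on DERIV_isCont)
  next
    case (Suc k)
    have "Ck_on k (\<lambda>r. T (\<tau> r)) {r0<..}"
      by (rule Ck_on_compose[OF smooth_on_Ck[OF smT] Suc o]) (use \<tau> in auto)
    then have "Ck_on k (\<lambda>r. v * T (\<tau> r)) {r0<..}" for v
      by (rule Ck_on_bounded_linear[OF bounded_linear_mult_right _ o])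
    moreover have "(\<tau> has_derivative (\<lambda>u. u * T (\<tau> r))) (at r)" if "r \<in> {r0<..}" for r
      using d\<tau>[of r] that unfolding has_field_derivative_def
      by (auto elim!: has_derivative_eq_rhs simp: fun_eq_iff)
    ultimately show ?case using o by (rule_tac Ck_on_SucI[where f'="\<lambda>r u. u * T (\<tau> r)"])
  qed
  then have sm\<tau>: "smooth_on \<tau> {r0<..}" by (simp add: smooth_on_def)
  have sm\<tau>': "smooth_on (\<lambda>r. T (\<tau> r)) {r0<..}"
    by (rule smooth_on_compose[OF smT sm\<tau> o]) (use \<tau> in auto)
  define \<sigma> where "\<sigma> r = 1 / (c * exp (E (\<tau> r)))" for r
  have sm\<sigma>: "smooth_on \<sigma> {r0<..}"
    unfolding \<sigma>_def using c
    by (intro smooth_intros smooth_on_compose[OF smE' sm\<tau> o]) (use \<tau> in auto)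
  have Tpos: "T s > 0" if "s \<in> J" for s
    unfolding T_def using e(2)[of s] c JI[OF that] by auto
  have main: "(\<tau> has_real_derivative T (\<tau> r)) (at r) \<and> T (\<tau> r) > 0 \<and> \<tau> r = r * \<sigma> r \<and>
        poly q (\<tau> r) > 0 \<and> r * T (\<tau> r) * poly q (\<tau> r) = poly F (\<tau> r)" if "r > r0" for r
  proof (intro conjI d\<tau>[OF that] Tpos \<tau>(1)[OF that])
    have r: "r = c * \<tau> r * exp (E (\<tau> r))" using \<tau>(2)[OF that] by (simp add: R_def)
    show "\<tau> r = r * \<sigma> r" unfolding \<sigma>_def using c r by (simp add: field_simps)
    show qp: "poly q (\<tau> r) > 0" using e(2)[of "\<tau> r"] JI[OF \<tau>(1)[OF that]] by auto
    have "r * T (\<tau> r) * poly q (\<tau> r) = (c * \<tau> r * exp (E (\<tau> r))) * T (\<tau> r) * poly q (\<tau> r)" using r by simp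
    also have "\<dots> = poly F (\<tau> r)" unfolding T_def G using c qp by (simp add: field_simps)
    finally show "r * T (\<tau> r) * poly q (\<tau> r) = poly F (\<tau> r)" .
  qed
  have J0: "s \<in> J" if "0 \<le> s" "s < L" for s using that e by (auto simp: J_def)
  have pos: "\<tau> r \<in> {0<..<L}" if "r > 0" for r
  proof -
    have t: "\<tau> r \<in> J" "R (\<tau> r) = r" using \<tau>[of r] that r0 by auto
    have "\<tau> r > 0"
    proof (rule ccontr)
      assume "\<not> \<tau> r > 0"
      then have "R (\<tau> r) \<le> R 0" using Rmono[of "\<tau> r" 0] JI[OF t(1)] JI[OF J0[of 0]] L by (cases "\<tau> r = 0") auto
      then show False using t R0 that by simp
    qed
    then show ?thesis using t by (simp add: J_def)
  qed
  have nonneg: "0 \<le> \<tau> r \<and> \<tau> r < L" if "r \<ge> 0" for r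
    using pos[of r] \<tau>R[OF J0[of 0]] R0 L that by (cases "r = 0") auto
  have "\<forall>r>0. \<tau> r \<in> {0<..<L} \<and> R (\<tau> r) = r" using pos \<tau>(2) r0 by (intro allI impI conjI) auto
  moreover have "\<forall>s\<in>{0<..<L}. R s > 0 \<and> \<tau> (R s) = s \<and>
        ((\<lambda>s. ln (R s)) has_real_derivative poly q s / poly F s) (at s)"
  proof (intro ballI conjI)
    fix s assume s: "s \<in> {0<..<L}"
    show "R s > 0" using Rpos[OF s] .
    show "\<tau> (R s) = s" using s by (intro \<tau>R J0) auto
    show "((\<lambda>s. ln (R s)) has_real_derivative poly q s / poly F s) (at s)" using dlnR[OF s] .
  qed
  moreover have "\<forall>r>r0. (\<tau> has_real_derivative T (\<tau> r)) (at r) \<and> T (\<tau> r) > 0 \<and> \<tau> r = r * \<sigma> r \<and>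
        poly q (\<tau> r) > 0 \<and> r * T (\<tau> r) * poly q (\<tau> r) = poly F (\<tau> r)"
    by (intro allI impI main)
  moreover have "\<forall>r\<ge>0. 0 \<le> \<tau> r \<and> \<tau> r < L" by (intro allI impI nonneg)
  moreover note r0 sm\<tau> sm\<tau>' sm\<sigma> R2
  ultimately show ?thesis
    by (intro exI[of _ r0] exI[of _ \<tau>] exI[of _ "\<lambda>r. T (\<tau> r)"] exI[of _ \<sigma>] exI[of _ R] conjI)
qed

text \<open>On the opposite end the fibre norm is 1/r and the momentum is L - \<tau>. Both ln R(s)
  and - ln R2(L - s) have derivative q / F, and the common normalisation at L / 2 makes them
  equal.\<close>

lemma profile_flip:
  fixes F q F2 q2 :: "real poly"
  assumes L: "L > 0"
    and R: "\<And>s. s \<in> {0<..<L} \<Longrightarrow> R s > 0 \<and> ((\<lambda>s. ln (R s)) has_real_derivative poly q s / poly F s) (at s)" "R (L / 2) = 1"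
    and R2: "\<And>s. s \<in> {0<..<L} \<Longrightarrow> R2 s > 0 \<and> \<tau>2 (R2 s) = s \<and> ((\<lambda>s. ln (R2 s)) has_real_derivative poly q2 s / poly F2 s) (at s)"
      "R2 (L / 2) = 1"
    and e: "\<And>s. poly F2 s = poly F (L - s)" "\<And>s. poly q2 s = poly q (L - s)"
    and \<tau>: "\<tau> r \<in> {0<..<L}" "R (\<tau> r) = r"
  shows "\<tau>2 (inverse r) = L - \<tau> r"
proof -
  let ?h = "\<lambda>s. ln (R s) + ln (R2 (L - s))"
  have d: "(?h has_real_derivative 0) (at s)" if "s \<in> {0<..<L}" for s
  proof -
    have s2: "L - s \<in> {0<..<L}" using that by auto
    have "((\<lambda>s. ln (R2 (L - s))) has_real_derivative poly q2 (L - s) / poly F2 (L - s) * (- 1)) (at s)"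
      by (rule DERIV_chain2[where f="\<lambda>s. ln (R2 s)" and g="\<lambda>s. L - s"])
        (use R2(1)[OF s2] in \<open>auto intro!: derivative_eq_intros\<close>)
    from DERIV_add[OF conjunct2[OF R(1)[OF that]] this] show ?thesis by (simp add: e)
  qed
  have "?h s = ?h (L / 2)" if "s \<in> {0<..<L}" for s
    by (rule DERIV_isconst3[of 0 L s "L / 2" ?h, OF L that _ d]) (use L in auto)
  then have "ln (R (\<tau> r)) + ln (R2 (L - \<tau> r)) = 0" using \<tau>(1) R(2) R2(2) by simp
  then have "ln (R2 (L - \<tau> r)) = ln (inverse r)"
    using \<tau> R(1)[OF \<tau>(1)] by (simp add: ln_inverse)
  moreover have p: "L - \<tau> r \<in> {0<..<L}" using \<tau>(1) by auto
  ultimately have "R2 (L - \<tau> r) = inverse r" using R(1)[OF \<tau>(1)] R2(1)[OF p] \<tau>(2) by (simp add: ln_inj_iff)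
  then show ?thesis using R2(1)[OF p] by metis
qed

section \<open>Forms with a potential\<close>

text \<open>The real (1,1)-form of the potential, \<open>\<i>\<close> times its complex Hessian,
  expressed by real second derivatives; it is the exterior derivative of u -> -
  d\<Phi>(\<open>\<i> *s u\<close>) / 2.\<close>

definition pot_form :: "(complex^4 \<Rightarrow> real) \<Rightarrow> complex^4 \<Rightarrow> complex^4 \<Rightarrow> complex^4 \<Rightarrow> real" where
  "pot_form \<Phi> z u v = (FD (\<lambda>y. FD \<Phi> y (\<i> *s u)) z v - FD (\<lambda>y. FD \<Phi> y (\<i> *s v)) z u) / 2"

lemma linear_FD: "smooth_on f UNIV \<Longrightarrow> linear (\<lambda>u. FD f z u)"
  using has_derivative_linear[OF smooth_FD_apply] .

lemma linear_ii: "linear (\<lambda>u. \<i> *s (u :: complex^'n))"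
  by (rule linearI) (auto simp: vec_eq_iff algebra_simps scaleR_conv_of_real[where 'a=complex])

text \<open>Closedness is the symmetry of third derivatives, J-invariance that of second derivatives
  together with \<open>\<i>\<close> squaring to -1.\<close>

lemma pot_form_props:
  assumes "smooth_on \<Phi> UNIV"
  shows "smooth_form2 (pot_form \<Phi>)" "local_closed (pot_form \<Phi>)" "J_invariant (pot_form \<Phi>)"
proof -
  let ?D = "\<lambda>w y. FD \<Phi> y w"
  have sm: "smooth_on (?D w) UNIV" for w by (rule smooth_on_FD[OF assms])
  have sym: "FD (?D w) z u = FD (?D u) z w" for w u z by (rule second_derivative_symmetric[OF assms])
  have lin1: "linear (\<lambda>u. FD (?D w) z u)" for w z by (rule linear_FD[OF sm])
  have lin2: "linear (\<lambda>w. FD (?D (\<i> *s w)) z u)" for u z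
    unfolding sym[of "\<i> *s _"] using linear_compose[OF linear_ii lin1] by (simp add: o_def)
  have lin3: "linear (\<lambda>x. (f x - g x) / 2)" if "linear f" "linear g" for f g :: "complex^4 \<Rightarrow> real"
    using linear_compose_scale_right[OF linear_compose_sub[OF that], of "1/2"] by simp
  show "smooth_form2 (pot_form \<Phi>)"
    unfolding smooth_form2_def bilinear_def
  proof (intro conjI allI)
    show "linear (\<lambda>y. pot_form \<Phi> z x y)" "linear (\<lambda>x. pot_form \<Phi> z x y)" for x y z
      unfolding pot_form_def by (intro lin3 lin1 lin2)+
    show "smooth_on (\<lambda>z. pot_form \<Phi> z u v) UNIV" for u v
      unfolding pot_form_def by (intro smooth_intros smooth_on_FD[OF sm]) auto
  qed (simp add: pot_form_def)
  have FD3: "FD (\<lambda>z. pot_form \<Phi> z v w) z u = (FD (\<lambda>y. FD (?D (\<i> *s v)) y w) z u - FD (\<lambda>y. FD (?D (\<i> *s w)) y v) z u) / 2" for u v w z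
    unfolding pot_form_def
    by (rule FD_eq) (intro bounded_linear.has_derivative[OF bounded_linear_divide] has_derivative_diff
        smooth_FD_apply[OF smooth_on_FD[OF sm]])
  have sym3: "FD (\<lambda>y. FD (?D a) y w) z u = FD (\<lambda>y. FD (?D a) y u) z w" for a u w z
    by (rule second_derivative_symmetric[OF sm])
  show "local_closed (pot_form \<Phi>)"
    unfolding local_closed_def FD3
  proof (intro allI)
    fix z u v w
    show "(FD (\<lambda>y. FD (?D (\<i> *s v)) y w) z u - FD (\<lambda>y. FD (?D (\<i> *s w)) y v) z u) / 2
      + (FD (\<lambda>y. FD (?D (\<i> *s w)) y u) z v - FD (\<lambda>y. FD (?D (\<i> *s u)) y w) z v) / 2
      + (FD (\<lambda>y. FD (?D (\<i> *s u)) y v) z w - FD (\<lambda>y. FD (?D (\<i> *s v)) y u) z w) / 2 = 0"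
      using sym3[of "\<i> *s v" w z u] sym3[of "\<i> *s w" v z u] sym3[of "\<i> *s u" w z v]
        by (simp add: diff_divide_distrib)
  qed
  show "J_invariant (pot_form \<Phi>)"
    unfolding J_invariant_def pot_form_def
  proof (intro allI)
    fix z u v
    have ii: "\<i> *s (\<i> *s u) = - u" for u :: "complex^4" by (simp add: vec_eq_iff)
    have neg: "FD (?D (- w)) z u = - FD (?D w) z u" for w u
      unfolding sym[of "- w"] sym[of w] using linear_neg[OF lin1] .
    show "(FD (?D (\<i> *s (\<i> *s u))) z (\<i> *s v) - FD (?D (\<i> *s (\<i> *s v))) z (\<i> *s u)) / 2
      = (FD (?D (\<i> *s u)) z v - FD (?D (\<i> *s v)) z u) / 2"
      unfolding ii neg using sym[of u z "\<i> *s v"] sym[of v z "\<i> *s u"] by simp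
  qed
qed

subsection \<open>Wirtinger calculus\<close>

text \<open>The functions p and q list the derivatives by the coordinates and by their conjugates.
  As a relation it carries differentiability along, so that calculus rules compose;
  \<open>wirt_d_z\<close> returns to the operators.\<close>

definition wirt :: "(complex^4 \<Rightarrow> complex) \<Rightarrow> (4 \<Rightarrow> complex) \<Rightarrow> (4 \<Rightarrow> complex) \<Rightarrow> complex^4 \<Rightarrow> bool" where
  "wirt f p q z \<longleftrightarrow> (f has_derivative (\<lambda>u. \<Sum>j\<in>UNIV. p j * u $ j + q j * cnj (u $ j))) (at z)"

lemma wirt_d_z:
  assumes "wirt f p q z" shows "d_z j f z = p j" "d_zbar j f z = q j"
proof -
  have FD: "FD f z u = (\<Sum>j\<in>UNIV. p j * u $ j + q j * cnj (u $ j))" for u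
    using assms unfolding wirt_def by (rule FD_eq)
  have "FD f z (axis j a) = p j * a + q j * cnj a" for a
  proof -
    have "(\<Sum>i\<in>UNIV. p i * axis j a $ i + q i * cnj (axis j a $ i)) = (\<Sum>i\<in>UNIV. if i = j then p j * a + q j * cnj a else 0)"
      by (intro sum.cong) (auto simp: axis_def)
    then show ?thesis by (simp add: FD)
  qed
  then show "d_z j f z = p j" "d_zbar j f z = q j"
    by (auto simp: d_z_def d_zbar_def algebra_simps)
qed

lemma wirt_eqI: "wirt f p q z \<Longrightarrow> (\<And>j. p j = p' j) \<Longrightarrow> (\<And>j. q j = q' j) \<Longrightarrow> wirt f p' q' z"
  by (simp add: wirt_def)

lemma wirt_const: "wirt (\<lambda>z. c) (\<lambda>j. 0) (\<lambda>j. 0) z"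
  by (simp add: wirt_def)

lemma wirt_nth: "wirt (\<lambda>z. z $ k) (\<lambda>j. if j = k then 1 else 0) (\<lambda>j. 0) z"
proof -
  have "(\<Sum>j\<in>UNIV. (if j = k then 1 else 0) * u $ j + 0 * cnj (u $ j)) = u $ k" for u :: "complex^4"
    by (simp add: if_distrib[of "\<lambda>x. x * _"] cong: if_cong)
  then show ?thesis unfolding wirt_def
    by (auto intro!: bounded_linear_imp_has_derivative bounded_linear_vec_nth)
qed

lemma wirt_cnj: "wirt f p q z \<Longrightarrow> wirt (\<lambda>z. cnj (f z)) (\<lambda>j. cnj (q j)) (\<lambda>j. cnj (p j)) z"
  unfolding wirt_def
  by (drule bounded_linear.has_derivative[OF bounded_linear_cnj]) (simp add: add.commute)

lemma wirt_add:
  "wirt f p q z \<Longrightarrow> wirt g p' q' z \<Longrightarrow> wirt (\<lambda>z. f z + g z) (\<lambda>j. p j + p' j) (\<lambda>j. q j + q' j) z"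
  unfolding wirt_def
  by (drule (1) has_derivative_add, erule has_derivative_eq_rhs)
    (simp add: fun_eq_iff algebra_simps sum.distrib)

lemma wirt_sum:
  "(\<And>i. i \<in> A \<Longrightarrow> wirt (f i) (p i) (q i) z) \<Longrightarrow> wirt (\<lambda>z. \<Sum>i\<in>A. f i z) (\<lambda>j. \<Sum>i\<in>A. p i j) (\<lambda>j. \<Sum>i\<in>A. q i j) z"
  by (induction A rule: infinite_finite_induct) (auto intro: wirt_const wirt_add)

lemma wirt_mult:
  "wirt f p q z \<Longrightarrow> wirt g p' q' z \<Longrightarrow> wirt (\<lambda>z. f z * g z) (\<lambda>j. f z * p' j + p j * g z) (\<lambda>j. f z * q' j + q j * g z) z"
  unfolding wirt_def
  by (drule (1) has_derivative_mult, erule has_derivative_eq_rhs)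
    (simp add: fun_eq_iff algebra_simps sum.distrib sum_distrib_left sum_distrib_right)

lemma wirt_cmult: "wirt f p q z \<Longrightarrow> wirt (\<lambda>z. c * f z) (\<lambda>j. c * p j) (\<lambda>j. c * q j) z"
  by (rule wirt_eqI[OF wirt_mult[OF wirt_const]]) auto

text \<open>A real function has real derivative on u and on \<open>\<i> *s u\<close>; the second
  fact says that the holomorphic and the antiholomorphic part have equal real parts, so either of
  them determines the derivative.\<close>

lemma wirt_real_deriv:
  assumes "wirt (\<lambda>z. of_real (f z)) p q z"
  shows "(f has_derivative (\<lambda>u. Re (\<Sum>j\<in>UNIV. p j * u $ j + q j * cnj (u $ j)))) (at z)"
    and "of_real (Re (\<Sum>j\<in>UNIV. p j * u $ j + q j * cnj (u $ j))) = (\<Sum>j\<in>UNIV. p j * u $ j + q j * cnj (u $ j))"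
    and "(f has_derivative (\<lambda>u. 2 * Re (\<Sum>j\<in>UNIV. p j * u $ j))) (at z)"
    and "(f has_derivative (\<lambda>u. 2 * Re (\<Sum>j\<in>UNIV. q j * cnj (u $ j)))) (at z)"
proof -
  let ?D = "\<lambda>u. \<Sum>j\<in>UNIV. p j * u $ j + q j * cnj (u $ j)"
  show 1: "(f has_derivative (\<lambda>u. Re (?D u))) (at z)"
    using bounded_linear.has_derivative[OF bounded_linear_Re assms[unfolded wirt_def]] by simp
  have 2: "of_real (Re (?D u)) = ?D u" for u
  proof -
    have "((\<lambda>z. complex_of_real (f z)) has_derivative (\<lambda>u. of_real (Re (?D u)))) (at z)"
      using bounded_linear.has_derivative[OF bounded_linear_of_real 1] .
    from has_derivative_unique[OF this assms[unfolded wirt_def]] show ?thesis by (rule fun_cong)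
  qed
  then show "of_real (Re (?D u)) = ?D u" .
  have im: "Im (?D u) = 0" for u by (subst 2[symmetric]) (rule Im_complex_of_real)
  let ?P = "\<lambda>u. \<Sum>j\<in>UNIV. p j * u $ j" and ?Q = "\<lambda>u. \<Sum>j\<in>UNIV. q j * cnj (u $ j)"
  have PQ: "?D u = ?P u + ?Q u" for u by (simp add: sum.distrib)
  have "?D (\<i> *s u) = \<i> * (?P u - ?Q u)" for u
    by (simp add: sum.distrib sum_distrib_left sum_subtractf algebra_simps sum_negf)
  then have "Re (?P u) = Re (?Q u)" for u using im[of "\<i> *s u"] by simp
  then have "Re (?D u) = 2 * Re (?P u)" "Re (?D u) = 2 * Re (?Q u)" for u unfolding PQ by simp_all
  with 1 show "(f has_derivative (\<lambda>u. 2 * Re (?P u))) (at z)" "(f has_derivative (\<lambda>u. 2 * Re (?Q u))) (at z)"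
    by simp_all
qed

lemma wirt_of_real:
  assumes "wirt (\<lambda>z. of_real (f z)) p q z" "(g has_real_derivative g') (at (f z))"
  shows "wirt (\<lambda>z. of_real (g (f z))) (\<lambda>j. of_real g' * p j) (\<lambda>j. of_real g' * q j) z"
proof -
  let ?D = "\<lambda>u. \<Sum>j\<in>UNIV. p j * u $ j + q j * cnj (u $ j)"
  have "((\<lambda>z. g (f z)) has_derivative (\<lambda>u. g' * Re (?D u))) (at z)"
    using has_derivative_compose[OF wirt_real_deriv(1)[OF assms(1)] assms(2)[unfolded has_field_derivative_def]] .
  then have "((\<lambda>z. complex_of_real (g (f z))) has_derivative (\<lambda>u. of_real (g' * Re (?D u)))) (at z)"
    by (rule bounded_linear.has_derivative[OF bounded_linear_of_real])
  moreover have "of_real (g' * Re (?D u)) = (\<Sum>j\<in>UNIV. (of_real g' * p j) * u $ j + (of_real g' * q j) * cnj (u $ j))" for u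
    unfolding of_real_mult wirt_real_deriv(2)[OF assms(1)] by (simp add: sum_distrib_left algebra_simps)
  ultimately show ?thesis by (simp add: wirt_def)
qed

text \<open>\<open>dk k\<close> is the derivative of \<open>\<Phi>\<close> with respect to the conjugate of the \<open>k\<close>-th coordinate. The part of
  the Hessian of type \<open>(0,2)\<close> is symmetric and so does not contribute.\<close>

lemma pot_form_explicit:
  assumes sm: "smooth_on \<Phi> UNIV"
    and dk: "\<And>y w. FD \<Phi> y w = 2 * Re (\<Sum>k\<in>UNIV. dk k y * cnj (w $ k))"
    and w: "\<And>k. wirt (dk k) (\<lambda>j. h j k) (q k) z" and herm: "\<And>j k. cnj (h j k) = h k j"
  shows "pot_form \<Phi> z u v = - 2 * Im (\<Sum>k\<in>UNIV. \<Sum>j\<in>UNIV. h j k * u $ j * cnj (v $ k))"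
proof -
  define G where "G u w = (\<Sum>k\<in>UNIV. \<Sum>j\<in>UNIV. h j k * u $ j * cnj (w $ k))" for u w :: "complex^4"
  define T where "T u w = (\<Sum>k\<in>UNIV. \<Sum>j\<in>UNIV. q k j * cnj (u $ j) * cnj (w $ k))" for u w :: "complex^4"
  have H: "FD (\<lambda>y. FD \<Phi> y w) z u = 2 * Re (G u w + T u w)" for u w
  proof -
    have "((\<lambda>y. \<Sum>k\<in>UNIV. dk k y * cnj (w $ k)) has_derivative
       (\<lambda>u. \<Sum>k\<in>UNIV. (\<Sum>j\<in>UNIV. h j k * u $ j + q k j * cnj (u $ j)) * cnj (w $ k))) (at z)"
      by (intro has_derivative_sum has_derivative_mult_left w[unfolded wirt_def])
    from has_derivative_mult_right[OF bounded_linear.has_derivative[OF bounded_linear_Re this], of 2]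
    have "FD (\<lambda>y. 2 * Re (\<Sum>k\<in>UNIV. dk k y * cnj (w $ k))) z u
       = 2 * Re (\<Sum>k\<in>UNIV. (\<Sum>j\<in>UNIV. h j k * u $ j + q k j * cnj (u $ j)) * cnj (w $ k))"
      by (rule FD_eq)
    moreover have "(\<Sum>k\<in>UNIV. (\<Sum>j\<in>UNIV. h j k * u $ j + q k j * cnj (u $ j)) * cnj (w $ k)) = G u w + T u w"
      by (simp add: G_def T_def sum.distrib sum_distrib_right distrib_right)
    ultimately show ?thesis unfolding dk by simp
  qed
  have G_sym: "G w u = cnj (G u w)" for u w
    unfolding G_def by (subst sum.swap) (simp add: herm mult_ac)
  have Gi: "G (\<i> *s u) w = \<i> * G u w" "G u (\<i> *s w) = - \<i> * G u w"
    "T (\<i> *s u) w = - \<i> * T u w" "T u (\<i> *s w) = - \<i> * T u w" for u w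
    by (simp_all add: G_def T_def sum_distrib_left algebra_simps sum_negf)
  have ReT: "Re (T u w) = Re (T w u)" for u w
    using second_derivative_symmetric[OF sm, of w z u] G_sym[of u w] unfolding H by simp
  have "Im (T u w) = Im (T w u)" for u w
    using ReT[of "\<i> *s u" w] unfolding Gi by simp
  with ReT have T_sym: "T u w = T w u" for u w by (intro complex_eqI)
  have "pot_form \<Phi> z u v = Re (- \<i> * G v u - \<i> * T v u) - Re (- \<i> * G u v - \<i> * T u v)"
    unfolding pot_form_def H Gi by (simp; linarith)
  also have "\<dots> = - 2 * Im (G u v)"
    using T_sym[of u v] G_sym[of u v] by (simp; linarith)
  finally show ?thesis by (simp add: G_def)
qed

section \<open>The momentum construction in a chart\<close>

abbreviation base :: "4 set" where "base \<equiv> {1, 2, 3}"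

lemma base_iff: "k \<in> base \<longleftrightarrow> k \<noteq> 4" using exhaust_4[of k] by auto

definition nn :: "complex^4 \<Rightarrow> 4 \<Rightarrow> real" where "nn z k = 1 + (cmod (z $ k))\<^sup>2"

lemma nn_pos: "nn z k > 0" by (simp add: nn_def add_pos_nonneg)

lemma nn_complex: "complex_of_real (nn z k) = 1 + z $ k * cnj (z $ k)"
  by (simp add: nn_def complex_norm_square[symmetric])

lemma smooth_cmod2 [smooth_intros]:
  assumes "smooth_on f S" "open S" shows "smooth_on (\<lambda>z. (cmod (f z))\<^sup>2) S"
  unfolding cmod_power2 using assms by (intro smooth_intros)

lemma smooth_nn [smooth_intros]: "smooth_on (\<lambda>z. nn z k) UNIV"
  unfolding nn_def by (intro smooth_intros) auto

definition pp :: "real \<Rightarrow> complex^4 \<Rightarrow> real" where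
  "pp \<sigma> z = exp (- \<sigma> * (\<Sum>k\<in>base. ln (nn z k)))"

text \<open>The squared norm of a fibre point in the product Fubini-Study metric of
  \<open>O(1,1,1)\<close> for \<sigma> = 1, and of the dual bundle for \<sigma> = -1.\<close>

definition rr :: "real \<Rightarrow> complex^4 \<Rightarrow> real" where
  "rr \<sigma> z = (cmod (z $ 4))\<^sup>2 * pp \<sigma> z"

text \<open>The coefficients of \<open>z $ 4\<close> times the holomorphic differential of ln r, the
  vertical one-form of the Chern connection. The factor \<open>z $ 4\<close> removes the pole along
  the zero section.\<close>

definition aa :: "real \<Rightarrow> complex^4 \<Rightarrow> 4 \<Rightarrow> complex" where
  "aa \<sigma> z j = (if j = 4 then 1 else - of_real \<sigma> * z $ 4 * cnj (z $ j) / of_real (nn z j))"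

text \<open>The common shape of the metric and of its Ricci form: a multiple A of the vertical
  rank-one form plus a diagonal part with weights h on the base.\<close>

definition herm :: "real \<Rightarrow> complex^4 \<Rightarrow> real \<Rightarrow> (4 \<Rightarrow> real) \<Rightarrow> 4 \<Rightarrow> 4 \<Rightarrow> complex" where
  "herm \<sigma> z A h j k = of_real A * aa \<sigma> z j * cnj (aa \<sigma> z k) + (if j = k \<and> k \<noteq> 4 then of_real (h k) else 0)"

lemma pp_pos: "pp \<sigma> z > 0" by (simp add: pp_def)

lemma rr_nonneg: "rr \<sigma> z \<ge> 0" using pp_pos[of \<sigma> z] by (simp add: rr_def)

lemma smooth_rr: "smooth_on (rr \<sigma>) UNIV"
  unfolding rr_def[abs_def] pp_def by (intro smooth_intros nn_pos) auto

lemma wirt_nn: "wirt (\<lambda>z. of_real (nn z k)) (\<lambda>j. if j = k then cnj (z $ k) else 0) (\<lambda>j. if j = k then z $ k else 0) z"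
  unfolding nn_complex
  by (rule wirt_eqI[OF wirt_add[OF wirt_const wirt_mult[OF wirt_nth wirt_cnj[OF wirt_nth]]]]) auto

lemma wirt_ln_nn: "wirt (\<lambda>z. of_real (ln (nn z k)))
   (\<lambda>j. if j = k then cnj (z $ k) / of_real (nn z k) else 0) (\<lambda>j. if j = k then z $ k / of_real (nn z k) else 0) z"
  by (rule wirt_eqI[OF wirt_of_real[OF wirt_nn DERIV_ln[OF nn_pos]]]) (auto simp: divide_inverse)

lemma wirt_pp: "wirt (\<lambda>z. of_real (pp \<sigma> z))
   (\<lambda>j. if j = 4 then 0 else - of_real (\<sigma> * pp \<sigma> z) * cnj (z $ j) / of_real (nn z j))
   (\<lambda>j. if j = 4 then 0 else - of_real (\<sigma> * pp \<sigma> z) * z $ j / of_real (nn z j)) z"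
proof -
  have s: "wirt (\<lambda>z. of_real (\<Sum>k\<in>base. ln (nn z k)))
    (\<lambda>j. \<Sum>k\<in>base. if j = k then cnj (z $ k) / of_real (nn z k) else 0)
    (\<lambda>j. \<Sum>k\<in>base. if j = k then z $ k / of_real (nn z k) else 0) z"
    unfolding of_real_sum by (rule wirt_sum) (rule wirt_ln_nn)
  have "((\<lambda>x. exp (- \<sigma> * x)) has_real_derivative - \<sigma> * exp (- \<sigma> * x)) (at x)" for x
    by (auto intro!: derivative_eq_intros)
  from wirt_of_real[OF s this] show ?thesis
    unfolding pp_def by (rule wirt_eqI) (auto simp: sum.delta, (metis exhaust_4)+)
qed

lemma wirt_rr: "wirt (\<lambda>z. of_real (rr \<sigma> z))
   (\<lambda>j. cnj (z $ 4) * of_real (pp \<sigma> z) * aa \<sigma> z j) (\<lambda>j. z $ 4 * of_real (pp \<sigma> z) * cnj (aa \<sigma> z j)) z"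
proof -
  have "complex_of_real (rr \<sigma> z) = z $ 4 * cnj (z $ 4) * of_real (pp \<sigma> z)" for z
    by (simp add: rr_def complex_norm_square[symmetric])
  then show ?thesis
    by (simp only:, intro wirt_eqI[OF wirt_mult[OF wirt_mult[OF wirt_nth wirt_cnj[OF wirt_nth]] wirt_pp]])
      (auto simp: aa_def)
qed

text \<open>The antiholomorphic gradient of f(r) plus the sum of the b_k ln (1 + |z_k|^2). Both the
  Kaehler potential and the logarithm of the volume density have this form, so one computation of
  Hessians serves the metric and its curvature.\<close>

definition dbar :: "real \<Rightarrow> (real \<Rightarrow> real) \<Rightarrow> (4 \<Rightarrow> real) \<Rightarrow> 4 \<Rightarrow> complex^4 \<Rightarrow> complex" where
  "dbar \<sigma> f' b k z = (if k = 4 then of_real (f' (rr \<sigma> z)) * z $ 4 * of_real (pp \<sigma> z)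
     else of_real (b k - \<sigma> * (rr \<sigma> z * f' (rr \<sigma> z))) * z $ k / of_real (nn z k))"

lemma dbar_eq:
  "dbar \<sigma> f' b k z = of_real (f' (rr \<sigma> z)) * (z $ 4 * of_real (pp \<sigma> z) * cnj (aa \<sigma> z k))
     + (if k = 4 then 0 else of_real (b k) * z $ k / of_real (nn z k))"
proof -
  have "complex_of_real (rr \<sigma> z) = z $ 4 * cnj (z $ 4) * of_real (pp \<sigma> z)"
    by (simp add: rr_def complex_norm_square[symmetric])
  then show ?thesis by (simp add: dbar_def aa_def field_simps diff_divide_distrib)
qed

lemma wirt_potential:
  assumes "(f has_real_derivative f' (rr \<sigma> z)) (at (rr \<sigma> z))"
  shows "wirt (\<lambda>z. of_real (f (rr \<sigma> z) + (\<Sum>k\<in>base. b k * ln (nn z k))))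
    (\<lambda>k. cnj (dbar \<sigma> f' b k z)) (\<lambda>k. dbar \<sigma> f' b k z) z"
proof -
  have "wirt (\<lambda>z. of_real (f (rr \<sigma> z)) + (\<Sum>k\<in>base. of_real (b k) * of_real (ln (nn z k))))
    (\<lambda>j. of_real (f' (rr \<sigma> z)) * (cnj (z $ 4) * of_real (pp \<sigma> z) * aa \<sigma> z j)
      + (\<Sum>k\<in>base. of_real (b k) * (if j = k then cnj (z $ k) / of_real (nn z k) else 0)))
    (\<lambda>j. of_real (f' (rr \<sigma> z)) * (z $ 4 * of_real (pp \<sigma> z) * cnj (aa \<sigma> z j))
      + (\<Sum>k\<in>base. of_real (b k) * (if j = k then z $ k / of_real (nn z k) else 0))) z"
    by (intro wirt_add wirt_of_real[OF wirt_rr] assms wirt_sum wirt_cmult wirt_ln_nn)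
  then show ?thesis unfolding of_real_add of_real_sum of_real_mult
    by (rule wirt_eqI) (auto simp: dbar_eq if_distrib[of "\<lambda>x. _ * x"] sum.delta cong: if_cong, (metis exhaust_4)+)
qed

text \<open>Only the function r f'(r) matters: its value shifts the base weights b_k, and its
  derivative times \<open>pp \<sigma> z\<close> is the vertical coefficient. For the metric it is
  the momentum.\<close>

lemma wirt_dbar:
  assumes "(f' has_real_derivative f'') (at (rr \<sigma> z))"
  shows "\<exists>q. wirt (dbar \<sigma> f' b k) (\<lambda>j. herm \<sigma> z (pp \<sigma> z * (f' (rr \<sigma> z) + rr \<sigma> z * f''))
     (\<lambda>k. (b k - \<sigma> * (rr \<sigma> z * f' (rr \<sigma> z))) / (nn z k)\<^sup>2) j k) q z"
proof -
  have rc: "complex_of_real (rr \<sigma> z) = z $ 4 * cnj (z $ 4) * of_real (pp \<sigma> z)" for z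
    by (simp add: rr_def complex_norm_square[symmetric])
  have n0: "complex_of_real (nn z k) \<noteq> 0" for z k using nn_pos[of z k] by simp
  show ?thesis
  proof (cases "k = 4")
    case True
    have "wirt (\<lambda>z. of_real (f' (rr \<sigma> z)) * z $ 4 * of_real (pp \<sigma> z))
      (\<lambda>j. (of_real (f' (rr \<sigma> z)) * z $ 4) * (if j = 4 then 0 else - of_real (\<sigma> * pp \<sigma> z) * cnj (z $ j) / of_real (nn z j))
         + (of_real (f' (rr \<sigma> z)) * (if j = 4 then 1 else 0)
            + of_real f'' * (cnj (z $ 4) * of_real (pp \<sigma> z) * aa \<sigma> z j) * z $ 4) * of_real (pp \<sigma> z))
      (\<lambda>j. (of_real (f' (rr \<sigma> z)) * z $ 4) * (if j = 4 then 0 else - of_real (\<sigma> * pp \<sigma> z) * z $ j / of_real (nn z j))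
         + (of_real (f' (rr \<sigma> z)) * 0
            + of_real f'' * (z $ 4 * of_real (pp \<sigma> z) * cnj (aa \<sigma> z j)) * z $ 4) * of_real (pp \<sigma> z)) z"
      by (intro wirt_mult wirt_of_real[OF wirt_rr assms] wirt_nth wirt_pp)
    then have w: "wirt (dbar \<sigma> f' b k) (\<lambda>j. (of_real (f' (rr \<sigma> z)) * z $ 4) * (if j = 4 then 0 else - of_real (\<sigma> * pp \<sigma> z) * cnj (z $ j) / of_real (nn z j))
         + (of_real (f' (rr \<sigma> z)) * (if j = 4 then 1 else 0)
            + of_real f'' * (cnj (z $ 4) * of_real (pp \<sigma> z) * aa \<sigma> z j) * z $ 4) * of_real (pp \<sigma> z))
      (\<lambda>j. (of_real (f' (rr \<sigma> z)) * z $ 4) * (if j = 4 then 0 else - of_real (\<sigma> * pp \<sigma> z) * z $ j / of_real (nn z j))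
         + (of_real (f' (rr \<sigma> z)) * 0
            + of_real f'' * (z $ 4 * of_real (pp \<sigma> z) * cnj (aa \<sigma> z j)) * z $ 4) * of_real (pp \<sigma> z)) z"
      by (simp add: dbar_def[abs_def] True)
    show ?thesis
      by (rule exI, rule wirt_eqI[OF w], (auto simp: herm_def True aa_def rc field_simps)[1], rule refl)
  next
    case False
    have U: "((\<lambda>x. b k - \<sigma> * (x * f' x)) has_real_derivative - \<sigma> * (f' (rr \<sigma> z) + rr \<sigma> z * f'')) (at (rr \<sigma> z))"
      using assms by (auto intro!: derivative_eq_intros)
    have inv: "((\<lambda>x. inverse x) has_real_derivative - inverse ((nn z k)\<^sup>2)) (at (nn z k))"
      using nn_pos[of z k] by (auto intro!: derivative_eq_intros simp: power2_eq_square)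
    have w: "wirt (\<lambda>z. of_real (b k - \<sigma> * (rr \<sigma> z * f' (rr \<sigma> z))) * z $ k * of_real (inverse (nn z k)))
       (\<lambda>j. of_real (b k - \<sigma> * (rr \<sigma> z * f' (rr \<sigma> z))) * z $ k * (of_real (- inverse ((nn z k)\<^sup>2)) * (if j = k then cnj (z $ k) else 0))
         + (of_real (b k - \<sigma> * (rr \<sigma> z * f' (rr \<sigma> z))) * (if j = k then 1 else 0)
           + of_real (- \<sigma> * (f' (rr \<sigma> z) + rr \<sigma> z * f'')) * (cnj (z $ 4) * of_real (pp \<sigma> z) * aa \<sigma> z j) * z $ k) * of_real (inverse (nn z k)))
       (\<lambda>j. of_real (b k - \<sigma> * (rr \<sigma> z * f' (rr \<sigma> z))) * z $ k * (of_real (- inverse ((nn z k)\<^sup>2)) * (if j = k then z $ k else 0))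
         + (of_real (b k - \<sigma> * (rr \<sigma> z * f' (rr \<sigma> z))) * 0
           + of_real (- \<sigma> * (f' (rr \<sigma> z) + rr \<sigma> z * f'')) * (z $ 4 * of_real (pp \<sigma> z) * cnj (aa \<sigma> z j)) * z $ k) * of_real (inverse (nn z k))) z"
      by (intro wirt_mult wirt_of_real[OF wirt_rr U] wirt_nth wirt_of_real[OF wirt_nn inv])
    have d: "dbar \<sigma> f' b k = (\<lambda>z. of_real (b k - \<sigma> * (rr \<sigma> z * f' (rr \<sigma> z))) * z $ k * of_real (inverse (nn z k)))"
      using False by (simp add: dbar_def[abs_def] divide_inverse)
    have h: "of_real B * z $ k * (of_real (- inverse ((nn z k)\<^sup>2)) * (if j = k then cnj (z $ k) else 0))
         + (of_real B * (if j = k then 1 else 0)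
           + of_real (- \<sigma> * U) * (cnj (z $ 4) * of_real (pp \<sigma> z) * aa \<sigma> z j) * z $ k) * of_real (inverse (nn z k))
       = herm \<sigma> z (pp \<sigma> z * U) hh j k" if hh: "hh k = B / (nn z k)\<^sup>2" for B U j hh
    proof -
      define n where "n = complex_of_real (nn z k)"
      have n: "n \<noteq> 0" "1 + z $ k * cnj (z $ k) = n" using n0 nn_complex by (auto simp: n_def)
      have e1: "of_real B * z $ k * (- inverse (n\<^sup>2) * cnj (z $ k)) + of_real B * inverse n = of_real B / n\<^sup>2"
      proof -
        have "of_real B * z $ k * (- inverse (n\<^sup>2) * cnj (z $ k)) + of_real B * inverse n
           = of_real B * (n - z $ k * cnj (z $ k)) / n\<^sup>2"
          using n(1) by (simp add: field_simps power2_eq_square)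
        also have "n - z $ k * cnj (z $ k) = 1" unfolding n(2)[symmetric] by simp
        finally show ?thesis by simp
      qed
      have e2: "of_real (- \<sigma> * U) * (cnj (z $ 4) * of_real (pp \<sigma> z) * aa \<sigma> z j) * z $ k * inverse n
        = of_real (pp \<sigma> z * U) * aa \<sigma> z j * cnj (aa \<sigma> z k)"
        using False by (simp add: aa_def[of \<sigma> z k] n_def divide_inverse)
      show ?thesis
        unfolding herm_def e2[symmetric] hh using e1 False by (simp add: n_def algebra_simps)
    qed
    show ?thesis unfolding d by (rule exI, rule wirt_eqI[OF w], rule h, rule refl, rule refl)
  qed
qed

lemma herm_herm: "cnj (herm \<sigma> z A h j k) = herm \<sigma> z A h k j"
  by (simp add: herm_def)

lemma herm_form: "(\<Sum>k\<in>UNIV. \<Sum>j\<in>UNIV. herm \<sigma> z A h j k * u $ j * cnj (v $ k)) =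
   of_real A * (\<Sum>j\<in>UNIV. aa \<sigma> z j * u $ j) * cnj (\<Sum>j\<in>UNIV. aa \<sigma> z j * v $ j)
   + (\<Sum>k\<in>base. of_real (h k) * u $ k * cnj (v $ k))"
  unfolding herm_def by (simp add: sum_4 algebra_simps)

subsection \<open>Linear algebra of the metric matrix\<close>

lemma matrix_inv_det_nz:
  fixes A :: "'a::field^'n^'n"
  assumes "det A \<noteq> 0"
  shows "A ** matrix_inv A = mat 1" "matrix_inv A ** A = mat 1"
proof -
  have "\<exists>A'. A ** A' = mat 1 \<and> A' ** A = mat 1"
    using assms by (simp add: invertible_det_nz[symmetric] invertible_def)
  then show "A ** matrix_inv A = mat 1" "matrix_inv A ** A = mat 1"
    unfolding matrix_inv_def by (metis (mono_tags, lifting) someI_ex)+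
qed

text \<open>A triangular matrix with unit diagonal that diagonalises every \<open>herm\<close> with
  the same \<sigma> and z simultaneously.\<close>

definition frame :: "real \<Rightarrow> complex^4 \<Rightarrow> complex^4^4" where
  "frame \<sigma> z = (\<chi> j l. if l = 4 then aa \<sigma> z j else if j = l then 1 else 0)"

definition frame_adj :: "real \<Rightarrow> complex^4 \<Rightarrow> complex^4^4" where
  "frame_adj \<sigma> z = (\<chi> l k. cnj (frame \<sigma> z $ k $ l))"

definition diag :: "real \<Rightarrow> (4 \<Rightarrow> real) \<Rightarrow> complex^4^4" where
  "diag A h = (\<chi> i j. if i = j then (if i = 4 then of_real A else of_real (h i)) else 0)"

text \<open>In the index type the numeral 4 is 0 and hence the least element. The column 4 of
  \<open>frame\<close> therefore lies below the diagonal.\<close>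

lemma not_less_4: "\<not> i < (4::4)"
proof -
  have "(0::4) \<le> i" unfolding less_eq_bit0_def zero_bit0_def
    using Rep_bit0[of i] by (simp add: Abs_bit0_inverse)
  then have "\<not> i < 0" by simp
  moreover have "(4::4) = 0" by simp
  ultimately show ?thesis by (simp only: not_False_eq_True)
qed

lemma det_frame: "det (frame \<sigma> z) = 1"
proof -
  have "det (frame \<sigma> z) = (\<Prod>i\<in>UNIV. frame \<sigma> z $ i $ i)"
    by (rule det_lowerdiagonal) (use not_less_4 in \<open>auto simp: frame_def\<close>)
  also have "\<dots> = 1" by (intro prod.neutral) (auto simp: frame_def aa_def)
  finally show ?thesis .
qed

lemma det_frame_adj: "det (frame_adj \<sigma> z) = 1"
proof -
  have "det (frame_adj \<sigma> z) = (\<Prod>i\<in>UNIV. frame_adj \<sigma> z $ i $ i)"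
    by (rule det_upperdiagonal) (use not_less_4 in \<open>auto simp: frame_def frame_adj_def\<close>)
  also have "\<dots> = 1" by (intro prod.neutral) (auto simp: frame_def frame_adj_def aa_def)
  finally show ?thesis .
qed

lemma herm_matrix: "(\<chi> j k. herm \<sigma> z A h j k) = frame \<sigma> z ** diag A h ** frame_adj \<sigma> z"
proof -
  have fd: "(frame \<sigma> z ** diag A h) $ j $ l = frame \<sigma> z $ j $ l * (if l = 4 then of_real A else of_real (h l))" for j l
    unfolding matrix_matrix_mult_def diag_def by (simp add: if_distrib[of "\<lambda>x. _ * x"] cong: if_cong)
  have "(frame \<sigma> z ** diag A h ** frame_adj \<sigma> z) $ j $ k = herm \<sigma> z A h j k" for j k
  proof -
    have "(frame \<sigma> z ** diag A h ** frame_adj \<sigma> z) $ j $ k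
       = (\<Sum>l\<in>UNIV. frame \<sigma> z $ j $ l * (if l = 4 then of_real A else of_real (h l)) * cnj (frame \<sigma> z $ k $ l))"
      unfolding matrix_matrix_mult_def[of "_ ** _"] by (simp add: fd frame_adj_def)
    also have "\<dots> = (\<Sum>l\<in>UNIV. (if l = 4 then aa \<sigma> z j * of_real A * cnj (aa \<sigma> z k) else 0)
        + (if l = k then (if j = k \<and> k \<noteq> 4 then of_real (h k) else 0) else 0))"
      by (intro sum.cong) (auto simp: frame_def)
    also have "\<dots> = herm \<sigma> z A h j k" by (simp add: sum.distrib herm_def)
    finally show ?thesis .
  qed
  then show ?thesis by (simp add: vec_eq_iff)
qed

lemma det_herm: "det (\<chi> j k. herm \<sigma> z A h j k) = of_real (A * (\<Prod>k\<in>base. h k))"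
proof -
  have "det (diag A h) = (\<Prod>i\<in>UNIV. diag A h $ i $ i)" by (rule det_diagonal) (simp add: diag_def)
  also have "\<dots> = of_real (A * (\<Prod>k\<in>base. h k))" unfolding UNIV_4 by (simp add: diag_def)
  finally show ?thesis unfolding herm_matrix by (simp add: det_mul det_frame det_frame_adj)
qed

text \<open>Both matrices are diagonal in the same frame, so the quotient is conjugate to a diagonal
  matrix of quotients. The scalar curvature is a trace of this kind, up to sign.\<close>

lemma trace_inverse_herm:
  assumes "A \<noteq> 0" "\<And>k. k \<noteq> 4 \<Longrightarrow> h k \<noteq> 0"
  shows "(\<Sum>j\<in>UNIV. \<Sum>k\<in>UNIV. matrix_inv (\<chi> j k. herm \<sigma> z A h j k) $ k $ j * herm \<sigma> z A' h' j k)
     = of_real (A' / A + (\<Sum>k\<in>base. h' k / h k))"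
proof -
  let ?g = "\<chi> j k. herm \<sigma> z A h j k" and ?g' = "\<chi> j k. herm \<sigma> z A' h' j k"
  have "det ?g \<noteq> 0" unfolding det_herm using assms by simp
  then have inv: "matrix_inv ?g ** ?g = mat 1" by (rule matrix_inv_det_nz)
  have ai: "frame_adj \<sigma> z ** matrix_inv (frame_adj \<sigma> z) = mat 1"
    by (rule matrix_inv_det_nz) (simp add: det_frame_adj)
  let ?E = "diag (A' / A) (\<lambda>k. h' k / h k)"
  have DE: "diag A h ** ?E = diag A' h'"
    using assms unfolding matrix_matrix_mult_def diag_def
    by (auto simp: vec_eq_iff if_distrib[of "\<lambda>x. _ * x"] if_distrib[of "\<lambda>x. x * _"] cong: if_cong)
  have "?g' = frame \<sigma> z ** diag A h ** (frame_adj \<sigma> z ** matrix_inv (frame_adj \<sigma> z)) ** ?E ** frame_adj \<sigma> z"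
    unfolding herm_matrix ai by (simp add: matrix_mul_assoc[symmetric] DE[symmetric])
  also have "\<dots> = ?g ** (matrix_inv (frame_adj \<sigma> z) ** ?E ** frame_adj \<sigma> z)"
    unfolding herm_matrix by (simp add: matrix_mul_assoc)
  finally have "matrix_inv ?g ** ?g' = matrix_inv (frame_adj \<sigma> z) ** ?E ** frame_adj \<sigma> z"
    by (simp only: matrix_mul_assoc inv matrix_mul_lid)
  then have "trace (matrix_inv ?g ** ?g') = trace (frame_adj \<sigma> z ** (matrix_inv (frame_adj \<sigma> z) ** ?E))"
    by (simp only: trace_mul_sym[of "frame_adj \<sigma> z"])
  also have "\<dots> = trace ?E" by (simp add: matrix_mul_assoc ai)
  also have "\<dots> = of_real (A' / A + (\<Sum>k\<in>base. h' k / h k))"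
    unfolding trace_def by (simp add: sum_4 diag_def)
  finally show ?thesis
    unfolding trace_def matrix_matrix_mult_def by (subst sum.swap) simp
qed

subsection \<open>The extremal metric in a chart\<close>

text \<open>The data of the construction at one end of the fibre. The momentum \<tau> is measured
  from that end, \<open>c k - \<sigma> * \<tau>\<close> is the size of the k-th base factor, and
  \<open>s\<close> is the quotient \<tau> / r, kept as a separate function since it must be smooth
  across r = 0.\<close>

locale chart_profile =
  fixes \<sigma> r0 \<alpha> \<beta> L :: real and c :: "4 \<Rightarrow> real" and F q :: "real poly" and \<tau> \<tau>' s :: "real \<Rightarrow> real"
  assumes sigma: "\<sigma> = 1 \<or> \<sigma> = -1" and r0: "r0 < 0"
    and smooth_\<tau>: "smooth_on \<tau> {r0<..}" and smooth_\<tau>': "smooth_on \<tau>' {r0<..}" and smooth_s: "smooth_on s {r0<..}"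
    and prof: "\<And>r. r > r0 \<Longrightarrow> (\<tau> has_real_derivative \<tau>' r) (at r)" "\<And>r. r > r0 \<Longrightarrow> \<tau>' r > 0"
      "\<And>r. r > r0 \<Longrightarrow> \<tau> r = r * s r" "\<And>r. r > r0 \<Longrightarrow> poly q (\<tau> r) > 0"
      "\<And>r. r > r0 \<Longrightarrow> r * \<tau>' r * poly q (\<tau> r) = poly F (\<tau> r)"
    and range: "\<And>r. r \<ge> 0 \<Longrightarrow> 0 \<le> \<tau> r \<and> \<tau> r < L"
    and q_eq: "\<And>x. poly q x = (\<Prod>k\<in>base. c k - \<sigma> * x)"
    and c_pos: "\<And>x k. 0 \<le> x \<Longrightarrow> x < L \<Longrightarrow> k \<noteq> 4 \<Longrightarrow> c k - \<sigma> * x > 0"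
    and F_eq: "\<And>x. 0 \<le> x \<Longrightarrow> x < L \<Longrightarrow>
      poly (pderiv (pderiv F)) x = ((\<Sum>k\<in>base. 2 / (c k - \<sigma> * x)) - (\<alpha> * x + \<beta>)) * poly q x"
begin

text \<open>The radial potential with r \<psi>'(r) = \<tau>(r). The lower limit is negative, so that
  0 is an interior point.\<close>

definition \<psi> :: "real \<Rightarrow> real" where "\<psi> x = integral {r0 / 2..x} s"

definition \<Phi> :: "complex^4 \<Rightarrow> real" where
  "\<Phi> z = \<psi> (rr \<sigma> z) + (\<Sum>k\<in>base. c k * ln (nn z k))"

definition om :: "complex^4 \<Rightarrow> complex^4 \<Rightarrow> complex^4 \<Rightarrow> real" where "om = pot_form \<Phi>"

definition hh :: "complex^4 \<Rightarrow> 4 \<Rightarrow> real" where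
  "hh z k = (c k - \<sigma> * \<tau> (rr \<sigma> z)) / (nn z k)\<^sup>2"

definition met :: "complex^4 \<Rightarrow> 4 \<Rightarrow> 4 \<Rightarrow> complex" where
  "met z = herm \<sigma> z (pp \<sigma> z * \<tau>' (rr \<sigma> z)) (hh z)"

lemma rr_r0: "rr \<sigma> z > r0" using rr_nonneg[of \<sigma> z] r0 by simp

lemma \<tau>_range: "0 \<le> \<tau> (rr \<sigma> z)" "\<tau> (rr \<sigma> z) < L" using range[OF rr_nonneg] by auto

lemma base_pos: "k \<noteq> 4 \<Longrightarrow> c k - \<sigma> * \<tau> (rr \<sigma> z) > 0"
  using c_pos \<tau>_range by blast

lemma hh_pos: "k \<noteq> 4 \<Longrightarrow> hh z k > 0"
  using base_pos nn_pos[of z k] by (simp add: hh_def)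

lemma A_pos: "pp \<sigma> z * \<tau>' (rr \<sigma> z) > 0" using pp_pos prof(2)[OF rr_r0] by simp

lemma deriv_\<psi>: "x > r0 / 2 \<Longrightarrow> (\<psi> has_real_derivative s x) (at x)"
proof -
  assume x: "x > r0 / 2"
  have "continuous_on {r0 / 2..x + 1} s"
    by (rule continuous_on_subset[OF smooth_on_imp_continuous_on[OF smooth_s]]) (use r0 in auto)
  then have "((\<lambda>u. integral {r0 / 2..u} s) has_real_derivative s x) (at x within {r0 / 2..x + 1})"
    by (rule integral_has_real_derivative) (use x in auto)
  then show ?thesis unfolding \<psi>_def using x by (subst (asm) at_within_Icc_at) auto
qed

lemma rr_half: "rr \<sigma> z > r0 / 2" using rr_nonneg[of \<sigma> z] r0 by simp

lemma smooth_\<psi>: "smooth_on \<psi> {r0 / 2<..}"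
proof (rule smooth_on_has_derivativeI)
  show "(\<psi> has_derivative (\<lambda>u. u * s x)) (at x)" if "x \<in> {r0 / 2<..}" for x
    using deriv_\<psi>[of x] that unfolding has_field_derivative_def
    by (auto elim!: has_derivative_eq_rhs simp: fun_eq_iff)
  show "smooth_on (\<lambda>x. v * s x) {r0 / 2<..}" for v
    by (intro smooth_intros smooth_on_subset[OF smooth_s]) (use r0 in auto)
qed auto

lemma smooth_\<Phi>: "smooth_on \<Phi> UNIV"
  unfolding \<Phi>_def
proof (intro smooth_intros nn_pos smooth_on_compose[OF smooth_\<psi>] smooth_rr)
qed (use rr_half in auto)

lemma wirt_\<Phi>: "wirt (\<lambda>z. of_real (\<Phi> z)) (\<lambda>k. cnj (dbar \<sigma> s c k z)) (\<lambda>k. dbar \<sigma> s c k z) z"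
  unfolding \<Phi>_def by (rule wirt_potential) (rule deriv_\<psi>[OF rr_half])

text \<open>Differentiating \<tau> = r s identifies the vertical coefficient of the metric, up to
  the factor \<open>pp \<sigma> z\<close>, as \<tau>'.\<close>

lemma has_s': "\<exists>s'. (s has_real_derivative s') (at x) \<and> s x + x * s' = \<tau>' x" if "x > r0" for x
proof -
  have "s differentiable (at x)"
    using smooth_on_has_derivative[OF smooth_s, of x] that by (auto simp: differentiable_def)
  then obtain s' where s': "(s has_real_derivative s') (at x)"
    using real_differentiable_def by blast
  then have "((\<lambda>r. r * s r) has_real_derivative s x + x * s') (at x)"
    by (auto intro!: derivative_eq_intros)
  then have "(\<tau> has_real_derivative s x + x * s') (at x)"
    by (rule has_field_derivative_transform_within_open[where S="{r0<..}"]) (use that prof(3) in auto)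
  then show ?thesis using s' DERIV_unique prof(1)[OF that] by blast
qed

lemma wirt_dk: "\<exists>qq. wirt (dbar \<sigma> s c k) (\<lambda>j. met z j k) qq z"
proof -
  obtain s' where s': "(s has_real_derivative s') (at (rr \<sigma> z))" "s (rr \<sigma> z) + rr \<sigma> z * s' = \<tau>' (rr \<sigma> z)"
    using has_s'[OF rr_r0] by blast
  show ?thesis
    using wirt_dbar[OF s'(1), of c k] unfolding s'(2) prof(3)[OF rr_r0, symmetric] met_def hh_def[abs_def] .
qed

lemma om_explicit: "om z u v = - 2 * Im (\<Sum>k\<in>UNIV. \<Sum>j\<in>UNIV. met z j k * u $ j * cnj (v $ k))"
proof -
  have "\<forall>k. \<exists>qq. wirt (dbar \<sigma> s c k) (\<lambda>j. met z j k) qq z" by (intro allI wirt_dk)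
  from choice[OF this] obtain qq where qq: "\<And>k. wirt (dbar \<sigma> s c k) (\<lambda>j. met z j k) (qq k) z" by blast
  show ?thesis unfolding om_def
  proof (rule pot_form_explicit[OF smooth_\<Phi>, where dk="dbar \<sigma> s c" and q=qq])
    show "FD \<Phi> y w = 2 * Re (\<Sum>k\<in>UNIV. dbar \<sigma> s c k y * cnj (w $ k))" for y w
      by (rule FD_eq[OF wirt_real_deriv(4)[OF wirt_\<Phi>]])
  qed (use qq in \<open>auto simp: met_def herm_herm\<close>)
qed

lemma om_form: "om z u v = - 2 * Im (of_real (pp \<sigma> z * \<tau>' (rr \<sigma> z)) * (\<Sum>j\<in>UNIV. aa \<sigma> z j * u $ j) * cnj (\<Sum>j\<in>UNIV. aa \<sigma> z j * v $ j)
   + (\<Sum>k\<in>base. of_real (hh z k) * u $ k * cnj (v $ k)))"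
  unfolding om_explicit met_def herm_form ..

lemma om_pos: "pos_form om"
  unfolding pos_form_def
proof (intro allI impI)
  fix z u :: "complex^4" assume u: "u \<noteq> 0"
  let ?a = "\<Sum>j\<in>UNIV. aa \<sigma> z j * u $ j"
  have ai: "(\<Sum>j\<in>UNIV. aa \<sigma> z j * (\<i> *s u) $ j) = \<i> * ?a" by (simp add: sum_distrib_left mult_ac)
  have m: "x * cnj (\<i> * x) = - \<i> * of_real ((cmod x)\<^sup>2)" for x :: complex
    unfolding complex_norm_square by (simp add: mult_ac)
  have "om z u (\<i> *s u) = - 2 * Im (of_real (pp \<sigma> z * \<tau>' (rr \<sigma> z)) * (?a * cnj (\<i> * ?a))
     + (\<Sum>k\<in>base. of_real (hh z k) * (u $ k * cnj (\<i> * u $ k))))"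
    unfolding om_form ai by (simp add: mult.assoc)
  also have "\<dots> = 2 * (pp \<sigma> z * \<tau>' (rr \<sigma> z) * (cmod ?a)\<^sup>2 + (\<Sum>k\<in>base. hh z k * (cmod (u $ k))\<^sup>2))"
    unfolding m by (simp add: algebra_simps)
  also have "\<dots> > 0"
  proof -
    have nn: "hh z k * (cmod (u $ k))\<^sup>2 \<ge> 0" if "k \<in> base" for k
      using hh_pos[of k z] that by (intro mult_nonneg_nonneg) (auto simp: base_iff less_imp_le)
    have n1: "(\<Sum>k\<in>base. hh z k * (cmod (u $ k))\<^sup>2) \<ge> 0" by (rule sum_nonneg[OF nn])
    have n2: "pp \<sigma> z * \<tau>' (rr \<sigma> z) * (cmod ?a)\<^sup>2 \<ge> 0" using A_pos[of z] by simp
    show ?thesis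
    proof (cases "\<exists>k\<in>base. u $ k \<noteq> 0")
      case True
      then obtain k where k: "k \<in> base" "u $ k \<noteq> 0" by blast
      then have "hh z k * (cmod (u $ k))\<^sup>2 > 0" using hh_pos[of k z] base_iff by simp
      then have "(\<Sum>k\<in>base. hh z k * (cmod (u $ k))\<^sup>2) > 0"
        using k(1) nn by (intro sum_pos2[of base k]) auto
      then show ?thesis using n2 by simp
    next
      case False
      then have "u $ k = 0" if "k \<noteq> 4" for k using that base_iff by blast
      then have "u $ 4 \<noteq> 0" using u by (metis vec_eq_iff zero_index)
      moreover have "?a = u $ 4" using False by (simp add: sum_4 aa_def)
      ultimately have "pp \<sigma> z * \<tau>' (rr \<sigma> z) * (cmod ?a)\<^sup>2 > 0" using A_pos[of z] by simp
      then show ?thesis using n1 by simp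
    qed
  qed
  finally show "om z u (\<i> *s u) > 0" .
qed

lemma nn_rot: "nn (rot \<theta> z) k = nn z k"
  by (simp add: nn_def rot_def norm_mult)

lemma pp_rot: "pp \<sigma>' (rot \<theta> z) = pp \<sigma>' z"
  by (simp add: pp_def nn_rot)

lemma rr_rot: "rr \<sigma>' (rot \<theta> z) = rr \<sigma>' z"
  by (simp add: rr_def pp_rot) (simp add: rot_def norm_mult)

lemma om_T_invariant: "T_invariant om"
  unfolding T_invariant_def
proof (intro allI)
  fix \<theta> z u v
  have cc: "cis a * cnj (cis a) = 1" "cnj (cis a) * cis a = 1" for a by (simp_all add: cis_cnj cis_mult)
  have cc': "cnj (cis a) * (cis a * x) = x" for a x by (simp only: mult.assoc[symmetric] cc mult_1)
  have a: "(\<Sum>j\<in>UNIV. aa \<sigma> (rot \<theta> z) j * rot \<theta> u $ j) = cis (\<theta> $ 4) * (\<Sum>j\<in>UNIV. aa \<sigma> z j * u $ j)" for u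
    unfolding sum_distrib_left
  proof (intro sum.cong refl)
    fix j :: 4
    show "aa \<sigma> (rot \<theta> z) j * rot \<theta> u $ j = cis (\<theta> $ 4) * (aa \<sigma> z j * u $ j)"
      by (simp add: aa_def nn_rot) (simp add: rot_def mult_ac cc cc')
  qed
  have b: "x * rot \<theta> u $ k * cnj (rot \<theta> v $ k) = x * u $ k * cnj (v $ k)" for x k
  proof -
    have "x * rot \<theta> u $ k * cnj (rot \<theta> v $ k) = (cis (\<theta> $ k) * cnj (cis (\<theta> $ k))) * (x * u $ k * cnj (v $ k))"
      by (simp add: rot_def mult_ac)
    then show ?thesis by (simp only: cc mult_1)
  qed
  have h: "hh (rot \<theta> z) = hh z" by (simp add: hh_def rr_rot nn_rot fun_eq_iff)
  have r: "w * (cis t * x) * cnj (cis t * y) = w * x * cnj y" for w t x y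
  proof -
    have "w * (cis t * x) * cnj (cis t * y) = (cis t * cnj (cis t)) * (w * x * cnj y)" by (simp add: mult_ac)
    then show ?thesis by (simp only: cc mult_1)
  qed
  show "om (rot \<theta> z) (rot \<theta> u) (rot \<theta> v) = om z u v"
    unfolding om_form a b h pp_rot rr_rot r ..
qed

lemma om_toric: "toric_form om"
  unfolding toric_form_def using pot_form_props[OF smooth_\<Phi>] om_T_invariant by (simp add: om_def)

text \<open>In both cases the right-hand side is the conjugate of \<open>z $ k\<close> times the
  derivative of the potential by the conjugate coordinate, so its differential is read off from the
  metric matrix. On the fibre the moment map is the profile itself.\<close>

lemma mom_om: "mom om (axis k 1) z = (if k = 4 then \<tau> (rr \<sigma> z)
    else (c k - \<sigma> * \<tau> (rr \<sigma> z)) * (cmod (z $ k))\<^sup>2 / nn z k)"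
proof -
  define h where "h z = (if k = 4 then \<tau> (rr \<sigma> z)
    else (c k - \<sigma> * \<tau> (rr \<sigma> z)) * (cmod (z $ k))\<^sup>2 / nn z k)" for z
  have cn: "(complex_of_real (cmod w))\<^sup>2 = w * cnj w" for w using complex_norm_square[of w] by simp
  have hc: "complex_of_real (h z) = cnj (z $ k) * dbar \<sigma> s c k z" for z
  proof (cases "k = 4")
    case True
    have "complex_of_real (\<tau> (rr \<sigma> z)) = of_real (s (rr \<sigma> z)) * of_real ((cmod (z $ 4))\<^sup>2 * pp \<sigma> z)"
      using prof(3)[OF rr_r0, of z] by (simp add: rr_def mult_ac)
    then show ?thesis using True by (simp add: h_def dbar_def cn mult_ac)
  next
    case False
    then show ?thesis
      using prof(3)[OF rr_r0, of z, symmetric] by (simp add: h_def dbar_def cn mult_ac)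
  qed
  have "(h has_derivative (\<lambda>u. om z u (vf (axis k 1) z))) (at z)" for z
  proof -
    obtain qq where qq: "wirt (dbar \<sigma> s c k) (\<lambda>j. met z j k) qq z" using wirt_dk by blast
    have "wirt (\<lambda>z. of_real (h z)) (\<lambda>j. cnj (z $ k) * met z j k)
      (\<lambda>j. cnj (z $ k) * qq j + (if j = k then 1 else 0) * dbar \<sigma> s c k z) z"
      unfolding hc by (rule wirt_eqI[OF wirt_mult[OF wirt_cnj[OF wirt_nth] qq]]) auto
    from wirt_real_deriv(3)[OF this]
    have "(h has_derivative (\<lambda>u. 2 * Re (\<Sum>j\<in>UNIV. cnj (z $ k) * met z j k * u $ j))) (at z)" .
    moreover have "om z u (vf (axis k 1) z) = 2 * Re (\<Sum>j\<in>UNIV. cnj (z $ k) * met z j k * u $ j)" for u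
    proof -
      have "(\<Sum>i\<in>UNIV. \<Sum>j\<in>UNIV. met z j i * u $ j * cnj (vf (axis k 1) z $ i))
         = (\<Sum>i\<in>UNIV. if i = k then - \<i> * (\<Sum>j\<in>UNIV. cnj (z $ k) * met z j k * u $ j) else 0)"
        by (intro sum.cong) (auto simp: vf_def axis_def sum_distrib_left mult_ac)
      then show ?thesis unfolding om_explicit by simp
    qed
    ultimately show ?thesis by simp
  qed
  moreover have "h 0 = 0"
    using prof(3)[of 0] r0 by (simp add: h_def rr_def)
  ultimately have "h z = mom om (axis k 1) z" by (rule mom_unique[OF om_toric])
  then show ?thesis by (simp add: h_def)
qed

lemma metric_matrix_om:
  assumes "\<omega> C = om"
  shows "metric_matrix \<omega> C z = (\<chi> j k. met z j k)"
proof -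
  have "om z (axis j a) (axis k b) = - 2 * Im (met z j k * a * cnj b)" for j k a b
  proof -
    have "(\<Sum>k'\<in>UNIV. \<Sum>j'\<in>UNIV. met z j' k' * axis j a $ j' * cnj (axis k b $ k'))
      = (\<Sum>k'\<in>UNIV. if k' = k then (\<Sum>j'\<in>UNIV. if j' = j then met z j k * a * cnj b else 0) else 0)"
      by (intro sum.cong refl) (simp add: axis_def if_distrib[of "\<lambda>x. _ * x"] if_distrib[of "\<lambda>x. x * _"]
          if_distrib[of cnj] cong: if_cong)
    then show ?thesis unfolding om_explicit by simp
  qed
  then show ?thesis unfolding metric_matrix_def assms by (simp add: complex_eq_iff vec_eq_iff)
qed

section \<open>Scalar curvature and extremality\<close>

definition u :: "real \<Rightarrow> real" where "u x = ln (\<tau>' x * poly q (\<tau> x))"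

lemma smooth_u: "smooth_on u {r0<..}"
  unfolding u_def using prof by (intro smooth_intros smooth_\<tau> smooth_\<tau>') auto

definition u' :: "real \<Rightarrow> real" where "u' x = FD u x 1"

lemma deriv_u: "x > r0 \<Longrightarrow> (u has_real_derivative u' x) (at x)"
proof -
  assume x: "x > r0"
  have d: "(u has_derivative (\<lambda>h. FD u x h)) (at x)" using smooth_on_has_derivative[OF smooth_u] x by auto
  have "FD u x h = u' x * h" for h
    using linear_scale[OF has_derivative_linear[OF d], of h 1] by (simp add: u'_def mult.commute)
  with d show ?thesis by (simp add: has_field_derivative_def)
qed

text \<open>Differentiating r \<tau>' q(\<tau>) = F(\<tau>) and dividing by \<tau>' q(\<tau>) gives
  the formula without a division by r, so it holds at r = 0 too.\<close>

lemma x_u': "x > r0 \<Longrightarrow> x * u' x = poly (pderiv F) (\<tau> x) / poly q (\<tau> x) - 1"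
proof -
  assume x: "x > r0"
  define m where "m x = \<tau>' x * poly q (\<tau> x)" for x
  have mpos: "m x > 0" using prof x by (simp add: m_def)
  have "((\<lambda>x. exp (u x)) has_real_derivative exp (u x) * u' x) (at x)"
    using deriv_u[OF x] by (auto intro!: derivative_eq_intros)
  then have "(m has_real_derivative exp (u x) * u' x) (at x)"
    by (rule has_field_derivative_transform_within_open[where S="{r0<..}"]) (use x prof in \<open>auto simp: u_def m_def\<close>)
  moreover have "exp (u x) = m x" using mpos by (simp add: u_def m_def)
  ultimately have "((\<lambda>x. x * m x) has_real_derivative m x + x * (m x * u' x)) (at x)"
    by (auto intro!: derivative_eq_intros)
  then have "((\<lambda>x. poly F (\<tau> x)) has_real_derivative m x + x * (m x * u' x)) (at x)"
    by (rule has_field_derivative_transform_within_open[where S="{r0<..}"])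
      (use x prof(5) in \<open>auto simp: m_def mult.assoc\<close>)
  moreover have "((\<lambda>x. poly F (\<tau> x)) has_real_derivative poly (pderiv F) (\<tau> x) * \<tau>' x) (at x)"
    by (rule DERIV_chain2[OF poly_DERIV prof(1)[OF x]])
  ultimately have "m x + x * (m x * u' x) = poly (pderiv F) (\<tau> x) * \<tau>' x" by (rule DERIV_unique)
  then have "x * u' x = poly (pderiv F) (\<tau> x) * \<tau>' x / m x - 1" using mpos by (simp add: field_simps)
  also have "poly (pderiv F) (\<tau> x) * \<tau>' x / m x = poly (pderiv F) (\<tau> x) / poly q (\<tau> x)"
    using prof(2)[OF x] by (simp add: m_def)
  finally show ?thesis .
qed

lemma has_u'':
  assumes x: "x > r0"
  shows "\<exists>u''. (u' has_real_derivative u'') (at x) \<and> u' x + x * u'' =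
    (poly (pderiv (pderiv F)) (\<tau> x) * poly q (\<tau> x) - poly (pderiv F) (\<tau> x) * poly (pderiv q) (\<tau> x)) / (poly q (\<tau> x))\<^sup>2 * \<tau>' x"
proof -
  have "smooth_on u' {r0<..}" unfolding u'_def[abs_def] by (rule smooth_on_FD[OF smooth_u])
  then have "u' differentiable (at x)"
    using smooth_on_has_derivative[of u' _ x] x by (auto simp: differentiable_def)
  then obtain u'' where u'': "(u' has_real_derivative u'') (at x)"
    using real_differentiable_def by blast
  then have "((\<lambda>x. x * u' x) has_real_derivative u' x + x * u'') (at x)"
    by (auto intro!: derivative_eq_intros)
  then have "((\<lambda>x. poly (pderiv F) (\<tau> x) / poly q (\<tau> x) - 1) has_real_derivative u' x + x * u'') (at x)"
    by (rule has_field_derivative_transform_within_open[where S="{r0<..}"]) (use x x_u' in auto)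
  moreover have "((\<lambda>x. poly (pderiv F) (\<tau> x) / poly q (\<tau> x) - 1) has_real_derivative
     (poly (pderiv (pderiv F)) (\<tau> x) * poly q (\<tau> x) - poly (pderiv F) (\<tau> x) * poly (pderiv q) (\<tau> x)) / (poly q (\<tau> x))\<^sup>2 * \<tau>' x) (at x)"
  proof -
    have q0: "poly q (\<tau> x) \<noteq> 0" using prof(4)[OF x] by simp
    have "((\<lambda>x. poly (pderiv F) (\<tau> x) / poly q (\<tau> x) - 1) has_real_derivative
      (poly (pderiv (pderiv F)) (\<tau> x) * \<tau>' x * poly q (\<tau> x) - poly (pderiv F) (\<tau> x) * (poly (pderiv q) (\<tau> x) * \<tau>' x))
        / (poly q (\<tau> x) * poly q (\<tau> x)) - 0) (at x)"
      by (intro DERIV_diff DERIV_divide DERIV_chain2[OF poly_DERIV prof(1)[OF x]] DERIV_const q0)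
    then show ?thesis by (simp add: power2_eq_square algebra_simps)
  qed
  ultimately show ?thesis using u'' DERIV_unique by blast
qed

lemma q_logderiv:
  assumes "0 \<le> x" "x < L"
  shows "poly (pderiv q) x = - \<sigma> * (\<Sum>k\<in>base. 1 / (c k - \<sigma> * x)) * poly q x"
proof -
  have nz: "c 1 - \<sigma> * x \<noteq> 0" "c 2 - \<sigma> * x \<noteq> 0" "c 3 - \<sigma> * x \<noteq> 0"
    using c_pos[OF assms, of 1] c_pos[OF assms, of 2] c_pos[OF assms, of 3] by auto
  have e: "poly q = (\<lambda>x. (c 1 - \<sigma> * x) * ((c 2 - \<sigma> * x) * (c 3 - \<sigma> * x)))"
    by (auto simp: q_eq)
  have "(poly q has_real_derivative
    - \<sigma> * ((c 2 - \<sigma> * x) * (c 3 - \<sigma> * x)) + (- \<sigma> * (c 3 - \<sigma> * x) + - \<sigma> * (c 2 - \<sigma> * x)) * (c 1 - \<sigma> * x)) (at x)"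
    unfolding e by (auto intro!: derivative_eq_intros)
  from DERIV_unique[OF poly_DERIV this] have "poly (pderiv q) x = - \<sigma> * ((c 2 - \<sigma> * x) * (c 3 - \<sigma> * x)) + (- \<sigma> * (c 3 - \<sigma> * x) + - \<sigma> * (c 2 - \<sigma> * x)) * (c 1 - \<sigma> * x)"
    .
  also have "\<dots> = - \<sigma> * (\<Sum>k\<in>base. 1 / (c k - \<sigma> * x)) * poly q x"
  proof -
    have "- \<sigma> * (b * d) + (- \<sigma> * d + - \<sigma> * b) * a = - \<sigma> * (1 / a + (1 / b + 1 / d)) * (a * (b * d))"
      if "a \<noteq> 0" "b \<noteq> 0" "d \<noteq> 0" for a b d :: real
      using that by (simp add: field_simps)
    from this[OF nz] show ?thesis unfolding q_eq by simp
  qed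
  finally show ?thesis .
qed

text \<open>The determinant is \<open>pp\<close> times \<tau>' times the product of the base
  entries. The numerators of these form q(\<tau>), the denominators contribute the 2 and
  \<open>pp\<close> the \<sigma> in the coefficient of the logarithms.\<close>

lemma log_det:
  assumes "\<omega> C = om"
  shows "ln (Re (det (metric_matrix \<omega> C z))) = u (rr \<sigma> z) + (\<Sum>k\<in>base. - (2 + \<sigma>) * ln (nn z k))"
proof -
  let ?t = "\<tau> (rr \<sigma> z)"
  have d: "Re (det (metric_matrix \<omega> C z)) = pp \<sigma> z * \<tau>' (rr \<sigma> z) * (\<Prod>k\<in>base. hh z k)"
    unfolding metric_matrix_om[where \<omega>=\<omega> and C=C, OF assms] met_def det_herm by simp
  have p: "(\<Prod>k\<in>base. hh z k) > 0" using hh_pos by (intro prod_pos) (auto simp: base_iff)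
  have lh: "ln (hh z k) = ln (c k - \<sigma> * ?t) - 2 * ln (nn z k)" if "k \<noteq> 4" for k
    unfolding hh_def using base_pos[OF that, of z] nn_pos[of z k] by (simp add: ln_div ln_realpow)
  have "ln (\<Prod>k\<in>base. hh z k) = (\<Sum>k\<in>base. ln (hh z k))"
  proof (rule ln_prod)
    show "hh z i \<noteq> 0" if "i \<in> base" for i using that by (metis base_iff hh_pos less_irrefl)
  qed simp
  also have "\<dots> = (\<Sum>k\<in>base. ln (c k - \<sigma> * ?t)) - (\<Sum>k\<in>base. 2 * ln (nn z k))"
    using lh by (simp add: sum_subtractf)
  also have "(\<Sum>k\<in>base. ln (c k - \<sigma> * ?t)) = ln (poly q ?t)"
    unfolding q_eq
  proof (rule ln_prod[symmetric])
    show "c i - \<sigma> * ?t \<noteq> 0" if "i \<in> base" for i using that by (metis base_iff base_pos less_irrefl)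
  qed simp
  finally have lnh: "ln (\<Prod>k\<in>base. hh z k) = ln (poly q ?t) - (\<Sum>k\<in>base. 2 * ln (nn z k))" .
  have "ln (Re (det (metric_matrix \<omega> C z))) = (- \<sigma> * (\<Sum>k\<in>base. ln (nn z k)) + ln (\<tau>' (rr \<sigma> z))) + ln (\<Prod>k\<in>base. hh z k)"
    unfolding d using p prof(2)[OF rr_r0, of z] pp_pos[of \<sigma> z] by (simp add: ln_mult_pos) (simp add: pp_def)
  then show ?thesis
    unfolding lnh u_def using prof(2,4)[OF rr_r0, of z] by (simp add: ln_mult_pos sum_distrib_left algebra_simps)
qed

text \<open>Relative to the metric, the vertical entry of the Hessian of the log determinant is the
  \<tau>-derivative of F' / q. The term of it that contains q' cancels the part of the base entries
  that contains F', and what remains is F'' / q minus the sum of the 2 / (c_k - \<sigma>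
  \<tau>).\<close>

lemma scalar_curvature_om:
  assumes "\<omega> C = om"
  shows "scalar_curvature \<omega> C z = of_real (\<alpha> * \<tau> (rr \<sigma> z) + \<beta>)"
proof -
  let ?b = "\<lambda>_::4. - (2 + \<sigma>)" and ?r = "rr \<sigma> z" and ?t = "\<tau> (rr \<sigma> z)"
  have "d_zbar k (\<lambda>y. of_real (ln (Re (det (metric_matrix \<omega> C y))))) y = dbar \<sigma> u' ?b k y" for k y
    unfolding log_det[where \<omega>=\<omega> and C=C, OF assms]
    by (rule wirt_d_z(2)[OF wirt_potential]) (rule deriv_u[OF rr_r0])
  then have dz: "d_zbar k (\<lambda>y. of_real (ln (Re (det (metric_matrix \<omega> C y))))) = dbar \<sigma> u' ?b k" for k
    by (simp add: fun_eq_iff)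
  obtain u'' where u'': "(u' has_real_derivative u'') (at ?r)" "u' ?r + ?r * u'' =
    (poly (pderiv (pderiv F)) ?t * poly q ?t - poly (pderiv F) ?t * poly (pderiv q) ?t) / (poly q ?t)\<^sup>2 * \<tau>' ?r"
    using has_u''[OF rr_r0] by blast
  let ?U = "u' ?r + ?r * u''"
  let ?h' = "\<lambda>k. (- (2 + \<sigma>) - \<sigma> * (?r * u' ?r)) / (nn z k)\<^sup>2"
  have dd: "d_z j (dbar \<sigma> u' ?b k) z = herm \<sigma> z (pp \<sigma> z * ?U) ?h' j k" for j k
    using wirt_dbar[OF u''(1), of ?b k] wirt_d_z(1) by blast
  have "scalar_curvature \<omega> C z = - of_real (pp \<sigma> z * ?U / (pp \<sigma> z * \<tau>' ?r) + (\<Sum>k\<in>base. ?h' k / hh z k))"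
  proof -
    have A0: "pp \<sigma> z * \<tau>' ?r \<noteq> 0" using A_pos[of z] by (rule less_imp_neq[symmetric])
    have h0: "hh z k \<noteq> 0" if "k \<noteq> 4" for k using hh_pos[OF that, of z] by simp
    show ?thesis
      unfolding scalar_curvature_def inverse_metric_def dz dd
      unfolding metric_matrix_om[where \<omega>=\<omega> and C=C, OF assms] met_def
      by (subst trace_inverse_herm[OF A0 h0]) auto
  qed
  also have "pp \<sigma> z * ?U / (pp \<sigma> z * \<tau>' ?r) + (\<Sum>k\<in>base. ?h' k / hh z k) = - (\<alpha> * ?t + \<beta>)"
  proof -
    have q0: "poly q ?t \<noteq> 0" and t0: "\<tau>' ?r \<noteq> 0" and p0: "pp \<sigma> z \<noteq> 0"
      using prof(2,4)[OF rr_r0, of z] pp_pos[of \<sigma> z] by auto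
    \<comment> \<open>With S as below, the vertical entry is F'' / q + \<sigma> S W and the base
      entries add up to (- 2 - \<sigma> W) S.\<close>
    define W where "W = poly (pderiv F) ?t / poly q ?t"
    define S where "S = (\<Sum>k\<in>base. 1 / (c k - \<sigma> * ?t))"
    have qd: "poly (pderiv q) ?t = - \<sigma> * S * poly q ?t" unfolding S_def by (rule q_logderiv[OF \<tau>_range])
    have Fd: "poly (pderiv (pderiv F)) ?t = (2 * S - (\<alpha> * ?t + \<beta>)) * poly q ?t"
      unfolding F_eq[OF \<tau>_range] S_def by (simp add: sum_distrib_left)
    have "pp \<sigma> z * ?U / (pp \<sigma> z * \<tau>' ?r) = (poly (pderiv (pderiv F)) ?t * poly q ?t - poly (pderiv F) ?t * poly (pderiv q) ?t) / (poly q ?t)\<^sup>2"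
      unfolding u''(2) using t0 p0 by simp
    also have "\<dots> = 2 * S - (\<alpha> * ?t + \<beta>) + \<sigma> * S * W"
      unfolding qd Fd W_def using q0 by (simp add: field_simps power2_eq_square)
    finally have 1: "pp \<sigma> z * ?U / (pp \<sigma> z * \<tau>' ?r) = 2 * S - (\<alpha> * ?t + \<beta>) + \<sigma> * S * W" .
    have "?h' k / hh z k = (- 2 - \<sigma> * W) * (1 / (c k - \<sigma> * ?t))" for k
    proof -
      have "(a / n) / (b / n) = a * (1 / b)" if "n \<noteq> 0" for a b n :: real using that by simp
      moreover have "(nn z k)\<^sup>2 \<noteq> 0" using nn_pos[of z k] by simp
      moreover have "- (2 + \<sigma>) - \<sigma> * (W - 1) = - 2 - \<sigma> * W" by (simp add: algebra_simps)
      ultimately show ?thesis unfolding hh_def x_u'[OF rr_r0] W_def[symmetric] by metis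
    qed
    then have "(\<Sum>k\<in>base. ?h' k / hh z k) = (- 2 - \<sigma> * W) * S" by (simp only: S_def sum_distrib_left)
    with 1 show ?thesis by (simp add: algebra_simps)
  qed
  finally show ?thesis by simp
qed

text \<open>The antiholomorphic differential of \<tau> is the contraction of the metric with the
  Euler field of the fibre. Since the scalar curvature is affine in \<tau>, its gradient is \<alpha>
  times this holomorphic field.\<close>

lemma extremal_gradient_om:
  assumes "\<omega> C = om"
  shows "extremal_gradient \<omega> C z = (\<chi> j. of_real \<alpha> * (if j = 4 then z $ 4 else 0))"
proof -
  let ?g = "metric_matrix \<omega> C z" and ?r = "rr \<sigma> z"
  have S: "scalar_curvature \<omega> C = (\<lambda>z. of_real (\<alpha> * \<tau> (rr \<sigma> z) + \<beta>))"
    using scalar_curvature_om[where \<omega>=\<omega> and C=C, OF assms] by blast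
  have "((\<lambda>x. \<alpha> * \<tau> x + \<beta>) has_real_derivative \<alpha> * \<tau>' ?r) (at ?r)"
    using prof(1)[OF rr_r0, of z] by (auto intro!: derivative_eq_intros)
  from wirt_d_z(2)[OF wirt_of_real[OF wirt_rr this]]
  have dS: "d_zbar k (scalar_curvature \<omega> C) z = of_real \<alpha> * (\<Sum>l\<in>UNIV. (if l = 4 then z $ 4 else 0) * ?g $ l $ k)" for k
    unfolding S metric_matrix_om[where \<omega>=\<omega> and C=C, OF assms] met_def
    by (simp add: herm_def aa_def[of \<sigma> z 4] if_distrib[of "\<lambda>x. x * _"] mult_ac cong: if_cong)
  have "det ?g \<noteq> 0"
    unfolding metric_matrix_om[where \<omega>=\<omega> and C=C, OF assms] met_def det_herm using A_pos[of z] hh_pos[of _ z]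
    by (auto simp: base_iff[symmetric] less_imp_neq[symmetric])
  then have inv: "?g ** matrix_inv ?g = mat 1" by (rule matrix_inv_det_nz)
  have "(\<Sum>k\<in>UNIV. matrix_inv ?g $ k $ j * (of_real \<alpha> * (\<Sum>l\<in>UNIV. w l * ?g $ l $ k))) = of_real \<alpha> * w j" for w :: "4 \<Rightarrow> complex" and j
  proof -
    have "(\<Sum>k\<in>UNIV. matrix_inv ?g $ k $ j * (of_real \<alpha> * (\<Sum>l\<in>UNIV. w l * ?g $ l $ k)))
       = of_real \<alpha> * (\<Sum>l\<in>UNIV. w l * (\<Sum>k\<in>UNIV. ?g $ l $ k * matrix_inv ?g $ k $ j))"
      unfolding sum_distrib_left by (subst sum.swap) (simp add: mult_ac)
    moreover have "(\<Sum>k\<in>UNIV. ?g $ l $ k * matrix_inv ?g $ k $ j) = (if l = j then 1 else 0)" for l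
      using arg_cong[OF inv, of "\<lambda>M. M $ l $ j"] by (simp add: matrix_matrix_mult_def mat_def)
    ultimately show ?thesis by (simp add: if_distrib[of "\<lambda>x. _ * x"] cong: if_cong)
  qed
  then show ?thesis
    unfolding extremal_gradient_def inverse_metric_def dS by simp
qed

end

section \<open>Extremal metrics in all Kaehler classes\<close>

definition xn :: "complex^4 \<Rightarrow> 4 \<Rightarrow> real" where "xn z k = (cmod (z $ k))\<^sup>2 / nn z k"

text \<open>The holomorphic differential of ln r in the logarithmic frame.\<close>

definition lform :: "real \<Rightarrow> complex^4 \<Rightarrow> complex^4 \<Rightarrow> complex" where
  "lform \<sigma> z \<xi> = \<xi> $ 4 - of_real \<sigma> * (\<Sum>k\<in>base. of_real (xn z k) * \<xi> $ k)"

text \<open>The momentum metric in the logarithmic frame, with \<phi> = F / q and base weights h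
  kept as parameters: for equal parameters it is the same form in all charts, so gluing only
  requires that the momenta agree.\<close>

definition log_form :: "real \<Rightarrow> (4 \<Rightarrow> real) \<Rightarrow> real \<Rightarrow> complex^4 \<Rightarrow> complex^4 \<Rightarrow> complex^4 \<Rightarrow> real" where
  "log_form \<sigma> h \<phi> z \<xi> \<eta> = - 2 * Im (of_real \<phi> * lform \<sigma> z \<xi> * cnj (lform \<sigma> z \<eta>)
     + (\<Sum>k\<in>base. of_real (h k * (xn z k / nn z k)) * \<xi> $ k * cnj (\<eta> $ k)))"

lemma (in chart_profile) om_log:
  "om z (z * \<xi>) (z * \<eta>) = log_form \<sigma> (\<lambda>k. c k - \<sigma> * \<tau> (rr \<sigma> z)) (poly F (\<tau> (rr \<sigma> z)) / poly q (\<tau> (rr \<sigma> z))) z \<xi> \<eta>"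
proof -
  let ?r = "rr \<sigma> z"
  have cn: "(complex_of_real (cmod w))\<^sup>2 = w * cnj w" for w using complex_norm_square[of w] by simp
  have a: "(\<Sum>j\<in>UNIV. aa \<sigma> z j * (z * \<xi>) $ j) = z $ 4 * lform \<sigma> z \<xi>" for \<xi>
    by (simp add: sum_4 aa_def lform_def xn_def cn algebra_simps)
  have h: "of_real (hh z k) * (z * \<xi>) $ k * cnj ((z * \<eta>) $ k)
    = of_real ((c k - \<sigma> * \<tau> ?r) * (xn z k / nn z k)) * \<xi> $ k * cnj (\<eta> $ k)" for k
    by (simp add: hh_def xn_def cn[unfolded power2_eq_square] power2_eq_square mult_ac)
  have \<phi>: "pp \<sigma> z * \<tau>' ?r * (cmod (z $ 4))\<^sup>2 = poly F (\<tau> ?r) / poly q (\<tau> ?r)"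
    using prof(4,5)[OF rr_r0, of z] by (simp add: rr_def field_simps)
  have "of_real (pp \<sigma> z * \<tau>' ?r) * (z $ 4 * lform \<sigma> z \<xi>) * cnj (z $ 4 * lform \<sigma> z \<eta>)
    = of_real (pp \<sigma> z * \<tau>' ?r * (cmod (z $ 4))\<^sup>2) * lform \<sigma> z \<xi> * cnj (lform \<sigma> z \<eta>)"
    by (simp add: cn mult_ac)
  then show ?thesis
    unfolding om_form a h \<phi> log_form_def by simp
qed

lemma norm_trans_fun_base:
  "k \<noteq> 4 \<Longrightarrow> (cmod (trans_fun s s' z $ k))\<^sup>2 = (if s k = s' k then (cmod (z $ k))\<^sup>2 else inverse ((cmod (z $ k))\<^sup>2))"
  by (simp add: trans_fun_def norm_inverse power_inverse)

lemma xn_trans_fun: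
  assumes "z \<in> torus" "k \<noteq> 4"
  shows "xn (trans_fun s s' z) k = (if s k = s' k then xn z k else 1 - xn z k)"
    and "xn (trans_fun s s' z) k / nn (trans_fun s s' z) k = xn z k / nn z k"
    and "ln (nn (trans_fun s s' z) k) = ln (nn z k) - (if s k = s' k then 0 else ln ((cmod (z $ k))\<^sup>2))"
proof -
  define x where "x = (cmod (z $ k))\<^sup>2"
  have x: "x > 0" using assms(1) by (simp add: x_def torus_def)
  have n: "nn (trans_fun s s' z) k = (if s k = s' k then 1 + x else 1 + inverse x)" "nn z k = 1 + x"
    using norm_trans_fun_base[OF assms(2), of s s' z] by (auto simp: nn_def x_def)
  have y: "xn (trans_fun s s' z) k = (if s k = s' k then x else inverse x) / nn (trans_fun s s' z) k" "xn z k = x / (1 + x)"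
    using norm_trans_fun_base[OF assms(2), of s s' z] by (auto simp: xn_def x_def n)
  have p: "1 + x \<noteq> 0" "1 + inverse x = (1 + x) / x" using x by (auto simp: field_simps)
  show "xn (trans_fun s s' z) k = (if s k = s' k then xn z k else 1 - xn z k)"
    unfolding y n using x p by (simp add: field_simps)
  have "inverse x / ((1 + x) / x) / ((1 + x) / x) = x / (1 + x) / (1 + x)"
    using x by (simp add: field_simps)
  then show "xn (trans_fun s s' z) k / nn (trans_fun s s' z) k = xn z k / nn z k"
    unfolding y n p(2) by simp
  show "ln (nn (trans_fun s s' z) k) = ln (nn z k) - (if s k = s' k then 0 else ln ((cmod (z $ k))\<^sup>2))"
    unfolding n x_def[symmetric] using x p by (simp add: ln_div)
qed

lemma sgn_fib_trans: "sgn_fib s' = (if s 4 = s' 4 then sgn_fib s else - sgn_fib s)"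
  using exhaust_2[of "s 4"] exhaust_2[of "s' 4"] by (auto simp: sgn_fib_def)

text \<open>Flipping a base coordinate turns \<open>xn\<close> into 1 - \<open>xn\<close> and
  \<open>\<xi> $ k\<close> into its negative; the surplus term \<open>\<xi> $ k\<close> is what the
  fibre component picks up.\<close>

lemma lform_trans_fun:
  assumes "z \<in> torus"
  shows "lform (sgn_fib s') (trans_fun s s' z) (mat_log s s' \<xi>) = (if s 4 = s' 4 then 1 else -1) * lform (sgn_fib s) z \<xi>"
proof -
  have "(\<Sum>k\<in>flips s s'. \<xi> $ k) = (\<Sum>k\<in>base. if s k = s' k then 0 else \<xi> $ k)"
    using flips_subset by (intro sum.mono_neutral_cong_left) (auto simp: flips_def)
  moreover have "(\<Sum>k\<in>base. if s k = s' k then 0 else \<xi> $ k) + (\<Sum>k\<in>base. of_real (xn (trans_fun s s' z) k) * mat_log s s' \<xi> $ k)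
     = (\<Sum>k\<in>base. of_real (xn z k) * \<xi> $ k)"
    unfolding sum.distrib[symmetric]
  proof (intro sum.cong refl)
    fix k :: 4 assume "k \<in> base"
    then have k: "k \<noteq> 4" by auto
    show "(if s k = s' k then 0 else \<xi> $ k) + of_real (xn (trans_fun s s' z) k) * mat_log s s' \<xi> $ k = of_real (xn z k) * \<xi> $ k"
      unfolding xn_trans_fun(1)[OF assms k] using k by (simp add: mat_log_def algebra_simps)
  qed
  ultimately have e: "(\<Sum>k\<in>base. of_real (xn (trans_fun s s' z) k) * mat_log s s' \<xi> $ k)
     = (\<Sum>k\<in>base. of_real (xn z k) * \<xi> $ k) - (\<Sum>k\<in>flips s s'. \<xi> $ k)" by (simp only: eq_diff_eq add.commute)
  have m: "mat_log s s' \<xi> $ 4 = (if s 4 = s' 4 then 1 else -1) * (\<xi> $ 4 - of_real (sgn_fib s) * (\<Sum>k\<in>flips s s'. \<xi> $ k))"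
    by (simp add: mat_log_def Let_def)
  show ?thesis
    unfolding lform_def e m sgn_fib_trans[of s' s] by (simp add: algebra_simps)
qed

lemma log_form_trans_fun:
  assumes "z \<in> torus"
  shows "log_form (sgn_fib s') h \<phi> (trans_fun s s' z) (mat_log s s' \<xi>) (mat_log s s' \<eta>) = log_form (sgn_fib s) h \<phi> z \<xi> \<eta>"
proof -
  have "(\<Sum>k\<in>base. of_real (h k * (xn (trans_fun s s' z) k / nn (trans_fun s s' z) k)) * mat_log s s' \<xi> $ k * cnj (mat_log s s' \<eta> $ k))
      = (\<Sum>k\<in>base. of_real (h k * (xn z k / nn z k)) * \<xi> $ k * cnj (\<eta> $ k))"
  proof (intro sum.cong refl)
    fix k :: 4 assume "k \<in> base"
    then have k: "k \<noteq> 4" by auto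
    show "of_real (h k * (xn (trans_fun s s' z) k / nn (trans_fun s s' z) k)) * mat_log s s' \<xi> $ k * cnj (mat_log s s' \<eta> $ k)
      = of_real (h k * (xn z k / nn z k)) * \<xi> $ k * cnj (\<eta> $ k)"
      unfolding xn_trans_fun(2)[OF assms k] using k by (simp add: mat_log_def)
  qed
  then show ?thesis
    unfolding log_form_def lform_trans_fun[OF assms] by simp
qed

lemma rr_torus: "z \<in> torus \<Longrightarrow> rr \<sigma> z = exp (ln ((cmod (z $ 4))\<^sup>2) - \<sigma> * (\<Sum>k\<in>base. ln (nn z k)))"
  by (simp add: rr_def pp_def torus_def exp_diff exp_minus divide_inverse)

text \<open>The fibre norm is a global function up to inversion. In logarithms, the flipped base
  coordinates contribute the same sum to the fibre coordinate and to the Fubini-Study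
  factors.\<close>

lemma rr_trans_fun:
  assumes "z \<in> torus"
  shows "rr (sgn_fib s') (trans_fun s s' z) = (if s 4 = s' 4 then rr (sgn_fib s) z else inverse (rr (sgn_fib s) z))"
proof -
  let ?\<epsilon> = "if s 4 = s' 4 then 1 else -1 :: real"
  have nz: "z $ k \<noteq> 0" for k using assms by (simp add: torus_def)
  let ?S = "\<Sum>k\<in>flips s s'. ln ((cmod (z $ k))\<^sup>2)"
  have S: "?S = (\<Sum>k\<in>base. if s k = s' k then 0 else ln ((cmod (z $ k))\<^sup>2))"
    using flips_subset by (intro sum.mono_neutral_cong_left) (auto simp: flips_def)
  have lp: "ln ((cmod (\<Prod>k\<in>flips s s'. z $ k))\<^sup>2) = ?S"
  proof -
    have "(cmod (\<Prod>k\<in>flips s s'. z $ k))\<^sup>2 = (\<Prod>k\<in>flips s s'. (cmod (z $ k))\<^sup>2)"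
      by (simp add: prod_norm[symmetric] prod_power_distrib)
    then show ?thesis using nz by (simp add: ln_prod)
  qed
  have P: "(\<Prod>k\<in>flips s s'. z $ k) \<noteq> 0" using nz by simp
  have "ln ((cmod (z $ 4 * (if s 4 = 1 then inverse (\<Prod>k\<in>flips s s'. z $ k) else (\<Prod>k\<in>flips s s'. z $ k))))\<^sup>2)
      = ln ((cmod (z $ 4))\<^sup>2) - sgn_fib s * ?S"
    unfolding lp[symmetric] using nz[of 4] P
    by (auto simp: sgn_fib_def norm_mult norm_inverse power_mult_distrib power_inverse ln_mult ln_inverse)
  then have 1: "ln ((cmod (trans_fun s s' z $ 4))\<^sup>2) = ?\<epsilon> * (ln ((cmod (z $ 4))\<^sup>2) - sgn_fib s * ?S)"
    unfolding trans_fun_def Let_def vec_lambda_beta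
    by (cases "s 4 = s' 4") (simp_all only: if_True if_False norm_inverse power_inverse ln_inverse mult_1 mult_minus1 eqTrueI[OF refl])
  have 2: "(\<Sum>k\<in>base. ln (nn (trans_fun s s' z) k)) = (\<Sum>k\<in>base. ln (nn z k)) - ?S"
    unfolding S sum_subtractf[symmetric]
    by (intro sum.cong refl xn_trans_fun(3)[OF assms]) auto
  have "?\<epsilon> * (a - g * t) - (if s 4 = s' 4 then g else - g) * (n - t) = ?\<epsilon> * (a - g * n)" for a g t n :: real
    by (simp add: algebra_simps)
  then have "rr (sgn_fib s') (trans_fun s s' z) = exp (?\<epsilon> * (ln ((cmod (z $ 4))\<^sup>2) - sgn_fib s * (\<Sum>k\<in>base. ln (nn z k))))"
    unfolding rr_torus[OF trans_fun_torus[OF assms]] sgn_fib_trans[of s' s] 1 2 by (simp only:)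
  then show ?thesis unfolding rr_torus[OF assms] by (simp add: exp_minus[symmetric])
qed

text \<open>One profile serves the charts with \<open>s 4 = 1\<close>, where the momentum is \<tau>
  and the base sizes are C_k - \<tau>. For the others the momentum is L - \<tau> and F and q are
  reflected, which changes the sign of \<sigma> and replaces C_k by C_k - L.\<close>

lemma extremal_exists:
  fixes C :: "4 \<Rightarrow> real"
  assumes L: "L > 0" and C: "\<And>k. k \<noteq> 4 \<Longrightarrow> C k > L"
  shows "\<exists>\<omega>. extremal P_O_O111 \<omega> \<and> toric_two_form \<omega> \<and> class_fib \<omega> = L \<and> (\<forall>k. k \<noteq> 4 \<longrightarrow> class_base \<omega> k = C k)"
proof -
  \<comment> \<open>N is q times the sum of the 2 / (C_k - x), cleared of denominators.\<close>
  define q N :: "real poly" where "q = [:C 1, -1:] * ([:C 2, -1:] * [:C 3, -1:])"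
    and "N = smult 2 ([:C 2, -1:] * [:C 3, -1:] + ([:C 1, -1:] * [:C 3, -1:] + [:C 1, -1:] * [:C 2, -1:]))"
  have q_eq: "poly q x = (\<Prod>k\<in>base. C k - x)" for x by (simp add: q_def algebra_simps)
  have q_pos: "poly q x > 0" if "x \<le> L" for x
    unfolding q_eq using C that by (intro prod_pos) (metis base_iff diff_gt_0_iff_gt less_le_trans not_le)
  have N_eq: "poly N x = (\<Sum>k\<in>base. 2 / (C k - x)) * poly q x" if "x \<le> L" for x
  proof -
    have *: "2 * (b * d + (a * d + a * b)) = (2 / a + (2 / b + 2 / d)) * (a * (b * d))"
      if "a \<noteq> 0" "b \<noteq> 0" "d \<noteq> 0" for a b d :: real
      using that by (simp add: field_simps)
    have *: "2 * ((C 2 - x) * (C 3 - x) + ((C 1 - x) * (C 3 - x) + (C 1 - x) * (C 2 - x)))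
      = (2 / (C 1 - x) + (2 / (C 2 - x) + 2 / (C 3 - x))) * ((C 1 - x) * ((C 2 - x) * (C 3 - x)))"
      using C[of 1] C[of 2] C[of 3] that by (intro *) auto
    have "poly N x = 2 * ((C 2 - x) * (C 3 - x) + ((C 1 - x) * (C 3 - x) + (C 1 - x) * (C 2 - x)))"
      by (simp add: N_def algebra_simps)
    then show ?thesis unfolding * q_eq by simp
  qed
  obtain F \<alpha> \<beta> where F: "poly F 0 = 0" "poly F L = 0" "poly (pderiv F) 0 = poly q 0"
     "poly (pderiv F) L = - poly q L" "pderiv (pderiv F) = N - [:\<beta>, \<alpha>:] * q"
    using extremal_poly_exists[OF L, of q N] q_pos by auto
  have F2: "poly (pderiv (pderiv F)) x = ((\<Sum>k\<in>base. 2 / (C k - x)) - (\<alpha> * x + \<beta>)) * poly q x" if "x \<le> L" for x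
    unfolding F(5) using N_eq[OF that] by (simp add: algebra_simps)
  have F_pos: "poly F x > 0" if "x \<in> {0<..<L}" for x
  proof (rule extremal_poly_pos[where A=base and c=C and \<alpha>=\<alpha> and \<beta>=\<beta>])
    show "poly (pderiv F) 0 > 0" "poly (pderiv F) L < 0" using F q_pos[of 0] q_pos[of L] L by auto
    show "L < C k" if "k \<in> base" for k using C that by auto
    show "poly (pderiv (pderiv F)) x = ((\<Sum>k\<in>base. 2 / (C k - x)) - (\<alpha> * x + \<beta>)) * (\<Prod>k\<in>base. C k - x)"
      if "x \<in> {0<..<L}" for x unfolding q_eq[symmetric] by (rule F2) (use that in auto)
  qed (use L F that in auto)
  define Fb qb where "Fb = pcompose F [:L, -1:]" and "qb = pcompose q [:L, -1:]"
  have Fb: "poly Fb x = poly F (L - x)" and qb: "poly qb x = poly q (L - x)" for x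
    by (simp_all add: Fb_def qb_def poly_pcompose)
  have Fb': "poly (pderiv Fb) x = - poly (pderiv F) (L - x)" "poly (pderiv (pderiv Fb)) x = poly (pderiv (pderiv F)) (L - x)" for x
    by (simp_all add: Fb_def pderiv_pcompose poly_pcompose pderiv_mult pderiv_minus pderiv_pCons)
  obtain ra \<tau>a \<tau>a' sa Ra where a: "ra < 0" "smooth_on \<tau>a {ra<..}" "smooth_on \<tau>a' {ra<..}" "smooth_on sa {ra<..}"
    "\<forall>r>ra. (\<tau>a has_real_derivative \<tau>a' r) (at r) \<and> \<tau>a' r > 0 \<and> \<tau>a r = r * sa r \<and>
        poly q (\<tau>a r) > 0 \<and> r * \<tau>a' r * poly q (\<tau>a r) = poly F (\<tau>a r)"
    "\<forall>r\<ge>0. 0 \<le> \<tau>a r \<and> \<tau>a r < L" "\<forall>r>0. \<tau>a r \<in> {0<..<L} \<and> Ra (\<tau>a r) = r"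
    "\<forall>s\<in>{0<..<L}. Ra s > 0 \<and> \<tau>a (Ra s) = s \<and> ((\<lambda>s. ln (Ra s)) has_real_derivative poly q s / poly F s) (at s)"
    "Ra (L / 2) = 1"
    using profile_exists[OF L F(1,2,3) q_pos F_pos] by auto
  have "\<exists>r0 \<tau> \<tau>' \<sigma> R. r0 < 0 \<and> smooth_on \<tau> {r0<..} \<and> smooth_on \<tau>' {r0<..} \<and> smooth_on \<sigma> {r0<..} \<and>
     (\<forall>r>r0. (\<tau> has_real_derivative \<tau>' r) (at r) \<and> \<tau>' r > 0 \<and> \<tau> r = r * \<sigma> r \<and>
        poly qb (\<tau> r) > 0 \<and> r * \<tau>' r * poly qb (\<tau> r) = poly Fb (\<tau> r)) \<and>
     (\<forall>r\<ge>0. 0 \<le> \<tau> r \<and> \<tau> r < L) \<and>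
     (\<forall>r>0. \<tau> r \<in> {0<..<L} \<and> R (\<tau> r) = r) \<and> (\<forall>s\<in>{0<..<L}. R s > 0 \<and> \<tau> (R s) = s \<and>
        ((\<lambda>s. ln (R s)) has_real_derivative poly qb s / poly Fb s) (at s)) \<and> R (L / 2) = 1"
    by (rule profile_exists[OF L]) (use F q_pos F_pos in \<open>auto simp: Fb qb Fb'\<close>)
  then obtain rb \<tau>b \<tau>b' sb Rb where b: "rb < 0" "smooth_on \<tau>b {rb<..}" "smooth_on \<tau>b' {rb<..}" "smooth_on sb {rb<..}"
    "\<forall>r>rb. (\<tau>b has_real_derivative \<tau>b' r) (at r) \<and> \<tau>b' r > 0 \<and> \<tau>b r = r * sb r \<and>
        poly qb (\<tau>b r) > 0 \<and> r * \<tau>b' r * poly qb (\<tau>b r) = poly Fb (\<tau>b r)"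
    "\<forall>r\<ge>0. 0 \<le> \<tau>b r \<and> \<tau>b r < L" "\<forall>r>0. \<tau>b r \<in> {0<..<L} \<and> Rb (\<tau>b r) = r"
    "\<forall>s\<in>{0<..<L}. Rb s > 0 \<and> \<tau>b (Rb s) = s \<and> ((\<lambda>s. ln (Rb s)) has_real_derivative poly qb s / poly Fb s) (at s)"
    "Rb (L / 2) = 1" by auto
  have ab: "\<tau>b (inverse r) = L - \<tau>a r" if "r > 0" for r
  proof (rule profile_flip[OF L, where r=r and \<tau>=\<tau>a and ?\<tau>2.0=\<tau>b and R=Ra and ?R2.0=Rb and q=q and F=F and ?q2.0=qb and ?F2.0=Fb])
    show "\<tau>a r \<in> {0<..<L}" "Ra (\<tau>a r) = r" using a(7) that by blast+
  qed (use a(8) b(8) in \<open>(blast intro: a(9) b(9) Fb qb)+\<close>)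
  have A1: "poly q x = (\<Prod>k\<in>base. C k - 1 * x)" for x unfolding q_eq by simp
  have A2: "C k - 1 * x > 0" if "x < L" "k \<noteq> 4" for x k using C[OF that(2)] that(1) by simp
  have A3: "poly (pderiv (pderiv F)) x = ((\<Sum>k\<in>base. 2 / (C k - 1 * x)) - (\<alpha> * x + \<beta>)) * poly q x" if "x < L" for x
    unfolding mult_1 by (rule F2) (use that in simp)
  interpret A: chart_profile 1 ra \<alpha> \<beta> L C F q \<tau>a \<tau>a' sa
    by unfold_locales (use a in \<open>(blast intro: A1 A2 A3)+\<close>)
  have B1: "poly qb x = (\<Prod>k\<in>base. C k - L - - 1 * x)" for x unfolding qb q_eq by (intro prod.cong) auto
  have B2: "C k - L - - 1 * x > 0" if "0 \<le> x" "k \<noteq> 4" for x k using C[OF that(2)] that(1) by simp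
  \<comment> \<open>The affine curvature function is the same, re-expanded in the reflected
    variable.\<close>
  have B3: "poly (pderiv (pderiv Fb)) x = ((\<Sum>k\<in>base. 2 / (C k - L - - 1 * x)) - (- \<alpha> * x + (\<alpha> * L + \<beta>))) * poly qb x"
    if "0 \<le> x" for x
  proof -
    have "poly (pderiv (pderiv Fb)) x = ((\<Sum>k\<in>base. 2 / (C k - (L - x))) - (\<alpha> * (L - x) + \<beta>)) * poly q (L - x)"
      unfolding Fb' by (rule F2) (use that in simp)
    moreover have "C k - (L - x) = C k - L - - 1 * x" for k by simp
    ultimately show ?thesis unfolding qb by (simp only:) (simp add: algebra_simps)
  qed
  interpret B: chart_profile "-1" rb "- \<alpha>" "\<alpha> * L + \<beta>" L "\<lambda>k. C k - L" Fb qb \<tau>b \<tau>b' sb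
    by unfold_locales (use b in \<open>(blast intro: B1 B2 B3)+\<close>)
  define \<omega> where "\<omega> c = (if inv chart c 4 = 1 then A.om else B.om)" for c :: "(bundle_coords set, 4) chart"
  have \<omega>A: "\<omega> (chart s) = A.om" if "s 4 = 1" for s using that by (simp add: \<omega>_def)
  have \<omega>B: "\<omega> (chart s) = B.om" if "s 4 = 2" for s using that by (simp add: \<omega>_def)
  have cases: "s 4 = 1 \<or> s 4 = 2" for s :: "4 \<Rightarrow> 2" by (rule exhaust_2)
  have tor: "toric_form (\<omega> (chart s))" and pos: "pos_form (\<omega> (chart s))" for s
    using cases[of s] A.om_toric B.om_toric A.om_pos B.om_pos \<omega>A \<omega>B by auto
  have rr_pos: "rr \<sigma> z > 0" if "z \<in> torus" for \<sigma> z using rr_torus[OF that] by simp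
  have sg: "s 4 = 1 \<Longrightarrow> sgn_fib s = 1" "s 4 = 2 \<Longrightarrow> sgn_fib s = -1" for s by (auto simp: sgn_fib_def)
  \<comment> \<open>The momentum as one global function, always measured from the end covered by the
    charts with \<open>s 4 = 1\<close>.\<close>
  define ta where "ta s z = (if s 4 = 1 then \<tau>a (rr (sgn_fib s) z) else L - \<tau>b (rr (sgn_fib s) z))" for s z
  have \<omega>_log: "\<omega> (chart s) z (z * \<xi>) (z * \<eta>)
      = log_form (sgn_fib s) (\<lambda>k. C k - ta s z) (poly F (ta s z) / poly q (ta s z)) z \<xi> \<eta>" for s z \<xi> \<eta>
    using cases[of s]
  proof
    assume s: "s 4 = 1"
    then show ?thesis unfolding \<omega>A[of s, OF s] A.om_log ta_def by (simp add: sg(1)[of s, OF s])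
  next
    assume s: "s 4 = 2"
    have "(\<lambda>k. C k - L - - 1 * \<tau>b (rr (- 1) z)) = (\<lambda>k. C k - ta s z)"
      by (simp add: ta_def s sg(2)[of s, OF s] fun_eq_iff)
    then show ?thesis unfolding \<omega>B[of s, OF s] B.om_log Fb qb by (simp add: ta_def s sg(2)[of s, OF s])
  qed
  have ta_trans: "ta s' (trans_fun s s' z) = ta s z" if z: "z \<in> torus" for s s' z
  proof -
    have ab': "\<tau>b r = L - \<tau>a (inverse r)" if "r > 0" for r using ab[of "inverse r"] that by simp
    show ?thesis
      using cases[of s] cases[of s'] rr_trans_fun[OF z, of s' s] ab[OF rr_pos[OF z]] ab'[OF rr_pos[OF z]]
      by (auto simp: ta_def)
  qed
  have tf: "two_form P_O_O111 \<omega>"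
    unfolding two_form_iff
  proof (intro conjI allI ballI)
    show "local_two_form (\<omega> (chart s))" for s using toric_formD(1)[OF tor] by (simp add: local_two_form_eq)
    fix s s' z \<xi> \<eta> assume z: "z \<in> torus"
    show "\<omega> (chart s) z (z * \<xi>) (z * \<eta>) = \<omega> (chart s') (trans_fun s s' z) (trans_fun s s' z * mat_log s s' \<xi>)
       (trans_fun s s' z * mat_log s s' \<eta>)"
      unfolding \<omega>_log ta_trans[OF z] log_form_trans_fun[OF z] ..
  qed
  then have ttf: "toric_two_form \<omega>" using tor by (simp add: toric_two_form_def)
  have kf: "kaehler_form P_O_O111 \<omega>"
    unfolding kaehler_iff using tf tor pos by (auto simp: toric_form_def)
  have "holomorphic_map_on (extremal_gradient \<omega> (chart s)) UNIV" for s
  proof -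
    have h: "holomorphic_map_on (\<lambda>z. \<chi> j :: 4. of_real \<gamma> * (if j = 4 then z $ 4 else 0)) (UNIV :: (complex^4) set)" for \<gamma>
    proof (rule holomorphic_map_onI)
      fix z :: "complex^4" and l :: 4
      show "chol (\<lambda>z. (\<chi> j :: 4. of_real \<gamma> * (if j = 4 then z $ 4 else 0)) $ l) z"
        by (cases "l = 4") (auto intro!: chol_mult chol_const chol_nth)
    qed
    show ?thesis using cases[of s]
    proof
      assume s: "s 4 = 1"
      have "extremal_gradient \<omega> (chart s) = (\<lambda>z. \<chi> j. of_real \<alpha> * (if j = 4 then z $ 4 else 0))"
        using A.extremal_gradient_om[where \<omega>=\<omega> and C="chart s", OF \<omega>A[of s, OF s]] by blast
      then show ?thesis using h by simp
    next
      assume s: "s 4 = 2"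
      have "extremal_gradient \<omega> (chart s) = (\<lambda>z. \<chi> j. of_real (- \<alpha>) * (if j = 4 then z $ 4 else 0))"
        using B.extremal_gradient_om[where \<omega>=\<omega> and C="chart s", OF \<omega>B[of s, OF s]] by blast
      then show ?thesis using h[of "- \<alpha>"] by simp
    qed
  qed
  then have ext: "extremal P_O_O111 \<omega>"
    unfolding extremal_def using kf by (simp add: P_O_O111_eq image_chart del: image_image)
  \<comment> \<open>The class numbers are evaluated at the common point 1, where each base sphere is
    at its equator: both base moments are (C_k - \<tau>) / 2, so that adding the fibre moment \<tau>
    gives C_k.\<close>
  define \<rho> where "\<rho> = rr 1 (1 :: complex^4)"
  have \<rho>: "\<rho> > 0" unfolding \<rho>_def by (rule rr_pos) (simp add: torus_def)
  have rm: "rr (-1) (1 :: complex^4) = inverse \<rho>"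
    by (simp add: \<rho>_def rr_def pp_def exp_minus[symmetric])
  have nn1: "nn 1 k = 2" for k by (simp add: nn_def)
  have g1: "gm \<omega> (\<lambda>_. 1) k = (if k = 4 then \<tau>a \<rho> else (C k - \<tau>a \<rho>) / 2)" for k
    unfolding gm_def \<omega>A[of "\<lambda>_. 1", OF refl] A.mom_om by (simp add: \<rho>_def nn1)
  have g2: "gm \<omega> (\<lambda>_. 2) k = (if k = 4 then L - \<tau>a \<rho> else (C k - \<tau>a \<rho>) / 2)" for k
    unfolding gm_def \<omega>B[of "\<lambda>_. 2", OF refl] B.mom_om rm ab[OF \<rho>] by (simp add: nn1)
  have "class_fib \<omega> = L" "class_base \<omega> k = C k" if "k \<noteq> 4" for k
    using that by (simp_all add: class_fib_def class_base_def g1 g2)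
  then show ?thesis using ext ttf by (intro exI[of _ \<omega>]) (auto simp: class_fib_def g1 g2)
qed

theorem calabi_dream_P_O_O111: "calabi_dream_manifold P_O_O111"
  unfolding calabi_dream_manifold_def
proof (intro conjI allI impI)
  show "compact_complex_manifold P_O_O111" by (rule compact_complex_manifold_P_O_O111)
  show "\<exists>\<omega>. kaehler_form P_O_O111 \<omega>"
    using extremal_exists[of 1 "\<lambda>_. 2"] by (auto simp: extremal_def)
  fix \<omega> assume "kaehler_form P_O_O111 \<omega>"
  from average[OF this] obtain \<omega>1 where 1: "kaehler_form P_O_O111 \<omega>1" "cohomologous P_O_O111 \<omega> \<omega>1"
    "\<And>s. T_invariant (\<omega>1 (chart s))" by blast
  then have t: "toric_two_form \<omega>1" and p: "\<And>s. pos_form (\<omega>1 (chart s))"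
    by (auto simp: kaehler_iff toric_two_form_def toric_form_def two_form_iff local_two_form_eq)
  obtain \<omega>2 where 2: "extremal P_O_O111 \<omega>2" "toric_two_form \<omega>2" "class_fib \<omega>2 = class_fib \<omega>1"
    "\<forall>k. k \<noteq> 4 \<longrightarrow> class_base \<omega>2 k = class_base \<omega>1 k"
    using extremal_exists[of "class_fib \<omega>1" "class_base \<omega>1", OF class_fib_pos[OF t p] class_base_gt[OF t p]] by blast
  have "cohomologous P_O_O111 \<omega>1 \<omega>2"
    by (rule cohomologous_if_class_eq[OF t 2(2)]) (use 2 in auto)
  then show "\<exists>\<omega>'. extremal P_O_O111 \<omega>' \<and> cohomologous P_O_O111 \<omega> \<omega>'"
    using 2(1) 1(2) cohomologous_trans by blast
qed

section \<open>The moment polytope\<close>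

text \<open>The normal \<open>nrm k c\<close> corresponds to the homogeneous coordinate \<open>x $ k $ c\<close> for \<open>k \<noteq> 4\<close>, and to
  \<open>y $ c\<close> for \<open>k = 4\<close>.\<close>

definition nrm :: "4 \<Rightarrow> 2 \<Rightarrow> real^4" where
  "nrm k c = (if k = 4 then (if c = 1 then - axis 4 1 else axis 4 1)
     else if c = 1 then axis k 1 else - axis k 1 - axis 4 1)"

definition polyt :: "(real^4) set" where "polyt = {x. \<forall>k c. x \<bullet> nrm k c \<ge> -1}"

lemma polytD: "x \<in> polyt \<Longrightarrow> x \<bullet> nrm k c + 1 \<ge> 0"
proof -
  assume "x \<in> polyt"
  then have "-1 \<le> x \<bullet> nrm k c" by (auto simp: polyt_def)
  then show ?thesis by linarith
qed

text \<open>The point at which the four facets with normals \<open>nrm i (t i)\<close> meet;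
  \<open>h\<close> is its fourth coordinate.\<close>

definition vtx :: "(4 \<Rightarrow> 2) \<Rightarrow> real^4" where
  "vtx t = (let h = if t 4 = 1 then 1 else -1 in \<chi> k. if k = 4 then h else if t k = 1 then -1 else 1 - h)"

text \<open>The basis dual to the normals \<open>nrm i (t i)\<close>: along the i-th vector only the
  i-th of the facets at the vertex is left.\<close>

definition edir :: "(4 \<Rightarrow> 2) \<Rightarrow> 4 \<Rightarrow> real^4" where
  "edir t i = (let h = if t 4 = 1 then -1 else 1 in
     if i = 4 then \<chi> k. if k = 4 then h else if t k = 1 then 0 else - h
     else (if t i = 1 then axis i 1 else - axis i 1))"

lemma inner_nrm: "x \<bullet> nrm k c = (if k = 4 then (if c = 1 then - x $ 4 else x $ 4)
    else if c = 1 then x $ k else - x $ k - x $ 4)"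
  by (simp add: nrm_def inner_axis inner_diff_right)

lemma two_cases: "c = 1 \<or> c = (2::2)" by (rule exhaust_2)

lemma flip_two: "(c + 1 = 1) \<longleftrightarrow> c \<noteq> (1::2)"
  using two_cases[of c] by auto

text \<open>The two fibre normals cancel, while the two normals of a base factor add up to
  \<open>- axis 4 1\<close>; the latter is the twist by \<open>O(1,1,1)\<close>.\<close>

lemma inner_nrm_flip: "x \<bullet> nrm k (c + 1) = (if k = 4 then 0 else - x $ 4) - x \<bullet> nrm k c"
  using two_cases[of c] by (elim disjE) (simp_all add: inner_nrm)

lemma inner_edir_nrm: "edir t i \<bullet> nrm j (t j) = (if i = j then 1 else 0)"
  by (auto simp: inner_nrm edir_def Let_def axis_def)

lemma expand_edir: "x = (\<Sum>i\<in>UNIV. (x \<bullet> nrm i (t i)) *\<^sub>R edir t i)"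
  by (auto simp: vec_eq_iff sum_4 inner_nrm edir_def Let_def axis_def forall_4)

lemma vtx_nrm: "vtx t \<bullet> nrm i (t i) = -1"
  using two_cases[of "t 4"] by (auto simp: inner_nrm vtx_def Let_def)

lemma vtx_flip: "vtx t \<bullet> nrm i (t i + 1) > -1"
  unfolding inner_nrm_flip vtx_nrm by (auto simp: vtx_def Let_def)

lemma vtx_nrm_eq: "vtx t \<bullet> nrm i c = -1 \<longleftrightarrow> c = t i"
proof -
  have "c = t i \<or> c = t i + 1" using two_cases[of c] two_cases[of "t i"] by auto
  moreover have "t i + 1 \<noteq> t i" by simp
  ultimately show ?thesis using vtx_nrm[of t i] vtx_flip[of t i] by auto
qed

lemma vtx_in_polyt: "vtx t \<in> polyt"
  unfolding polyt_def
proof (intro CollectI allI)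
  fix k c
  have "c = t k \<or> c = t k + 1" using two_cases[of c] two_cases[of "t k"] by auto
  then show "vtx t \<bullet> nrm k c \<ge> -1" using vtx_nrm[of t k] vtx_flip[of t k] by auto
qed

lemma minus_vtx: "x - vtx t = (\<Sum>i\<in>UNIV. (x \<bullet> nrm i (t i) + 1) *\<^sub>R edir t i)"
  by (subst expand_edir[of _ t]) (simp add: inner_diff_left vtx_nrm)

lemma vtx_update: "vtx (t(i := t i + 1)) = vtx t + (vtx t \<bullet> nrm i (t i + 1) + 1) *\<^sub>R edir t i"
proof -
  have "(\<Sum>j\<in>UNIV. (vtx (t(i := t i + 1)) \<bullet> nrm j (t j) + 1) *\<^sub>R edir t j)
      = (vtx (t(i := t i + 1)) \<bullet> nrm i (t i) + 1) *\<^sub>R edir t i"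
    (is "sum ?f UNIV = _")
  proof -
    have "?f j = 0" if "j \<noteq> i" for j using vtx_nrm[of "t(i := t i + 1)" j] that by simp
    then have "sum ?f UNIV = sum ?f {i}" by (intro sum.mono_neutral_right) auto
    then show ?thesis by simp
  qed
  moreover have "vtx (t(i := t i + 1)) \<bullet> nrm i (t i) = vtx t \<bullet> nrm i (t i + 1)"
    using two_cases[of "t i"] by (auto simp: inner_nrm vtx_def Let_def)
  ultimately show ?thesis using minus_vtx[of "vtx (t(i := t i + 1))" t] by (simp add: algebra_simps)
qed

section \<open>Vertices and edges of the polytope\<close>

lemma convex_polyt: "convex polyt" and closed_polyt: "closed polyt"
proof -
  have e: "polyt = (\<Inter>k. \<Inter>c. {x. nrm k c \<bullet> x \<ge> -1})" by (auto simp: polyt_def inner_commute)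
  show "convex polyt" unfolding e by (intro convex_INT convex_halfspace_ge)
  show "closed polyt" unfolding e by (intro closed_INT ballI closed_halfspace_ge)
qed

lemma polyt_iff: "x \<in> polyt \<longleftrightarrow> \<bar>x $ 4\<bar> \<le> 1 \<and> (\<forall>k\<in>base. x $ k \<ge> -1 \<and> x $ k + x $ 4 \<le> 1)"
  by (auto simp: polyt_def forall_4 forall_2 inner_nrm)

lemma compact_polyt: "compact polyt"
proof -
  have "\<bar>x $ k\<bar> \<le> 2" if "x \<in> polyt" for x k
    using that exhaust_4[of k] by (elim disjE) (auto simp: polyt_iff abs_le_iff)
  then have "norm x \<le> 8" if "x \<in> polyt" for x
    using norm_le_l1_cart[of x] sum_mono[of "UNIV :: 4 set" "\<lambda>i. \<bar>x $ i\<bar>" "\<lambda>_. 2"] that by fastforce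
  then have "bounded polyt" by (auto simp: bounded_iff)
  then show ?thesis by (simp add: compact_eq_bounded_closed closed_polyt)
qed

lemma eq_vtx: "(\<And>i. x \<bullet> nrm i (t i) = -1) \<Longrightarrow> x = vtx t"
  using minus_vtx[of x t] by simp

lemma extreme_vtx: "vtx t extreme_point_of polyt"
  unfolding extreme_point_of_def
proof (intro conjI ballI notI vtx_in_polyt)
  fix a b assume ab: "a \<in> polyt" "b \<in> polyt" "vtx t \<in> open_segment a b"
  then obtain u where u: "0 < u" "u < 1" "vtx t = (1 - u) *\<^sub>R a + u *\<^sub>R b" and ne: "a \<noteq> b"
    by (auto simp: in_segment)
  have "a \<bullet> nrm i (t i) = -1 \<and> b \<bullet> nrm i (t i) = -1" for i
  proof -
    have "(1 - u) * (a \<bullet> nrm i (t i) + 1) + u * (b \<bullet> nrm i (t i) + 1) = 0"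
      using vtx_nrm[of t i] unfolding u(3) by (simp add: inner_add_left algebra_simps)
    moreover have "a \<bullet> nrm i (t i) + 1 \<ge> 0" "b \<bullet> nrm i (t i) + 1 \<ge> 0" using ab by (auto simp: polytD)
    moreover have "(1 - u) * (a \<bullet> nrm i (t i) + 1) \<ge> 0" "u * (b \<bullet> nrm i (t i) + 1) \<ge> 0"
      using calculation u by auto
    ultimately have "(1 - u) * (a \<bullet> nrm i (t i) + 1) = 0" "u * (b \<bullet> nrm i (t i) + 1) = 0" by linarith+
    then show ?thesis using u by auto
  qed
  then have "a = vtx t" "b = vtx t" by (auto intro: eq_vtx)
  then show False using ne by simp
qed

lemma not_extremeI: "d \<noteq> 0 \<Longrightarrow> x + d \<in> S \<Longrightarrow> x - d \<in> S \<Longrightarrow> \<not> x extreme_point_of S"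
  for d :: "'a::real_vector"
proof -
  assume d: "d \<noteq> 0" "x + d \<in> S" "x - d \<in> S"
  have "x = midpoint (x + d) (x - d)" by (simp add: midpoint_def algebra_simps scaleR_2[symmetric])
  moreover have "x + d \<noteq> x - d" using d(1) by (simp add: algebra_simps scaleR_2[symmetric])
  ultimately have "x \<in> open_segment (x + d) (x - d)" by (metis midpoint_in_open_segment)
  then show ?thesis using d unfolding extreme_point_of_def by blast
qed

text \<open>If neither facet of some pair is active at x, then x can be moved both ways: along the
  k-th axis for a base pair, and, once all base pairs have an active facet, along the fibre edge
  direction that keeps these facets active.\<close>

lemma extreme_polyt: "x extreme_point_of polyt \<longleftrightarrow> (\<exists>t. x = vtx t)"
proof
  assume x: "x extreme_point_of polyt"
  then have P: "x \<in> polyt" by (auto simp: extreme_point_of_def)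
  have base: "\<exists>c. x \<bullet> nrm k c = -1" if k: "k \<noteq> 4" for k
  proof (rule ccontr)
    assume "\<nexists>c. x \<bullet> nrm k c = -1"
    then have "x \<bullet> nrm k 1 \<noteq> -1" "x \<bullet> nrm k 2 \<noteq> -1" by auto
    then have n: "x $ k > -1" "x $ k + x $ 4 < 1"
      using k polytD[OF P, of k 1] polytD[OF P, of k 2] by (auto simp: inner_nrm)
    define e where "e = min (x $ k + 1) (1 - x $ k - x $ 4)"
    have e: "e > 0" "e \<le> x $ k + 1" "e \<le> 1 - x $ k - x $ 4" using n by (auto simp: e_def)
    have "x + axis k e \<in> polyt" "x - axis k e \<in> polyt" 
      using P k e unfolding polyt_iff by (auto simp: axis_def)
    moreover have "axis k e \<noteq> 0" using e by simp
    ultimately show False using not_extremeI x by metis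
  qed
  then obtain t0 where t0: "\<And>k. k \<noteq> 4 \<Longrightarrow> x \<bullet> nrm k (t0 k) = -1" by metis
  have "\<exists>c. x \<bullet> nrm 4 c = -1"
  proof (rule ccontr)
    assume "\<nexists>c. x \<bullet> nrm 4 c = -1"
    then have "x \<bullet> nrm 4 1 \<noteq> -1" "x \<bullet> nrm 4 2 \<noteq> -1" by auto
    then have n: "x $ 4 > -1" "x $ 4 < 1"
      using polytD[OF P, of 4 1] polytD[OF P, of 4 2] by (auto simp: inner_nrm)
    define e where "e = min (x $ 4 + 1) (1 - x $ 4)"
    have e: "e > 0" "e \<le> x $ 4 + 1" "e \<le> 1 - x $ 4" using n by (auto simp: e_def)
    \<comment> \<open>The active base facets stay active, and with them the opposite ones are
      governed by the coordinate 4 alone. The value \<open>t0 4\<close> is unspecified and affects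
      only the sign of the direction.\<close>
    have i: "(x + r *\<^sub>R edir t0 4) \<bullet> nrm k c \<ge> -1" if "\<bar>r\<bar> \<le> e" for r k c
    proof -
      have c: "c = t0 k \<or> c = t0 k + 1" using two_cases[of c] two_cases[of "t0 k"] by auto
      have r: "\<bar>(edir t0 4) $ 4\<bar> = 1" by (auto simp: edir_def Let_def)
      then have "\<bar>r * edir t0 4 $ 4\<bar> \<le> e" using that by (simp add: abs_mult)
      then have x4: "\<bar>(x + r *\<^sub>R edir t0 4) $ 4\<bar> \<le> 1" using e by auto
      show ?thesis
      proof (cases "k = 4")
        case True then show ?thesis using x4 by (auto simp: inner_nrm)
      next
        case False
        have "(x + r *\<^sub>R edir t0 4) \<bullet> nrm k (t0 k) = -1"
          using t0[OF False] False by (simp add: inner_add_left inner_edir_nrm)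
        then show ?thesis using c x4 inner_nrm_flip[of "x + r *\<^sub>R edir t0 4" k "t0 k"] False by auto
      qed
    qed
    have "x + e *\<^sub>R edir t0 4 \<in> polyt" "x - e *\<^sub>R edir t0 4 \<in> polyt"
      using i[of e] i[of "-e"] e unfolding polyt_def by auto
    moreover have "edir t0 4 \<bullet> nrm 4 (t0 4) = 1" by (simp add: inner_edir_nrm)
    then have "e *\<^sub>R edir t0 4 \<noteq> 0" using e by auto
    ultimately show False using not_extremeI x by metis
  qed
  then obtain c where "x \<bullet> nrm 4 c = -1" ..
  then have "x = vtx (t0(4 := c))" using t0 by (intro eq_vtx) auto
  then show "\<exists>t. x = vtx t" by blast
qed (auto simp: extreme_vtx)

lemma polyt_eq_hull: "polyt = convex hull (range vtx)"
  using Krein_Milman_Minkowski[OF compact_polyt convex_polyt] by (simp add: extreme_polyt full_SetCompr_eq)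

lemma polytope_polyt: "polytope polyt"
  unfolding polytope_def using polyt_eq_hull by (meson finite_imageI finite)

lemma interior_polytI:
  assumes "\<And>k c. x \<bullet> nrm k c > -1"
  shows "x \<in> interior polyt"
proof (rule interiorI)
  show "open (\<Inter>k. \<Inter>c. {x. nrm k c \<bullet> x > -1})" by (intro open_INT ballI open_halfspace_gt finite)
  show "x \<in> (\<Inter>k. \<Inter>c. {x. nrm k c \<bullet> x > -1})" using assms by (auto simp: inner_commute)
qed (auto simp: polyt_def inner_commute less_imp_le)

lemma zero_interior_polyt: "0 \<in> interior polyt"
  by (rule interior_polytI) simp

lemma vtx_lattice: "vtx t \<in> integer_lattice"
  by (auto simp: integer_lattice_def vtx_def Let_def)

lemma nrm_lattice: "nrm k c \<in> integer_lattice"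
  by (auto simp: integer_lattice_def nrm_def axis_def)

lemma edir_lattice: "edir t i \<in> integer_lattice"
  by (auto simp: integer_lattice_def edir_def Let_def axis_def)

lemma inner_lattice: "x \<in> integer_lattice \<Longrightarrow> x \<bullet> nrm k c \<in> \<int>"
  by (auto simp: integer_lattice_def inner_nrm)

lemma lattice_basis_edir: "lattice_basis (edir t)"
  unfolding lattice_basis_def
proof (intro conjI ballI allI edir_lattice)
  fix x :: "real^4" assume x: "x \<in> integer_lattice"
  show "\<exists>!a. x = (\<Sum>i\<in>UNIV. of_int (a i) *\<^sub>R edir t i)"
  proof (rule ex1I[of _ "\<lambda>i. \<lfloor>x \<bullet> nrm i (t i)\<rfloor>"])
    show "x = (\<Sum>i\<in>UNIV. of_int \<lfloor>x \<bullet> nrm i (t i)\<rfloor> *\<^sub>R edir t i)"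
      using expand_edir[of x t] inner_lattice[OF x] by simp
    fix a :: "4 \<Rightarrow> int" assume a: "x = (\<Sum>i\<in>UNIV. of_int (a i) *\<^sub>R edir t i)"
    have "x \<bullet> nrm j (t j) = of_int (a j)" for j
      unfolding a by (simp add: inner_sum_left inner_edir_nrm if_distrib cong: if_cong)
    then show "a = (\<lambda>i. \<lfloor>x \<bullet> nrm i (t i)\<rfloor>)" by simp
  qed
qed

text \<open>Each segment is the face on which the three other facets at the vertex are active.
  Conversely, an edge through the vertex is exposed by a functional that does not increase along any
  edge direction and must vanish on one of them, so the edge contains the corresponding segment;
  equal dimension gives equality.\<close>

lemma edges_polyt:
  "{E. E edge_of polyt \<and> vtx t \<in> E} = range (\<lambda>i. closed_segment (vtx t) (vtx t + (vtx t \<bullet> nrm i (t i + 1) + 1) *\<^sub>R edir t i))"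
proof -
  let ?w = "\<lambda>i. vtx t \<bullet> nrm i (t i + 1) + 1"
  let ?S = "\<lambda>i. closed_segment (vtx t) (vtx t + ?w i *\<^sub>R edir t i)"
  have w: "?w i > 0" for i using vtx_flip[of t i] by simp
  have nb: "vtx t + ?w i *\<^sub>R edir t i \<in> polyt" for i using vtx_update[of t i] vtx_in_polyt by metis
  have edge: "?S i edge_of polyt" for i
  proof -
    \<comment> \<open>The sum of the three other normals is at least -3 on the polytope, with
      equality exactly when all three facets are active.\<close>
    define g where "g = (\<Sum>j\<in>UNIV - {i}. nrm j (t j))"
    have g: "x \<in> polyt \<Longrightarrow> g \<bullet> x \<ge> -3" for x
    proof -
      assume "x \<in> polyt"
      then have "(\<Sum>j\<in>UNIV - {i}. nrm j (t j) \<bullet> x) \<ge> (\<Sum>j\<in>UNIV - {i}. -1)"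
        by (intro sum_mono) (auto simp: polyt_def inner_commute)
      then show ?thesis by (simp add: g_def inner_sum_left)
    qed
    have eq: "polyt \<inter> {x. g \<bullet> x = -3} = ?S i"
    proof (intro set_eqI iffI)
      fix x assume x: "x \<in> polyt \<inter> {x. g \<bullet> x = -3}"
      have "(\<Sum>j\<in>UNIV - {i}. x \<bullet> nrm j (t j) + 1) = 0"
        using x by (simp add: g_def inner_sum_left inner_sum_right sum.distrib inner_commute)
      then have z: "x \<bullet> nrm j (t j) + 1 = 0" if "j \<noteq> i" for j
        using x that by (subst (asm) sum_nonneg_eq_0_iff) (auto simp: polytD)
      define c where "c = x \<bullet> nrm i (t i) + 1"
      have "(\<Sum>j\<in>UNIV. (x \<bullet> nrm j (t j) + 1) *\<^sub>R edir t j) = (\<Sum>j\<in>{i}. (x \<bullet> nrm j (t j) + 1) *\<^sub>R edir t j)"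
        by (intro sum.mono_neutral_right) (auto simp: z)
      then have xc: "x = vtx t + c *\<^sub>R edir t i" using minus_vtx[of x t] by (simp add: c_def algebra_simps)
      have e4: "i \<noteq> 4 \<Longrightarrow> edir t i $ 4 = 0" by (simp add: edir_def Let_def axis_def)
      have "x \<bullet> nrm i (t i + 1) = ?w i - 1 - c"
        unfolding xc inner_nrm_flip[of _ i "t i"] using e4 by (auto simp: inner_add_left inner_edir_nrm)
      moreover have "x \<bullet> nrm i (t i + 1) \<ge> -1" "x \<bullet> nrm i (t i) \<ge> -1" using x by (auto simp: polyt_def)
      ultimately have c: "0 \<le> c" "c \<le> ?w i" by (auto simp: c_def)
      have "v + c *\<^sub>R e = (1 - c / r) *\<^sub>R v + (c / r) *\<^sub>R (v + r *\<^sub>R e)" if "r > 0" for v e :: "real^4" and r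
        using that by (simp add: scaleR_add_right scaleR_diff_left)
      then have "x = (1 - c / ?w i) *\<^sub>R vtx t + (c / ?w i) *\<^sub>R (vtx t + ?w i *\<^sub>R edir t i)"
        using w[of i] unfolding xc by blast
      then show "x \<in> ?S i" unfolding in_segment using c w[of i] by (intro exI[of _ "c / ?w i"]) auto
    next
      fix x assume x: "x \<in> ?S i"
      then have p: "x \<in> polyt"
        using nb[of i] vtx_in_polyt[of t] convex_polyt by (meson convex_contains_segment subsetD)
      obtain u where u: "x = vtx t + (u * ?w i) *\<^sub>R edir t i"
        using x by (auto simp: in_segment algebra_simps)
      have "x \<bullet> nrm j (t j) = -1" if "j \<in> UNIV - {i}" for j
        unfolding u using that by (simp add: inner_add_left vtx_nrm inner_edir_nrm)
      then have "g \<bullet> x = (\<Sum>j\<in>UNIV - {i}. -1)" unfolding g_def inner_sum_left by (intro sum.cong) (auto simp: inner_commute)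
      then show "x \<in> polyt \<inter> {x. g \<bullet> x = -3}" using p by simp
    qed
    have "?S i face_of polyt"
      unfolding eq[symmetric] by (rule face_of_Int_supporting_hyperplane_ge[OF convex_polyt g])
    moreover have "edir t i \<noteq> 0" using inner_edir_nrm[of t i i] by auto
    then have "aff_dim (?S i) = 1" using w[of i] by (simp add: segment_convex_hull aff_dim_convex_hull aff_dim_2)
    ultimately show ?thesis by (simp add: edge_of_def)
  qed
  show ?thesis
  proof (intro set_eqI iffI)
    fix E assume "E \<in> range ?S"
    then show "E \<in> {E. E edge_of polyt \<and> vtx t \<in> E}" using edge by auto
  next
    fix E assume "E \<in> {E. E edge_of polyt \<and> vtx t \<in> E}"
    then have E: "E face_of polyt" "aff_dim E = 1" "vtx t \<in> E" by (auto simp: edge_of_def)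
    then have "E exposed_face_of polyt"
      using exposed_face_of_polyhedron polytope_imp_polyhedron[OF polytope_polyt] by blast
    then obtain a b where ab: "polyt \<subseteq> {x. a \<bullet> x \<le> b}" "E = polyt \<inter> {x. a \<bullet> x = b}"
      by (auto simp: exposed_face_of_def)
    have "E \<noteq> {vtx t}" using E(2) by auto
    then obtain x where x: "x \<in> E" "x \<noteq> vtx t" using E(3) by blast
    have v: "a \<bullet> vtx t = b" using E(3) ab(2) by auto
    have n: "a \<bullet> edir t i \<le> 0" for i
    proof -
      have "a \<bullet> (vtx t + ?w i *\<^sub>R edir t i) \<le> b" using ab(1) nb by blast
      then have "?w i * (a \<bullet> edir t i) \<le> 0" by (simp add: inner_add_right v)
      then show ?thesis using w[of i] by (simp add: mult_le_0_iff)
    qed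
    let ?c = "\<lambda>i. x \<bullet> nrm i (t i) + 1"
    have c: "?c i \<ge> 0" for i using x ab(2) by (auto simp: polytD)
    have "\<exists>i. x \<bullet> nrm i (t i) \<noteq> -1" using eq_vtx[of x t] x(2) by blast
    then have "\<exists>i. ?c i \<noteq> 0" by (simp only: eq_neg_iff_add_eq_0)
    then obtain i where i: "?c i \<noteq> 0" by blast
    \<comment> \<open>x - vtx t is a combination of edge directions with coefficients >= 0, and a is
      <= 0 on each of them; the products sum to 0, so each of them vanishes.\<close>
    have "a \<bullet> (x - vtx t) = 0" using x ab(2) v by (auto simp: inner_diff_right)
    then have "(\<Sum>i\<in>UNIV. - (?c i * (a \<bullet> edir t i))) = 0"
      unfolding minus_vtx by (simp add: inner_sum_right sum_negf)
    then have "- (?c i * (a \<bullet> edir t i)) = 0"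
      using c n by (subst (asm) sum_nonneg_eq_0_iff) (auto simp: mult_nonneg_nonpos)
    then have "a \<bullet> edir t i = 0" using i by simp
    then have "vtx t + ?w i *\<^sub>R edir t i \<in> E" using nb ab(2) v by (simp add: inner_add_right)
    then have sub: "?S i \<subseteq> E" using E face_of_imp_convex[OF E(1)] by (meson convex_contains_segment)
    have "?S i face_of E"
      using edge[of i] face_of_subset[OF _ sub face_of_imp_subset[OF E(1)]] by (auto simp: edge_of_def)
    then have "?S i = E"
      using face_of_aff_dim_lt[OF face_of_imp_convex[OF E(1)]] E(2) edge[of i] by (force simp: edge_of_def)
    then show "E \<in> range ?S" by blast
  qed
qed

lemma delzant_polyt: "delzant polyt"
  unfolding delzant_def
proof (intro conjI allI impI polytope_polyt)
  show "interior polyt \<noteq> {}" using zero_interior_polyt by auto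
  fix v assume "v extreme_point_of polyt"
  then obtain t where t: "v = vtx t" by (auto simp: extreme_polyt)
  show "\<exists>b w. lattice_basis b \<and> (\<forall>i. w i > 0) \<and>
        {E. E edge_of polyt \<and> v \<in> E} = range (\<lambda>i. closed_segment v (v + w i *\<^sub>R b i))"
    unfolding t
  proof (intro exI conjI allI)
    show "lattice_basis (edir t)" by (rule lattice_basis_edir)
    show "vtx t \<bullet> nrm i (t i + 1) + 1 > 0" for i using vtx_flip[of t i] by simp
  qed (rule edges_polyt)
qed

subsection \<open>The dual polytope\<close>

text \<open>The signs of the base coordinates select the base normals. Each negative coordinate also
  lowers the fourth one through the twist, and \<open>r\<close> is what the fibre normal then has to
  supply.\<close>

lemma fan_complete: "\<exists>t a. (\<forall>i. a i \<ge> 0) \<and> y = (\<Sum>i\<in>UNIV. a i *\<^sub>R nrm i (t i))"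
proof -
  define r where "r = y $ 4 + (\<Sum>k\<in>base. max 0 (- y $ k))"
  define t :: "4 \<Rightarrow> 2" where "t k = (if k = 4 then if r \<ge> 0 then 2 else 1 else if y $ k \<ge> 0 then 1 else 2)" for k
  define a where "a k = (if k = 4 then \<bar>r\<bar> else \<bar>y $ k\<bar>)" for k
  have "y = (\<Sum>i\<in>UNIV. a i *\<^sub>R nrm i (t i))"
    unfolding vec_eq_iff forall_4
    by (simp add: sum_4 a_def t_def nrm_def axis_def) (auto simp: r_def)
  then show ?thesis by (intro exI[of _ t] exI[of _ a]) (auto simp: a_def)
qed

definition nrms :: "(real^4) set" where "nrms = (\<Union>k. range (nrm k))"

lemma finite_nrms: "finite nrms" by (simp add: nrms_def)

text \<open>A dual point is a nonnegative combination of the normals of one cone. Pairing it with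
  the vertex of that cone, where all these normals take the value -1, bounds the sum of the
  coefficients by 1.\<close>

lemma dual_polyt: "dual_polytope polyt = convex hull nrms"
proof
  show "convex hull nrms \<subseteq> dual_polytope polyt"
  proof (rule hull_minimal)
    show "nrms \<subseteq> dual_polytope polyt" by (auto simp: nrms_def dual_polytope_def polyt_def)
    have e: "dual_polytope polyt = (\<Inter>x\<in>polyt. {y. x \<bullet> y \<ge> -1})" by (auto simp: dual_polytope_def)
    show "convex (dual_polytope polyt)" unfolding e by (intro convex_INT convex_halfspace_ge)
  qed
  show "dual_polytope polyt \<subseteq> convex hull nrms"
  proof
    fix y assume y: "y \<in> dual_polytope polyt"
    obtain t a where a: "\<And>i. a i \<ge> 0" and ya: "y = (\<Sum>i\<in>UNIV. a i *\<^sub>R nrm i (t i))"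
      using fan_complete by blast
    have n: "nrm k c \<in> convex hull nrms" for k c by (rule hull_inc) (auto simp: nrms_def)
    have "vtx t \<bullet> y = - (\<Sum>i\<in>UNIV. a i)" by (simp add: ya inner_sum_right vtx_nrm sum_negf)
    then have s: "(\<Sum>i\<in>UNIV. a i) \<le> 1" using y vtx_in_polyt[of t] by (auto simp: dual_polytope_def)
    \<comment> \<open>The weight missing to 1 is placed on the origin, which the opposite fibre
      normals put into the hull.\<close>
    have "0 = (1/2) *\<^sub>R nrm 4 1 + (1/2) *\<^sub>R nrm 4 2" by (simp add: nrm_def)
    then have 0: "0 \<in> convex hull nrms"
      using convexD[OF convex_convex_hull n[of 4 1] n[of 4 2], of "1/2" "1/2"] by simp
    show "y \<in> convex hull nrms"
    proof (cases "(\<Sum>i\<in>UNIV. a i) = 0")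
      case True
      then have "a i = 0" for i using a by (simp add: sum_nonneg_eq_0_iff)
      then show ?thesis using 0 by (simp add: ya)
    next
      case False
      define s where "s = (\<Sum>i\<in>UNIV. a i)"
      have sp: "s > 0" "s \<le> 1" using False a s sum_nonneg[of UNIV a] by (auto simp: s_def less_le)
      have "(\<Sum>i\<in>UNIV. (a i / s) *\<^sub>R nrm i (t i)) \<in> convex hull nrms"
        using sp a n by (intro convex_sum) (auto simp: sum_divide_distrib[symmetric] s_def[symmetric])
      moreover have "(\<Sum>i\<in>UNIV. (a i / s) *\<^sub>R nrm i (t i)) = (1 / s) *\<^sub>R y"
        by (simp add: ya scaleR_sum_right)
      ultimately have "(1 - s) *\<^sub>R 0 + s *\<^sub>R ((1 / s) *\<^sub>R y) \<in> convex hull nrms"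
        using sp by (intro convexD[OF convex_convex_hull 0]) auto
      then show ?thesis using sp by simp
    qed
  qed
qed

lemma nrm_inj: "nrm k c = nrm k' c' \<Longrightarrow> k = k' \<and> c = c'"
  using exhaust_4[of k] exhaust_4[of k'] two_cases[of c] two_cases[of c']
  by (elim disjE) (auto simp: nrm_def vec_eq_iff forall_4 axis_def)

lemma rays_polyt: "rays polyt = nrms"
proof -
  have "nrm k c extreme_point_of (convex hull nrms)" for k c
  proof -
    \<comment> \<open>A functional with value at most -1 at this normal only. For
      \<open>nrm 4 1\<close> the vector \<open>axis 4 1\<close> would be -1 on the twisted base
      normals as well; the entries - 1/2 raise these values to - 1/2.\<close>
    define q :: "real^4" where "q = (if k = 4 then if c = 1 then \<chi> j. if j = 4 then 1 else - 1 / 2 else - axis 4 1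
       else if c = 1 then - axis k 1 else axis k 1)"
    have q: "q \<bullet> nrm k' c' \<le> -1 \<longleftrightarrow> k' = k \<and> c' = c" for k' c'
      using exhaust_4[of k] exhaust_4[of k'] two_cases[of c] two_cases[of c']
      by (elim disjE) (simp_all add: inner_nrm q_def axis_def)
    have "convex hull (nrms - {nrm k c}) \<subseteq> {y. q \<bullet> y > -1}"
      using q by (intro hull_minimal convex_halfspace_gt) (force simp: nrms_def not_le[symmetric])
    then have "nrm k c \<notin> convex hull (nrms - {nrm k c})" using q[of k c] by force
    then have "nrm k c extreme_point_of (convex hull (insert (nrm k c) (nrms - {nrm k c})))"
      by (intro extreme_point_of_convex_hull_insert) (simp_all add: finite_nrms)
    moreover have "insert (nrm k c) (nrms - {nrm k c}) = nrms" by (auto simp: nrms_def)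
    ultimately show ?thesis by simp
  qed
  then show ?thesis
    unfolding rays_def dual_polyt using extreme_point_of_convex_hull by (fastforce simp: nrms_def)
qed

lemma fano_polyt: "fano_polytope polyt"
  unfolding fano_polytope_def lattice_polytope_def
proof (intro conjI delzant_polyt zero_interior_polyt exI)
  show "polyt = convex hull (range vtx)" by (rule polyt_eq_hull)
  show "dual_polytope polyt = convex hull nrms" by (rule dual_polyt)
qed (auto simp: vtx_lattice nrm_lattice nrms_def)

lemma cone_rays_polyt: "cone_rays polyt (vtx t) = range (\<lambda>i. nrm i (t i))"
  unfolding cone_rays_def rays_polyt by (auto simp: nrms_def vtx_nrm_eq)

section \<open>The toric manifold of the moment polytope\<close>

lemma nrms_eq: "nrms = (\<lambda>(k, c). nrm k c) ` UNIV"
  by (force simp: nrms_def)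

lemma nrm_in_nrms [simp]: "nrm k c \<in> nrms" by (auto simp: nrms_def)

lemma prod_nrms: "(\<Prod>u\<in>nrms. f u) = (\<Prod>k\<in>UNIV. f (nrm k 1) * f (nrm k 2) :: complex)"
proof -
  have "inj (\<lambda>(k, c). nrm k c)" by (auto intro!: injI dest: nrm_inj)
  then have "(\<Prod>u\<in>nrms. f u) = (\<Prod>x\<in>UNIV \<times> UNIV. f (nrm (fst x) (snd x)))"
    unfolding nrms_eq UNIV_Times_UNIV by (simp add: prod.reindex split_def)
  also have "\<dots> = (\<Prod>k\<in>UNIV. \<Prod>c\<in>UNIV. f (nrm k c))" by (simp add: prod.cartesian_product split_def)
  finally show ?thesis by (simp add: UNIV_2)
qed

text \<open>The characters given by the four axis vectors yield the relations, and the relations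
  imply all others. One scalar per base factor and one for the fibre remain, which is the group in
  \<open>bundle_orbit\<close>.\<close>

lemma cox_group_polyt: "t \<in> cox_group polyt \<longleftrightarrow> t \<in> nrms \<rightarrow>\<^sub>E (UNIV - {0}) \<and>
    (\<forall>k\<in>base. t (nrm k 1) = t (nrm k 2)) \<and> t (nrm 4 2) = t (nrm 4 1) * (\<Prod>k\<in>base. t (nrm k 1))"
  (is "_ \<longleftrightarrow> ?A \<and> ?B")
proof -
  let ?C = "\<lambda>m. (\<Prod>u\<in>nrms. t u powi \<lfloor>m \<bullet> u\<rfloor>) = 1"
  have "(\<forall>m\<in>integer_lattice. ?C m) \<longleftrightarrow> ?B" if t: ?A
  proof
    have nz: "t (nrm k c) \<noteq> 0" for k c using t by (auto simp: PiE_iff)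
    assume C: "\<forall>m\<in>integer_lattice. ?C m"
    have fm: "\<lfloor>- 1 :: real\<rfloor> = -1" by linarith
    have pm: "x powi - 1 = inverse x" for x :: complex using power_int_minus[of x 1] by simp
    have l: "axis k 1 \<in> integer_lattice" for k :: 4 by (auto simp: integer_lattice_def axis_def)
    have b: "t (nrm k 1) = t (nrm k 2)" if "k \<in> base" for k
    proof -
      have "t (nrm k 1) * inverse (t (nrm k 2)) = 1"
        using bspec[OF C l[of k]] that unfolding prod_nrms UNIV_4 inner_nrm
        by (elim insertE emptyE) (simp_all add: axis_def fm pm)
      then show ?thesis using nz[of k 2] by (simp add: field_simps)
    qed
    have "inverse (t (nrm 1 2)) * (inverse (t (nrm 2 2)) * (inverse (t (nrm 3 2)) * (inverse (t (nrm 4 1)) * t (nrm 4 2)))) = 1"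
      using bspec[OF C l[of 4]] unfolding prod_nrms UNIV_4 inner_nrm by (simp add: axis_def fm pm)
    then have "t (nrm 4 2) = t (nrm 4 1) * (t (nrm 1 2) * (t (nrm 2 2) * t (nrm 3 2)))"
      using nz[of 1 2] nz[of 2 2] nz[of 3 2] nz[of 4 1] by (simp add: field_simps)
    with b show ?B by simp
  next
    have nz: "t (nrm k c) \<noteq> 0" for k c using t by (auto simp: PiE_iff)
    assume B: ?B
    show "\<forall>m\<in>integer_lattice. ?C m"
    proof
      fix m :: "real^4" assume "m \<in> integer_lattice"
      then have "\<exists>a. m $ k = of_int a" for k by (auto simp: integer_lattice_def Ints_def)
      then obtain a where a: "\<And>k. m $ k = of_int (a k)" by metis
      have f: "\<lfloor>- real_of_int x\<rfloor> = - x" "\<lfloor>- real_of_int x - real_of_int y\<rfloor> = - x - y" for x y by linarith+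
      have p: "x powi i * x powi (- i - j) = inverse (x powi j)" if "x \<noteq> 0" for x :: complex and i j
        using that by (simp add: power_int_diff power_int_minus field_simps)
      show "?C m"
        unfolding prod_nrms UNIV_4 inner_nrm
        using B nz by (simp add: a f p power_int_mult_distrib power_int_minus) (simp add: nz field_simps)
    qed
  qed
  then show ?thesis unfolding cox_group_def rays_polyt by blast
qed

section \<open>Cox coordinates as homogeneous coordinates of the bundle\<close>

definition conv :: "(real^4 \<Rightarrow> complex) \<Rightarrow> bundle_coords" where
  "conv z = ((\<chi> k c. z (nrm (emb k) c)), (\<chi> c. z (nrm 4 c)))"

definition cox_pts :: "(real^4 \<Rightarrow> complex) set" where "cox_pts = nrms \<rightarrow>\<^sub>E UNIV"

lemma emb_cases: "k = 4 \<or> (\<exists>j. k = emb j)"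
proof -
  have "1 = emb 1" "2 = emb 2" "3 = emb 3" by simp_all
  then show ?thesis using exhaust_4[of k] by blast
qed

lemma inj_emb: "inj emb"
  by (auto simp: inj_def forall_3)

lemma emb_neq_4 [simp]: "emb k \<noteq> 4"
  by (simp add: emb_def)

lemma conv_inj: "w \<in> cox_pts \<Longrightarrow> w' \<in> cox_pts \<Longrightarrow> conv w = conv w' \<Longrightarrow> w = w'"
proof (rule PiE_ext)
  fix u assume w: "conv w = conv w'" and "u \<in> nrms"
  then obtain k c where u: "u = nrm k c" by (auto simp: nrms_def)
  show "w u = w' u" using w emb_cases[of k] by (auto simp: conv_def vec_eq_iff u)
qed (auto simp: cox_pts_def)

lemma conv_surj: "\<exists>w\<in>cox_pts. conv w = a"
proof -
  obtain x y where a: "a = (x, y)" by fastforce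
  define g where "g k c = (if k = 4 then y $ c else x $ (inv emb k) $ c)" for k c
  define w where "w = (\<lambda>u\<in>nrms. g (fst (inv (\<lambda>(k, c). nrm k c) u)) (snd (inv (\<lambda>(k, c). nrm k c) u)))"
  have i: "inj (\<lambda>(k, c). nrm k c)" by (auto intro!: injI dest: nrm_inj)
  have w: "w (nrm k c) = g k c" for k c
    using inv_f_f[OF i, of "(k, c)"] by (simp add: w_def)
  have "inv emb (emb k) = k" for k by (rule inv_f_f) (rule inj_emb)
  then have "conv w = a" by (simp add: conv_def w g_def a vec_eq_iff)
  moreover have "w \<in> cox_pts" by (simp add: w_def cox_pts_def)
  ultimately show ?thesis by blast
qed

lemma conv_cox_orbit:
  assumes "z \<in> cox_pts"
  shows "w \<in> cox_orbit polyt z \<longleftrightarrow> w \<in> cox_pts \<and> conv w \<in> bundle_orbit (conv z)"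
proof
  assume "w \<in> cox_orbit polyt z"
  then obtain t where t: "t \<in> cox_group polyt" "w = (\<lambda>u\<in>nrms. t u * z u)"
    by (auto simp: cox_orbit_def rays_polyt)
  have w: "w (nrm k c) = t (nrm k c) * z (nrm k c)" for k c using t by simp
  have nz: "t (nrm k c) \<noteq> 0" for k c using t by (auto simp: cox_group_polyt PiE_iff)
  have e: "t (nrm (emb k) 2) = t (nrm (emb k) 1)" for k
    using t exhaust_3[of k] by (auto simp: cox_group_polyt emb_def)
  have e4: "t (nrm 4 2) = t (nrm 4 1) * (\<Prod>k\<in>UNIV. t (nrm (emb k) 1))"
    using t prod_emb[of "\<lambda>k. t (nrm k 1)"] by (simp add: cox_group_polyt)
  have "conv w \<in> bundle_orbit (conv z)"
    unfolding conv_def w bundle_orbit_iff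
    by (intro exI[of _ "\<chi> k. t (nrm (emb k) 1)"] exI[of _ "t (nrm 4 1)"])
      (simp add: nz vec_eq_iff forall_2 e e4)
  then show "w \<in> cox_pts \<and> conv w \<in> bundle_orbit (conv z)" using t by (simp add: cox_pts_def)
next
  assume w: "w \<in> cox_pts \<and> conv w \<in> bundle_orbit (conv z)"
  then obtain t s where t: "\<And>k. t $ k \<noteq> 0" "s \<noteq> 0"
    "(\<chi> k c. w (nrm (emb k) c)) = (\<chi> k. t $ k *s (\<chi> c. z (nrm (emb k) c)))"
    "(\<chi> c. w (nrm 4 c)) = (vector [s * z (nrm 4 1), s * (\<Prod>k\<in>UNIV. t $ k) * z (nrm 4 2)] :: complex^2)"
    unfolding conv_def bundle_orbit_iff by auto
  obtain r where r: "r \<in> cox_pts" "conv r = ((\<chi> k c. t $ k), vector [s, s * (\<Prod>k\<in>UNIV. t $ k)])"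
    using conv_surj by blast
  have r1: "r (nrm (emb k) c) = t $ k" "r (nrm 4 1) = s" "r (nrm 4 2) = s * (\<Prod>k\<in>UNIV. t $ k)" for k c
    using r(2) two_cases[of c] by (auto simp: conv_def vec_eq_iff forall_2)
  have b: "\<exists>j. k = emb j" if "k \<in> base" for k using that emb_cases[of k] by auto
  have "r u \<noteq> 0" if u: "u \<in> nrms" for u
  proof -
    obtain k c where "u = nrm k c" using u by (auto simp: nrms_def)
    then show ?thesis using emb_cases[of k] two_cases[of c] t(1,2) by (auto simp: r1)
  qed
  moreover have "r (nrm k 1) = r (nrm k 2)" if "k \<in> base" for k using b[OF that] by (auto simp: r1)
  moreover have "(\<Prod>k\<in>UNIV. t $ k) = (\<Prod>k\<in>base. r (nrm k 1))"
    using prod_emb[of "\<lambda>k. r (nrm k 1)"] by (simp add: r1)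
  ultimately have "r \<in> cox_group polyt" using r(1) by (auto simp: cox_group_polyt cox_pts_def PiE_iff r1)
  moreover have "w = (\<lambda>u\<in>nrms. r u * z u)"
  proof (rule conv_inj)
    show "conv w = conv (\<lambda>u\<in>nrms. r u * z u)"
      using t(3,4) by (simp add: conv_def r1 vec_eq_iff forall_2)
  qed (use w in \<open>auto simp: cox_pts_def\<close>)
  ultimately show "w \<in> cox_orbit polyt z" by (auto simp: cox_orbit_def rays_polyt)
qed

lemma cox_orbit_eq: "z \<in> cox_pts \<Longrightarrow> cox_orbit polyt z = {w \<in> cox_pts. conv w \<in> bundle_orbit (conv z)}"
  using conv_cox_orbit by blast

lemma image_conv_cox_orbit: "z \<in> cox_pts \<Longrightarrow> conv ` cox_orbit polyt z = bundle_orbit (conv z)"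
  by (auto simp: cox_orbit_eq image_iff) (metis conv_surj)

definition unconv :: "bundle_coords set \<Rightarrow> (real^4 \<Rightarrow> complex) set" where
  "unconv q = {w \<in> cox_pts. conv w \<in> q}"

text \<open>The toric chart of a vertex requires the coordinates outside its cone to be nonzero, and
  the bundle chart those selected by its index; the chart of \<open>vtx t\<close> is hence that of
  the complementary index.\<close>

definition opp :: "(4 \<Rightarrow> 2) \<Rightarrow> 4 \<Rightarrow> 2" where "opp t k = t k + 1"

lemma opp_eq: "opp t k = (if t k = 1 then 2 else 1)"
  using two_cases[of "t k + 1"] flip_two[of "t k"] by (auto simp: opp_def)

lemma opp_opp: "opp (opp t) = t"
  by (auto simp: opp_def fun_eq_iff add.assoc)

lemma fst_chart_conv: "fst (chart (opp t)) = {bundle_orbit (conv z) | z. z \<in> cox_pts \<and> (\<forall>k. z (nrm k (opp t k)) \<noteq> 0)}"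
  (is "_ = ?R")
proof (intro set_eqI iffI)
  fix p assume "p \<in> fst (chart (opp t))"
  then obtain x y where xy: "p = bundle_orbit (x, y)" "\<forall>k. x $ k $ opp t (emb k) \<noteq> 0" "y $ opp t 4 \<noteq> 0"
    by (auto simp: chart_def bundle_chart_domain_def)
  obtain z where z: "z \<in> cox_pts" "conv z = (x, y)" using conv_surj by blast
  have "z (nrm k (opp t k)) \<noteq> 0" for k
    using z(2) xy emb_cases[of k] by (auto simp: conv_def)
  then show "p \<in> ?R" using xy(1) z by force
next
  fix p assume "p \<in> ?R"
  then obtain z where z: "p = bundle_orbit (conv z)" "z \<in> cox_pts" "\<And>k. z (nrm k (opp t k)) \<noteq> 0" by blast
  then show "p \<in> fst (chart (opp t))"
    by (force simp: chart_def bundle_chart_domain_def conv_def vec_eq_iff)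
qed

lemma toric_chart_domain_polyt:
  "toric_chart_domain polyt (vtx t) = {cox_orbit polyt z | z. z \<in> cox_pts \<and> (\<forall>k. z (nrm k (opp t k)) \<noteq> 0)}"
proof -
  have "nrms - range (\<lambda>i. nrm i (t i)) = range (\<lambda>k. nrm k (opp t k))"
  proof -
    have c: "c = t k \<or> c = opp t k" for c k using two_cases[of c] two_cases[of "t k"] by (auto simp: opp_def)
    have "opp t k \<noteq> t k" for k by (simp add: opp_def)
    moreover have "u \<in> range (\<lambda>k. nrm k (opp t k))" if u: "u \<in> nrms" "u \<notin> range (\<lambda>i. nrm i (t i))" for u
    proof -
      obtain k d where k: "u = nrm k d" using u(1) by (auto simp: nrms_def)
      with u(2) have "d = opp t k" using c[of d k] by blast
      then show ?thesis using k by blast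
    qed
    ultimately show ?thesis by (auto dest: nrm_inj)
  qed
  then show ?thesis unfolding toric_chart_domain_def rays_polyt cone_rays_polyt cox_pts_def by auto
qed

lemma conv_domain: "p \<in> toric_chart_domain polyt (vtx t) \<Longrightarrow> conv ` p \<in> fst (chart (opp t)) \<and> unconv (conv ` p) = p"
proof -
  assume "p \<in> toric_chart_domain polyt (vtx t)"
  then obtain z where z: "p = cox_orbit polyt z" "z \<in> cox_pts" "\<forall>k. z (nrm k (opp t k)) \<noteq> 0"
    unfolding toric_chart_domain_polyt by blast
  then have "conv ` p = bundle_orbit (conv z)" using image_conv_cox_orbit by blast
  then show ?thesis using z by (auto simp only: fst_chart_conv unconv_def cox_orbit_eq)
qed

lemma unconv_domain: "q \<in> fst (chart (opp t)) \<Longrightarrow> unconv q \<in> toric_chart_domain polyt (vtx t) \<and> conv ` unconv q = q"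
proof -
  assume "q \<in> fst (chart (opp t))"
  then obtain z where z: "q = bundle_orbit (conv z)" "z \<in> cox_pts" "\<forall>k. z (nrm k (opp t k)) \<noteq> 0"
    unfolding fst_chart_conv by blast
  then have "unconv q = cox_orbit polyt z" by (simp add: unconv_def cox_orbit_eq)
  then show ?thesis using z image_conv_cox_orbit[OF z(2)] by (auto simp only: toric_chart_domain_polyt)
qed

text \<open>\<open>toric_manifold\<close> has a chart for every ordering of the dual basis, so its
  charts agree with those of the bundle only up to a permutation of the coordinates.\<close>

definition permv :: "('n \<Rightarrow> 'n) \<Rightarrow> complex^'n \<Rightarrow> complex^'n" where "permv \<pi> z = (\<chi> i. z $ \<pi> i)"

lemma permv_permv: "permv \<pi> (permv \<rho> z) = permv (\<rho> \<circ> \<pi>) z" by (simp add: permv_def)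

lemma permv_id: "permv id z = z" by (simp add: permv_def)

text \<open>The exponents of the monomial are 1 at \<open>nrm l (t l)\<close> and -1 at the opposite
  normal. The fibre direction has a component along the fourth axis too, which puts it on all
  opposite base normals with one sign and so produces the factor \<open>e\<close> or its
  inverse.\<close>

lemma toric_chart_map_polyt:
  assumes p: "p \<in> toric_chart_domain polyt (vtx t)"
  shows "toric_chart_map polyt (\<lambda>i. edir t (\<pi> i)) p = permv \<pi> (snd (chart (opp t)) (conv ` p))"
proof -
  obtain z where z: "p = cox_orbit polyt z" "z \<in> cox_pts" "\<And>k. z (nrm k (opp t k)) \<noteq> 0"
    using p unfolding toric_chart_domain_polyt by blast
  define w where "w = (SOME w. w \<in> p)"
  have "z \<in> p" using z bundle_orbit_refl by (simp add: cox_orbit_eq)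
  then have w: "w \<in> p" unfolding w_def by (rule someI[of "\<lambda>w. w \<in> p"])
  then have wc: "w \<in> cox_pts" "conv w \<in> bundle_orbit (conv z)" using z by (auto simp: cox_orbit_eq)
  have pw: "conv ` p = bundle_orbit (conv w)"
    using bundle_orbit_eq[OF wc(2)] image_conv_cox_orbit[OF z(2)] z(1) by simp
  obtain r where r: "r \<in> cox_group polyt" "w = (\<lambda>u\<in>nrms. r u * z u)"
    using w z(1) by (auto simp: cox_orbit_def rays_polyt)
  have nz: "w (nrm k (opp t k)) \<noteq> 0" for k
    using r z(3) by (auto simp: cox_group_polyt PiE_iff)
  let ?s = "opp t"
  have s1: "?s k + 1 = t k" for k by (simp add: opp_def add.assoc)
  have ex: "(\<Prod>u\<in>nrms. w u powi \<lfloor>edir t l \<bullet> u\<rfloor>) = (\<Prod>k\<in>UNIV. w (nrm k (t k)) powi (if l = k then 1 else 0) *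
      w (nrm k (?s k)) powi ((if k = 4 then 0 else - \<lfloor>edir t l $ 4\<rfloor>) - (if l = k then 1 else 0)))" for l
  proof -
    have i: "edir t l $ 4 = of_int \<lfloor>edir t l $ 4\<rfloor>" using edir_lattice[of t l] by (simp add: integer_lattice_def)
    have 1: "\<lfloor>edir t l \<bullet> nrm k (t k)\<rfloor> = (if l = k then 1 else 0)" for k by (simp add: inner_edir_nrm)
    have "edir t l \<bullet> nrm k (t k + 1) = of_int ((if k = 4 then 0 else - \<lfloor>edir t l $ 4\<rfloor>) - (if l = k then 1 else 0))" for k
      unfolding inner_nrm_flip inner_edir_nrm using i by auto
    then have 2: "\<lfloor>edir t l \<bullet> nrm k (?s k)\<rfloor> = (if k = 4 then 0 else - \<lfloor>edir t l $ 4\<rfloor>) - (if l = k then 1 else 0)" for k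
      unfolding opp_def by (simp only: floor_of_int)
    have e: "f (nrm k 1) * f (nrm k 2) = f (nrm k (t k)) * f (nrm k (?s k))" for f :: "_ \<Rightarrow> complex" and k
      using two_cases[of "t k"] by (auto simp: opp_eq)
    show ?thesis unfolding prod_nrms
      by (intro prod.cong refl) (simp only: e[of "\<lambda>u. w u powi \<lfloor>edir t l \<bullet> u\<rfloor>"] 1 2)
  qed
  have co: "(\<Prod>u\<in>nrms. w u powi \<lfloor>edir t l \<bullet> u\<rfloor>) = snd (chart ?s) (bundle_orbit (conv w)) $ l" for l
  proof -
    have cm: "snd (chart ?s) (bundle_orbit (conv w)) =
      (let u = (\<lambda>k. w (nrm (emb k) (t (emb k))) / w (nrm (emb k) (?s (emb k)))); e = (\<Prod>k\<in>UNIV. w (nrm (emb k) (?s (emb k))))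
       in vector [u 1, u 2, u 3, if ?s 4 = 1 then w (nrm 4 2) / (e * w (nrm 4 1)) else e * w (nrm 4 1) / w (nrm 4 2)])"
      unfolding chart_def conv_def by (simp add: bundle_chart_map_orbit nz s1 Let_def)
    have fm: "\<lfloor>- 1 :: real\<rfloor> = -1" by linarith
    show ?thesis
    proof (cases "l = 4")
      case True
      have h: "edir t 4 $ 4 = (if ?s 4 = 1 then 1 else -1)"
        using two_cases[of "t 4"] by (auto simp: edir_def Let_def opp_eq)
      have e: "(\<Prod>k\<in>UNIV. w (nrm (emb k) (?s (emb k)))) = w (nrm 1 (?s 1)) * w (nrm 2 (?s 2)) * w (nrm 3 (?s 3))"
        by (rule prod_emb)
      have "t 4 = 1 \<and> ?s 4 = 2 \<or> t 4 = 2 \<and> ?s 4 = 1" using two_cases[of "t 4"] by (auto simp: opp_eq)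
      then show ?thesis
        unfolding ex cm True h Let_def e using nz[of 1] nz[of 2] nz[of 3] nz[of 4]
        by (elim disjE conjE; simp only: UNIV_4; simp add: fm divide_inverse)
    next
      case False
      then have h: "edir t l $ 4 = 0" by (simp add: edir_def Let_def axis_def)
      show ?thesis
        unfolding ex cm h Let_def using exhaust_4[of l] False
        by (elim disjE; simp only: UNIV_4; simp add: divide_inverse)
    qed
  qed
  show ?thesis
    unfolding toric_chart_map_def rays_polyt Let_def w_def[symmetric] co pw permv_def ..
qed

text \<open>An enumeration of the rays of a cone differs from \<open>nrm i (t i)\<close> by a
  permutation, and the dual basis is determined by it.\<close>

lemma toric_manifold_polyt:
  "toric_manifold polyt = {(toric_chart_domain polyt (vtx t), toric_chart_map polyt (\<lambda>i. edir t (\<pi> i))) | t \<pi>. bij \<pi>}"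
proof -
  have "(\<exists>b. bij_betw b UNIV (cone_rays polyt (vtx t)) \<and> (\<forall>i j. m i \<bullet> b j = (if i = j then 1 else 0))) \<longleftrightarrow>
      (\<exists>\<pi>. bij \<pi> \<and> m = (\<lambda>i. edir t (\<pi> i)))" for m t
  proof
    let ?n = "\<lambda>i. nrm i (t i)"
    have n: "bij_betw ?n UNIV (cone_rays polyt (vtx t))"
      unfolding cone_rays_polyt bij_betw_def by (auto intro!: injI dest: nrm_inj)
    {
      assume "\<exists>b. bij_betw b UNIV (cone_rays polyt (vtx t)) \<and> (\<forall>i j. m i \<bullet> b j = (if i = j then 1 else 0))"
      then obtain b where b: "bij_betw b UNIV (cone_rays polyt (vtx t))" "\<And>i j. m i \<bullet> b j = (if i = j then 1 else 0)"
        by blast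
      define \<pi> where "\<pi> = inv_into UNIV ?n \<circ> b"
      have \<pi>: "bij \<pi>" unfolding \<pi>_def by (rule bij_betw_trans[OF b(1) bij_betw_inv_into[OF n]])
      have "b j \<in> cone_rays polyt (vtx t)" for j using b(1) by (auto simp: bij_betw_def)
      then have bn: "b j = ?n (\<pi> j)" for j
        using bij_betw_inv_into_right[OF n, of "b j"] by (simp add: \<pi>_def)
      have "m i \<bullet> ?n k = (if \<pi> i = k then 1 else 0)" for i k
        using b(2)[of i "inv \<pi> k"] \<pi> by (auto simp: bn bij_is_surj surj_f_inv_f bij_is_inj)
      then have "m i = edir t (\<pi> i)" for i
        by (subst expand_edir[of _ t]) (simp add: if_distrib[of "\<lambda>c. c *\<^sub>R _"] cong: if_cong)
      then show "\<exists>\<pi>. bij \<pi> \<and> m = (\<lambda>i. edir t (\<pi> i))" using \<pi> by blast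
    }
    assume "\<exists>\<pi>. bij \<pi> \<and> m = (\<lambda>i. edir t (\<pi> i))"
    then obtain \<pi> where \<pi>: "bij \<pi>" "m = (\<lambda>i. edir t (\<pi> i))" by blast
    show "\<exists>b. bij_betw b UNIV (cone_rays polyt (vtx t)) \<and> (\<forall>i j. m i \<bullet> b j = (if i = j then 1 else 0))"
      using \<pi>(1) by (intro exI[of _ "?n \<circ> \<pi>"] conjI bij_betw_trans[OF _ n])
        (auto simp: \<pi>(2) inner_edir_nrm bij_def inj_eq)
  qed
  note iff = this
  show ?thesis
  proof (intro set_eqI iffI)
    fix c assume "c \<in> toric_manifold polyt"
    then obtain t m where c: "c = (toric_chart_domain polyt (vtx t), toric_chart_map polyt m)"
      "\<exists>b. bij_betw b UNIV (cone_rays polyt (vtx t)) \<and> (\<forall>i j. m i \<bullet> b j = (if i = j then 1 else 0))"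
      unfolding toric_manifold_def extreme_polyt by blast
    then show "c \<in> {(toric_chart_domain polyt (vtx t), toric_chart_map polyt (\<lambda>i. edir t (\<pi> i))) | t \<pi>. bij \<pi>}"
      using iff[of t m] by blast
  next
    fix c assume "c \<in> {(toric_chart_domain polyt (vtx t), toric_chart_map polyt (\<lambda>i. edir t (\<pi> i))) | t \<pi>. bij \<pi>}"
    then obtain t \<pi> where c: "c = (toric_chart_domain polyt (vtx t), toric_chart_map polyt (\<lambda>i. edir t (\<pi> i)))" "bij \<pi>"
      by blast
    then show "c \<in> toric_manifold polyt"
      using iff[of t "\<lambda>i. edir t (\<pi> i)"] unfolding toric_manifold_def extreme_polyt by blast
  qed
qed

lemma linear_permv: "linear (permv \<pi> :: complex^'n::finite \<Rightarrow> complex^'n)"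
  by (rule linearI) (auto simp: permv_def vec_eq_iff)

lemma has_derivative_permv: "(permv \<pi> has_derivative permv \<pi>) (at z)" for z :: "complex^'n::finite"
  using linear_permv[of \<pi>] by (simp add: linear_conv_bounded_linear bounded_linear_imp_has_derivative)

lemma holomorphic_permv_comp:
  assumes "holomorphic_map_on f S"
  shows "holomorphic_map_on (\<lambda>z. permv \<pi> (f z)) S"
  unfolding holomorphic_map_on_def
proof
  fix z assume "z \<in> S"
  then obtain D where D: "(f has_derivative D) (at z)" "\<And>v. D (\<i> *s v) = \<i> *s D v"
    using assms by (auto simp: holomorphic_map_on_def)
  have "((\<lambda>z. permv \<pi> (f z)) has_derivative (\<lambda>v. permv \<pi> (D v))) (at z)"
    by (rule has_derivative_compose[OF D(1) has_derivative_permv])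
  then show "\<exists>D. ((\<lambda>z. permv \<pi> (f z)) has_derivative D) (at z) \<and> (\<forall>v. D (\<i> *s v) = \<i> *s D v)"
    by (intro exI[of _ "\<lambda>v. permv \<pi> (D v)"] conjI) (auto simp: D permv_def vec_eq_iff)
qed

lemma holomorphic_comp_permv:
  assumes "holomorphic_map_on f S"
  shows "holomorphic_map_on (\<lambda>z. f (permv \<pi> z)) (permv \<pi> -` S)"
  unfolding holomorphic_map_on_def
proof
  fix z assume "z \<in> permv \<pi> -` S"
  then obtain D where D: "(f has_derivative D) (at (permv \<pi> z))" "\<And>v. D (\<i> *s v) = \<i> *s D v"
    using assms by (auto simp: holomorphic_map_on_def)
  have "((\<lambda>z. f (permv \<pi> z)) has_derivative (\<lambda>v. D (permv \<pi> v))) (at z)"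
    by (rule has_derivative_compose[OF has_derivative_permv D(1)])
  moreover have "permv \<pi> (\<i> *s v) = \<i> *s permv \<pi> v" for v by (simp add: permv_def vec_eq_iff)
  ultimately show "\<exists>D. ((\<lambda>z. f (permv \<pi> z)) has_derivative D) (at z) \<and> (\<forall>v. D (\<i> *s v) = \<i> *s D v)"
    by (intro exI[of _ "\<lambda>v. D (permv \<pi> v)"] conjI) (auto simp: D)
qed

lemma holomorphic_trans_fun: "holomorphic_map_on (trans_fun s s') (overl s s')"
  by (intro holomorphic_map_onI chol_trans_fun)

lemma points_toric_polyt: "points (toric_manifold polyt) = (\<Union>t. toric_chart_domain polyt (vtx t))"
  unfolding points_def toric_manifold_polyt using bij_id by fastforce

lemma points_eq_opp: "points P_O_O111 = (\<Union>t. fst (chart (opp t)))"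
proof -
  have "range opp = UNIV" using opp_opp by (metis surjI)
  then have "range chart = range (\<lambda>t. chart (opp t))" by (metis image_image)
  then show ?thesis by (simp add: points_def P_O_O111_eq)
qed

theorem biholomorphic_toric_polyt: "biholomorphic (toric_manifold polyt) P_O_O111"
  unfolding biholomorphic_def
proof (intro exI conjI ballI)
  show "unconv (conv ` p) = p" if "p \<in> points (toric_manifold polyt)" for p
    using that conv_domain by (auto simp: points_toric_polyt)
  show "conv ` unconv q = q" if "q \<in> points P_O_O111" for q
    using that unconv_domain by (auto simp: points_eq_opp)
  show "holomorphic_between (toric_manifold polyt) P_O_O111 ((`) conv)"
    unfolding holomorphic_between_def
  proof (intro conjI ballI)
    show "(`) conv ` points (toric_manifold polyt) \<subseteq> points P_O_O111"
      using conv_domain unfolding points_toric_polyt points_eq_opp by blast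
    fix c d assume "c \<in> toric_manifold polyt" "d \<in> P_O_O111"
    then obtain t \<pi> s' where c: "c = (toric_chart_domain polyt (vtx t), toric_chart_map polyt (\<lambda>i. edir t (\<pi> i)))"
      and \<pi>: "bij \<pi>" and d: "d = chart s'" by (auto simp: toric_manifold_polyt P_O_O111_eq)
    let ?s = "opp t" and ?\<rho> = "inv \<pi>"
    let ?W = "snd c ` {p \<in> fst c. conv ` p \<in> fst d}"
    have perm: "permv ?\<rho> (permv \<pi> z) = z" "permv \<pi> (permv ?\<rho> z) = z" for z :: "complex^4"
      using \<pi> by (simp_all add: permv_permv bij_is_inj bij_is_surj surj_iff[THEN iffD1] inj_iff[THEN iffD1] permv_id)
    have cp: "conv ` p = pt ?s (permv ?\<rho> (snd c p))" if p: "p \<in> fst c" for p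
    proof -
      have "snd c p = permv \<pi> (snd (chart ?s) (conv ` p))"
        using toric_chart_map_polyt p by (simp add: c)
      moreover obtain x where x: "conv ` p = pt ?s x" using conv_domain[of p t] p by (auto simp: c fst_chart)
      ultimately show ?thesis unfolding x by (simp add: perm(1))
    qed
    have inj: "inj_on (snd c) (fst c)"
    proof (rule inj_onI)
      fix p p' assume "p \<in> fst c" "p' \<in> fst c" "snd c p = snd c p'"
      then show "p = p'" using cp conv_domain by (metis c fst_conv)
    qed
    \<comment> \<open>The chart map of c is onto coordinate space: the preimage of w is found by
      undoing the permutation, taking the point of the bundle chart, and pulling it back with
      \<open>unconv\<close>.\<close>
    have W: "?W = permv ?\<rho> -` overl ?s s'"
    proof (intro set_eqI iffI)
      fix w assume "w \<in> ?W"
      then show "w \<in> permv ?\<rho> -` overl ?s s'" using cp by (auto simp: d pt_mem_iff)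
    next
      fix w assume w: "w \<in> permv ?\<rho> -` overl ?s s'"
      let ?q = "pt ?s (permv ?\<rho> w)"
      have q: "?q \<in> fst (chart ?s)" by (simp add: fst_chart)
      have u: "unconv ?q \<in> fst c" "conv ` unconv ?q = ?q" using unconv_domain[OF q] by (auto simp: c)
      have "snd c (unconv ?q) = w" using cp[OF u(1)] u(2) perm toric_chart_map_polyt u(1) by (simp add: c)
      then show "w \<in> ?W" using u w pt_mem_iff[of ?s "permv ?\<rho> w" s'] by (force simp: d)
    qed
    have "open ?W" unfolding W
      by (intro open_vimage open_overl linear_continuous_on) (use linear_permv linear_conv_bounded_linear in blast)
    moreover have "holomorphic_map_on (snd d \<circ> (`) conv \<circ> inv_into (fst c) (snd c)) ?W"
    proof (rule holomorphic_map_on_cong)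
      show "holomorphic_map_on (\<lambda>z. trans_fun ?s s' (permv ?\<rho> z)) ?W"
        unfolding W by (rule holomorphic_comp_permv[OF holomorphic_trans_fun])
      fix w assume w: "w \<in> ?W"
      then obtain p where p: "p \<in> fst c" "w = snd c p" by blast
      have "permv ?\<rho> w \<in> overl ?s s'" using w W by blast
      then show "(snd d \<circ> (`) conv \<circ> inv_into (fst c) (snd c)) w = trans_fun ?s s' (permv ?\<rho> w)"
        using p inj cp[OF p(1)] by (simp add: d inv_into_f_f chart_map_pt)
    qed fact
    ultimately show "let W = ?W in open W \<and> holomorphic_map_on (snd d \<circ> (`) conv \<circ> inv_into (fst c) (snd c)) W"
      by simp
  qed
  show "holomorphic_between P_O_O111 (toric_manifold polyt) unconv"
    unfolding holomorphic_between_def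
  proof (intro conjI ballI)
    show "unconv ` points P_O_O111 \<subseteq> points (toric_manifold polyt)"
      using unconv_domain unfolding points_toric_polyt points_eq_opp by blast
    fix c d assume "c \<in> P_O_O111" "d \<in> toric_manifold polyt"
    then obtain t \<pi> s' where d: "d = (toric_chart_domain polyt (vtx t), toric_chart_map polyt (\<lambda>i. edir t (\<pi> i)))"
      and c: "c = chart s'" by (auto simp: toric_manifold_polyt P_O_O111_eq)
    let ?s = "opp t"
    let ?W = "snd c ` {p \<in> fst c. unconv p \<in> fst d}"
    have m: "unconv (pt s' z) \<in> fst d \<longleftrightarrow> z \<in> overl s' ?s" for z
    proof -
      have "pt s' z \<in> points P_O_O111" by (auto simp: points_P_O_O111)
      then have "conv ` unconv (pt s' z) = pt s' z" using unconv_domain by (auto simp: points_eq_opp)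
      then show ?thesis using conv_domain[of "unconv (pt s' z)" t] unconv_domain[of "pt s' z" t] pt_mem_iff[of s' z ?s]
        by (auto simp: d)
    qed
    have W: "?W = overl s' ?s" using m by (force simp: c fst_chart)
    have "holomorphic_map_on (snd d \<circ> unconv \<circ> inv_into (fst c) (snd c)) ?W"
    proof (rule holomorphic_map_on_cong)
      show "holomorphic_map_on (\<lambda>z. permv \<pi> (trans_fun s' ?s z)) ?W"
        unfolding W by (rule holomorphic_permv_comp[OF holomorphic_trans_fun])
      fix z assume "z \<in> ?W"
      then have z: "z \<in> overl s' ?s" using W by blast
      then have "conv ` unconv (pt s' z) = pt s' z"
        using unconv_domain pt_mem_iff by blast
      then show "(snd d \<circ> unconv \<circ> inv_into (fst c) (snd c)) z = permv \<pi> (trans_fun s' ?s z)"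
        using toric_chart_map_polyt[of "unconv (pt s' z)" t \<pi>] m[of z] z by (simp add: c d chart_map_pt)
    qed (simp add: W open_overl)
    then show "let W = ?W in open W \<and> holomorphic_map_on (snd d \<circ> unconv \<circ> inv_into (fst c) (snd c)) W"
      by (simp add: W open_overl)
  qed
qed

section \<open>The relative Ding invariant\<close>

text \<open>Fubini: the slice of the polytope over \<open>x $ 4 = y\<close> is the cube \<open>[-1, 1 - y]\<^sup>3\<close>.\<close>

lemma distr_polyt:
  "distr (density lborel (indicator polyt)) borel (\<lambda>x. x $ 4)
     = density lborel (\<lambda>y. ennreal (indicator {-1..1} y * (2 - y) ^ 3))"
proof (rule measure_eqI)
  fix A assume "A \<in> sets (distr (density lborel (indicator polyt)) borel (\<lambda>x :: real^4. x $ 4))"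
  then have A [measurable]: "A \<in> sets borel" by simp
  have P [measurable]: "polyt \<in> sets borel" using closed_polyt by simp
  let ?b = "axis 4 1 :: real^4" and ?B = "Basis - {axis 4 1 :: real^4}"
  have B: "Basis = insert ?b ?B" by (auto simp: Basis_vec_def)
  have "card (Basis :: (real^4) set) = 4" by simp
  moreover have "?b \<in> Basis" by (simp add: axis_in_Basis_iff)
  ultimately have card: "card ?B = 3" by (simp only: card_Diff_singleton)
  have Beq: "(\<forall>b\<in>?B. p b) \<longleftrightarrow> (\<forall>k\<in>base. p (axis k 1))" for p
  proof -
    have "?B = (\<lambda>k. axis k 1) ` base"
      using exhaust_4 by (fastforce simp: Basis_vec_def axis_eq_axis)
    then show ?thesis by simp
  qed
  interpret product_sigma_finite "\<lambda>_ :: real^4. lborel :: real measure" ..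
  define h :: "real^4 \<Rightarrow> ennreal" where "h x = indicator polyt x * indicator A (x $ 4)" for x
  have h [measurable]: "h \<in> borel_measurable borel" unfolding h_def by measurable
  define e where "e f = (\<Sum>b\<in>Basis. f b *\<^sub>R b)" for f :: "real^4 \<Rightarrow> real"
  have e [measurable]: "e \<in> measurable (\<Pi>\<^sub>M b\<in>Basis. lborel) borel" unfolding e_def by measurable
  have en: "e f $ k = f (axis k 1)" for f k
  proof -
    have "e f \<bullet> axis k 1 = f (axis k 1)" unfolding e_def by (rule inner_sum_left_Basis) simp
    then show ?thesis by (simp add: inner_axis)
  qed
  \<comment> \<open>For fixed fourth coordinate the remaining conditions are independent of each
    other, so the indicator factorises and the inner integral is a product of three lengths 2 -
    y.\<close>
  have sl: "h (e (x(?b := y))) = (indicator A y * indicator {-1..1} y) * (\<Prod>b\<in>?B. indicator {-1..1 - y} (x b))" for x y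
  proof -
    have "e (x(?b := y)) \<in> polyt \<longleftrightarrow> y \<in> {-1..1} \<and> (\<forall>b\<in>?B. x b \<in> {-1..1 - y})"
      unfolding polyt_iff en Beq by (auto simp: axis_eq_axis abs_le_iff algebra_simps)
    then show ?thesis unfolding h_def en by (simp add: indicator_def)
  qed
  have "emeasure (distr (density lborel (indicator polyt)) borel (\<lambda>x. x $ 4)) A = (\<integral>\<^sup>+ x. h x \<partial>lborel)"
  proof -
    have s: "(\<lambda>x :: real^4. x $ 4) -` A \<in> sets lborel"
      using measurable_sets[of "\<lambda>x :: real^4. x $ 4" lborel borel A] A by simp
    then have "emeasure (distr (density lborel (indicator polyt)) borel (\<lambda>x. x $ 4)) A
        = (\<integral>\<^sup>+ x. indicator polyt x * indicator ((\<lambda>x. x $ 4) -` A) x \<partial>lborel)"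
      by (simp add: emeasure_distr emeasure_density)
    then show ?thesis by (simp add: h_def indicator_vimage)
  qed
  also have "\<dots> = (\<integral>\<^sup>+ f. h (e f) \<partial>(\<Pi>\<^sub>M b\<in>Basis. lborel))"
    unfolding e_def by (subst lborel_eq) (rule nn_integral_distr, measurable)
  also have "\<dots> = (\<integral>\<^sup>+ y. (\<integral>\<^sup>+ x. h (e (x(?b := y))) \<partial>(\<Pi>\<^sub>M b\<in>?B. lborel)) \<partial>lborel)"
    by (subst (1) B, rule product_nn_integral_insert_rev) (use e B in auto)
  also have "\<dots> = (\<integral>\<^sup>+ y. ennreal (indicator {-1..1} y * (2 - y) ^ 3) * indicator A y \<partial>lborel)"
  proof (rule nn_integral_cong)
    fix y :: real
    have "(\<integral>\<^sup>+ x. (\<Prod>b\<in>?B. indicator {-1..1 - y} (x b)) \<partial>(\<Pi>\<^sub>M b\<in>?B. lborel))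
        = (\<Prod>b\<in>?B. (\<integral>\<^sup>+ t. indicator {-1..1 - y} t \<partial>lborel))"
      by (rule product_nn_integral_prod) auto
    also have "\<dots> = emeasure lborel {-1..1 - y} ^ 3" by (simp add: card)
    finally show "(\<integral>\<^sup>+ x. h (e (x(?b := y))) \<partial>(\<Pi>\<^sub>M b\<in>?B. lborel))
        = ennreal (indicator {-1..1} y * (2 - y) ^ 3) * indicator A y"
      unfolding sl by (subst nn_integral_cmult) (auto simp: indicator_def ennreal_power)
  qed
  also have "\<dots> = emeasure (density lborel (\<lambda>y. ennreal (indicator {-1..1} y * (2 - y) ^ 3))) A"
    by (simp add: emeasure_density)
  finally show "emeasure (distr (density lborel (indicator polyt)) borel (\<lambda>x. x $ 4)) A
     = emeasure (density lborel (\<lambda>y. ennreal (indicator {-1..1} y * (2 - y) ^ 3))) A" .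
qed simp

lemma LINT_polyt_fib:
  assumes [measurable]: "g \<in> borel_measurable borel"
  shows "(LINT x:polyt|lborel. g (x $ 4)) = (\<integral>y. (g y * (2 - y) ^ 3) * indicator {-1..1} y \<partial>lborel)"
proof -
  have P [measurable]: "polyt \<in> sets borel" using closed_polyt by simp
  have "(LINT x:polyt|lborel. g (x $ 4)) = integral\<^sup>L (density lborel (\<lambda>x. ennreal (indicator polyt x))) (\<lambda>x. g (x $ 4))"
    unfolding set_lebesgue_integral_def by (subst integral_density) auto
  also have "\<dots> = integral\<^sup>L (distr (density lborel (indicator polyt)) borel (\<lambda>x. x $ 4)) g"
    by (subst integral_distr) (simp_all add: ennreal_indicator)
  also have "\<dots> = (\<integral>y. (indicator {-1..1} y * (2 - y) ^ 3) *\<^sub>R g y \<partial>lborel)"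
    unfolding distr_polyt by (subst integral_density) (auto simp: indicator_def)
  finally show ?thesis by (simp add: mult_ac)
qed

text \<open>The antiderivatives come from substituting y = 2 - w in y (2 - y)^3 and y^2 (2 - y)^3,
  which become 2 w^3 - w^4 and 4 w^3 - 4 w^4 + w^5 with w = 2 - y.\<close>

lemma LINT_moments:
  "(LINT x:polyt|lborel. (1::real)) = 20" "(LINT x:polyt|lborel. x $ 4) = - 42 / 5"
  "(LINT x:polyt|lborel. x $ 4 * x $ 4) = 116 / 15"
proof -
  let ?E = "\<lambda>y :: real. - ((2 - y) ^ 4) / 4"
  have "(\<integral>y. (1 * (2 - y) ^ 3) * indicator {-1..1} y \<partial>lborel) = ?E 1 - ?E (-1)"
    by (rule integral_FTC_Icc_real) (auto intro!: derivative_eq_intros continuous_intros)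
  then show "(LINT x:polyt|lborel. (1::real)) = 20" using LINT_polyt_fib[of "\<lambda>_. 1"] by simp
  let ?F = "\<lambda>y :: real. (2 - y) ^ 5 / 5 - (2 - y) ^ 4 / 2"
  have "(\<integral>y. (y * (2 - y) ^ 3) * indicator {-1..1} y \<partial>lborel) = ?F 1 - ?F (-1)"
    by (rule integral_FTC_Icc_real)
      (auto intro!: derivative_eq_intros continuous_intros simp: field_simps power_numeral_reduce)
  then show "(LINT x:polyt|lborel. x $ 4) = - 42 / 5" using LINT_polyt_fib[of "\<lambda>y. y"] by simp
  let ?G = "\<lambda>y :: real. - ((2 - y) ^ 6) / 6 + 4 * (2 - y) ^ 5 / 5 - (2 - y) ^ 4"
  have "(\<integral>y. (y * y * (2 - y) ^ 3) * indicator {-1..1} y \<partial>lborel) = ?G 1 - ?G (-1)"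
    by (rule integral_FTC_Icc_real)
      (auto intro!: derivative_eq_intros continuous_intros simp: field_simps power_numeral_reduce)
  then show "(LINT x:polyt|lborel. x $ 4 * x $ 4) = 116 / 15" using LINT_polyt_fib[of "\<lambda>y. y * y"] by simp
qed

lemma set_integrable_polyt:
  fixes f :: "real^4 \<Rightarrow> real"
  shows "continuous_on UNIV f \<Longrightarrow> set_integrable lborel polyt f"
  unfolding set_integrable_def by (rule borel_integrable_compact[OF compact_polyt]) (rule continuous_on_subset, auto)

text \<open>The reflection \<open>x\<^sub>k \<mapsto> - x\<^sub>k - x\<^sub>4\<close> preserves the polytope and the coordinate \<open>x\<^sub>4\<close>.\<close>

lemma LINT_polyt_reflect:
  assumes g: "continuous_on UNIV g" and k: "k \<noteq> 4"
  shows "(LINT x:polyt|lborel. x $ k * g (x $ 4)) = - (LINT x:polyt|lborel. x $ 4 * g (x $ 4)) / 2"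
proof -
  define T :: "real^4 \<Rightarrow> real^4" where "T x = (\<chi> j. if j = 4 then x $ 4 else - x $ j - x $ 4)" for x
  have TT: "T (T x) = x" for x by (simp add: T_def vec_eq_iff)
  have lin: "linear T" by (rule linearI) (auto simp: T_def vec_eq_iff algebra_simps)
  have TP: "T x \<in> polyt" if "x \<in> polyt" for x
    using that by (auto simp: polyt_iff T_def)
  have img: "T ` polyt = polyt" using TP TT by (metis image_subsetI imageI subset_antisym subsetI)
  \<comment> \<open>T is an involution, so its determinant has absolute value 1 and the substitution
    preserves the integral.\<close>
  have "matrix (T \<circ> T) = matrix T ** matrix T" by (rule matrix_compose[OF lin lin])
  moreover have "T \<circ> T = id" using TT by auto
  ultimately have "det (matrix T) * det (matrix T) = det (mat 1 :: real^4^4)" by (metis det_mul matrix_id_mat_1)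
  then have det: "\<bar>det (matrix T)\<bar> = 1" by (simp add: abs_square_eq_1 power2_eq_square[symmetric])
  define f :: "real^4 \<Rightarrow> real^4" where "f x = g (x $ 4) *\<^sub>R x" for x
  have c: "continuous_on UNIV f" unfolding f_def
    by (intro continuous_intros continuous_on_compose2[OF g]) auto
  have "integrable lborel (\<lambda>x. indicator polyt x *\<^sub>R f x)"
    by (rule borel_integrable_compact[OF compact_polyt continuous_on_subset[OF c]]) simp
  then have i: "set_integrable lborel polyt f" by (simp add: set_integrable_def)
  then have fa: "f absolutely_integrable_on polyt"
    unfolding set_integrable_def by (rule integrable_completion[THEN iffD2, rotated]) (use i in \<open>auto simp: set_integrable_def\<close>)
  have "integral (T ` polyt) f = integral polyt (\<lambda>x. \<bar>det (matrix T)\<bar> *\<^sub>R f (T x))"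
  proof (rule integral_change_of_variables)
    show "polyt \<in> sets lebesgue" using closed_polyt by (simp add: sets_completionI_sets)
    show "(T has_derivative T) (at x within polyt)" for x
      using lin linear_conv_bounded_linear bounded_linear_imp_has_derivative by blast
    show "inj_on T polyt" by (metis TT inj_onI)
  qed (use fa img in simp)
  then have v: "integral polyt f = integral polyt (\<lambda>x. f (T x))" by (simp add: img det)
  have s: "set_integrable lborel polyt (\<lambda>x. x $ j * g (x $ 4))" for j
    by (intro set_integrable_polyt continuous_intros continuous_on_compose2[OF g]) auto
  let ?I = "\<lambda>j. integral polyt (\<lambda>x. x $ j * g (x $ 4))"
  have "f integrable_on polyt" using set_borel_integral_eq_integral(1)[OF i] .
  then have "integral polyt (\<lambda>x. f x $ k) = integral polyt f $ k" by (rule integral_component_eq_cart)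
  moreover have "(\<lambda>x. f x $ k) = (\<lambda>x. x $ k * g (x $ 4))" by (simp add: f_def mult.commute)
  ultimately have "integral polyt f $ k = ?I k" by simp
  moreover have "integral polyt (\<lambda>x. f (T x) $ k) = integral polyt (\<lambda>x. f (T x)) $ k"
  proof (rule integral_component_eq_cart)
    have "continuous_on UNIV T" using lin linear_continuous_on linear_conv_bounded_linear by blast
    then have "continuous_on UNIV (\<lambda>x. f (T x))" using continuous_on_compose2[OF c] by auto
    then have "integrable lborel (\<lambda>x. indicator polyt x *\<^sub>R f (T x))"
      by (intro borel_integrable_compact[OF compact_polyt continuous_on_subset]) auto
    then show "(\<lambda>x. f (T x)) integrable_on polyt"
      by (intro set_borel_integral_eq_integral(1)) (simp add: set_integrable_def)
  qed
  moreover have "integral polyt (\<lambda>x. f (T x) $ k) = integral polyt (\<lambda>x. - (x $ k * g (x $ 4)) - x $ 4 * g (x $ 4))"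
    using k by (intro integral_cong) (simp add: f_def T_def algebra_simps)
  moreover have "\<dots> = - ?I k - ?I 4"
    using set_borel_integral_eq_integral(1)[OF s] by (simp add: integral_diff integrable_neg)
  ultimately have "?I k = - ?I k - ?I 4" using v by simp
  then show ?thesis using set_borel_integral_eq_integral(2)[OF s] by simp
qed

text \<open>If the integral vanished, f would be 0 almost everywhere on the polytope; but f is
  positive on a nonempty open set, which is not a null set.\<close>

lemma LINT_polyt_pos:
  assumes f: "continuous_on UNIV f" and nn: "\<And>x. x \<in> polyt \<Longrightarrow> f x \<ge> 0" and x0: "x0 \<in> interior polyt" "f x0 > 0"
  shows "(LINT x:polyt|lborel. f x) > (0::real)"
proof -
  have i: "integrable lborel (\<lambda>x. indicator polyt x *\<^sub>R f x)"
    using set_integrable_polyt[OF f] by (simp add: set_integrable_def)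
  have n: "AE x in lborel. 0 \<le> indicator polyt x *\<^sub>R f x" using nn by (auto simp: indicator_def)
  have "(LINT x:polyt|lborel. f x) \<noteq> 0"
  proof
    assume "(LINT x:polyt|lborel. f x) = 0"
    then have ae: "AE x in lborel. indicator polyt x *\<^sub>R f x = 0"
      using integral_nonneg_eq_0_iff_AE[OF i n] by (simp add: set_lebesgue_integral_def)
    define U where "U = interior polyt \<inter> f -` {0<..}"
    have U: "open U" unfolding U_def
      by (intro open_Int open_interior open_vimage f) auto
    have "AE x in lborel. x \<notin> U"
      using ae by eventually_elim (use interior_subset in \<open>auto simp: U_def indicator_def split: if_splits\<close>)
    then have "U \<in> null_sets lborel" using U by (simp add: AE_iff_null_sets[symmetric])
    then have "negligible U" by (simp add: negligible_iff_null_sets null_sets_completionI)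
    then show False using open_not_negligible[OF U] x0 by (auto simp: U_def)
  qed
  moreover have "(LINT x:polyt|lborel. f x) \<ge> 0"
    unfolding set_lebesgue_integral_def by (rule integral_nonneg_AE[OF n])
  ultimately show ?thesis by simp
qed

section \<open>The extremal potential and the destabilising function\<close>

text \<open>With 1 - \<theta> = A (x_4 + B), orthogonality to x_4 gives B = (116/15) / (42/5) =
  58/63, and the integral of 1 - \<theta>, which is the volume 20, gives A = 20 / (20 B - 42/5) =
  3150/1577.\<close>

definition pot :: "real^4 \<Rightarrow> real" where "pot x = 1 - 3150 / 1577 * (x $ 4 + 58 / 63)"

lemma continuous_affine: "continuous_on UNIV (\<lambda>x :: real^4. a \<bullet> x + c)" for c :: real
  by (intro continuous_intros)

lemma LINT_polyt_add:
  fixes f g :: "real^4 \<Rightarrow> real"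
  assumes "continuous_on UNIV f" "continuous_on UNIV g"
  shows "(LINT x:polyt|lborel. f x + g x) = (LINT x:polyt|lborel. f x) + (LINT x:polyt|lborel. g x)"
    and "(LINT x:polyt|lborel. f x - g x) = (LINT x:polyt|lborel. f x) - (LINT x:polyt|lborel. g x)"
  using assms by (simp_all add: set_integrable_polyt)

text \<open>The reflections reduce the conditions for the base coordinates to the one for x_4. For
  uniqueness, the difference of two solutions is affine and orthogonal to all affine functions,
  hence to itself.\<close>

lemma extremal_potential_polyt: "extremal_potential polyt = pot"
  unfolding extremal_potential_def
proof (rule the_equality)
  let ?A = "3150 / 1577 :: real"
  have cn: "continuous_on UNIV (\<lambda>x :: real^4. x $ i)" for i by (intro continuous_intros)
  have sI: "(LINT x:polyt|lborel. c * f x) = c * (LINT x:polyt|lborel. f x)" for c :: real and f by simp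
  have pa: "pot = (\<lambda>x. (- ?A *\<^sub>R axis 4 1) \<bullet> x + (1 - ?A * (58 / 63)))"
    by (simp add: pot_def fun_eq_iff inner_axis' algebra_simps)
  have p0: "(LINT x:polyt|lborel. pot x) = 0"
  proof -
    have "pot = (\<lambda>x. (1 - ?A * (58 / 63)) * 1 + (- ?A) * x $ 4)" by (simp add: pot_def fun_eq_iff algebra_simps)
    then have "(LINT x:polyt|lborel. pot x) = (LINT x:polyt|lborel. (1 - ?A * (58 / 63)) * 1 + (- ?A) * x $ 4)"
      by simp
    also have "\<dots> = (1 - ?A * (58 / 63)) * 20 + (- ?A) * (- 42 / 5)"
      by (subst LINT_polyt_add(1)) (intro continuous_intros, intro continuous_intros, simp only: sI LINT_moments)
    finally show ?thesis by simp
  qed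
  have p4: "(LINT x:polyt|lborel. x $ 4 * (1 - pot x)) = 0"
  proof -
    have "(\<lambda>x. x $ 4 * (1 - pot x)) = (\<lambda>x. ?A * (x $ 4 * x $ 4) + (?A * (58 / 63)) * x $ 4)"
      by (simp add: pot_def fun_eq_iff algebra_simps)
    then have "(LINT x:polyt|lborel. x $ 4 * (1 - pot x)) = (LINT x:polyt|lborel. ?A * (x $ 4 * x $ 4) + (?A * (58 / 63)) * x $ 4)"
      by simp
    also have "\<dots> = ?A * (116 / 15) + (?A * (58 / 63)) * (- 42 / 5)"
      by (subst LINT_polyt_add(1)) (intro continuous_intros, intro continuous_intros, simp only: sI LINT_moments)
    finally show ?thesis by simp
  qed
  have pk: "(LINT x:polyt|lborel. x $ i * (1 - pot x)) = 0" for i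
  proof (cases "i = 4")
    case False
    then have "(LINT x:polyt|lborel. x $ i * (1 - (1 - ?A * (x $ 4 + 58 / 63)))) =
        - (LINT x:polyt|lborel. x $ 4 * (1 - (1 - ?A * (x $ 4 + 58 / 63)))) / 2"
      by (intro LINT_polyt_reflect[where g="\<lambda>y. 1 - (1 - ?A * (y + 58 / 63))"] continuous_intros)
    then show ?thesis using p4 unfolding pot_def by simp
  qed (use p4 in simp)
  show "(\<exists>a c. pot = (\<lambda>x. a \<bullet> x + c)) \<and>
     (LINT x:polyt|lborel. pot x) = 0 \<and> (\<forall>i. (LINT x:polyt|lborel. x $ i * (1 - pot x)) = 0)"
    using pa p0 pk by blast
  fix \<theta> assume "(\<exists>a c. \<theta> = (\<lambda>x. a \<bullet> x + c)) \<and>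
     (LINT x:polyt|lborel. \<theta> x) = 0 \<and> (\<forall>i. (LINT x:polyt|lborel. x $ i * (1 - \<theta> x)) = 0)"
  then obtain a c where \<theta>: "\<theta> = (\<lambda>x. a \<bullet> x + c)" and t0: "(LINT x:polyt|lborel. \<theta> x) = 0"
    and tk: "\<And>i. (LINT x:polyt|lborel. x $ i * (1 - \<theta> x)) = 0" by blast
  define d e where "d = a - (- ?A *\<^sub>R axis 4 1)" and "e = c - (1 - ?A * (58 / 63))"
  have \<delta>: "\<theta> x - pot x = d \<bullet> x + e" for x
    unfolding \<theta> pa d_def e_def by (simp add: inner_diff_left inner_add_left)
  have c\<theta>: "continuous_on UNIV \<theta>" and cp: "continuous_on UNIV pot"
    unfolding \<theta> pa by (rule continuous_affine)+
  have d0: "(LINT x:polyt|lborel. d \<bullet> x + e) = 0"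
    unfolding \<delta>[symmetric] LINT_polyt_add(2)[OF c\<theta> cp] using t0 p0 by simp
  have dk: "(LINT x:polyt|lborel. x $ i * (d \<bullet> x + e)) = 0" for i
  proof -
    have "(LINT x:polyt|lborel. x $ i * (d \<bullet> x + e)) = (LINT x:polyt|lborel. x $ i * (1 - pot x) - x $ i * (1 - \<theta> x))"
      unfolding \<delta>[symmetric] by (simp add: algebra_simps)
    also have "\<dots> = 0"
      by (subst LINT_polyt_add(2)) (intro continuous_intros cn cp c\<theta>, intro continuous_intros cn cp c\<theta>, simp add: pk tk)
    finally show ?thesis .
  qed
  have cd: "continuous_on UNIV (\<lambda>x. d \<bullet> x + e)" by (rule continuous_affine)
  \<comment> \<open>The square is a combination of functions whose integrals are known to be
    0.\<close>
  have "(d \<bullet> x + e) * (d \<bullet> x + e) = (\<Sum>i\<in>UNIV. d $ i * (x $ i * (d \<bullet> x + e))) + e * (d \<bullet> x + e)" for x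
    unfolding distrib_right[of "d \<bullet> x" e "d \<bullet> x + e"]
    by (simp add: inner_vec_def[of d x] sum_distrib_right mult.assoc)
  then have "(LINT x:polyt|lborel. (d \<bullet> x + e) * (d \<bullet> x + e))
      = (LINT x:polyt|lborel. (\<Sum>i\<in>UNIV. d $ i * (x $ i * (d \<bullet> x + e))) + e * (d \<bullet> x + e))"
    by presburger
  also have "\<dots> = 0"
    unfolding sum_4
    by (simp only: LINT_polyt_add(1) continuous_intros cn cd sI dk d0 UNIV_I)
  finally have sq: "(LINT x:polyt|lborel. (d \<bullet> x + e) * (d \<bullet> x + e)) = 0" .
  have z: "d \<bullet> x + e = 0" if "x \<in> interior polyt" for x
  proof (rule ccontr)
    assume "d \<bullet> x + e \<noteq> 0"
    then have "(LINT x:polyt|lborel. (d \<bullet> x + e) * (d \<bullet> x + e)) > 0"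
      using that by (intro LINT_polyt_pos continuous_intros cd) (auto simp: zero_less_mult_iff)
    then show False using sq by simp
  qed
  have e0: "e = 0" using z[OF zero_interior_polyt] by simp
  obtain r where r: "r > 0" "ball 0 r \<subseteq> interior polyt"
    using zero_interior_polyt open_interior open_contains_ball by blast
  have "d = 0"
  proof (rule ccontr)
    assume "d \<noteq> 0"
    then have "(r / 2 / norm d) *\<^sub>R d \<in> ball 0 r" using r by simp
    then have "d \<bullet> ((r / 2 / norm d) *\<^sub>R d) + e = 0" using z r(2) by blast
    then show False using \<open>d \<noteq> 0\<close> r e0 by simp
  qed
  then show "\<theta> = pot" using \<delta> e0 by (auto simp: fun_eq_iff)
qed

text \<open>With A = 3150/1577, the function f is the negative part of (1 - \<theta>) / A, so f (1 -
  \<theta>) = - A f^2 everywhere, and the integral is negative as soon as f is positive somewhere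
  inside.\<close>

theorem ding_unstable_polyt: "\<not> relatively_Ding_semistable polyt"
proof -
  let ?u = "\<lambda>x :: real^4. - x $ 4 - 58 / 63"
  define f where "f x = max 0 (?u x)" for x :: "real^4"
  have "rational_PL_convex polyt f"
    unfolding rational_PL_convex_def
  proof (intro exI conjI ballI)
    have "rational_affine (\<lambda>x :: real^4. 0)" unfolding rational_affine_def
      by (intro exI[of _ 0]) auto
    moreover have "rational_affine ?u" unfolding rational_affine_def
      by (intro exI[of _ "axis 4 (-1)"] exI[of _ "- 58 / 63"] conjI allI) (simp_all add: inner_axis', simp add: axis_def)
    ultimately show "rational_affine l" if "l \<in> {\<lambda>x. 0, ?u}" for l using that by auto
  qed (auto simp: f_def)
  moreover have "ding_invariant polyt f < 0"
  proof -
    have "f x * (1 - pot x) = - (3150 / 1577) * (f x * f x)" for x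
      unfolding f_def pot_def max_def by (simp add: algebra_simps)
    moreover have "(LINT x:polyt|lborel. c * (f x * f x)) = c * (LINT x:polyt|lborel. f x * f x)" for c by simp
    ultimately have "(LINT x:polyt|lborel. f x * (1 - pot x)) = - (3150 / 1577) * (LINT x:polyt|lborel. f x * f x)"
      by (simp only:)
    moreover have "(LINT x:polyt|lborel. f x * f x) > 0"
    proof (rule LINT_polyt_pos)
      show "continuous_on UNIV (\<lambda>x. f x * f x)" unfolding f_def by (intro continuous_intros)
      \<comment> \<open>An interior point strictly between the facet x_4 = -1 and the zero set x_4 =
        - 58/63.\<close>
      let ?x = "axis 4 (- 62 / 63) :: real^4"
      show "?x \<in> interior polyt" by (rule interior_polytI) (auto simp: inner_nrm axis_def)
      show "f ?x * f ?x > 0" by (simp add: f_def axis_def)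
    qed simp
    moreover have "measure lborel polyt > 0"
    proof -
      have "(LINT x:polyt|lborel. (1::real)) = measure lborel polyt"
        using closed_polyt by (simp add: set_lebesgue_integral_def)
      then show ?thesis using LINT_moments(1) by simp
    qed
    moreover have "f 0 = 0" by (simp add: f_def)
    ultimately show ?thesis
      unfolding ding_invariant_def extremal_potential_polyt by (simp add: divide_neg_pos field_simps)
  qed
  ultimately show ?thesis unfolding relatively_Ding_semistable_def by force
qed

theorem corollary1p9:
  shows "(\<exists>P :: (real^4) set. fano_polytope P \<and> biholomorphic (toric_manifold P) P_O_O111 \<and>
            \<not> relatively_Ding_semistable P) \<and>
         calabi_dream_manifold P_O_O111"
  using fano_polyt biholomorphic_toric_polyt ding_unstable_polyt calabi_dream_P_O_O111 by blast

end
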